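(* Let $n>2$. The Drinfel'd quantum double $\mathcal D(\widehat{\mathcal B},\widehat{\mathcal B'})$ of the Hopf subalgebras $\widehat{\mathcal B}$ and $\widehat{\mathcal B'}$ of $U_{r,s}(\widehat{\mathfrak{sl}_n})$, formed with respect to the skew-dual pairing $\langle\,,\rangle:\widehat{\mathcal B'}\times\widehat{\mathcal B}\to\mathbb K$ specified in the context, is isomorphic to $U_{r,s}(\widehat{\mathfrak{sl}_n})$ as Hopf algebras.
   Context: Base field: $\mathbb K=\mathbb Q(r,s)$, the field of rational functions in two parameters $r,s$ ($r\ne\pm s$). $I=\{1,\dots,n-1\}$, $I_0=\{0\}\cup I$. $\varepsilon_1,\dots,\varepsilon_n$ is an orthonormal basis of $\mathbb R^n$, $\alpha_i=\varepsilon_i-\varepsilon_{i+1}$ ($i\in I$), $\delta$ is the primitive imaginary root of $\widehat{\mathfrak{sl}_n}$ (orthogonal to everything), $\alpha_0=\delta-(\varepsilon_1-\varepsilon_n)$; $a_{ij}=(\alpha_i,\alpha_j)$. $\omega_\delta=\omega_0\omega_1\cdots\omega_{n-1}$, $\omega'_\delta=\omega'_0\omega'_1\cdots\omega'_{n-1}$. **$U=U_{r,s}(\widehat{\mathfrak{sl}_n})$**: the unital associative $\mathbb K$-algebra generated by $e_j,f_j,\omega_j^{\pm1},\omega_j'^{\pm1}$ ($j\in I_0$), $\gamma^{\pm1/2},\gamma'^{\pm1/2},D^{\pm1},D'^{\pm1}$ with relations: (A1) $\gamma^{\pm1/2},\gamma'^{\pm1/2}$ are central with $\gamma=\omega_\delta$,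 $\gamma'=\omega'_\delta$, $\gamma\gamma'=rs$; $\omega_i\omega_i^{-1}=\omega_i'\omega_i'^{-1}=1=DD^{-1}=D'D'^{-1}$; all $\omega_i^{\pm1},\omega_i'^{\pm1},D^{\pm1},D'^{\pm1}$ commute with one another. (A2) For $i\in I_0$, $j\in I$: $De_iD^{-1}=r^{\delta_{0i}}e_i$, $Df_iD^{-1}=r^{-\delta_{0i}}f_i$; $\omega_je_i\omega_j^{-1}=r^{(\varepsilon_j,\alpha_i)}s^{(\varepsilon_{j+1},\alpha_i)}e_i$, $\omega_jf_i\omega_j^{-1}=r^{-(\varepsilon_j,\alpha_i)}s^{-(\varepsilon_{j+1},\alpha_i)}f_i$; $\omega_0e_i\omega_0^{-1}=r^{-(\varepsilon_{i+1},\alpha_0)}s^{(\varepsilon_1,\alpha_i)}e_i$, $\omega_0f_i\omega_0^{-1}=r^{(\varepsilon_{i+1},\alpha_0)}s^{-(\varepsilon_1,\alpha_i)}f_i$. (A3) For $i\in I_0$, $j\in I$: $D'e_iD'^{-1}=s^{\delta_{0i}}e_i$, $D'f_iD'^{-1}=s^{-\delta_{0i}}f_i$; $\omega_j'e_i\omega_j'^{-1}=s^{(\varepsilon_j,\alpha_i)}r^{(\varepsilon_{j+1},\alpha_i)}e_i$, $\omega_j'f_i\omega_j'^{-1}=s^{-(\varepsilon_j,\alpha_i)}r^{-(\varepsilon_{j+1},\alpha_i)}f_i$; $\omega_0'e_i\omega_0'^{-1}=s^{-(\varepsilon_{i+1},\alpha_0)}r^{(\varepsilon_1,\alpha_i)}e_i$,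 $\omega_0'f_i\omega_0'^{-1}=s^{(\varepsilon_{i+1},\alpha_0)}r^{-(\varepsilon_1,\alpha_i)}f_i$. (A4) $[e_i,f_j]=\frac{\delta_{ij}}{r-s}(\omega_i-\omega_i')$, $i,j\in I_0$. (A5) $[e_i,e_j]=0=[f_i,f_j]$ for $i,j\in I_0$, $(i,j)\notin\{(0,n-1),(n-1,0)\}$, with $a_{ij}=0$. (A6) For $i\in I_0$, with index $i+1$ read mod $n$: $e_i^2e_{i+1}-(r+s)e_ie_{i+1}e_i+rs\,e_{i+1}e_i^2=0$, $e_ie_{i+1}^2-(r+s)e_{i+1}e_ie_{i+1}+rs\,e_{i+1}^2e_i=0$. (A7) For $i\in I_0$, with index $i+1$ read mod $n$: $f_i^2f_{i+1}-(r^{-1}+s^{-1})f_if_{i+1}f_i+(rs)^{-1}f_{i+1}f_i^2=0$, $f_if_{i+1}^2-(r^{-1}+s^{-1})f_{i+1}f_if_{i+1}+(rs)^{-1}f_{i+1}^2f_i=0$. Hopf structure: $\gamma^{\pm1/2},\gamma'^{\pm1/2},D^{\pm1},D'^{\pm1},\omega_i^{\pm1},\omega_i'^{\pm1}$ are group-like (coproduct $g\otimes g$, counit $1$, antipode the inverse); $\Delta(e_i)=e_i\otimes1+\omega_i\otimes e_i$, $\Delta(f_i)=f_i\otimes\omega_i'+1\otimes f_i$, $\epsilon(e_i)=\epsilon(f_i)=0$, $S(e_i)=-\omega_i^{-1}e_i$, $S(f_i)=-f_i\omega_i'^{-1}$ ($i\in I_0$). $\widehat{\mathcal B}$ is the Hopf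 subalgebra of $U$ generated by $e_j,\omega_j^{\pm1}$ ($j\in I_0$), $\gamma^{\pm1/2},D^{\pm1}$; $\widehat{\mathcal B'}$ the one generated by $f_j,\omega_j'^{\pm1}$ ($j\in I_0$), $\gamma'^{\pm1/2},D'^{\pm1}$. **Skew-dual pairing** of Hopf algebras $\mathfrak A,\mathfrak B$: a bilinear form $\langle\,,\rangle:\mathfrak B\times\mathfrak A\to\mathbb K$ with $\langle b,1\rangle=\epsilon(b)$, $\langle1,a\rangle=\epsilon(a)$, $\langle b,a_1a_2\rangle=\langle\Delta^{op}(b),a_1\otimes a_2\rangle$, $\langle b_1b_2,a\rangle=\langle b_1\otimes b_2,\Delta(a)\rangle$. The pairing used is the unique skew-dual pairing $\widehat{\mathcal B'}\times\widehat{\mathcal B}\to\mathbb K$ such that: (1) $\langle f_i,e_j\rangle=\delta_{ij}\frac1{s-r}$ ($i,j\in I_0$); (2) $\langle\omega_i',\omega_j\rangle=r^{(\varepsilon_j,\alpha_i)}s^{(\varepsilon_{j+1},\alpha_i)}$ ($i\in I_0,j\in I$), $\langle\omega_i',\omega_0\rangle=r^{-(\varepsilon_{i+1},\alpha_0)}s^{(\varepsilon_1,\alpha_i)}$ ($i\in I_0$); (3) $\langle\omega_i'^{\pm1},\omega_j^{-1}\rangle=\langle\omega_i'^{\pm1},\omega_j\rangle^{-1}=\langle\omega_i',\omega_j\rangle^{\mp1}$ ($i,j\in I_0$); (4) $\langle\gamma'^{\pm1/2},\gamma\rangle=\langle\gamma',\gamma^{\pm1/2}\rangle=\langle\gamma',\gamma\rangle^{\pm1/2}=1$;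 (5) $\langle D',D\rangle^{\pm1}=\langle D'^{\pm1},D\rangle=\langle D',D^{\pm1}\rangle=1$; (6) $\langle\gamma'^{\pm1/2},\omega_i^{\pm1}\rangle=1=\langle\omega_i'^{\pm1},\gamma^{\pm1/2}\rangle$ ($i\in I_0$); (7) $\langle D'^{\pm1},\omega_i\rangle=\langle D',\omega_i^{\pm1}\rangle=s^{\mp\delta_{0i}}$, $\langle\omega_i'^{\pm1},D\rangle=\langle\omega_i',D^{\pm1}\rangle=r^{\pm\delta_{0i}}$ ($i\in I_0$); (8) $\langle D',\gamma^{\pm1/2}\rangle=\langle D'^{\pm1},\gamma^{1/2}\rangle=s^{\mp1/2}$, $\langle\gamma'^{\pm1/2},D\rangle=\langle\gamma'^{1/2},D^{\pm1}\rangle=r^{\pm1/2}$; and all other pairs of generators are $0$. **Drinfel'd double** $\mathcal D(\mathfrak A,\mathfrak B)$ of skew-paired Hopf algebras: the Hopf algebra with underlying coalgebra $\mathfrak A\otimes\mathfrak B$ (tensor product coalgebra), product $(a\otimes b)(a'\otimes b')=\sum\langle S_{\mathfrak B}(b_{(1)}),a'_{(1)}\rangle\langle b_{(3)},a'_{(3)}\rangle\,aa'_{(2)}\otimes b_{(2)}b'$ and antipode $S(a\otimes b)=(1\otimes S_{\mathfrak B}(b))(S_{\mathfrak A}(a)\otimes1)$.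
   Formalization: The relation γγ'=rs is read as γγ'=(rs)^c and imposes nothing, since group-like γ,γ' would force rs=1; the base field is Q(r^{1/2},s^{1/2}), as the pairing takes these values; "other pairs are 0" covers only an e or f with a group-like. *)

theory Defs
  imports
    "HOL-Library.Poly_Mapping"
    "HOL-Computational_Algebra.Polynomial"
    "HOL-Computational_Algebra.Fraction_Field"
    "HOL-Algebra.QuotRing"
    "HOL-Algebra.Module"
begin

section \<open>Algebras over a field\<close>

text \<open>
  Vector spaces and algebras are \<^typ>\<open>('k, 'a) module\<close> records with a
  carrier set; the ground field is the whole type \<open>'k\<close>.  The locale
  \<^locale>\<open>algebra\<close> of the library covers commutative algebras only.
\<close>

definition scalars :: "('k::field, 'k) module" where
  "scalars = \<lparr>carrier = UNIV, mult = (*), one = 1, zero = 0, add = (+), smult = (*)\<rparr>"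

definition linear_maps ::
    "('k::field, 'a, 'm) module_scheme \<Rightarrow> ('k, 'b, 'n) module_scheme \<Rightarrow> ('a \<Rightarrow> 'b) set" where
  "linear_maps M N = {f \<in> carrier M \<rightarrow> carrier N.
     (\<forall>x\<in>carrier M. \<forall>y\<in>carrier M. f (x \<oplus>\<^bsub>M\<^esub> y) = f x \<oplus>\<^bsub>N\<^esub> f y) \<and>
     (\<forall>c. \<forall>x\<in>carrier M. f (c \<odot>\<^bsub>M\<^esub> x) = c \<odot>\<^bsub>N\<^esub> f x)}"

definition assoc_algebra :: "('k::field, 'a, 'm) module_scheme \<Rightarrow> bool" where
  "assoc_algebra A \<longleftrightarrow> ring A \<and> module scalars A \<and>
     (\<forall>c. \<forall>x\<in>carrier A. \<forall>y\<in>carrier A.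
        (c \<odot>\<^bsub>A\<^esub> x) \<otimes>\<^bsub>A\<^esub> y = c \<odot>\<^bsub>A\<^esub> (x \<otimes>\<^bsub>A\<^esub> y) \<and>
        x \<otimes>\<^bsub>A\<^esub> (c \<odot>\<^bsub>A\<^esub> y) = c \<odot>\<^bsub>A\<^esub> (x \<otimes>\<^bsub>A\<^esub> y))"

definition algebra_hom ::
    "('k::field, 'a, 'm) module_scheme \<Rightarrow> ('k, 'b, 'n) module_scheme \<Rightarrow> ('a \<Rightarrow> 'b) set" where
  "algebra_hom A B = ring_hom A B \<inter> linear_maps A B"

definition opposite :: "('k, 'a) module \<Rightarrow> ('k, 'a) module" where
  "opposite A = A\<lparr>mult := \<lambda>x y. y \<otimes>\<^bsub>A\<^esub> x\<rparr>"

definition generated_submodule ::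
    "('k::field, 'a, 'm) module_scheme \<Rightarrow> 'a set \<Rightarrow> 'a set" where
  "generated_submodule M S = \<Inter>{N. submodule N scalars M \<and> S \<subseteq> N}"

definition quotient_module :: "('k, 'a, 'm) module_scheme \<Rightarrow> 'a set \<Rightarrow> ('k, 'a set) module" where
  "quotient_module M I =
     ring.extend (M Quot I) (module.fields (\<lambda>c X. \<Union>x\<in>X. I +>\<^bsub>M\<^esub> (c \<odot>\<^bsub>M\<^esub> x)))"


section \<open>Free algebras\<close>

datatype 'g word = Word (letters: "'g list")

instantiation word :: (type) monoid_add
begin
definition zero_word :: "'a word" where "0 = Word []"
definition plus_word :: "'a word \<Rightarrow> 'a word \<Rightarrow> 'a word" where
  "u + v = Word (letters u @ letters v)"
instance by standard (simp_all add: zero_word_def plus_word_def)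
end

text \<open>
  As words form a monoid under concatenation, the library's convolution product makes
  \<^typ>\<open>'g word \<Rightarrow>\<^sub>0 'k\<close> the free algebra over all of \<open>'g\<close>.
\<close>

definition free_algebra :: "'g set \<Rightarrow> ('k::field, 'g word \<Rightarrow>\<^sub>0 'k) module" where
  "free_algebra X =
     \<lparr>carrier = {p. \<forall>w\<in>Poly_Mapping.keys p. set (letters w) \<subseteq> X},
      mult = (*), one = 1, zero = 0, add = (+),
      smult = \<lambda>c. Poly_Mapping.map ((*) c)\<rparr>"

definition var :: "'g \<Rightarrow> 'g word \<Rightarrow>\<^sub>0 'k::field" where
  "var g = Poly_Mapping.single (Word [g]) 1"

definition const :: "'k \<Rightarrow> 'g word \<Rightarrow>\<^sub>0 'k::field" where
  "const c = Poly_Mapping.single 0 c"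

definition free_algebra_hom ::
    "('k::field, 'a, 'm) module_scheme \<Rightarrow> ('g \<Rightarrow> 'a) \<Rightarrow> ('g word \<Rightarrow>\<^sub>0 'k) \<Rightarrow> 'a" where
  "free_algebra_hom A \<phi> p =
     (\<Oplus>\<^bsub>A\<^esub>w\<in>Poly_Mapping.keys p. Poly_Mapping.lookup p w \<odot>\<^bsub>A\<^esub>
        foldr (\<lambda>g x. \<phi> g \<otimes>\<^bsub>A\<^esub> x) (letters w) \<one>\<^bsub>A\<^esub>)"


section \<open>Tensor products\<close>

text \<open>\<open>M \<otimes> N\<close> is the free vector space on \<open>carrier M \<times> carrier N\<close> modulo bilinearity.\<close>

definition free_module :: "'x set \<Rightarrow> ('k::field, 'x \<Rightarrow>\<^sub>0 'k) module" where
  \<comment> \<open>\<^const>\<open>mult\<close> and \<^const>\<open>one\<close> are junk\<close>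
  "free_module X =
     \<lparr>carrier = {p. Poly_Mapping.keys p \<subseteq> X}, mult = \<lambda>_ _. 0, one = 0, zero = 0, add = (+),
      smult = \<lambda>c. Poly_Mapping.map ((*) c)\<rparr>"

definition tensor_kernel ::
    "('k::field, 'a, 'm) module_scheme \<Rightarrow> ('k, 'b, 'n) module_scheme \<Rightarrow> ('a \<times> 'b \<Rightarrow>\<^sub>0 'k) set" where
  "tensor_kernel M N = generated_submodule (free_module (carrier M \<times> carrier N))
     ({Poly_Mapping.single (x \<oplus>\<^bsub>M\<^esub> x', y) 1
         - Poly_Mapping.single (x, y) 1 - Poly_Mapping.single (x', y) 1
       | x x' y. x \<in> carrier M \<and> x' \<in> carrier M \<and> y \<in> carrier N} \<union>
      {Poly_Mapping.single (x, y \<oplus>\<^bsub>N\<^esub> y') 1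
         - Poly_Mapping.single (x, y) 1 - Poly_Mapping.single (x, y') 1
       | x y y'. x \<in> carrier M \<and> y \<in> carrier N \<and> y' \<in> carrier N} \<union>
      {Poly_Mapping.single (c \<odot>\<^bsub>M\<^esub> x, y) 1 - Poly_Mapping.single (x, y) c
       | c x y. x \<in> carrier M \<and> y \<in> carrier N} \<union>
      {Poly_Mapping.single (x, c \<odot>\<^bsub>N\<^esub> y) 1 - Poly_Mapping.single (x, y) c
       | c x y. x \<in> carrier M \<and> y \<in> carrier N})"

definition tensor_module ::
    "('k::field, 'a, 'm) module_scheme \<Rightarrow> ('k, 'b, 'n) module_scheme \<Rightarrow>
     ('k, ('a \<times> 'b \<Rightarrow>\<^sub>0 'k) set) module" where
  "tensor_module M N =
     quotient_module (free_module (carrier M \<times> carrier N)) (tensor_kernel M N)"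

definition tensor ::
    "('k::field, 'a, 'm) module_scheme \<Rightarrow> ('k, 'b, 'n) module_scheme \<Rightarrow>
     'a \<Rightarrow> 'b \<Rightarrow> ('a \<times> 'b \<Rightarrow>\<^sub>0 'k) set" where
  "tensor M N x y =
     tensor_kernel M N +>\<^bsub>free_module (carrier M \<times> carrier N)\<^esub> Poly_Mapping.single (x, y) 1"

text \<open>
  The linear map \<open>M \<otimes> N \<rightarrow> V\<close> with \<open>x \<otimes> y \<mapsto> f x y\<close>, for bilinear \<open>f\<close>; bilinearity makes the
  image of the coset \<open>t\<close> a singleton.
\<close>

definition tensor_lift ::
    "('k::field, 'v, 'm) module_scheme \<Rightarrow> ('a \<Rightarrow> 'b \<Rightarrow> 'v) \<Rightarrow> ('a \<times> 'b \<Rightarrow>\<^sub>0 'k) set \<Rightarrow> 'v" where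
  "tensor_lift V f t = the_elem
     ((\<lambda>p. \<Oplus>\<^bsub>V\<^esub>z\<in>Poly_Mapping.keys p. Poly_Mapping.lookup p z \<odot>\<^bsub>V\<^esub> f (fst z) (snd z)) ` t)"

definition tensor_algebra ::
    "('k::field, 'a, 'm) module_scheme \<Rightarrow> ('k, 'b, 'n) module_scheme \<Rightarrow>
     ('k, ('a \<times> 'b \<Rightarrow>\<^sub>0 'k) set) module" where
  "tensor_algebra A B = (tensor_module A B)
     \<lparr>mult := \<lambda>t u.
        tensor_lift (tensor_module A B) (\<lambda>a b.
          tensor_lift (tensor_module A B) (\<lambda>a' b'.
            tensor A B (a \<otimes>\<^bsub>A\<^esub> a') (b \<otimes>\<^bsub>B\<^esub> b')) u) t,
      one := tensor A B \<one>\<^bsub>A\<^esub> \<one>\<^bsub>B\<^esub>\<rparr>"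


section \<open>Hopf algebras\<close>

record (overloaded) ('k::field, 'a) hopf = "('k, 'a) module" +
  comult :: "'a \<Rightarrow> ('a \<times> 'a \<Rightarrow>\<^sub>0 'k) set"
  counit :: "'a \<Rightarrow> 'k"
  antipode :: "'a \<Rightarrow> 'a"

text \<open>Sweedler sums \<open>\<Sum> f x\<^sub>1 x\<^sub>2\<close> and \<open>\<Sum> f x\<^sub>1 x\<^sub>2 x\<^sub>3\<close> with values in \<open>V\<close>.\<close>

definition sweedler2 ::
    "('k::field, 'a, 'm) hopf_scheme \<Rightarrow> ('k, 'v, 'n) module_scheme \<Rightarrow>
     ('a \<Rightarrow> 'a \<Rightarrow> 'v) \<Rightarrow> 'a \<Rightarrow> 'v" where
  "sweedler2 H V f x = tensor_lift V f (comult H x)"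

definition sweedler3 ::
    "('k::field, 'a, 'm) hopf_scheme \<Rightarrow> ('k, 'v, 'n) module_scheme \<Rightarrow>
     ('a \<Rightarrow> 'a \<Rightarrow> 'a \<Rightarrow> 'v) \<Rightarrow> 'a \<Rightarrow> 'v" where
  "sweedler3 H V f x = sweedler2 H V (\<lambda>y x3. sweedler2 H V (\<lambda>x1 x2. f x1 x2 x3) y) x"

definition hopf_algebra :: "('k::field, 'a, 'm) hopf_scheme \<Rightarrow> bool" where
  "hopf_algebra H \<longleftrightarrow>
     assoc_algebra H \<and>
     comult H \<in> algebra_hom H (tensor_algebra H H) \<and>
     counit H \<in> algebra_hom H scalars \<and>
     antipode H \<in> linear_maps H H \<and>
     (let H3 = tensor_module H (tensor_module H H);
          pure3 = (\<lambda>a b c. tensor H (tensor_module H H) a (tensor H H b c))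
      in \<forall>x\<in>carrier H.
        sweedler3 H H3 pure3 x = sweedler2 H H3 (\<lambda>a y. sweedler2 H H3 (\<lambda>b c. pure3 a b c) y) x) \<and>
     (\<forall>x\<in>carrier H.
        sweedler2 H H (\<lambda>a b. counit H a \<odot>\<^bsub>H\<^esub> b) x = x \<and>
        sweedler2 H H (\<lambda>a b. counit H b \<odot>\<^bsub>H\<^esub> a) x = x \<and>
        sweedler2 H H (\<lambda>a b. antipode H a \<otimes>\<^bsub>H\<^esub> b) x = counit H x \<odot>\<^bsub>H\<^esub> \<one>\<^bsub>H\<^esub> \<and>
        sweedler2 H H (\<lambda>a b. a \<otimes>\<^bsub>H\<^esub> antipode H b) x = counit H x \<odot>\<^bsub>H\<^esub> \<one>\<^bsub>H\<^esub>)"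

definition hopf_isomorphic ::
    "('k::field, 'a, 'm) hopf_scheme \<Rightarrow> ('k, 'b, 'n) hopf_scheme \<Rightarrow> bool" where
  "hopf_isomorphic H L \<longleftrightarrow> hopf_algebra H \<and> hopf_algebra L \<and>
     (\<exists>\<phi> \<in> algebra_hom H L. bij_betw \<phi> (carrier H) (carrier L) \<and>
        (\<forall>x\<in>carrier H.
           comult L (\<phi> x) = sweedler2 H (tensor_module L L) (\<lambda>a b. tensor L L (\<phi> a) (\<phi> b)) x \<and>
           counit L (\<phi> x) = counit H x \<and>
           antipode L (\<phi> x) = \<phi> (antipode H x)))"

text \<open>
  The canonical map \<open>C \<otimes> C \<rightarrow> H \<otimes> H\<close> of a subspace \<open>C\<close> of \<open>H\<close>.  The two sides are quotients of
  different free spaces, so this is not a set inclusion; it is injective.  The coproduct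
  of a Hopf subalgebra is the coproduct of \<open>H\<close> pulled back along it.
\<close>

definition tensor_incl ::
    "('k::field, 'a, 'm) hopf_scheme \<Rightarrow> ('a \<times> 'a \<Rightarrow>\<^sub>0 'k) set \<Rightarrow> ('a \<times> 'a \<Rightarrow>\<^sub>0 'k) set" where
  "tensor_incl H = tensor_lift (tensor_module H H) (tensor H H)"

definition hopf_subalgebra :: "'a set \<Rightarrow> ('k::field, 'a) hopf \<Rightarrow> bool" where
  "hopf_subalgebra C H \<longleftrightarrow> submodule C scalars H \<and> submonoid C H \<and>
     comult H ` C \<subseteq>
       tensor_incl H ` carrier (tensor_module (H\<lparr>carrier := C\<rparr>) (H\<lparr>carrier := C\<rparr>)) \<and>
     antipode H ` C \<subseteq> C"

definition restrict_hopf :: "('k::field, 'a) hopf \<Rightarrow> 'a set \<Rightarrow> ('k, 'a) hopf" where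
  "restrict_hopf H C = H\<lparr>carrier := C,
     comult := \<lambda>x. inv_into (carrier (tensor_module (H\<lparr>carrier := C\<rparr>) (H\<lparr>carrier := C\<rparr>)))
       (tensor_incl H) (comult H x)\<rparr>"

definition generated_hopf_subalgebra ::
    "('k::field, 'a) hopf \<Rightarrow> 'a set \<Rightarrow> ('k, 'a) hopf" where
  "generated_hopf_subalgebra H S =
     restrict_hopf H (\<Inter>{C. hopf_subalgebra C H \<and> S \<subseteq> C})"


section \<open>Skew-dual pairings and the Drinfeld double\<close>

text \<open>
  The pairing on tensor squares is \<open>\<langle>b \<otimes> b', a \<otimes> a'\<rangle> = \<langle>b, a\<rangle> \<langle>b', a'\<rangle>\<close>; the values of \<open>p\<close> outside
  the two carriers are irrelevant.
\<close>

definition skew_dual_pairing ::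
    "('k::field, 'b, 'm) hopf_scheme \<Rightarrow> ('k, 'a, 'n) hopf_scheme \<Rightarrow> ('b \<Rightarrow> 'a \<Rightarrow> 'k) \<Rightarrow> bool" where
  "skew_dual_pairing B A p \<longleftrightarrow>
     (\<forall>b\<in>carrier B. p b \<in> linear_maps A scalars) \<and>
     (\<forall>a\<in>carrier A. (\<lambda>b. p b a) \<in> linear_maps B scalars) \<and>
     (\<forall>b\<in>carrier B. p b \<one>\<^bsub>A\<^esub> = counit B b) \<and>
     (\<forall>a\<in>carrier A. p \<one>\<^bsub>B\<^esub> a = counit A a) \<and>
     (\<forall>b\<in>carrier B. \<forall>a1\<in>carrier A. \<forall>a2\<in>carrier A.
        p b (a1 \<otimes>\<^bsub>A\<^esub> a2) = sweedler2 B scalars (\<lambda>b1 b2. p b2 a1 * p b1 a2) b) \<and>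
     (\<forall>b1\<in>carrier B. \<forall>b2\<in>carrier B. \<forall>a\<in>carrier A.
        p (b1 \<otimes>\<^bsub>B\<^esub> b2) a = sweedler2 A scalars (\<lambda>a1 a2. p b1 a1 * p b2 a2) a)"

definition double_mult ::
    "('k::field, 'a) hopf \<Rightarrow> ('k, 'b) hopf \<Rightarrow> ('b \<Rightarrow> 'a \<Rightarrow> 'k) \<Rightarrow>
     ('a \<times> 'b \<Rightarrow>\<^sub>0 'k) set \<Rightarrow> ('a \<times> 'b \<Rightarrow>\<^sub>0 'k) set \<Rightarrow> ('a \<times> 'b \<Rightarrow>\<^sub>0 'k) set" where
  "double_mult A B p t u =
     (let T = tensor_module A B in
      tensor_lift T (\<lambda>a b. tensor_lift T (\<lambda>a' b'.
        sweedler3 B T (\<lambda>b1 b2 b3. sweedler3 A T (\<lambda>a1 a2 a3.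
          (p (antipode B b1) a1 * p b3 a3) \<odot>\<^bsub>T\<^esub>
            tensor A B (a \<otimes>\<^bsub>A\<^esub> a2) (b2 \<otimes>\<^bsub>B\<^esub> b')) a') b) u) t)"

definition drinfeld_double ::
    "('k::field, 'a) hopf \<Rightarrow> ('k, 'b) hopf \<Rightarrow> ('b \<Rightarrow> 'a \<Rightarrow> 'k) \<Rightarrow>
     ('k, ('a \<times> 'b \<Rightarrow>\<^sub>0 'k) set) hopf" where
  "drinfeld_double A B p =
     (let T = tensor_module A B; T2 = tensor_module T T in
      \<lparr>carrier = carrier T,
       mult = double_mult A B p,
       one = tensor A B \<one>\<^bsub>A\<^esub> \<one>\<^bsub>B\<^esub>,
       zero = \<zero>\<^bsub>T\<^esub>,
       add = add T,
       smult = smult T,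
       comult = tensor_lift T2 (\<lambda>a b.
         sweedler2 A T2 (\<lambda>a1 a2. sweedler2 B T2 (\<lambda>b1 b2.
           tensor T T (tensor A B a1 b1) (tensor A B a2 b2)) b) a),
       counit = tensor_lift scalars (\<lambda>a b. counit A a * counit B b),
       antipode = tensor_lift T (\<lambda>a b.
         double_mult A B p (tensor A B \<one>\<^bsub>A\<^esub> (antipode B b)) (tensor A B (antipode A a) \<one>\<^bsub>B\<^esub>))\<rparr>)"


section \<open>The ground field and the root data\<close>

text \<open>
  The values of the pairing involve \<open>r\<^sup>1\<^sup>/\<^sup>2\<close> and \<open>s\<^sup>1\<^sup>/\<^sup>2\<close>, so the ground field is
  \<open>\<rat>(r\<^sup>1\<^sup>/\<^sup>2, s\<^sup>1\<^sup>/\<^sup>2)\<close>, the rational functions in the two square roots, and not just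
  \<open>\<rat>(r, s)\<close>.  The parameters \<open>r\<close> and \<open>s\<close> are \<open>rr\<close> and \<open>ss\<close>.
\<close>

type_synonym K = "rat poly poly fract"

definition sqrt_r :: K where "sqrt_r = Fract [:[:0, 1:]:] 1"
definition sqrt_s :: K where "sqrt_s = Fract [:0, 1:] 1"
definition rr :: K where "rr = sqrt_r ^ 2"
definition ss :: K where "ss = sqrt_s ^ 2"

text \<open>
  Vectors are given by their coordinates \<open>1, \<dots>, n\<close> with respect to the \<open>\<epsilon>\<^sub>k\<close>.  The component of
  \<open>\<alpha>\<^sub>0\<close> along \<open>\<delta>\<close> is left out, as \<open>\<delta>\<close> is orthogonal to everything.
\<close>

definition inner_prod :: "nat \<Rightarrow> (nat \<Rightarrow> int) \<Rightarrow> (nat \<Rightarrow> int) \<Rightarrow> int" where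
  "inner_prod n x y = (\<Sum>k=1..n. x k * y k)"

definition eps :: "nat \<Rightarrow> nat \<Rightarrow> int" where
  "eps j = (\<lambda>k. if k = j then 1 else 0)"

definition alpha :: "nat \<Rightarrow> nat \<Rightarrow> nat \<Rightarrow> int" where
  "alpha n i = (if i = 0 then (\<lambda>k. - (eps 1 k - eps n k)) else (\<lambda>k. eps i k - eps (Suc i) k))"

text \<open>
  \<open>weight n rr ss j i\<close> is the eigenvalue of \<open>e\<^sub>i\<close> under conjugation by \<open>\<omega>\<^sub>j\<close>, and
  \<open>weight n ss rr j i\<close> the one under conjugation by \<open>\<omega>'\<^sub>j\<close>.
\<close>

definition weight :: "nat \<Rightarrow> K \<Rightarrow> K \<Rightarrow> nat \<Rightarrow> nat \<Rightarrow> K" where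
  "weight n x y j i =
     (if j = 0
      then x powi (- inner_prod n (eps (Suc i)) (alpha n 0)) *
           y powi (inner_prod n (eps 1) (alpha n i))
      else x powi (inner_prod n (eps j) (alpha n i)) *
           y powi (inner_prod n (eps (Suc j)) (alpha n i)))"


section \<open>The two-parameter quantum affine algebra\<close>

text \<open>\<open>SqrtGamma\<close> is \<open>\<gamma>\<^sup>1\<^sup>/\<^sup>2\<close>; \<open>Inv t\<close> is a formal symbol for the inverse of \<open>Grp t\<close>.\<close>

datatype grouplike = Omega nat | Omega' nat | SqrtGamma | SqrtGamma' | Deg | Deg'

datatype generator = GenE nat | GenF nat | Grp grouplike | Inv grouplike

definition grouplikes_B :: "nat \<Rightarrow> grouplike set" where
  "grouplikes_B n = Omega ` {..<n} \<union> {SqrtGamma, Deg}"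

definition grouplikes_B' :: "nat \<Rightarrow> grouplike set" where
  "grouplikes_B' n = Omega' ` {..<n} \<union> {SqrtGamma', Deg'}"

definition gens_B :: "nat \<Rightarrow> generator set" where
  "gens_B n = GenE ` {..<n} \<union> Grp ` grouplikes_B n \<union> Inv ` grouplikes_B n"

definition gens_B' :: "nat \<Rightarrow> generator set" where
  "gens_B' n = GenF ` {..<n} \<union> Grp ` grouplikes_B' n \<union> Inv ` grouplikes_B' n"

definition gens :: "nat \<Rightarrow> generator set" where
  "gens n = gens_B n \<union> gens_B' n"

definition commutator :: "'a::ring_1 \<Rightarrow> 'a \<Rightarrow> 'a" where
  "commutator x y = x * y - y * x"

text \<open>
  Each element \<open>x - y\<close> below stands for the defining relation \<open>x = y\<close>.  The relation usually
  abbreviated \<open>\<gamma>\<gamma>' = rs\<close> is \<open>\<gamma>\<gamma>' = (rs)\<^sup>c\<close>, with \<open>c\<close> the canonical central element: it names the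
  central group-like element \<open>\<omega>\<^sub>\<delta>\<omega>'\<^sub>\<delta>\<close> and puts no constraint on the generators.  It cannot mean
  the scalar \<open>rs\<close>, since the counit takes the value 1 on \<open>\<gamma>\<gamma>'\<close> and \<open>rs \<noteq> 1\<close>.
\<close>

inductive_set relations :: "nat \<Rightarrow> (generator word \<Rightarrow>\<^sub>0 K) set" for n :: nat where
  \<comment> \<open>the group-like generators\<close>
  central: "t \<in> {SqrtGamma, SqrtGamma'} \<Longrightarrow> x \<in> {Grp t, Inv t} \<Longrightarrow> y \<in> gens n \<Longrightarrow>
    commutator (var x) (var y) \<in> relations n"
| gamma: "var (Grp SqrtGamma) ^ 2
    - prod_list (map (\<lambda>i. var (Grp (Omega i))) [0..<n]) \<in> relations n"
| gamma': "var (Grp SqrtGamma') ^ 2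
    - prod_list (map (\<lambda>i. var (Grp (Omega' i))) [0..<n]) \<in> relations n"
| right_inverse: "t \<in> grouplikes_B n \<union> grouplikes_B' n \<Longrightarrow>
    var (Grp t) * var (Inv t) - 1 \<in> relations n"
| left_inverse: "t \<in> grouplikes_B n \<union> grouplikes_B' n \<Longrightarrow>
    var (Inv t) * var (Grp t) - 1 \<in> relations n"
| commute: "t \<in> grouplikes_B n \<union> grouplikes_B' n \<Longrightarrow> u \<in> grouplikes_B n \<union> grouplikes_B' n \<Longrightarrow>
    x \<in> {Grp t, Inv t} \<Longrightarrow> y \<in> {Grp u, Inv u} \<Longrightarrow>
    commutator (var x) (var y) \<in> relations n"
  \<comment> \<open>their action on the \<open>e\<^sub>i\<close> and \<open>f\<^sub>i\<close>\<close>
| Deg_E: "i < n \<Longrightarrow> var (Grp Deg) * var (GenE i) * var (Inv Deg)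
    - const (if i = 0 then rr else 1) * var (GenE i) \<in> relations n"
| Deg_F: "i < n \<Longrightarrow> var (Grp Deg) * var (GenF i) * var (Inv Deg)
    - const (if i = 0 then inverse rr else 1) * var (GenF i) \<in> relations n"
| Omega_E: "i < n \<Longrightarrow> j < n \<Longrightarrow> var (Grp (Omega j)) * var (GenE i) * var (Inv (Omega j))
    - const (weight n rr ss j i) * var (GenE i) \<in> relations n"
| Omega_F: "i < n \<Longrightarrow> j < n \<Longrightarrow> var (Grp (Omega j)) * var (GenF i) * var (Inv (Omega j))
    - const (inverse (weight n rr ss j i)) * var (GenF i) \<in> relations n"
| Deg'_E: "i < n \<Longrightarrow> var (Grp Deg') * var (GenE i) * var (Inv Deg')
    - const (if i = 0 then ss else 1) * var (GenE i) \<in> relations n"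
| Deg'_F: "i < n \<Longrightarrow> var (Grp Deg') * var (GenF i) * var (Inv Deg')
    - const (if i = 0 then inverse ss else 1) * var (GenF i) \<in> relations n"
| Omega'_E: "i < n \<Longrightarrow> j < n \<Longrightarrow> var (Grp (Omega' j)) * var (GenE i) * var (Inv (Omega' j))
    - const (weight n ss rr j i) * var (GenE i) \<in> relations n"
| Omega'_F: "i < n \<Longrightarrow> j < n \<Longrightarrow> var (Grp (Omega' j)) * var (GenF i) * var (Inv (Omega' j))
    - const (inverse (weight n ss rr j i)) * var (GenF i) \<in> relations n"
  \<comment> \<open>commutation of the \<open>e\<^sub>i\<close> and \<open>f\<^sub>j\<close>\<close>
| E_F: "i < n \<Longrightarrow> j < n \<Longrightarrow> commutator (var (GenE i)) (var (GenF j))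
    - const ((if i = j then 1 else 0) / (rr - ss)) * (var (Grp (Omega i)) - var (Grp (Omega' i)))
    \<in> relations n"
| E_E: "i < n \<Longrightarrow> j < n \<Longrightarrow> (i, j) \<notin> {(0, n - 1), (n - 1, 0)} \<Longrightarrow>
    inner_prod n (alpha n i) (alpha n j) = 0 \<Longrightarrow>
    commutator (var (GenE i)) (var (GenE j)) \<in> relations n"
| F_F: "i < n \<Longrightarrow> j < n \<Longrightarrow> (i, j) \<notin> {(0, n - 1), (n - 1, 0)} \<Longrightarrow>
    inner_prod n (alpha n i) (alpha n j) = 0 \<Longrightarrow>
    commutator (var (GenF i)) (var (GenF j)) \<in> relations n"
  \<comment> \<open>the Serre relations\<close>
| Serre_E1: "i < n \<Longrightarrow> j = Suc i mod n \<Longrightarrow>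
    var (GenE i) ^ 2 * var (GenE j) - const (rr + ss) * (var (GenE i) * var (GenE j) * var (GenE i))
    + const (rr * ss) * (var (GenE j) * var (GenE i) ^ 2) \<in> relations n"
| Serre_E2: "i < n \<Longrightarrow> j = Suc i mod n \<Longrightarrow>
    var (GenE i) * var (GenE j) ^ 2 - const (rr + ss) * (var (GenE j) * var (GenE i) * var (GenE j))
    + const (rr * ss) * (var (GenE j) ^ 2 * var (GenE i)) \<in> relations n"
| Serre_F1: "i < n \<Longrightarrow> j = Suc i mod n \<Longrightarrow>
    var (GenF i) ^ 2 * var (GenF j)
    - const (inverse rr + inverse ss) * (var (GenF i) * var (GenF j) * var (GenF i))
    + const (inverse (rr * ss)) * (var (GenF j) * var (GenF i) ^ 2) \<in> relations n"
| Serre_F2: "i < n \<Longrightarrow> j = Suc i mod n \<Longrightarrow>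
    var (GenF i) * var (GenF j) ^ 2
    - const (inverse rr + inverse ss) * (var (GenF j) * var (GenF i) * var (GenF j))
    + const (inverse (rr * ss)) * (var (GenF j) ^ 2 * var (GenF i)) \<in> relations n"

type_synonym U_elem = "(generator word \<Rightarrow>\<^sub>0 K) set"

definition U_ideal :: "nat \<Rightarrow> U_elem" where
  "U_ideal n = genideal (free_algebra (gens n)) (relations n)"

definition U_algebra :: "nat \<Rightarrow> (K, U_elem) module" where
  "U_algebra n = quotient_module (free_algebra (gens n)) (U_ideal n)"

definition gen :: "nat \<Rightarrow> generator \<Rightarrow> U_elem" where
  "gen n g = U_ideal n +>\<^bsub>free_algebra (gens n)\<^esub> var g"

fun comult_gen :: "nat \<Rightarrow> generator \<Rightarrow> (U_elem \<times> U_elem \<Rightarrow>\<^sub>0 K) set" where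
  "comult_gen n (GenE i) =
     tensor (U_algebra n) (U_algebra n) (gen n (GenE i)) \<one>\<^bsub>U_algebra n\<^esub>
     \<oplus>\<^bsub>tensor_algebra (U_algebra n) (U_algebra n)\<^esub>
     tensor (U_algebra n) (U_algebra n) (gen n (Grp (Omega i))) (gen n (GenE i))"
| "comult_gen n (GenF i) =
     tensor (U_algebra n) (U_algebra n) (gen n (GenF i)) (gen n (Grp (Omega' i)))
     \<oplus>\<^bsub>tensor_algebra (U_algebra n) (U_algebra n)\<^esub>
     tensor (U_algebra n) (U_algebra n) \<one>\<^bsub>U_algebra n\<^esub> (gen n (GenF i))"
| "comult_gen n (Grp t) =
     tensor (U_algebra n) (U_algebra n) (gen n (Grp t)) (gen n (Grp t))"
| "comult_gen n (Inv t) =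
     tensor (U_algebra n) (U_algebra n) (gen n (Inv t)) (gen n (Inv t))"

fun counit_gen :: "generator \<Rightarrow> K" where
  "counit_gen (GenE i) = 0"
| "counit_gen (GenF i) = 0"
| "counit_gen (Grp t) = 1"
| "counit_gen (Inv t) = 1"

fun antipode_gen :: "nat \<Rightarrow> generator \<Rightarrow> U_elem" where
  "antipode_gen n (GenE i) =
     \<ominus>\<^bsub>U_algebra n\<^esub> (gen n (Inv (Omega i)) \<otimes>\<^bsub>U_algebra n\<^esub> gen n (GenE i))"
| "antipode_gen n (GenF i) =
     \<ominus>\<^bsub>U_algebra n\<^esub> (gen n (GenF i) \<otimes>\<^bsub>U_algebra n\<^esub> gen n (Inv (Omega' i)))"
| "antipode_gen n (Grp t) = gen n (Inv t)"
| "antipode_gen n (Inv t) = gen n (Grp t)"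

text \<open>
  The structure maps extend their values on generators to (anti)homomorphisms on the free
  algebra, and are then evaluated on cosets.
\<close>

definition U_rs :: "nat \<Rightarrow> (K, U_elem) hopf" where
  "U_rs n = module.extend (U_algebra n) (hopf.fields
     (\<lambda>X. the_elem
        (free_algebra_hom (tensor_algebra (U_algebra n) (U_algebra n)) (comult_gen n) ` X))
     (\<lambda>X. the_elem (free_algebra_hom scalars counit_gen ` X))
     (\<lambda>X. the_elem (free_algebra_hom (opposite (U_algebra n)) (antipode_gen n) ` X)))"

definition B_hat :: "nat \<Rightarrow> (K, U_elem) hopf" where
  "B_hat n = generated_hopf_subalgebra (U_rs n) (gen n ` gens_B n)"

definition B'_hat :: "nat \<Rightarrow> (K, U_elem) hopf" where
  "B'_hat n = generated_hopf_subalgebra (U_rs n) (gen n ` gens_B' n)"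


section \<open>The pairing\<close>

text \<open>\<open>gpow n t a\<close> is the power of the group-like generator \<open>t\<close> with exponent \<open>a = 1\<close> or \<open>a = -1\<close>.\<close>

definition gpow :: "nat \<Rightarrow> grouplike \<Rightarrow> int \<Rightarrow> U_elem" where
  "gpow n t a = gen n (if a = 1 then Grp t else Inv t)"

definition gamma_elem :: "nat \<Rightarrow> U_elem" where
  "gamma_elem n = gen n (Grp SqrtGamma) \<otimes>\<^bsub>U_rs n\<^esub> gen n (Grp SqrtGamma)"

definition gamma'_elem :: "nat \<Rightarrow> U_elem" where
  "gamma'_elem n = gen n (Grp SqrtGamma') \<otimes>\<^bsub>U_rs n\<^esub> gen n (Grp SqrtGamma')"

text \<open>
  The last two clauses are the vanishing of the pairing on the remaining pairs of
  generators, which pair an \<open>e\<^sub>j\<close> or an \<open>f\<^sub>i\<close> with a group-like generator.  The values on pairs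
  of group-like generators not listed here are determined by the axioms of a skew-dual
  pairing, except that \<open>\<langle>\<gamma>'\<^sup>1\<^sup>/\<^sup>2, \<gamma>\<^sup>1\<^sup>/\<^sup>2\<rangle>\<close> is determined only up to sign.
\<close>

definition pairing_on_generators :: "nat \<Rightarrow> (U_elem \<Rightarrow> U_elem \<Rightarrow> K) \<Rightarrow> bool" where
  "pairing_on_generators n p \<longleftrightarrow>
     (\<forall>i<n. \<forall>j<n. p (gen n (GenF i)) (gen n (GenE j)) = (if i = j then 1 else 0) * (1 / (ss - rr))) \<and>
     (\<forall>i<n. \<forall>j<n. p (gpow n (Omega' i) 1) (gpow n (Omega j) 1) = weight n rr ss j i) \<and>
     (\<forall>i<n. \<forall>j<n. \<forall>a\<in>{1, -1}.
        p (gpow n (Omega' i) a) (gpow n (Omega j) (-1)) =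
          inverse (p (gpow n (Omega' i) a) (gpow n (Omega j) 1)) \<and>
        p (gpow n (Omega' i) a) (gpow n (Omega j) (-1)) =
          p (gpow n (Omega' i) 1) (gpow n (Omega j) 1) powi (- a)) \<and>
     (\<forall>a\<in>{1, -1}.
        p (gpow n SqrtGamma' a) (gamma_elem n) = 1 \<and>
        p (gamma'_elem n) (gpow n SqrtGamma a) = 1 \<and>
        p (gamma'_elem n) (gamma_elem n) = 1) \<and>
     (\<forall>a\<in>{1, -1}.
        p (gpow n Deg' 1) (gpow n Deg 1) powi a = 1 \<and>
        p (gpow n Deg' a) (gpow n Deg 1) = 1 \<and>
        p (gpow n Deg' 1) (gpow n Deg a) = 1) \<and>
     (\<forall>i<n. \<forall>a\<in>{1, -1}. \<forall>b\<in>{1, -1}.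
        p (gpow n SqrtGamma' a) (gpow n (Omega i) b) = 1 \<and>
        p (gpow n (Omega' i) a) (gpow n SqrtGamma b) = 1) \<and>
     (\<forall>i<n. \<forall>a\<in>{1, -1}.
        p (gpow n Deg' a) (gpow n (Omega i) 1) = ss powi (if i = 0 then - a else 0) \<and>
        p (gpow n Deg' 1) (gpow n (Omega i) a) = ss powi (if i = 0 then - a else 0) \<and>
        p (gpow n (Omega' i) a) (gpow n Deg 1) = rr powi (if i = 0 then a else 0) \<and>
        p (gpow n (Omega' i) 1) (gpow n Deg a) = rr powi (if i = 0 then a else 0)) \<and>
     (\<forall>a\<in>{1, -1}.
        p (gpow n Deg' 1) (gpow n SqrtGamma a) = sqrt_s powi (- a) \<and>
        p (gpow n Deg' a) (gpow n SqrtGamma 1) = sqrt_s powi (- a) \<and>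
        p (gpow n SqrtGamma' a) (gpow n Deg 1) = sqrt_r powi a \<and>
        p (gpow n SqrtGamma' 1) (gpow n Deg a) = sqrt_r powi a) \<and>
     (\<forall>i<n. \<forall>t\<in>grouplikes_B n. \<forall>a\<in>{1, -1}. p (gen n (GenF i)) (gpow n t a) = 0) \<and>
     (\<forall>j<n. \<forall>t\<in>grouplikes_B' n. \<forall>a\<in>{1, -1}. p (gpow n t a) (gen n (GenE j)) = 0)"

end

theory Submission
  imports Defs
begin

text \<open>
  No identity of the double is verified directly.  The Borel subalgebra \<open>B\<close> acts on
  \<open>T = B \<otimes> B'\<close> by left multiplication, and \<open>B'\<close> acts by
  \<open>b \<cdot> (a \<otimes> c) = \<Sum> (S(b\<^sub>1) \<rightharpoonup> a \<leftharpoonup> b\<^sub>3) \<otimes> b\<^sub>2c\<close>, a convolution of three commuting actions of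
  \<open>B'\<close> and hence again an action.  The product of the double is \<open>(a \<otimes> b) u = a \<cdot> (b \<cdot> u)\<close>.  On
  group-like and skew-primitive generators, the commutators of the two actions are read off from
  the pairing and are the relations of \<open>U\<close>; so \<open>U\<close> acts on \<open>T\<close>.  Evaluating this
  action at \<open>1 \<otimes> 1\<close> gives a left inverse of the multiplication map \<open>T \<rightarrow> U\<close>, which is onto by
  straightening \<open>B'B\<close> into \<open>BB'\<close>.  All structure of the double is then transported along this
  bijection.
\<close>

section \<open>Vector spaces and linear maps\<close>

text \<open>Only the relations between B and B' cost a computation: those inside one Borel hold on
  \<open>T\<close> because both actions are homomorphisms defined on subalgebras of U. The constants
  arise as follows. A group-like k of B' and a group-like g of B commute because \<langle>S(k),
  g\<rangle>\<langle>k, g\<rangle> = 1, so the undetermined sign of the pairing on the two square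
  roots does no harm. Moving f_j to the right past a group-like t of B costs \<langle>\<omega>'_j,
  t\<rangle>. The normalisation \<langle>f_i, e_i\<rangle> = 1/(s - r) becomes the factor 1/(r - s)
  of [e_i, f_i]. The action replaces a PBW basis: it shows that B \<otimes> B' \<rightarrow> U is
  injective without any knowledge of the size of U. Two obstacles come before all this. U itself has
  to be proved a Hopf algebra, so its relations, the Serre relations included, are verified in U
  \<otimes> U and in the opposite algebra. And the coproduct of a Borel C is a preimage under C
  \<otimes> C \<rightarrow> U \<otimes> U, so the injectivity of that map must be known; it rests on
  a linear complement of C, found by Zorn's lemma.\<close>

abbreviation vspace :: "('k::field, 'a, 'm) module_scheme \<Rightarrow> bool" where
  "vspace M \<equiv> module scalars M"

lemma scalars_simps [simp]:
  "carrier scalars = UNIV" "mult scalars = (*)" "one scalars = 1" "zero scalars = 0"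
  "add scalars = (+)" "smult scalars = (*)"
  by (simp_all add: scalars_def)

lemma cring_scalars: "cring (scalars :: ('k::field, 'k) module)"
  by unfold_locales
     (auto simp: scalars_def algebra_simps Units_def add_eq_0_iff intro: exI[of _ "- _"])

context
  fixes M :: "('k::field, 'a, 'm) module_scheme"
  assumes M: "vspace M"
begin

interpretation module scalars M by (rule M)

lemma vs_zero_closed [simp]: "\<zero>\<^bsub>M\<^esub> \<in> carrier M" by simp
lemma vs_add_closed [simp]: "x \<in> carrier M \<Longrightarrow> y \<in> carrier M \<Longrightarrow> x \<oplus>\<^bsub>M\<^esub> y \<in> carrier M" by simp
lemma vs_smult_closed [simp]: "x \<in> carrier M \<Longrightarrow> c \<odot>\<^bsub>M\<^esub> x \<in> carrier M" by simp
lemma vs_neg_closed [simp]: "x \<in> carrier M \<Longrightarrow> \<ominus>\<^bsub>M\<^esub> x \<in> carrier M" by simp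
lemma vs_minus_closed [simp]: "x \<in> carrier M \<Longrightarrow> y \<in> carrier M \<Longrightarrow> x \<ominus>\<^bsub>M\<^esub> y \<in> carrier M" by simp
lemma vs_assoc: "x \<in> carrier M \<Longrightarrow> y \<in> carrier M \<Longrightarrow> z \<in> carrier M \<Longrightarrow>
    (x \<oplus>\<^bsub>M\<^esub> y) \<oplus>\<^bsub>M\<^esub> z = x \<oplus>\<^bsub>M\<^esub> (y \<oplus>\<^bsub>M\<^esub> z)"
  by (rule M.a_assoc)
lemma vs_comm: "x \<in> carrier M \<Longrightarrow> y \<in> carrier M \<Longrightarrow> x \<oplus>\<^bsub>M\<^esub> y = y \<oplus>\<^bsub>M\<^esub> x"
  by (rule M.a_comm)
lemma vs_lcomm: "x \<in> carrier M \<Longrightarrow> y \<in> carrier M \<Longrightarrow> z \<in> carrier M \<Longrightarrow>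
    x \<oplus>\<^bsub>M\<^esub> (y \<oplus>\<^bsub>M\<^esub> z) = y \<oplus>\<^bsub>M\<^esub> (x \<oplus>\<^bsub>M\<^esub> z)"
  by (rule M.a_lcomm)
lemma vs_l_zero [simp]: "x \<in> carrier M \<Longrightarrow> \<zero>\<^bsub>M\<^esub> \<oplus>\<^bsub>M\<^esub> x = x" by simp
lemma vs_r_zero [simp]: "x \<in> carrier M \<Longrightarrow> x \<oplus>\<^bsub>M\<^esub> \<zero>\<^bsub>M\<^esub> = x" by simp
lemma vs_smult_l_distr: "x \<in> carrier M \<Longrightarrow> (a + b) \<odot>\<^bsub>M\<^esub> x = a \<odot>\<^bsub>M\<^esub> x \<oplus>\<^bsub>M\<^esub> b \<odot>\<^bsub>M\<^esub> x"
  using smult_l_distr[of a b x] by simp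
lemma vs_smult_r_distr: "x \<in> carrier M \<Longrightarrow> y \<in> carrier M \<Longrightarrow>
    a \<odot>\<^bsub>M\<^esub> (x \<oplus>\<^bsub>M\<^esub> y) = a \<odot>\<^bsub>M\<^esub> x \<oplus>\<^bsub>M\<^esub> a \<odot>\<^bsub>M\<^esub> y"
  using smult_r_distr[of a x y] by simp
lemma vs_smult_smult [simp]: "x \<in> carrier M \<Longrightarrow> a \<odot>\<^bsub>M\<^esub> (b \<odot>\<^bsub>M\<^esub> x) = (a * b) \<odot>\<^bsub>M\<^esub> x"
  using smult_assoc1[of a b x] by simp
lemma vs_smult_one [simp]: "x \<in> carrier M \<Longrightarrow> 1 \<odot>\<^bsub>M\<^esub> x = x"
  using smult_one[of x] by simp
lemma vs_smult_zero [simp]: "x \<in> carrier M \<Longrightarrow> 0 \<odot>\<^bsub>M\<^esub> x = \<zero>\<^bsub>M\<^esub>"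
  using smult_l_null[of x] by simp
lemma vs_smult_r_zero [simp]: "c \<odot>\<^bsub>M\<^esub> \<zero>\<^bsub>M\<^esub> = \<zero>\<^bsub>M\<^esub>"
  using smult_r_null[of c] by simp
lemma vs_r_neg [simp]: "x \<in> carrier M \<Longrightarrow> x \<oplus>\<^bsub>M\<^esub> \<ominus>\<^bsub>M\<^esub> x = \<zero>\<^bsub>M\<^esub>" by (rule M.r_neg)
lemma vs_l_neg [simp]: "x \<in> carrier M \<Longrightarrow> \<ominus>\<^bsub>M\<^esub> x \<oplus>\<^bsub>M\<^esub> x = \<zero>\<^bsub>M\<^esub>" by (rule M.l_neg)

text \<open>Differences are rewritten as sums with a \<open>(- 1)\<close>-multiple, since linear
  maps are specified on addition and scaling only.\<close>

lemma vs_neg_eq: "x \<in> carrier M \<Longrightarrow> \<ominus>\<^bsub>M\<^esub> x = (- 1) \<odot>\<^bsub>M\<^esub> x"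
proof -
  assume x: "x \<in> carrier M"
  have "x \<oplus>\<^bsub>M\<^esub> (- 1) \<odot>\<^bsub>M\<^esub> x = (1 + - 1) \<odot>\<^bsub>M\<^esub> x"
    by (subst vs_smult_l_distr) (simp_all add: x)
  then have "x \<oplus>\<^bsub>M\<^esub> (- 1) \<odot>\<^bsub>M\<^esub> x = \<zero>\<^bsub>M\<^esub>" using x by simp
  then show ?thesis using x M.minus_equality[of "(- 1) \<odot>\<^bsub>M\<^esub> x" x] by (simp add: vs_comm)
qed

lemma vs_minus_eq: "x \<in> carrier M \<Longrightarrow> y \<in> carrier M \<Longrightarrow> x \<ominus>\<^bsub>M\<^esub> y = x \<oplus>\<^bsub>M\<^esub> (- 1) \<odot>\<^bsub>M\<^esub> y"
  by (simp add: M.minus_eq vs_neg_eq)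

lemma vs_eq_iff_minus: "x \<in> carrier M \<Longrightarrow> y \<in> carrier M \<Longrightarrow> x \<ominus>\<^bsub>M\<^esub> y = \<zero>\<^bsub>M\<^esub> \<longleftrightarrow> x = y"
  by (metis M.add.inv_closed M.minus_eq M.r_neg M.minus_equality M.minus_minus)

lemma vs_abelian_group: "abelian_group M" ..

end

text \<open>Additive inverses are supplied as \<open>(- 1)\<close>-multiples, which turns the
  existential group axiom into an identity between addition and scaling.\<close>

lemma vspaceI:
  assumes "\<zero>\<^bsub>M\<^esub> \<in> carrier M"
    and "\<And>x y. x \<in> carrier M \<Longrightarrow> y \<in> carrier M \<Longrightarrow> x \<oplus>\<^bsub>M\<^esub> y \<in> carrier M"
    and "\<And>c x. x \<in> carrier M \<Longrightarrow> c \<odot>\<^bsub>M\<^esub> x \<in> carrier M"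
    and "\<And>x y z. x \<in> carrier M \<Longrightarrow> y \<in> carrier M \<Longrightarrow> z \<in> carrier M \<Longrightarrow>
      (x \<oplus>\<^bsub>M\<^esub> y) \<oplus>\<^bsub>M\<^esub> z = x \<oplus>\<^bsub>M\<^esub> (y \<oplus>\<^bsub>M\<^esub> z)"
    and "\<And>x y. x \<in> carrier M \<Longrightarrow> y \<in> carrier M \<Longrightarrow> x \<oplus>\<^bsub>M\<^esub> y = y \<oplus>\<^bsub>M\<^esub> x"
    and "\<And>x. x \<in> carrier M \<Longrightarrow> \<zero>\<^bsub>M\<^esub> \<oplus>\<^bsub>M\<^esub> x = x"
    and "\<And>x. x \<in> carrier M \<Longrightarrow> (- 1) \<odot>\<^bsub>M\<^esub> x \<oplus>\<^bsub>M\<^esub> x = \<zero>\<^bsub>M\<^esub>"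
    and "\<And>a b x. x \<in> carrier M \<Longrightarrow> (a + b) \<odot>\<^bsub>M\<^esub> x = a \<odot>\<^bsub>M\<^esub> x \<oplus>\<^bsub>M\<^esub> b \<odot>\<^bsub>M\<^esub> x"
    and "\<And>a x y. x \<in> carrier M \<Longrightarrow> y \<in> carrier M \<Longrightarrow>
      a \<odot>\<^bsub>M\<^esub> (x \<oplus>\<^bsub>M\<^esub> y) = a \<odot>\<^bsub>M\<^esub> x \<oplus>\<^bsub>M\<^esub> a \<odot>\<^bsub>M\<^esub> y"
    and "\<And>a b x. x \<in> carrier M \<Longrightarrow> (a * b) \<odot>\<^bsub>M\<^esub> x = a \<odot>\<^bsub>M\<^esub> (b \<odot>\<^bsub>M\<^esub> x)"
    and "\<And>x. x \<in> carrier M \<Longrightarrow> 1 \<odot>\<^bsub>M\<^esub> x = x"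
  shows "vspace (M :: ('k::field, 'a, 'm) module_scheme)"
proof (intro moduleI cring_scalars)
  show "abelian_group M"
  proof (rule abelian_groupI)
    show "\<exists>y\<in>carrier M. y \<oplus>\<^bsub>M\<^esub> x = \<zero>\<^bsub>M\<^esub>" if "x \<in> carrier M" for x
      using assms(3,7) that by blast
  qed (fact assms)+
qed (simp_all add: assms(3,8-11))

text \<open>These four fields are all that a vector space depends on, so the property passes to
  records with another product or with Hopf fields, such as opposite and tensor algebras.\<close>

lemma vspace_cong:
  assumes "vspace M" "carrier N = carrier M" "add N = add M" "zero N = zero M" "smult N = smult M"
  shows "vspace N"
  by (rule vspaceI)
     (use assms(1) in \<open>simp_all add: assms(2-) vs_assoc vs_smult_l_distr vs_smult_r_distr
        flip: vs_neg_eq\<close>, use assms(1) in \<open>simp add: vs_comm\<close>)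

lemma vspace_scalars [simp]: "vspace (scalars :: ('k::field, 'k) module)"
  by (rule vspaceI) (auto simp: algebra_simps)

lemma submoduleI':
  assumes "vspace M" "N \<subseteq> carrier M" "\<zero>\<^bsub>M\<^esub> \<in> N"
    and "\<And>x y. x \<in> N \<Longrightarrow> y \<in> N \<Longrightarrow> x \<oplus>\<^bsub>M\<^esub> y \<in> N" "\<And>c x. x \<in> N \<Longrightarrow> c \<odot>\<^bsub>M\<^esub> x \<in> N"
  shows "submodule N scalars M"
  by (rule module.submoduleI[OF assms(1)])
     (use assms in \<open>auto simp: vs_neg_eq subset_iff\<close>)

lemma submoduleD:
  assumes "submodule N scalars M"
  shows "N \<subseteq> carrier M" "\<zero>\<^bsub>M\<^esub> \<in> N" "x \<in> N \<Longrightarrow> y \<in> N \<Longrightarrow> x \<oplus>\<^bsub>M\<^esub> y \<in> N" "x \<in> N \<Longrightarrow> c \<odot>\<^bsub>M\<^esub> x \<in> N"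
proof -
  interpret submodule N scalars M by (rule assms)
  show "N \<subseteq> carrier M" "\<zero>\<^bsub>M\<^esub> \<in> N" "x \<in> N \<Longrightarrow> y \<in> N \<Longrightarrow> x \<oplus>\<^bsub>M\<^esub> y \<in> N" "x \<in> N \<Longrightarrow> c \<odot>\<^bsub>M\<^esub> x \<in> N"
    using subset one_closed m_closed smult_closed[of c x] by auto
qed

lemma linI:
  assumes "\<And>x. x \<in> carrier M \<Longrightarrow> f x \<in> carrier N"
    and "\<And>x y. x \<in> carrier M \<Longrightarrow> y \<in> carrier M \<Longrightarrow> f (x \<oplus>\<^bsub>M\<^esub> y) = f x \<oplus>\<^bsub>N\<^esub> f y"
    and "\<And>c x. x \<in> carrier M \<Longrightarrow> f (c \<odot>\<^bsub>M\<^esub> x) = c \<odot>\<^bsub>N\<^esub> f x"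
  shows "f \<in> linear_maps M N"
  using assms by (auto simp: linear_maps_def)

lemma lin_closed: "f \<in> linear_maps M N \<Longrightarrow> x \<in> carrier M \<Longrightarrow> f x \<in> carrier N"
  by (auto simp: linear_maps_def)

lemma lin_add: "f \<in> linear_maps M N \<Longrightarrow> x \<in> carrier M \<Longrightarrow> y \<in> carrier M \<Longrightarrow>
    f (x \<oplus>\<^bsub>M\<^esub> y) = f x \<oplus>\<^bsub>N\<^esub> f y"
  by (auto simp: linear_maps_def)

lemma lin_smult: "f \<in> linear_maps M N \<Longrightarrow> x \<in> carrier M \<Longrightarrow> f (c \<odot>\<^bsub>M\<^esub> x) = c \<odot>\<^bsub>N\<^esub> f x"
  by (auto simp: linear_maps_def)

lemma lin_zero: "f \<in> linear_maps M N \<Longrightarrow> vspace M \<Longrightarrow> vspace N \<Longrightarrow> f \<zero>\<^bsub>M\<^esub> = \<zero>\<^bsub>N\<^esub>"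
  using lin_smult[of f M N "\<zero>\<^bsub>M\<^esub>" 0] by (simp add: lin_closed)

lemma lin_minus: "f \<in> linear_maps M N \<Longrightarrow> vspace M \<Longrightarrow> vspace N \<Longrightarrow> x \<in> carrier M \<Longrightarrow>
    y \<in> carrier M \<Longrightarrow> f (x \<ominus>\<^bsub>M\<^esub> y) = f x \<ominus>\<^bsub>N\<^esub> f y"
  by (simp add: vs_minus_eq lin_add lin_smult lin_closed)

lemmas lin_simps = lin_add lin_smult lin_closed

lemma lin_comp: "f \<in> linear_maps M N \<Longrightarrow> g \<in> linear_maps N L \<Longrightarrow> (\<lambda>x. g (f x)) \<in> linear_maps M L"
  by (rule linI) (simp_all add: lin_simps)

lemma lin_id: "(\<lambda>x. x) \<in> linear_maps M M"
  by (rule linI) auto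

lemma lin_smultI: "vspace N \<Longrightarrow> f \<in> linear_maps M N \<Longrightarrow> (\<lambda>x. c \<odot>\<^bsub>N\<^esub> f x) \<in> linear_maps M N"
  by (rule linI) (simp_all add: lin_simps vs_smult_r_distr mult.commute)

lemma lin_addI: "vspace N \<Longrightarrow> f \<in> linear_maps M N \<Longrightarrow> g \<in> linear_maps M N \<Longrightarrow>
    (\<lambda>x. f x \<oplus>\<^bsub>N\<^esub> g x) \<in> linear_maps M N"
  by (rule linI) (simp_all add: lin_simps vs_smult_r_distr vs_assoc vs_lcomm)

lemma lin_scalar: "vspace M \<Longrightarrow> x \<in> carrier M \<Longrightarrow> f \<in> linear_maps L scalars \<Longrightarrow>
    (\<lambda>l. f l \<odot>\<^bsub>M\<^esub> x) \<in> linear_maps L M"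
  by (rule linI) (simp_all add: lin_simps vs_smult_l_distr)

lemma linear_maps_cong:
  assumes "carrier M' = carrier M" "add M' = add M" "smult M' = smult M"
    and "carrier N' = carrier N" "add N' = add N" "smult N' = smult N"
  shows "linear_maps M' N' = linear_maps M N"
  by (simp add: linear_maps_def assms)

lemma lin_eqI_on: "f \<in> linear_maps M N \<Longrightarrow> (\<And>x. x \<in> carrier M \<Longrightarrow> g x = f x) \<Longrightarrow> vspace M \<Longrightarrow>
   g \<in> linear_maps M N"
  by (rule linI) (simp_all add: lin_simps)

subsection \<open>Quotients\<close>

context
  fixes M :: "('k::field, 'a, 'm) module_scheme" and I
  assumes M: "vspace M" and I: "submodule I scalars M"
begin

interpretation abelian_group M by (rule vs_abelian_group[OF M])
interpretation abelian_subgroup I M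
  using I by (intro abelian_subgroupI3) (auto intro!: abelian_group_axioms
      additive_subgroup.intro simp: submodule_def)

lemma coset_eq_iff:
  assumes "x \<in> carrier M" "y \<in> carrier M"
  shows "I +>\<^bsub>M\<^esub> x = I +>\<^bsub>M\<^esub> y \<longleftrightarrow> x \<ominus>\<^bsub>M\<^esub> y \<in> I"
  using assms a_repr_independence' a_repr_independenceD a_rcos_module_minus is_abelian_subgroup
  by (metis a_rcos_self abelian_group_axioms a_rcos_module_rev a_rcos_module_imp minus_eq)

lemma coset_self: "x \<in> carrier M \<Longrightarrow> x \<in> I +>\<^bsub>M\<^esub> x"
  by (rule a_rcos_self)

lemma coset_mem:
  assumes "x \<in> carrier M" "z \<in> I +>\<^bsub>M\<^esub> x"
  shows "z \<in> carrier M" "I +>\<^bsub>M\<^esub> z = I +>\<^bsub>M\<^esub> x"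
  using assms a_elemrcos_carrier a_repr_independence' by auto

lemma quotient_carrier: "carrier (quotient_module M I) = (\<lambda>x. I +>\<^bsub>M\<^esub> x) ` carrier M"
  by (auto simp: quotient_module_def FactRing_def ring.defs module.defs A_RCOSETS_def')

lemma quotient_zero: "\<zero>\<^bsub>quotient_module M I\<^esub> = I +>\<^bsub>M\<^esub> \<zero>\<^bsub>M\<^esub>"
  by (simp add: quotient_module_def FactRing_def ring.defs module.defs a_coset_add_zero a_subset)

lemma quotient_one: "\<one>\<^bsub>quotient_module M I\<^esub> = I +>\<^bsub>M\<^esub> \<one>\<^bsub>M\<^esub>"
  by (simp add: quotient_module_def FactRing_def ring.defs module.defs)

lemma quotient_add: "x \<in> carrier M \<Longrightarrow> y \<in> carrier M \<Longrightarrow>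
    (I +>\<^bsub>M\<^esub> x) \<oplus>\<^bsub>quotient_module M I\<^esub> (I +>\<^bsub>M\<^esub> y) = I +>\<^bsub>M\<^esub> (x \<oplus>\<^bsub>M\<^esub> y)"
  by (simp add: quotient_module_def FactRing_def ring.defs module.defs a_rcos_sum)

text \<open>The scalar multiple of a coset is a union over its representatives; all members of that
  union are one and the same coset because I is closed under scaling.\<close>

lemma quotient_smult:
  assumes x: "x \<in> carrier M"
  shows "c \<odot>\<^bsub>quotient_module M I\<^esub> (I +>\<^bsub>M\<^esub> x) = I +>\<^bsub>M\<^esub> (c \<odot>\<^bsub>M\<^esub> x)"
proof -
  have "I +>\<^bsub>M\<^esub> (c \<odot>\<^bsub>M\<^esub> z) = I +>\<^bsub>M\<^esub> (c \<odot>\<^bsub>M\<^esub> x)" if z: "z \<in> I +>\<^bsub>M\<^esub> x" for z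
  proof -
    note zc = coset_mem[OF x z]
    have "z \<ominus>\<^bsub>M\<^esub> x \<in> I" using zc x coset_eq_iff by blast
    then have "c \<odot>\<^bsub>M\<^esub> (z \<ominus>\<^bsub>M\<^esub> x) \<in> I" by (rule submoduleD(4)[OF I])
    then have "c \<odot>\<^bsub>M\<^esub> z \<ominus>\<^bsub>M\<^esub> c \<odot>\<^bsub>M\<^esub> x \<in> I"
      using zc x M by (simp add: vs_minus_eq vs_smult_r_distr)
    then show ?thesis using zc x M by (simp add: coset_eq_iff)
  qed
  then have "(\<Union>z\<in>I +>\<^bsub>M\<^esub> x. I +>\<^bsub>M\<^esub> (c \<odot>\<^bsub>M\<^esub> z)) = I +>\<^bsub>M\<^esub> (c \<odot>\<^bsub>M\<^esub> x)"
    using coset_self[OF x] by blast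
  then show ?thesis
    by (simp add: quotient_module_def FactRing_def ring.defs module.defs)
qed

lemma coset_lin: "(\<lambda>x. I +>\<^bsub>M\<^esub> x) \<in> linear_maps M (quotient_module M I)"
  by (rule linI) (simp_all add: quotient_carrier quotient_add quotient_smult)

lemma vspace_quotient: "vspace (quotient_module M I)"
proof (rule vspaceI, goal_cases)
  case 1 then show ?case using M by (simp add: quotient_carrier quotient_zero)
next
  case 2 then show ?case using M by (auto simp: quotient_carrier quotient_add)
next
  case 3 then show ?case using M by (auto simp: quotient_carrier quotient_smult)
next
  case 4 then show ?case using M by (auto simp: quotient_carrier quotient_add vs_assoc)
next
  case 5 then show ?case using M by (auto simp: quotient_carrier quotient_add vs_comm)
next
  case 6 then show ?case using M by (auto simp: quotient_carrier quotient_add quotient_zero)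
next
  case (7 x)
  have "(- 1) \<odot>\<^bsub>M\<^esub> y \<oplus>\<^bsub>M\<^esub> y = \<zero>\<^bsub>M\<^esub>" if "y \<in> carrier M" for y
    using vs_l_neg[OF M that] that M by (simp add: vs_neg_eq)
  then show ?case using M 7
    by (auto simp: quotient_carrier quotient_add quotient_smult quotient_zero)
next
  case 8 then show ?case using M
    by (auto simp: quotient_carrier quotient_add quotient_smult vs_smult_l_distr)
next
  case 9 then show ?case using M
    by (auto simp: quotient_carrier quotient_add quotient_smult vs_smult_r_distr)
qed (use M in \<open>auto simp: quotient_carrier quotient_smult\<close>)

lemma coset_eq_zero_iff: "x \<in> carrier M \<Longrightarrow> I +>\<^bsub>M\<^esub> x = \<zero>\<^bsub>quotient_module M I\<^esub> \<longleftrightarrow> x \<in> I"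
  using M by (simp add: quotient_zero coset_eq_iff vs_minus_eq)

text \<open>A linear map that vanishes on I is constant on each coset, so its image of a coset is a
  singleton. \<open>tensor_lift\<close> and the structure maps of \<open>U_rs\<close> are defined
  through such images.\<close>

lemma the_elem_coset:
  assumes f: "f \<in> linear_maps M N" and N: "vspace N" and ker: "\<And>x. x \<in> I \<Longrightarrow> f x = \<zero>\<^bsub>N\<^esub>"
    and x: "x \<in> carrier M"
  shows "the_elem (f ` (I +>\<^bsub>M\<^esub> x)) = f x"
proof -
  have "f z = f x" if z: "z \<in> I +>\<^bsub>M\<^esub> x" for z
  proof -
    note zc = coset_mem[OF x z]
    have "f (z \<ominus>\<^bsub>M\<^esub> x) = \<zero>\<^bsub>N\<^esub>" using zc x coset_eq_iff ker by blast
    then show ?thesis using zc x f M N by (simp add: lin_minus vs_eq_iff_minus lin_closed)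
  qed
  then have "f ` (I +>\<^bsub>M\<^esub> x) = {f x}" using coset_self[OF x] by blast
  then show ?thesis by simp
qed

lemma quotient_lift_lin:
  assumes f: "f \<in> linear_maps M N" and N: "vspace N" and ker: "\<And>x. x \<in> I \<Longrightarrow> f x = \<zero>\<^bsub>N\<^esub>"
  shows "(\<lambda>X. the_elem (f ` X)) \<in> linear_maps (quotient_module M I) N"
  by (rule linI) (use M in \<open>auto simp: quotient_carrier quotient_add quotient_smult
      the_elem_coset[OF assms] lin_simps[OF f]\<close>)

end

lemma submodule_kernel:
  assumes "f \<in> linear_maps M N" "vspace M" "vspace N"
  shows "submodule {x \<in> carrier M. f x = \<zero>\<^bsub>N\<^esub>} scalars M"
  by (rule submoduleI') (use assms in \<open>auto simp: lin_zero lin_simps\<close>)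

lemma submodule_generated:
  assumes "vspace M" "S \<subseteq> carrier M"
  shows "submodule (generated_submodule M S) scalars M"
proof -
  have "submodule (carrier M) scalars M"
    using assms by (intro submoduleI') auto
  then show ?thesis using assms unfolding generated_submodule_def
    by (intro submoduleI') (blast intro: submoduleD)+
qed

lemma generated_submodule_subset: "S \<subseteq> generated_submodule M S"
  by (auto simp: generated_submodule_def)

lemma generated_submodule_min: "submodule N scalars M \<Longrightarrow> S \<subseteq> N \<Longrightarrow> generated_submodule M S \<subseteq> N"
  by (auto simp: generated_submodule_def)

section \<open>Tensor products\<close>

text \<open>The step adds a single term instead of updating a value, so that additivity of a map
  applies directly.\<close>

lemma poly_mapping_add_induct [case_names zero add]:
  assumes "P 0" "\<And>p a b. P p \<Longrightarrow> a \<notin> Poly_Mapping.keys p \<Longrightarrow> b \<noteq> 0 \<Longrightarrow> P (p + Poly_Mapping.single a b)"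
  shows "P p"
proof (induction p rule: Poly_Mapping.update_induct)
  case const then show ?case by (rule assms)
next
  case (update p a b)
  have "Poly_Mapping.update a b p = p + Poly_Mapping.single a b"
    using update(1)
    by (intro poly_mapping_eqI)
       (auto simp: lookup_update lookup_add lookup_single in_keys_iff when_def)
  then show ?case using assms(2)[OF update(3,1,2)] by simp
qed

lemma keys_add_single:
  "a \<notin> Poly_Mapping.keys p \<Longrightarrow> b \<noteq> 0 \<Longrightarrow>
    Poly_Mapping.keys (p + Poly_Mapping.single a b) = insert a (Poly_Mapping.keys p)"
  by (auto simp: in_keys_iff lookup_add lookup_single when_def split: if_splits)

lemma lookup_scale: "Poly_Mapping.lookup (Poly_Mapping.map ((*) c) p) k = c * Poly_Mapping.lookup p k"
  for c :: "'k::field"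
  by (simp add: Poly_Mapping.map.rep_eq when_def)

lemma keys_scale: "Poly_Mapping.keys (Poly_Mapping.map ((*) c) p) \<subseteq> Poly_Mapping.keys p"
  for c :: "'k::field"
  by (auto simp: in_keys_iff lookup_scale)

lemma scale_single: "Poly_Mapping.map ((*) c) (Poly_Mapping.single a b) = Poly_Mapping.single a (c * b)"
  for c :: "'k::field"
  by (rule poly_mapping_eqI) (simp add: lookup_scale lookup_single when_def)

lemma minus_eq_scale: "p - q = p + Poly_Mapping.map ((*) (- 1)) q"
  for q :: "'x \<Rightarrow>\<^sub>0 'k::field"
  by (rule poly_mapping_eqI) (simp add: lookup_scale lookup_add lookup_minus)

section \<open>Free vector spaces and linear extension from a basis\<close>

lemma free_module_mem: "p \<in> carrier (free_module X) \<longleftrightarrow> Poly_Mapping.keys p \<subseteq> X"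
  by (simp add: free_module_def)

lemma free_module_simps [simp]:
  "zero (free_module X) = 0"
  "add (free_module X) = (+)" "smult (free_module X) = (\<lambda>c. Poly_Mapping.map ((*) c))"
  by (simp_all add: free_module_def)

lemma free_module_zero [simp]: "0 \<in> carrier (free_module X)"
  by (simp add: free_module_mem)

lemma free_module_single [simp]: "x \<in> X \<Longrightarrow> Poly_Mapping.single x c \<in> carrier (free_module X)"
  by (simp add: free_module_mem)

lemma free_module_add [simp]:
  "p \<in> carrier (free_module X) \<Longrightarrow> q \<in> carrier (free_module X) \<Longrightarrow> p + q \<in> carrier (free_module X)"
  using Poly_Mapping.keys_add by (fastforce simp: free_module_mem)

lemma free_module_scale [simp]:
  "p \<in> carrier (free_module X) \<Longrightarrow> Poly_Mapping.map ((*) c) p \<in> carrier (free_module X)"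
  for c :: "'k::field"
  using keys_scale[of c p] by (auto simp: free_module_mem)

lemma free_module_minus [simp]:
  "p \<in> carrier (free_module X) \<Longrightarrow> q \<in> carrier (free_module X) \<Longrightarrow> p - q \<in> carrier (free_module X)"
  for p :: "'x \<Rightarrow>\<^sub>0 'k::field"
  by (simp add: minus_eq_scale)

lemma vspace_free [simp]: "vspace (free_module X :: ('k::field, 'x \<Rightarrow>\<^sub>0 'k) module)"
  by (rule vspaceI)
     (auto intro!: poly_mapping_eqI simp: lookup_scale lookup_add algebra_simps)

lemma free_module_a_minus: "p \<in> carrier (free_module X) \<Longrightarrow> q \<in> carrier (free_module X) \<Longrightarrow>
    p \<ominus>\<^bsub>free_module X\<^esub> q = p - q"
  for p :: "'x \<Rightarrow>\<^sub>0 'k::field"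
  by (simp add: vs_minus_eq minus_eq_scale)

text \<open>The sum that occurs both in \<open>tensor_lift\<close> and in
  \<open>free_algebra_hom\<close>, isolated so that one linearity proof serves both.\<close>

definition lin_ext :: "('k::field, 'v, 'm) module_scheme \<Rightarrow> ('x \<Rightarrow> 'v) \<Rightarrow> ('x \<Rightarrow>\<^sub>0 'k) \<Rightarrow> 'v" where
  "lin_ext V f p = (\<Oplus>\<^bsub>V\<^esub>z\<in>Poly_Mapping.keys p. Poly_Mapping.lookup p z \<odot>\<^bsub>V\<^esub> f z)"

text \<open>Cancellation can make the support of a sum smaller than the union of the supports.
  Extending all sums to a common finite superset avoids tracking this.\<close>

lemma lin_ext_superset:
  assumes V: "vspace V" and "finite S" "Poly_Mapping.keys p \<subseteq> S" "f \<in> S \<rightarrow> carrier V"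
  shows "lin_ext V f p = (\<Oplus>\<^bsub>V\<^esub>z\<in>S. Poly_Mapping.lookup p z \<odot>\<^bsub>V\<^esub> f z)"
proof -
  interpret abelian_group V using V by (rule vs_abelian_group)
  show ?thesis unfolding lin_ext_def
  proof (rule add.finprod_mono_neutral_cong_left)
    show "Poly_Mapping.lookup p i \<odot>\<^bsub>V\<^esub> f i = \<zero>\<^bsub>V\<^esub>" if "i \<in> S - Poly_Mapping.keys p" for i
      using assms that by (auto simp: in_keys_iff Pi_def)
  qed (use assms in \<open>auto simp: Pi_iff\<close>)
qed

lemma lin_ext_closed:
  assumes V: "vspace V" and f: "f \<in> X \<rightarrow> carrier V" and p: "p \<in> carrier (free_module X)"
  shows "lin_ext V f p \<in> carrier V"
proof -
  interpret abelian_group V using V by (rule vs_abelian_group)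
  show ?thesis unfolding lin_ext_def using assms by (intro finsum_closed) (auto simp: Pi_iff free_module_mem subset_iff)
qed

lemma lin_ext_lin:
  assumes V: "vspace V" and f: "f \<in> X \<rightarrow> carrier V"
  shows "lin_ext V f \<in> linear_maps (free_module X) V"
proof (rule linI)
  interpret abelian_group V using V by (rule vs_abelian_group)
  show "lin_ext V f p \<in> carrier V" if "p \<in> carrier (free_module X)" for p
    by (rule lin_ext_closed[OF assms that])
  show "lin_ext V f (p \<oplus>\<^bsub>free_module X\<^esub> q) = lin_ext V f p \<oplus>\<^bsub>V\<^esub> lin_ext V f q"
    if pq: "p \<in> carrier (free_module X)" "q \<in> carrier (free_module X)" for p q
  proof -
    let ?S = "Poly_Mapping.keys p \<union> Poly_Mapping.keys q"
    have fS: "f \<in> ?S \<rightarrow> carrier V" using f pq by (auto simp: free_module_mem)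
    then have fS': "f z \<in> carrier V" if "z \<in> ?S" for z using that by blast
    have "lin_ext V f (p + q) = (\<Oplus>\<^bsub>V\<^esub>z\<in>?S. Poly_Mapping.lookup (p + q) z \<odot>\<^bsub>V\<^esub> f z)"
      by (rule lin_ext_superset[OF V _ Poly_Mapping.keys_add fS]) simp
    also have "\<dots> = (\<Oplus>\<^bsub>V\<^esub>z\<in>?S. Poly_Mapping.lookup p z \<odot>\<^bsub>V\<^esub> f z \<oplus>\<^bsub>V\<^esub> Poly_Mapping.lookup q z \<odot>\<^bsub>V\<^esub> f z)"
      by (rule finsum_cong') (use V fS' in \<open>auto simp: lookup_add vs_smult_l_distr\<close>)
    also have "\<dots> = (\<Oplus>\<^bsub>V\<^esub>z\<in>?S. Poly_Mapping.lookup p z \<odot>\<^bsub>V\<^esub> f z) \<oplus>\<^bsub>V\<^esub>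
        (\<Oplus>\<^bsub>V\<^esub>z\<in>?S. Poly_Mapping.lookup q z \<odot>\<^bsub>V\<^esub> f z)"
      by (rule finsum_addf) (use V fS' in auto)
    also have "\<dots> = lin_ext V f p \<oplus>\<^bsub>V\<^esub> lin_ext V f q"
      by (intro arg_cong2[of _ _ _ _ "add V"] lin_ext_superset[symmetric] V fS) auto
    finally show ?thesis by simp
  qed
  show "lin_ext V f (c \<odot>\<^bsub>free_module X\<^esub> p) = c \<odot>\<^bsub>V\<^esub> lin_ext V f p"
    if p: "p \<in> carrier (free_module X)" for c p
  proof -
    have fS: "f \<in> Poly_Mapping.keys p \<rightarrow> carrier V" using f p by (auto simp: free_module_mem)
    have "lin_ext V f (Poly_Mapping.map ((*) c) p) =
        (\<Oplus>\<^bsub>V\<^esub>z\<in>Poly_Mapping.keys p. c \<odot>\<^bsub>V\<^esub> (Poly_Mapping.lookup p z \<odot>\<^bsub>V\<^esub> f z))"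
      unfolding lin_ext_superset[OF V finite_keys keys_scale fS]
      by (rule finsum_cong') (use V fS in \<open>auto simp: lookup_scale Pi_iff\<close>)
    also have "\<dots> = c \<odot>\<^bsub>V\<^esub> lin_ext V f p"
      unfolding lin_ext_def
      by (rule module.finsum_smult_ldistr[OF V, symmetric]) (use V fS in \<open>auto simp: Pi_iff\<close>)
    finally show ?thesis by simp
  qed
qed

lemma lin_ext_single:
  assumes V: "vspace V" and f: "f x \<in> carrier V"
  shows "lin_ext V f (Poly_Mapping.single x c) = c \<odot>\<^bsub>V\<^esub> f x"
proof -
  interpret abelian_group V using V by (rule vs_abelian_group)
  show ?thesis using V f by (cases "c = 0") (simp_all add: lin_ext_def)
qed

lemma lin_ext_minus:
  assumes V: "vspace V" and f: "f \<in> X \<rightarrow> carrier V"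
    and "p \<in> carrier (free_module X)" "q \<in> carrier (free_module X)"
  shows "lin_ext V f (p - q) = lin_ext V f p \<ominus>\<^bsub>V\<^esub> lin_ext V f q"
  using lin_minus[OF lin_ext_lin[OF V f] vspace_free V assms(3,4)] assms(3,4)
  by (simp add: free_module_a_minus)

section \<open>Bilinear maps and the universal property of the tensor product\<close>

definition bilin ::
    "('k::field, 'a, 'm) module_scheme \<Rightarrow> ('k, 'b, 'n) module_scheme \<Rightarrow>
     ('k, 'v, 'l) module_scheme \<Rightarrow> ('a \<Rightarrow> 'b \<Rightarrow> 'v) \<Rightarrow> bool" where
  "bilin M N V f \<longleftrightarrow> (\<forall>x\<in>carrier M. f x \<in> linear_maps N V) \<and>
     (\<forall>y\<in>carrier N. (\<lambda>x. f x y) \<in> linear_maps M V)"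

lemma bilinI:
  assumes "\<And>x. x \<in> carrier M \<Longrightarrow> (\<lambda>y. f x y) \<in> linear_maps N V"
    and "\<And>y. y \<in> carrier N \<Longrightarrow> (\<lambda>x. f x y) \<in> linear_maps M V"
  shows "bilin M N V f"
  using assms by (simp add: bilin_def)

lemma bilinD:
  assumes "bilin M N V f"
  shows "x \<in> carrier M \<Longrightarrow> (\<lambda>y. f x y) \<in> linear_maps N V"
    and "y \<in> carrier N \<Longrightarrow> (\<lambda>x. f x y) \<in> linear_maps M V"
    and "x \<in> carrier M \<Longrightarrow> y \<in> carrier N \<Longrightarrow> f x y \<in> carrier V"
  using assms by (auto simp: bilin_def intro: lin_closed)

lemma bilin_simps:
  assumes "bilin M N V f"
  shows "x \<in> carrier M \<Longrightarrow> x' \<in> carrier M \<Longrightarrow> y \<in> carrier N \<Longrightarrow> f (x \<oplus>\<^bsub>M\<^esub> x') y = f x y \<oplus>\<^bsub>V\<^esub> f x' y"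
    and "x \<in> carrier M \<Longrightarrow> y \<in> carrier N \<Longrightarrow> y' \<in> carrier N \<Longrightarrow> f x (y \<oplus>\<^bsub>N\<^esub> y') = f x y \<oplus>\<^bsub>V\<^esub> f x y'"
    and "x \<in> carrier M \<Longrightarrow> y \<in> carrier N \<Longrightarrow> f (c \<odot>\<^bsub>M\<^esub> x) y = c \<odot>\<^bsub>V\<^esub> f x y"
    and "x \<in> carrier M \<Longrightarrow> y \<in> carrier N \<Longrightarrow> f x (c \<odot>\<^bsub>N\<^esub> y) = c \<odot>\<^bsub>V\<^esub> f x y"
  using lin_add[OF bilinD(2)[OF assms]] lin_add[OF bilinD(1)[OF assms]]
    lin_smult[OF bilinD(2)[OF assms]] lin_smult[OF bilinD(1)[OF assms]] by blast+

lemma bilin_lin: "bilin M N V f \<Longrightarrow> k \<in> linear_maps V W \<Longrightarrow> bilin M N W (\<lambda>x y. k (f x y))"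
  by (rule bilinI) (auto intro: lin_comp[of _ _ V] bilinD)

lemma bilin_comp: "bilin M N V f \<Longrightarrow> g \<in> linear_maps M' M \<Longrightarrow> h \<in> linear_maps N' N \<Longrightarrow>
    bilin M' N' V (\<lambda>x y. f (g x) (h y))"
  by (rule bilinI)
     (auto intro: lin_comp[of h _ N _ V] lin_comp[of g _ M "\<lambda>x. f x _" V] bilinD lin_closed)

lemma bilin_swap: "bilin M N V f \<Longrightarrow> bilin N M V (\<lambda>y x. f x y)"
  by (auto simp: bilin_def)

lemma bilin_cong:
  assumes "bilin M N V f" "vspace M" "vspace N"
    and "\<And>x y. x \<in> carrier M \<Longrightarrow> y \<in> carrier N \<Longrightarrow> g x y = f x y"
  shows "bilin M N V g"
  using assms by (intro bilinI) (auto intro: lin_eqI_on[OF bilinD(1)] lin_eqI_on[OF bilinD(2)])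

context
  fixes M :: "('k::field, 'a, 'm) module_scheme" and N :: "('k, 'b, 'n) module_scheme"
  assumes M: "vspace M" and N: "vspace N"
begin

private abbreviation "FF \<equiv> free_module (carrier M \<times> carrier N) :: ('k, 'a \<times> 'b \<Rightarrow>\<^sub>0 'k) module"
private abbreviation "T \<equiv> tensor_module M N"

lemma tensor_kernel_submodule: "submodule (tensor_kernel M N) scalars FF"
  unfolding tensor_kernel_def
  using M N by (intro submodule_generated) auto

private lemma coset_eqI:
  "p \<in> carrier FF \<Longrightarrow> q \<in> carrier FF \<Longrightarrow> p - q \<in> tensor_kernel M N \<Longrightarrow>
    tensor_kernel M N +>\<^bsub>FF\<^esub> p = tensor_kernel M N +>\<^bsub>FF\<^esub> q"
  by (simp add: coset_eq_iff[OF vspace_free tensor_kernel_submodule] free_module_a_minus)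

lemma vspace_tensor [simp]: "vspace T"
  unfolding tensor_module_def by (intro vspace_quotient vspace_free tensor_kernel_submodule)

private lemma coset_tensor:
  "x \<in> carrier M \<Longrightarrow> y \<in> carrier N \<Longrightarrow>
    tensor_kernel M N +>\<^bsub>FF\<^esub> Poly_Mapping.single (x, y) c = c \<odot>\<^bsub>T\<^esub> tensor M N x y"
  unfolding tensor_def tensor_module_def
  by (subst quotient_smult) (simp_all add: tensor_kernel_submodule scale_single)

lemma tensor_closed [simp]: "x \<in> carrier M \<Longrightarrow> y \<in> carrier N \<Longrightarrow> tensor M N x y \<in> carrier T"
  unfolding tensor_def tensor_module_def quotient_carrier[OF vspace_free tensor_kernel_submodule]
  by auto

lemma tensor_add_left:
  assumes "x \<in> carrier M" "x' \<in> carrier M" "y \<in> carrier N"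
  shows "tensor M N (x \<oplus>\<^bsub>M\<^esub> x') y = tensor M N x y \<oplus>\<^bsub>T\<^esub> tensor M N x' y"
proof -
  have "Poly_Mapping.single (x \<oplus>\<^bsub>M\<^esub> x', y) 1 - (Poly_Mapping.single (x, y) 1 + Poly_Mapping.single (x', y) 1)
      \<in> tensor_kernel M N"
    unfolding tensor_kernel_def diff_diff_eq[symmetric]
    by (rule generated_submodule_subset[THEN subsetD]) (use assms in blast)
  then show ?thesis using assms M N unfolding tensor_def tensor_module_def
    by (simp add: quotient_add tensor_kernel_submodule coset_eqI)
qed

lemma tensor_add_right:
  assumes "x \<in> carrier M" "y \<in> carrier N" "y' \<in> carrier N"
  shows "tensor M N x (y \<oplus>\<^bsub>N\<^esub> y') = tensor M N x y \<oplus>\<^bsub>T\<^esub> tensor M N x y'"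
proof -
  have "Poly_Mapping.single (x, y \<oplus>\<^bsub>N\<^esub> y') 1 - (Poly_Mapping.single (x, y) 1 + Poly_Mapping.single (x, y') 1)
      \<in> tensor_kernel M N"
    unfolding tensor_kernel_def diff_diff_eq[symmetric]
    by (rule generated_submodule_subset[THEN subsetD]) (use assms in blast)
  then show ?thesis using assms M N unfolding tensor_def tensor_module_def
    by (simp add: quotient_add tensor_kernel_submodule coset_eqI)
qed

lemma tensor_smult_left:
  assumes "x \<in> carrier M" "y \<in> carrier N"
  shows "tensor M N (c \<odot>\<^bsub>M\<^esub> x) y = c \<odot>\<^bsub>T\<^esub> tensor M N x y"
proof -
  have "Poly_Mapping.single (c \<odot>\<^bsub>M\<^esub> x, y) 1 - Poly_Mapping.single (x, y) c \<in> tensor_kernel M N"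
    unfolding tensor_kernel_def
    by (rule generated_submodule_subset[THEN subsetD]) (use assms in blast)
  then show ?thesis using assms M N
    by (subst coset_tensor[symmetric]) (simp_all add: tensor_def coset_eqI)
qed

lemma tensor_smult_right:
  assumes "x \<in> carrier M" "y \<in> carrier N"
  shows "tensor M N x (c \<odot>\<^bsub>N\<^esub> y) = c \<odot>\<^bsub>T\<^esub> tensor M N x y"
proof -
  have "Poly_Mapping.single (x, c \<odot>\<^bsub>N\<^esub> y) 1 - Poly_Mapping.single (x, y) c \<in> tensor_kernel M N"
    unfolding tensor_kernel_def
    by (rule generated_submodule_subset[THEN subsetD]) (use assms in blast)
  then show ?thesis using assms M N
    by (subst coset_tensor[symmetric]) (simp_all add: tensor_def coset_eqI)
qed

lemma bilin_tensor: "bilin M N T (tensor M N)"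
  by (intro bilinI linI)
     (simp_all add: tensor_add_left tensor_add_right tensor_smult_left tensor_smult_right)

text \<open>Coefficients of pure tensors are absorbed into the left factor, and zero is the pure
  tensor of zeros; hence there is no case for scaling or for zero.\<close>

lemma tensor_induct [consumes 1, case_names pure add]:
  assumes t: "t \<in> carrier T"
    and pure: "\<And>x y. x \<in> carrier M \<Longrightarrow> y \<in> carrier N \<Longrightarrow> P (tensor M N x y)"
    and add: "\<And>t u. t \<in> carrier T \<Longrightarrow> u \<in> carrier T \<Longrightarrow> P t \<Longrightarrow> P u \<Longrightarrow> P (t \<oplus>\<^bsub>T\<^esub> u)"
  shows "P t"
proof -
  let ?q = "\<lambda>p. tensor_kernel M N +>\<^bsub>FF\<^esub> p"
  note q = coset_lin[OF vspace_free tensor_kernel_submodule, folded tensor_module_def]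
  obtain p where p: "p \<in> carrier FF" "t = ?q p"
    using t unfolding tensor_module_def quotient_carrier[OF vspace_free tensor_kernel_submodule]
    by auto
  have "p \<in> carrier FF \<longrightarrow> P (?q p)"
  proof (induction p rule: poly_mapping_add_induct)
    case zero
    have "?q 0 = \<zero>\<^bsub>T\<^esub>" using lin_zero[OF q vspace_free] by simp
    also have "\<dots> = tensor M N \<zero>\<^bsub>M\<^esub> \<zero>\<^bsub>N\<^esub>"
      using tensor_smult_left[of "\<zero>\<^bsub>M\<^esub>" "\<zero>\<^bsub>N\<^esub>" 0] M N by simp
    finally show ?case using pure M N by simp
  next
    case (add p a b)
    obtain x y where a: "a = (x, y)" by (cases a)
    show ?case
    proof
      assume "p + Poly_Mapping.single a b \<in> carrier FF"
      then have *: "p \<in> carrier FF" "x \<in> carrier M" "y \<in> carrier N"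
        using add(2,3) by (auto simp: keys_add_single a free_module_mem)
      have "?q (p + Poly_Mapping.single a b) = ?q p \<oplus>\<^bsub>T\<^esub> ?q (Poly_Mapping.single a b)"
        using lin_add[OF q, of p "Poly_Mapping.single a b"] * by (simp add: a)
      also have "?q (Poly_Mapping.single a b) = tensor M N (b \<odot>\<^bsub>M\<^esub> x) y"
        using * by (simp add: a coset_tensor tensor_smult_left)
      finally show "P (?q (p + Poly_Mapping.single a b))"
        using * M by (auto intro!: assms(3) pure simp: add(1) lin_closed[OF q])
    qed
  qed
  then show ?thesis using p by simp
qed

context
  fixes V :: "('k, 'v, 'l) module_scheme" and f
  assumes V: "vspace V" and f: "bilin M N V f"
begin

private abbreviation "fp \<equiv> \<lambda>z. f (fst z) (snd z)"

private lemma fp: "fp \<in> carrier M \<times> carrier N \<rightarrow> carrier V"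
  using bilinD(3)[OF f] by auto

private lemma lin_ext_kernel: "p \<in> tensor_kernel M N \<Longrightarrow> lin_ext V fp p = \<zero>\<^bsub>V\<^esub>"
proof -
  let ?K = "{p \<in> carrier FF. lin_ext V fp p = \<zero>\<^bsub>V\<^esub>}"
  have zero: "(a \<oplus>\<^bsub>V\<^esub> b) \<ominus>\<^bsub>V\<^esub> a \<ominus>\<^bsub>V\<^esub> b = \<zero>\<^bsub>V\<^esub>" if "a \<in> carrier V" "b \<in> carrier V" for a b
    using V that vs_r_neg[OF V vs_add_closed[OF V that]]
    by (simp add: vs_minus_eq vs_neg_eq vs_smult_r_distr vs_assoc)
  have "submodule ?K scalars FF"
    by (intro submodule_kernel lin_ext_lin V fp vspace_free)
  then have "tensor_kernel M N \<subseteq> ?K"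
    unfolding tensor_kernel_def
    by (rule generated_submodule_min)
       (use M N in \<open>auto simp: lin_ext_minus[OF V fp] lin_ext_single[OF V] bilinD(3)[OF f]
          bilin_simps[OF f] zero V vs_eq_iff_minus[OF V]\<close>)
  then show "p \<in> tensor_kernel M N \<Longrightarrow> lin_ext V fp p = \<zero>\<^bsub>V\<^esub>" by auto
qed

lemma tensor_lift_lin: "tensor_lift V f \<in> linear_maps T V"
  unfolding tensor_lift_def tensor_module_def lin_ext_def[symmetric]
  by (rule quotient_lift_lin[OF vspace_free tensor_kernel_submodule lin_ext_lin[OF V fp] V lin_ext_kernel])

lemma tensor_lift_tensor [simp]:
  "x \<in> carrier M \<Longrightarrow> y \<in> carrier N \<Longrightarrow> tensor_lift V f (tensor M N x y) = f x y"
  unfolding tensor_lift_def tensor_def lin_ext_def[symmetric]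
  by (subst the_elem_coset[OF vspace_free tensor_kernel_submodule lin_ext_lin[OF V fp] V lin_ext_kernel])
     (simp_all add: lin_ext_single V bilinD(3)[OF f])

lemma tensor_lift_add: "t \<in> carrier T \<Longrightarrow> u \<in> carrier T \<Longrightarrow>
    tensor_lift V f (t \<oplus>\<^bsub>T\<^esub> u) = tensor_lift V f t \<oplus>\<^bsub>V\<^esub> tensor_lift V f u"
  by (rule lin_add[OF tensor_lift_lin])

end

lemma tensor_ext:
  assumes f: "f \<in> linear_maps T V" and g: "g \<in> linear_maps T V"
    and "\<And>x y. x \<in> carrier M \<Longrightarrow> y \<in> carrier N \<Longrightarrow> f (tensor M N x y) = g (tensor M N x y)"
    and "t \<in> carrier T"
  shows "f t = g t"
  using assms(4) by (induct rule: tensor_induct) (simp_all add: assms(3) lin_add[OF f] lin_add[OF g])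

lemma lin_tensor_lift:
  assumes "vspace V" "vspace W" "bilin M N V f" "k \<in> linear_maps V W" "t \<in> carrier T"
  shows "k (tensor_lift V f t) = tensor_lift W (\<lambda>x y. k (f x y)) t"
  by (rule tensor_ext[OF lin_comp[OF tensor_lift_lin] tensor_lift_lin])
     (use assms in \<open>auto simp: bilin_lin\<close>)

lemma tensor_lift_cong:
  assumes "vspace V" "bilin M N V f" "t \<in> carrier T"
    and "\<And>x y. x \<in> carrier M \<Longrightarrow> y \<in> carrier N \<Longrightarrow> g x y = f x y"
  shows "tensor_lift V g t = tensor_lift V f t"
proof -
  have g: "bilin M N V g" by (rule bilin_cong[OF assms(2) M N assms(4)])
  show ?thesis
    by (rule tensor_ext[OF tensor_lift_lin[OF assms(1) g] tensor_lift_lin[OF assms(1,2)] _ assms(3)])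
       (simp add: assms(1,2,4) g)
qed

text \<open>A lift at a fixed tensor is a finite sum of values of the bilinear map, so it inherits
  linearity in any parameter. This is what makes iterated lifts bilinear, for instance products of
  tensors and nested Sweedler sums.\<close>

lemma tensor_lift_param:
  assumes V: "vspace V" and F: "\<And>l. l \<in> carrier L \<Longrightarrow> bilin M N V (F l)" and L: "vspace L"
    and lin: "\<And>x y. x \<in> carrier M \<Longrightarrow> y \<in> carrier N \<Longrightarrow> (\<lambda>l. F l x y) \<in> linear_maps L V"
    and t: "t \<in> carrier T"
  shows "(\<lambda>l. tensor_lift V (F l) t) \<in> linear_maps L V"
  using t
proof (induct rule: tensor_induct)
  case (pure x y)
  show ?case
    by (rule lin_eqI_on[OF lin[OF pure]]) (simp_all add: V F L pure)
next
  case (add t u)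
  show ?case
    by (rule lin_eqI_on[OF lin_addI[OF V add(3,4)]])
       (simp_all add: V F L add tensor_lift_add)
qed

lemma tensor_zero_left: "y \<in> carrier N \<Longrightarrow> tensor M N \<zero>\<^bsub>M\<^esub> y = \<zero>\<^bsub>T\<^esub>"
  using lin_zero[OF bilinD(2)[OF bilin_tensor] M vspace_tensor] .

lemma tensor_zero_right: "x \<in> carrier M \<Longrightarrow> tensor M N x \<zero>\<^bsub>N\<^esub> = \<zero>\<^bsub>T\<^esub>"
  using lin_zero[OF bilinD(1)[OF bilin_tensor] N vspace_tensor] .

end

text \<open>The construction looks at carrier, addition and scaling alone, so changes of the
  product, of the coproduct or of the record type leave tensor products literally unchanged.\<close>

lemma tensor_module_cong:
  assumes "carrier M' = carrier M" "add M' = add M" "smult M' = smult M"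
    and "carrier N' = carrier N" "add N' = add N" "smult N' = smult N"
  shows "tensor_module M' N' = tensor_module M N" "tensor M' N' = tensor M N"
  by (simp_all add: fun_eq_iff tensor_module_def tensor_def tensor_kernel_def assms)

section \<open>Associative algebras\<close>

context
  fixes A :: "('k::field, 'a, 'm) module_scheme"
  assumes A: "assoc_algebra A"
begin

interpretation ring A using A by (simp add: assoc_algebra_def)

lemma alg_vspace [simp]: "vspace A" using A by (simp add: assoc_algebra_def)
lemma alg_mult_closed [simp]: "x \<in> carrier A \<Longrightarrow> y \<in> carrier A \<Longrightarrow> x \<otimes>\<^bsub>A\<^esub> y \<in> carrier A" by simp
lemma alg_one_closed [simp]: "\<one>\<^bsub>A\<^esub> \<in> carrier A" by simp
lemma alg_assoc: "x \<in> carrier A \<Longrightarrow> y \<in> carrier A \<Longrightarrow> z \<in> carrier A \<Longrightarrow>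
    (x \<otimes>\<^bsub>A\<^esub> y) \<otimes>\<^bsub>A\<^esub> z = x \<otimes>\<^bsub>A\<^esub> (y \<otimes>\<^bsub>A\<^esub> z)" by (rule m_assoc)
lemma alg_l_one [simp]: "x \<in> carrier A \<Longrightarrow> \<one>\<^bsub>A\<^esub> \<otimes>\<^bsub>A\<^esub> x = x" by simp
lemma alg_r_one [simp]: "x \<in> carrier A \<Longrightarrow> x \<otimes>\<^bsub>A\<^esub> \<one>\<^bsub>A\<^esub> = x" by simp
lemma alg_l_distr: "x \<in> carrier A \<Longrightarrow> y \<in> carrier A \<Longrightarrow> z \<in> carrier A \<Longrightarrow>
    (x \<oplus>\<^bsub>A\<^esub> y) \<otimes>\<^bsub>A\<^esub> z = x \<otimes>\<^bsub>A\<^esub> z \<oplus>\<^bsub>A\<^esub> y \<otimes>\<^bsub>A\<^esub> z" by (rule l_distr)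
lemma alg_r_distr: "x \<in> carrier A \<Longrightarrow> y \<in> carrier A \<Longrightarrow> z \<in> carrier A \<Longrightarrow>
    z \<otimes>\<^bsub>A\<^esub> (x \<oplus>\<^bsub>A\<^esub> y) = z \<otimes>\<^bsub>A\<^esub> x \<oplus>\<^bsub>A\<^esub> z \<otimes>\<^bsub>A\<^esub> y" by (rule r_distr)
lemma alg_smult_left [simp]: "x \<in> carrier A \<Longrightarrow> y \<in> carrier A \<Longrightarrow>
    (c \<odot>\<^bsub>A\<^esub> x) \<otimes>\<^bsub>A\<^esub> y = c \<odot>\<^bsub>A\<^esub> (x \<otimes>\<^bsub>A\<^esub> y)"
  using A by (simp add: assoc_algebra_def)
lemma alg_smult_right [simp]: "x \<in> carrier A \<Longrightarrow> y \<in> carrier A \<Longrightarrow>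
    x \<otimes>\<^bsub>A\<^esub> (c \<odot>\<^bsub>A\<^esub> y) = c \<odot>\<^bsub>A\<^esub> (x \<otimes>\<^bsub>A\<^esub> y)"
  using A by (simp add: assoc_algebra_def)
lemma alg_l_null [simp]: "x \<in> carrier A \<Longrightarrow> \<zero>\<^bsub>A\<^esub> \<otimes>\<^bsub>A\<^esub> x = \<zero>\<^bsub>A\<^esub>" by simp
lemma alg_r_null [simp]: "x \<in> carrier A \<Longrightarrow> x \<otimes>\<^bsub>A\<^esub> \<zero>\<^bsub>A\<^esub> = \<zero>\<^bsub>A\<^esub>" by simp

lemma lin_mult_left: "a \<in> carrier A \<Longrightarrow> (\<lambda>x. a \<otimes>\<^bsub>A\<^esub> x) \<in> linear_maps A A"
  by (rule linI) (simp_all add: r_distr)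

lemma lin_mult_right: "a \<in> carrier A \<Longrightarrow> (\<lambda>x. x \<otimes>\<^bsub>A\<^esub> a) \<in> linear_maps A A"
  by (rule linI) (simp_all add: l_distr)

lemma bilin_mult: "bilin A A A (\<lambda>x y. x \<otimes>\<^bsub>A\<^esub> y)"
  by (intro bilinI lin_mult_left lin_mult_right)

end

lemma assoc_algebraI:
  assumes V: "vspace A" and one: "\<one>\<^bsub>A\<^esub> \<in> carrier A"
    and bilin: "bilin A A A (\<lambda>x y. x \<otimes>\<^bsub>A\<^esub> y)"
    and assoc: "\<And>x y z. x \<in> carrier A \<Longrightarrow> y \<in> carrier A \<Longrightarrow> z \<in> carrier A \<Longrightarrow>
      (x \<otimes>\<^bsub>A\<^esub> y) \<otimes>\<^bsub>A\<^esub> z = x \<otimes>\<^bsub>A\<^esub> (y \<otimes>\<^bsub>A\<^esub> z)"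
    and l_one: "\<And>x. x \<in> carrier A \<Longrightarrow> \<one>\<^bsub>A\<^esub> \<otimes>\<^bsub>A\<^esub> x = x"
    and r_one: "\<And>x. x \<in> carrier A \<Longrightarrow> x \<otimes>\<^bsub>A\<^esub> \<one>\<^bsub>A\<^esub> = x"
  shows "assoc_algebra A"
  unfolding assoc_algebra_def
proof (intro conjI allI ballI)
  show "ring A"
  proof (rule ringI)
    show "abelian_group A" by (rule vs_abelian_group[OF V])
    show "Group.monoid A"
      by (rule Group.monoidI) (use bilinD(3)[OF bilin] one assoc l_one r_one in auto)
  qed (simp_all add: bilin_simps[OF bilin])
qed (simp_all add: V bilin_simps[OF bilin])

lemma alg_hom_lin: "f \<in> algebra_hom A B \<Longrightarrow> f \<in> linear_maps A B"
  by (simp add: algebra_hom_def)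

lemma alg_hom_mult: "f \<in> algebra_hom A B \<Longrightarrow> x \<in> carrier A \<Longrightarrow> y \<in> carrier A \<Longrightarrow>
    f (x \<otimes>\<^bsub>A\<^esub> y) = f x \<otimes>\<^bsub>B\<^esub> f y"
  by (simp add: algebra_hom_def ring_hom_def)

lemma alg_hom_one: "f \<in> algebra_hom A B \<Longrightarrow> f \<one>\<^bsub>A\<^esub> = \<one>\<^bsub>B\<^esub>"
  by (simp add: algebra_hom_def ring_hom_def)

lemma alg_hom_closed: "f \<in> algebra_hom A B \<Longrightarrow> x \<in> carrier A \<Longrightarrow> f x \<in> carrier B"
  by (rule lin_closed[OF alg_hom_lin])

lemma alg_homI:
  assumes "f \<in> linear_maps A B" "f \<one>\<^bsub>A\<^esub> = \<one>\<^bsub>B\<^esub>"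
    and "\<And>x y. x \<in> carrier A \<Longrightarrow> y \<in> carrier A \<Longrightarrow> f (x \<otimes>\<^bsub>A\<^esub> y) = f x \<otimes>\<^bsub>B\<^esub> f y"
  shows "f \<in> algebra_hom A B"
  using assms by (auto simp: algebra_hom_def ring_hom_def lin_simps)

lemma alg_hom_comp: "f \<in> algebra_hom A B \<Longrightarrow> g \<in> algebra_hom B C \<Longrightarrow> (\<lambda>x. g (f x)) \<in> algebra_hom A C"
  by (rule alg_homI)
     (auto simp: alg_hom_one alg_hom_mult alg_hom_closed intro: lin_comp[OF alg_hom_lin alg_hom_lin])

lemma algebra_hom_cong:
  assumes "carrier M' = carrier M" "add M' = add M" "smult M' = smult M"
      "mult M' = mult M" "one M' = one M"
    and "carrier N' = carrier N" "add N' = add N" "smult N' = smult N"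
      "mult N' = mult N" "one N' = one N"
  shows "algebra_hom M' N' = algebra_hom M N"
  by (simp add: algebra_hom_def linear_maps_cong[OF assms(1-3,6-8)] ring_hom_def assms)

lemma assoc_algebra_cong:
  assumes A: "assoc_algebra A" and eq: "carrier B = carrier A" "add B = add A" "zero B = zero A"
    "smult B = smult A" "mult B = mult A" "one B = one A"
  shows "assoc_algebra B"
proof -
  have "vspace B" by (rule vspace_cong[OF alg_vspace[OF A] eq(1-4)])
  moreover have "bilin B B B (\<lambda>x y. x \<otimes>\<^bsub>B\<^esub> y)"
    using bilin_mult[OF A] by (simp add: bilin_def linear_maps_def eq)
  ultimately show ?thesis
    by (intro assoc_algebraI) (simp_all add: A eq alg_assoc)
qed

lemma assoc_algebra_scalars [simp]: "assoc_algebra (scalars :: ('k::field, 'k) module)"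
  by (intro assoc_algebraI bilinI linI) (simp_all add: algebra_simps)

lemma opposite_simps [simp]:
  "carrier (opposite A) = carrier A" "add (opposite A) = add A" "zero (opposite A) = zero A"
  "smult (opposite A) = smult A" "one (opposite A) = one A"
  "x \<otimes>\<^bsub>opposite A\<^esub> y = y \<otimes>\<^bsub>A\<^esub> x" "opposite (opposite A) = A"
  by (simp_all add: opposite_def)

lemma assoc_algebra_opposite [simp]:
  assumes A: "assoc_algebra A" shows "assoc_algebra (opposite A)"
proof (rule assoc_algebraI)
  show "vspace (opposite A)" by (rule vspace_cong[OF alg_vspace[OF A]]) simp_all
  show "bilin (opposite A) (opposite A) (opposite A) (\<lambda>x y. x \<otimes>\<^bsub>opposite A\<^esub> y)"
    using bilin_swap[OF bilin_mult[OF A]] by (simp add: bilin_def linear_maps_def)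
qed (simp_all add: A alg_assoc)


subsection \<open>The endomorphism algebra\<close>

text \<open>Operators are kept extensional on the carrier of V, so that agreement on the carrier is
  equality and the ring axioms hold literally.\<close>

definition end_algebra :: "('k::field, 'v, 'm) module_scheme \<Rightarrow> ('k, 'v \<Rightarrow> 'v) module" where
  "end_algebra V =
     \<lparr>carrier = linear_maps V V \<inter> extensional (carrier V),
      mult = (\<lambda>f g. \<lambda>x\<in>carrier V. f (g x)), one = (\<lambda>x\<in>carrier V. x),
      zero = (\<lambda>x\<in>carrier V. \<zero>\<^bsub>V\<^esub>), add = (\<lambda>f g. \<lambda>x\<in>carrier V. f x \<oplus>\<^bsub>V\<^esub> g x),
      smult = (\<lambda>c f. \<lambda>x\<in>carrier V. c \<odot>\<^bsub>V\<^esub> f x)\<rparr>"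

lemma end_simps [simp]:
  assumes "x \<in> carrier V"
  shows "(f \<otimes>\<^bsub>end_algebra V\<^esub> g) x = f (g x)" "\<one>\<^bsub>end_algebra V\<^esub> x = x" "\<zero>\<^bsub>end_algebra V\<^esub> x = \<zero>\<^bsub>V\<^esub>"
    "(f \<oplus>\<^bsub>end_algebra V\<^esub> g) x = f x \<oplus>\<^bsub>V\<^esub> g x" "(c \<odot>\<^bsub>end_algebra V\<^esub> f) x = c \<odot>\<^bsub>V\<^esub> f x"
  using assms by (simp_all add: end_algebra_def)

lemma end_carrierD: "f \<in> carrier (end_algebra V) \<Longrightarrow> f \<in> linear_maps V V"
  by (simp add: end_algebra_def)

lemma end_carrier_closed: "f \<in> carrier (end_algebra V) \<Longrightarrow> x \<in> carrier V \<Longrightarrow> f x \<in> carrier V"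
  by (simp add: lin_closed[OF end_carrierD])

lemma end_restrictI: "vspace V \<Longrightarrow> f \<in> linear_maps V V \<Longrightarrow> (\<lambda>x\<in>carrier V. f x) \<in> carrier (end_algebra V)"
  by (simp add: end_algebra_def lin_eqI_on)

lemma end_eqI:
  assumes "f \<in> carrier (end_algebra V)" "g \<in> carrier (end_algebra V)"
    and "\<And>x. x \<in> carrier V \<Longrightarrow> f x = g x"
  shows "f = g"
  using assms by (auto simp: end_algebra_def intro: extensionalityI)

lemma assoc_algebra_end [simp]:
  assumes V: "vspace V" shows "assoc_algebra (end_algebra V)"
proof -
  let ?E = "end_algebra V"
  have one: "\<one>\<^bsub>?E\<^esub> \<in> carrier ?E" and zero: "\<zero>\<^bsub>?E\<^esub> \<in> carrier ?E"
    using end_restrictI[OF V lin_id] end_restrictI[OF V, of "\<lambda>_. \<zero>\<^bsub>V\<^esub>"] V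
    by (simp_all add: end_algebra_def linear_maps_def)
  have mult: "f \<otimes>\<^bsub>?E\<^esub> g \<in> carrier ?E" if "f \<in> carrier ?E" "g \<in> carrier ?E" for f g
    using end_restrictI[OF V lin_comp[OF that(2,1)[THEN end_carrierD]]] by (simp add: end_algebra_def)
  have add: "f \<oplus>\<^bsub>?E\<^esub> g \<in> carrier ?E" if "f \<in> carrier ?E" "g \<in> carrier ?E" for f g
    using end_restrictI[OF V lin_addI[OF V that[THEN end_carrierD]]] by (simp add: end_algebra_def)
  have smult: "c \<odot>\<^bsub>?E\<^esub> f \<in> carrier ?E" if "f \<in> carrier ?E" for c f
    using end_restrictI[OF V lin_smultI[OF V that[THEN end_carrierD]]] by (simp add: end_algebra_def)
  note closed = one zero mult add smult end_carrier_closed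
  have VE: "vspace ?E"
    using V vs_l_neg[OF V]
    by (intro vspaceI end_eqI[of _ V])
       (simp_all add: closed vs_assoc vs_smult_l_distr vs_smult_r_distr vs_comm[of V] vs_neg_eq)
  show ?thesis
    by (intro assoc_algebraI bilinI linI VE end_eqI[of _ V])
       (simp_all add: closed lin_add[OF end_carrierD] lin_smult[OF end_carrierD])
qed


subsection \<open>Tensor products of algebras\<close>

lemma tensor_algebra_simps [simp]:
  "carrier (tensor_algebra A B) = carrier (tensor_module A B)"
  "add (tensor_algebra A B) = add (tensor_module A B)"
  "zero (tensor_algebra A B) = zero (tensor_module A B)"
  "smult (tensor_algebra A B) = smult (tensor_module A B)"
  "one (tensor_algebra A B) = tensor A B \<one>\<^bsub>A\<^esub> \<one>\<^bsub>B\<^esub>"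
  by (simp_all add: tensor_algebra_def)

lemma linear_maps_tensor_algebra [simp]:
  "linear_maps (tensor_algebra A B) N = linear_maps (tensor_module A B) N"
  "linear_maps N (tensor_algebra A B) = linear_maps N (tensor_module A B)"
  by (simp_all add: linear_maps_def)

lemma bilin_tensor_algebra [simp]:
  "bilin (tensor_algebra A B) M N = bilin (tensor_module A B) M N"
  "bilin M (tensor_algebra A B) N = bilin M (tensor_module A B) N"
  "bilin M N (tensor_algebra A B) = bilin M N (tensor_module A B)"
  by (simp_all add: bilin_def fun_eq_iff)

context
  fixes A :: "('k::field, 'a, 'm) module_scheme" and B :: "('k, 'b, 'n) module_scheme"
  assumes A: "assoc_algebra A" and B: "assoc_algebra B"
begin

private abbreviation "TAB \<equiv> tensor_module A B"
private abbreviation "TA \<equiv> tensor_algebra A B"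

private lemma VTAB: "vspace TAB" and VA: "vspace A" and VB: "vspace B"
  using A B by simp_all

private lemmas tind = tensor_induct[OF VA VB, consumes 1, case_names pure add]

private lemma bilin1: "a \<in> carrier A \<Longrightarrow> b \<in> carrier B \<Longrightarrow>
    bilin A B TAB (\<lambda>a' b'. tensor A B (a \<otimes>\<^bsub>A\<^esub> a') (b \<otimes>\<^bsub>B\<^esub> b'))"
  by (intro bilin_comp[OF bilin_tensor] lin_mult_left A B VA VB)

private lemma bilin2: "u \<in> carrier TAB \<Longrightarrow>
    bilin A B TAB (\<lambda>a b. tensor_lift TAB (\<lambda>a' b'. tensor A B (a \<otimes>\<^bsub>A\<^esub> a') (b \<otimes>\<^bsub>B\<^esub> b')) u)"
  by (intro bilinI tensor_lift_param[OF VA VB VTAB] bilin1 VA VB)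
     (auto intro!: lin_comp[OF lin_mult_right] bilinD[OF bilin_tensor] simp: A B)

lemma tensor_mult_def: "t \<otimes>\<^bsub>TA\<^esub> u = tensor_lift TAB (\<lambda>a b.
    tensor_lift TAB (\<lambda>a' b'. tensor A B (a \<otimes>\<^bsub>A\<^esub> a') (b \<otimes>\<^bsub>B\<^esub> b')) u) t"
  by (simp add: tensor_algebra_def)

lemma tensor_mult_tensor [simp]: "a \<in> carrier A \<Longrightarrow> b \<in> carrier B \<Longrightarrow> a' \<in> carrier A \<Longrightarrow> b' \<in> carrier B \<Longrightarrow>
    tensor A B a b \<otimes>\<^bsub>TA\<^esub> tensor A B a' b' = tensor A B (a \<otimes>\<^bsub>A\<^esub> a') (b \<otimes>\<^bsub>B\<^esub> b')"
  by (simp add: tensor_mult_def bilin1 bilin2 A B)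

private lemma bilin_tmult: "bilin TA TA TA (\<lambda>t u. t \<otimes>\<^bsub>TA\<^esub> u)"
  unfolding tensor_mult_def bilin_tensor_algebra
  by (intro bilinI tensor_lift_lin tensor_lift_param[OF VA VB VTAB] bilin1 bilin2 VA VB VTAB)

lemma assoc_algebra_tensor [simp]: "assoc_algebra TA"
proof (rule assoc_algebraI)
  note bs = bilin_simps[OF bilin_tmult, simplified] bilinD(3)[OF bilin_tmult, simplified]
  show "vspace TA" by (rule vspace_cong[OF VTAB]) simp_all
  show "bilin TA TA TA (\<lambda>x y. x \<otimes>\<^bsub>TA\<^esub> y)" by (rule bilin_tmult)
  show "(t \<otimes>\<^bsub>TA\<^esub> u) \<otimes>\<^bsub>TA\<^esub> v = t \<otimes>\<^bsub>TA\<^esub> (u \<otimes>\<^bsub>TA\<^esub> v)"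
    if "t \<in> carrier TA" "u \<in> carrier TA" "v \<in> carrier TA" for t u v
    using that unfolding tensor_algebra_simps
  proof (induct t rule: tind)
    case (pure a b)
    from pure(3,1,2,4) show ?case
    proof (induct u rule: tind)
      case (pure a' b')
      from pure(5,1-4) show ?case
        by (induct v rule: tind)
           (simp_all add: A B alg_assoc bs)
    qed (simp add: bs VA VB VTAB)
  qed (simp add: bs VA VB VTAB)
  show "\<one>\<^bsub>TA\<^esub> \<otimes>\<^bsub>TA\<^esub> t = t" "t \<otimes>\<^bsub>TA\<^esub> \<one>\<^bsub>TA\<^esub> = t" if "t \<in> carrier TA" for t
    using that unfolding tensor_algebra_simps
    by (induct t rule: tind) (simp_all add: A B bs)
qed (simp add: A B)

text \<open>By bilinearity both sides of the product rule are determined by pure tensors. The lemma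
  is the source of nearly all homomorphisms on tensor squares below: coassociativity, counit laws,
  convolutions and the coregular actions of group-like elements.\<close>

lemma tensor_lift_alg_hom:
  assumes C: "assoc_algebra C" and f: "bilin A B C f" and one: "f \<one>\<^bsub>A\<^esub> \<one>\<^bsub>B\<^esub> = \<one>\<^bsub>C\<^esub>"
    and mult: "\<And>a a' b b'. a \<in> carrier A \<Longrightarrow> a' \<in> carrier A \<Longrightarrow> b \<in> carrier B \<Longrightarrow> b' \<in> carrier B \<Longrightarrow>
      f (a \<otimes>\<^bsub>A\<^esub> a') (b \<otimes>\<^bsub>B\<^esub> b') = f a b \<otimes>\<^bsub>C\<^esub> f a' b'"
  shows "tensor_lift C f \<in> algebra_hom TA C"
proof (rule alg_homI)
  note bs = bilin_simps[OF bilin_tmult, simplified] bilinD(3)[OF bilin_tmult, simplified]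
  have VC: "vspace C" using C by simp
  note l = tensor_lift_lin[OF VA VB VC f]
  show "tensor_lift C f \<in> linear_maps TA C" using l by simp
  show "tensor_lift C f \<one>\<^bsub>TA\<^esub> = \<one>\<^bsub>C\<^esub>" using A B VC f one by simp
  show "tensor_lift C f (t \<otimes>\<^bsub>TA\<^esub> u) = tensor_lift C f t \<otimes>\<^bsub>C\<^esub> tensor_lift C f u"
    if "t \<in> carrier TA" "u \<in> carrier TA" for t u
    using that unfolding tensor_algebra_simps
  proof (induct t rule: tind)
    case (pure a b)
    from pure(3,1,2) show ?case
      by (induct u rule: tind)
         (simp_all add: A B C VC f mult bs lin_simps[OF l] alg_r_distr bilinD(3)[OF f])
  qed (simp add: bs lin_simps[OF l] alg_l_distr C)
qed

end

lemma tensor_algebra_cong: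
  assumes "carrier A' = carrier A" "add A' = add A" "smult A' = smult A" "mult A' = mult A" "one A' = one A"
    and "carrier B' = carrier B" "add B' = add B" "smult B' = smult B" "mult B' = mult B" "one B' = one B"
  shows "tensor_algebra A' B' = tensor_algebra A B"
  unfolding tensor_algebra_def tensor_module_cong[OF assms(1-3,6-8)] assms ..


subsection \<open>Complements of subspaces\<close>

text \<open>By Zorn's lemma there is a maximal subspace N that meets C only in zero. A vector x
  outside C + N could be adjoined to N without meeting C, against maximality.\<close>

lemma complement_exists:
  assumes M: "vspace M" and C: "submodule C scalars M"
  obtains N where "submodule N scalars M" "N \<inter> C = {\<zero>\<^bsub>M\<^esub>}"
    "\<And>x. x \<in> carrier M \<Longrightarrow> \<exists>c\<in>C. \<exists>y\<in>N. x = c \<oplus>\<^bsub>M\<^esub> y"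
proof -
  let ?A = "{N. submodule N scalars M \<and> N \<inter> C = {\<zero>\<^bsub>M\<^esub>}}"
  have "{\<zero>\<^bsub>M\<^esub>} \<in> ?A"
    using submoduleD(2)[OF C] submoduleI'[OF M, of "{\<zero>\<^bsub>M\<^esub>}"] M by simp
  then have ne: "?A \<noteq> {}" by blast
  obtain N where N: "N \<in> ?A" and max: "\<And>X. X \<in> ?A \<Longrightarrow> N \<subseteq> X \<Longrightarrow> X = N"
  proof (rule subset_Zorn_nonempty[OF ne, THEN bexE])
    fix \<C> assume ch: "\<C> \<noteq> {}" "subset.chain ?A \<C>"
    have sub: "submodule X scalars M" "X \<inter> C = {\<zero>\<^bsub>M\<^esub>}" if "X \<in> \<C>" for X
      using ch that by (auto simp: subset.chain_def)
    have lin: "X \<subseteq> Y \<or> Y \<subseteq> X" if "X \<in> \<C>" "Y \<in> \<C>" for X Y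
      using ch that by (auto simp: subset.chain_def)
    have "submodule (\<Union>\<C>) scalars M"
    proof (rule submoduleI'[OF M])
      show "\<Union>\<C> \<subseteq> carrier M" using sub submoduleD(1) by blast
      show "\<zero>\<^bsub>M\<^esub> \<in> \<Union>\<C>" using sub submoduleD(2) ch(1) by blast
      show "x \<oplus>\<^bsub>M\<^esub> y \<in> \<Union>\<C>" if xy: "x \<in> \<Union>\<C>" "y \<in> \<Union>\<C>" for x y
      proof -
        obtain X Y where "X \<in> \<C>" "Y \<in> \<C>" "x \<in> X" "y \<in> Y" using xy by blast
        then obtain Z where "Z \<in> \<C>" "x \<in> Z" "y \<in> Z" using lin[of X Y] by blast
        then show ?thesis using submoduleD(3)[OF sub(1)] by blast
      qed
      show "c \<odot>\<^bsub>M\<^esub> x \<in> \<Union>\<C>" if "x \<in> \<Union>\<C>" for c x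
        using that submoduleD(4)[OF sub(1)] by blast
    qed
    then show "\<Union>\<C> \<in> ?A" using sub(2) ch(1) by blast
  qed blast
  note N' = N[simplified, THEN conjunct1]
  note CM = submoduleD[OF C] and NM = submoduleD[OF N']
  have "\<exists>c\<in>C. \<exists>y\<in>N. x = c \<oplus>\<^bsub>M\<^esub> y" if x: "x \<in> carrier M" for x
  proof (rule ccontr)
    assume no: "\<not> (\<exists>c\<in>C. \<exists>y\<in>N. x = c \<oplus>\<^bsub>M\<^esub> y)"
    \<comment> \<open>This is N + Kx; once it is seen to meet C only in zero, maximality of N forces
      x into N.\<close>
    define N2 where "N2 = {y \<oplus>\<^bsub>M\<^esub> k \<odot>\<^bsub>M\<^esub> x | y k. y \<in> N}"
    have cN: "y \<in> carrier M" if "y \<in> N" for y using NM(1) that by blast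
    have sub2: "submodule N2 scalars M"
    proof (rule submoduleI'[OF M])
      show "N2 \<subseteq> carrier M" using M x cN by (auto simp: N2_def)
      have "\<zero>\<^bsub>M\<^esub> = \<zero>\<^bsub>M\<^esub> \<oplus>\<^bsub>M\<^esub> 0 \<odot>\<^bsub>M\<^esub> x" using M x by simp
      then show "\<zero>\<^bsub>M\<^esub> \<in> N2" using NM(2) unfolding N2_def by blast
      show "a \<oplus>\<^bsub>M\<^esub> b \<in> N2" if ab: "a \<in> N2" "b \<in> N2" for a b
      proof -
        obtain y k z l where *: "y \<in> N" "z \<in> N" "a = y \<oplus>\<^bsub>M\<^esub> k \<odot>\<^bsub>M\<^esub> x" "b = z \<oplus>\<^bsub>M\<^esub> l \<odot>\<^bsub>M\<^esub> x"
          using ab unfolding N2_def by blast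
        have "a \<oplus>\<^bsub>M\<^esub> b = (y \<oplus>\<^bsub>M\<^esub> z) \<oplus>\<^bsub>M\<^esub> (k + l) \<odot>\<^bsub>M\<^esub> x"
          using * M x cN by (simp add: vs_smult_l_distr vs_assoc vs_lcomm[of M z])
        then show ?thesis using NM(3)[OF *(1,2)] unfolding N2_def by blast
      qed
      show "c \<odot>\<^bsub>M\<^esub> a \<in> N2" if a: "a \<in> N2" for c a
      proof -
        obtain y k where *: "y \<in> N" "a = y \<oplus>\<^bsub>M\<^esub> k \<odot>\<^bsub>M\<^esub> x"
          using a unfolding N2_def by blast
        have "c \<odot>\<^bsub>M\<^esub> a = c \<odot>\<^bsub>M\<^esub> y \<oplus>\<^bsub>M\<^esub> (c * k) \<odot>\<^bsub>M\<^esub> x"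
          using * M x cN by (simp add: vs_smult_r_distr)
        then show ?thesis using NM(4)[OF *(1)] unfolding N2_def by blast
      qed
    qed
    have "a = \<zero>\<^bsub>M\<^esub>" if a: "a \<in> N2" "a \<in> C" for a
    proof -
      obtain y k where *: "y \<in> N" "a = y \<oplus>\<^bsub>M\<^esub> k \<odot>\<^bsub>M\<^esub> x"
        using a(1) unfolding N2_def by blast
      have aM: "a \<in> carrier M" using CM(1) a(2) by blast
      \<comment> \<open>Otherwise the equation a = y + k x can be solved for x, which exhibits x as
        an element of C + N.\<close>
      have "k = 0"
      proof (rule ccontr)
        assume k: "k \<noteq> 0"
        have "inverse k \<odot>\<^bsub>M\<^esub> a \<oplus>\<^bsub>M\<^esub> (- inverse k) \<odot>\<^bsub>M\<^esub> y =
            (inverse k \<odot>\<^bsub>M\<^esub> y \<oplus>\<^bsub>M\<^esub> x) \<oplus>\<^bsub>M\<^esub> (- inverse k) \<odot>\<^bsub>M\<^esub> y"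
          using * M x cN k by (simp add: vs_smult_r_distr)
        also have "\<dots> = x \<oplus>\<^bsub>M\<^esub> (inverse k \<odot>\<^bsub>M\<^esub> y \<oplus>\<^bsub>M\<^esub> (- inverse k) \<odot>\<^bsub>M\<^esub> y)"
          using * M x cN by (simp add: vs_assoc vs_lcomm[of M x])
        also have "\<dots> = x"
          using * M x cN by (simp flip: vs_smult_l_distr)
        finally have "x = inverse k \<odot>\<^bsub>M\<^esub> a \<oplus>\<^bsub>M\<^esub> (- inverse k) \<odot>\<^bsub>M\<^esub> y" by simp
        then show False using no CM(4)[OF a(2)] NM(4)[OF *(1)] by blast
      qed
      then have "a = y" using * M x cN by simp
      then show ?thesis using * a N by blast
    qed
    then have "N2 \<inter> C = {\<zero>\<^bsub>M\<^esub>}" using submoduleD(2)[OF sub2] CM(2) by blast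
    moreover have "N \<subseteq> N2"
    proof
      fix y assume y: "y \<in> N"
      then have "y = y \<oplus>\<^bsub>M\<^esub> 0 \<odot>\<^bsub>M\<^esub> x" using M x cN by simp
      then show "y \<in> N2" using y unfolding N2_def by blast
    qed
    ultimately have "N2 = N" using max sub2 by blast
    moreover have "x \<in> N2"
    proof -
      have "x = \<zero>\<^bsub>M\<^esub> \<oplus>\<^bsub>M\<^esub> 1 \<odot>\<^bsub>M\<^esub> x" using M x by simp
      then show ?thesis using NM(2) unfolding N2_def by blast
    qed
    ultimately have "x \<in> N" by simp
    moreover have "x = \<zero>\<^bsub>M\<^esub> \<oplus>\<^bsub>M\<^esub> x" using M x by simp
    ultimately show False using no CM(2) by blast
  qed
  then show ?thesis using that N by blast
qed

text \<open>The C-component along a complement is unique because the difference of two of them lies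
  in both C and N.\<close>

lemma projection_exists:
  assumes M: "vspace M" and C: "submodule C scalars M"
  obtains \<pi> where "\<pi> \<in> linear_maps M (M\<lparr>carrier := C\<rparr>)" "\<And>x. x \<in> C \<Longrightarrow> \<pi> x = x"
proof -
  obtain N where N: "submodule N scalars M" "N \<inter> C = {\<zero>\<^bsub>M\<^esub>}"
    and ex: "\<And>x. x \<in> carrier M \<Longrightarrow> \<exists>c\<in>C. \<exists>y\<in>N. x = c \<oplus>\<^bsub>M\<^esub> y"
    by (rule complement_exists[OF assms]) blast
  note CM = submoduleD[OF C] and NM = submoduleD[OF N(1)]
  have cN: "y \<in> carrier M" if "y \<in> N" for y using NM(1) that by blast
  have cC: "y \<in> carrier M" if "y \<in> C" for y using CM(1) that by blast
  have uniq: "c = d" if "c \<in> C" "d \<in> C" "y \<in> N" "z \<in> N" "c \<oplus>\<^bsub>M\<^esub> y = d \<oplus>\<^bsub>M\<^esub> z" for c d y z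
  proof -
    have neg: "x \<oplus>\<^bsub>M\<^esub> (- 1) \<odot>\<^bsub>M\<^esub> x = \<zero>\<^bsub>M\<^esub>" if "x \<in> carrier M" for x
      using vs_r_neg[OF M that] that M by (simp add: vs_neg_eq)
    have "c = (c \<oplus>\<^bsub>M\<^esub> y) \<oplus>\<^bsub>M\<^esub> (- 1) \<odot>\<^bsub>M\<^esub> y"
      using that(1-4) M cN cC by (simp add: vs_assoc neg)
    then have "c \<oplus>\<^bsub>M\<^esub> (- 1) \<odot>\<^bsub>M\<^esub> d = ((d \<oplus>\<^bsub>M\<^esub> z) \<oplus>\<^bsub>M\<^esub> (- 1) \<odot>\<^bsub>M\<^esub> y) \<oplus>\<^bsub>M\<^esub> (- 1) \<odot>\<^bsub>M\<^esub> d"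
      unfolding that(5) by simp
    also have "\<dots> = (z \<oplus>\<^bsub>M\<^esub> (- 1) \<odot>\<^bsub>M\<^esub> y) \<oplus>\<^bsub>M\<^esub> (d \<oplus>\<^bsub>M\<^esub> (- 1) \<odot>\<^bsub>M\<^esub> d)"
      using that(2-4) M cN cC by (simp add: vs_assoc vs_lcomm[of M d])
    also have "\<dots> = z \<oplus>\<^bsub>M\<^esub> (- 1) \<odot>\<^bsub>M\<^esub> y"
      using that(2-4) M cN cC by (simp add: neg)
    finally have e: "c \<oplus>\<^bsub>M\<^esub> (- 1) \<odot>\<^bsub>M\<^esub> d = z \<oplus>\<^bsub>M\<^esub> (- 1) \<odot>\<^bsub>M\<^esub> y" .
    have "c \<oplus>\<^bsub>M\<^esub> (- 1) \<odot>\<^bsub>M\<^esub> d \<in> N" unfolding e using that NM by blast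
    moreover have "c \<oplus>\<^bsub>M\<^esub> (- 1) \<odot>\<^bsub>M\<^esub> d \<in> C" using that CM by blast
    ultimately have "c \<ominus>\<^bsub>M\<^esub> d = \<zero>\<^bsub>M\<^esub>" using N(2) that M cC by (auto simp: vs_minus_eq)
    then show ?thesis using that M cC by (simp add: vs_eq_iff_minus)
  qed
  define \<pi> where "\<pi> x = (THE c. c \<in> C \<and> (\<exists>y\<in>N. x = c \<oplus>\<^bsub>M\<^esub> y))" for x
  have \<pi>: "\<pi> (c \<oplus>\<^bsub>M\<^esub> y) = c" if "c \<in> C" "y \<in> N" for c y
    unfolding \<pi>_def using that uniq by (intro the_equality) blast+
  have "\<pi> \<in> linear_maps M (M\<lparr>carrier := C\<rparr>)"
  proof (rule linI)
    fix x assume x: "x \<in> carrier M"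
    then obtain c y where c: "c \<in> C" "y \<in> N" "x = c \<oplus>\<^bsub>M\<^esub> y" using ex by blast
    then show "\<pi> x \<in> carrier (M\<lparr>carrier := C\<rparr>)" by (simp add: \<pi>)
    show "\<pi> (k \<odot>\<^bsub>M\<^esub> x) = k \<odot>\<^bsub>M\<lparr>carrier := C\<rparr>\<^esub> \<pi> x" for k
      using \<pi>[OF CM(4)[OF c(1)] NM(4)[OF c(2)], of k k] c M cN cC
      by (simp add: \<pi> vs_smult_r_distr)
    fix x' assume x': "x' \<in> carrier M"
    then obtain d z where d: "d \<in> C" "z \<in> N" "x' = d \<oplus>\<^bsub>M\<^esub> z" using ex by blast
    have "x \<oplus>\<^bsub>M\<^esub> x' = (c \<oplus>\<^bsub>M\<^esub> d) \<oplus>\<^bsub>M\<^esub> (y \<oplus>\<^bsub>M\<^esub> z)"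
      using c d M cN cC by (simp add: vs_assoc vs_lcomm[of M y])
    then show "\<pi> (x \<oplus>\<^bsub>M\<^esub> x') = \<pi> x \<oplus>\<^bsub>M\<lparr>carrier := C\<rparr>\<^esub> \<pi> x'"
      using \<pi>[OF CM(3)[OF c(1) d(1)] NM(3)[OF c(2) d(2)]] c d by (simp add: \<pi>)
  qed
  moreover have "\<pi> x = x" if "x \<in> C" for x
    using \<pi>[OF that NM(2)] that M cC by simp
  ultimately show ?thesis using that by blast
qed

section \<open>Quotients of free algebras\<close>

context
  fixes R :: "('k::field, 'a, 'm) module_scheme" and I
  assumes R: "assoc_algebra R" and I: "ideal I R" and sub: "submodule I scalars R"
begin

private lemma VR: "vspace R" using R by simp

private lemma quotient_mult:
  "x \<in> carrier R \<Longrightarrow> y \<in> carrier R \<Longrightarrow>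
    (I +>\<^bsub>R\<^esub> x) \<otimes>\<^bsub>quotient_module R I\<^esub> (I +>\<^bsub>R\<^esub> y) = I +>\<^bsub>R\<^esub> (x \<otimes>\<^bsub>R\<^esub> y)"
  by (simp add: quotient_module_def FactRing_def ring.defs module.defs ideal.rcoset_mult_add[OF I])

lemma assoc_algebra_quotient: "assoc_algebra (quotient_module R I)"
proof (rule assoc_algebraI)
  show "vspace (quotient_module R I)" by (rule vspace_quotient[OF VR sub])
qed (use R VR in \<open>auto intro!: bilinI linI simp: quotient_carrier[OF VR sub] quotient_one[OF VR sub]
      quotient_mult quotient_add[OF VR sub] quotient_smult[OF VR sub] alg_l_distr alg_r_distr alg_assoc\<close>)

lemma coset_alg_hom: "(\<lambda>x. I +>\<^bsub>R\<^esub> x) \<in> algebra_hom R (quotient_module R I)"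
  by (rule alg_homI) (auto intro: coset_lin[OF VR sub] simp: quotient_one[OF VR sub] quotient_mult)

lemma quotient_lift_alg_hom:
  assumes A: "assoc_algebra A" and f: "f \<in> algebra_hom R A"
    and ker: "\<And>x. x \<in> I \<Longrightarrow> f x = \<zero>\<^bsub>A\<^esub>"
  shows "(\<lambda>X. the_elem (f ` X)) \<in> algebra_hom (quotient_module R I) A"
proof (rule alg_homI)
  note te = the_elem_coset[OF VR sub alg_hom_lin[OF f] alg_vspace[OF A] ker]
  show "(\<lambda>X. the_elem (f ` X)) \<in> linear_maps (quotient_module R I) A"
    by (rule quotient_lift_lin[OF VR sub alg_hom_lin[OF f] alg_vspace[OF A] ker])
  show "the_elem (f ` \<one>\<^bsub>quotient_module R I\<^esub>) = \<one>\<^bsub>A\<^esub>"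
    using te[of "\<one>\<^bsub>R\<^esub>"] by (simp add: quotient_one[OF VR sub] R alg_hom_one[OF f])
  fix X Y assume "X \<in> carrier (quotient_module R I)" "Y \<in> carrier (quotient_module R I)"
  then obtain x y where "x \<in> carrier R" "X = I +>\<^bsub>R\<^esub> x" "y \<in> carrier R" "Y = I +>\<^bsub>R\<^esub> y"
    by (auto simp: quotient_carrier[OF VR sub])
  then show "the_elem (f ` (X \<otimes>\<^bsub>quotient_module R I\<^esub> Y)) = the_elem (f ` X) \<otimes>\<^bsub>A\<^esub> the_elem (f ` Y)"
    using R by (simp add: quotient_mult te alg_hom_mult[OF f])
qed

end

lemma ideal_kernel:
  assumes R: "assoc_algebra R" and A: "assoc_algebra A" and f: "f \<in> algebra_hom R A"
  shows "ideal {x \<in> carrier R. f x = \<zero>\<^bsub>A\<^esub>} R"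
proof (rule idealI)
  show "ring R" using R unfolding assoc_algebra_def by blast
  show "subgroup {x \<in> carrier R. f x = \<zero>\<^bsub>A\<^esub>} (add_monoid R)"
    by (rule submodule.axioms(1)[OF submodule_kernel[OF alg_hom_lin[OF f] alg_vspace[OF R] alg_vspace[OF A]]])
qed (simp_all add: R A alg_hom_mult[OF f] alg_hom_closed[OF f])

section \<open>Evaluation homomorphisms on free algebras\<close>

lemma const_mult: "const c * p = Poly_Mapping.map ((*) c) p"
  by (simp add: const_def mult_map_scale_conv_mult)

lemma const_comm: "p * const c = const c * p" for p :: "'g word \<Rightarrow>\<^sub>0 'k::field"
  by (induct p rule: poly_mapping_add_induct)
     (simp_all add: const_def algebra_simps mult_single)

lemma free_algebra_mem: "p \<in> carrier (free_algebra X) \<longleftrightarrow> p \<in> carrier (free_module {w. set (letters w) \<subseteq> X})"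
  by (auto simp: free_algebra_def free_module_mem)

lemma free_algebra_simps [simp]:
  "mult (free_algebra X) = (*)" "one (free_algebra X) = 1" "zero (free_algebra X) = 0"
  "add (free_algebra X) = (+)" "smult (free_algebra X) = (\<lambda>c. Poly_Mapping.map ((*) c))"
  by (simp_all add: free_algebra_def)

lemma letters_simps [simp]: "letters 0 = []" "letters (u + v) = letters u @ letters v"
  by (simp_all add: zero_word_def plus_word_def)

lemma free_algebra_closed [simp]:
  fixes p :: "'g word \<Rightarrow>\<^sub>0 'k::field"
  assumes p: "p \<in> carrier (free_algebra X)"
  shows "q \<in> carrier (free_algebra X) \<Longrightarrow> p + q \<in> carrier (free_algebra X)"
    "q \<in> carrier (free_algebra X) \<Longrightarrow> p - q \<in> carrier (free_algebra X)"
    "q \<in> carrier (free_algebra X) \<Longrightarrow> p * q \<in> carrier (free_algebra X)"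
    "const c * p \<in> carrier (free_algebra X)"
proof -
  show "p * q \<in> carrier (free_algebra X)" if "q \<in> carrier (free_algebra X)"
    using p that Poly_Mapping.keys_mult[of p q]
    by (fastforce simp: free_algebra_mem free_module_mem)
qed (use p in \<open>simp_all add: free_algebra_mem const_mult\<close>)

lemma free_algebra_one [simp]: "1 \<in> carrier (free_algebra X)"
  by (simp add: free_algebra_def)

lemma free_algebra_var [simp]: "g \<in> X \<Longrightarrow> var g \<in> carrier (free_algebra X)"
  by (simp add: free_algebra_mem var_def)

lemma vspace_free_algebra [simp]: "vspace (free_algebra X :: ('k::field, 'g word \<Rightarrow>\<^sub>0 'k) module)"
  by (rule vspace_cong[OF vspace_free[of "{w. set (letters w) \<subseteq> X}"]]) (auto simp: free_algebra_mem)

lemma assoc_algebra_free [simp]: "assoc_algebra (free_algebra X :: ('k::field, 'g word \<Rightarrow>\<^sub>0 'k) module)"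
  by (rule assoc_algebraI)
     (auto intro!: bilinI linI simp: algebra_simps simp flip: const_mult const_comm)

context
  fixes A :: "('k::field, 'a, 'm) module_scheme" and \<phi> :: "'g \<Rightarrow> 'a" and X
  assumes A: "assoc_algebra A" and \<phi>: "\<And>g. g \<in> X \<Longrightarrow> \<phi> g \<in> carrier A"
begin

private abbreviation "val \<equiv> \<lambda>w. foldr (\<lambda>g x. \<phi> g \<otimes>\<^bsub>A\<^esub> x) (letters w) \<one>\<^bsub>A\<^esub>"

private lemma val_closed: "set (letters w) \<subseteq> X \<Longrightarrow> val w \<in> carrier A"
proof (cases w)
  case (Word gs)
  show "set (letters w) \<subseteq> X \<Longrightarrow> val w \<in> carrier A" unfolding Word
    by (induct gs) (auto simp: A \<phi>)
qed

private lemma val_add: "set (letters u) \<subseteq> X \<Longrightarrow> set (letters v) \<subseteq> X \<Longrightarrow> val (u + v) = val u \<otimes>\<^bsub>A\<^esub> val v"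
proof (cases u)
  case (Word gs)
  assume v: "set (letters v) \<subseteq> X"
  have "set gs \<subseteq> X \<Longrightarrow> val (Word gs + v) = val (Word gs) \<otimes>\<^bsub>A\<^esub> val v"
  proof (induct gs)
    case (Cons g gs)
    then show ?case using v val_closed[of "Word gs"] val_closed[OF v] by (simp add: A \<phi> alg_assoc)
  qed (use v val_closed[OF v] in \<open>simp add: A\<close>)
  then show "set (letters u) \<subseteq> X \<Longrightarrow> val (u + v) = val u \<otimes>\<^bsub>A\<^esub> val v" by (simp add: Word)
qed

private lemma VQ: "vspace A" using A by simp

private lemma val_Pi: "val \<in> {w. set (letters w) \<subseteq> X} \<rightarrow> carrier A"
  using val_closed by blast

lemma free_algebra_hom_lin: "free_algebra_hom A \<phi> \<in> linear_maps (free_algebra X) A"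
  using lin_ext_lin[OF VQ val_Pi]
  by (simp add: linear_maps_def Pi_iff free_algebra_mem free_algebra_hom_def lin_ext_def)

private lemma hom_single: "set (letters w) \<subseteq> X \<Longrightarrow>
    free_algebra_hom A \<phi> (Poly_Mapping.single w c) = c \<odot>\<^bsub>A\<^esub> val w"
  using lin_ext_single[of A val w c] val_closed[of w] A
  by (simp add: free_algebra_hom_def lin_ext_def)

lemma free_algebra_hom_hom: "free_algebra_hom A \<phi> \<in> algebra_hom (free_algebra X) A"
proof (rule alg_homI)
  note l = free_algebra_hom_lin
  let ?h = "free_algebra_hom A \<phi>"
  show "?h \<in> linear_maps (free_algebra X) A" by (rule l)
  have one: "Poly_Mapping.single 0 1 = (1 :: 'g word \<Rightarrow>\<^sub>0 'k)" by simp
  show "?h \<one>\<^bsub>free_algebra X\<^esub> = \<one>\<^bsub>A\<^esub>"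
    using hom_single[of 0 1] A by (simp add: one)
  have h_add: "?h (p + q) = ?h p \<oplus>\<^bsub>A\<^esub> ?h q"
    if "p \<in> carrier (free_algebra X)" "q \<in> carrier (free_algebra X)" for p q
    using lin_add[OF l that] by simp
  have h_zero: "?h 0 = \<zero>\<^bsub>A\<^esub>" using lin_zero[OF l] A by simp
  note closed = lin_closed[OF l]
  have single: "Poly_Mapping.single w c \<in> carrier (free_algebra X)" if "set (letters w) \<subseteq> X" for w c
    using that by (simp add: free_algebra_mem)
  have step: "p \<in> carrier (free_algebra X) \<and> set (letters a) \<subseteq> X"
    if "a \<notin> Poly_Mapping.keys p" "b \<noteq> 0" "p + Poly_Mapping.single a b \<in> carrier (free_algebra X)"
    for p a b
    using that by (auto simp: free_algebra_mem free_module_mem keys_add_single)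
  have *: "?h (Poly_Mapping.single u c * q) = ?h (Poly_Mapping.single u c) \<otimes>\<^bsub>A\<^esub> ?h q"
    if "set (letters u) \<subseteq> X" "q \<in> carrier (free_algebra X)" for u c q
    using that(2)
  proof (induct q rule: poly_mapping_add_induct)
    case zero
    then show ?case using that(1) A by (simp add: h_zero closed single)
  next
    case (add q v b)
    have "set (letters (u + v)) \<subseteq> X" using step[OF add(2-4)] that(1) by simp
    then show ?case using step[OF add(2-4)] that(1) A
      by (simp add: algebra_simps add alg_r_distr closed single mult_single h_add
          hom_single val_add val_closed del: letters_simps)
  qed
  show "?h (p \<otimes>\<^bsub>free_algebra X\<^esub> q) = ?h p \<otimes>\<^bsub>A\<^esub> ?h q"
    if "p \<in> carrier (free_algebra X)" and q: "q \<in> carrier (free_algebra X)" for p q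
    using that(1)
  proof (induct p rule: poly_mapping_add_induct)
    case zero
    then show ?case using q A by (simp add: h_zero closed)
  next
    case (add p v b)
    then show ?case using step[OF add(2-4)] q A
      by (simp add: distrib_right alg_l_distr closed single * h_add)
  qed
qed

lemma free_algebra_hom_var: "g \<in> X \<Longrightarrow> free_algebra_hom A \<phi> (var g) = \<phi> g"
  using hom_single[of "Word [g]" 1] A \<phi> by (simp add: var_def)

end

text \<open>Words grow by one letter on the left, as elements of \<open>subalg\<close> do. The zero
  polynomial is 0 times 1 and needs no case of its own.\<close>

lemma free_algebra_induct [consumes 1, case_names one var add scale]:
  assumes "p \<in> carrier (free_algebra X)"
    and one: "P 1"
    and var: "\<And>g q. g \<in> X \<Longrightarrow> q \<in> carrier (free_algebra X) \<Longrightarrow> P q \<Longrightarrow> P (var g * q)"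
    and add: "\<And>p q. p \<in> carrier (free_algebra X) \<Longrightarrow> q \<in> carrier (free_algebra X) \<Longrightarrow> P p \<Longrightarrow> P q \<Longrightarrow> P (p + q)"
    and scale: "\<And>c p. p \<in> carrier (free_algebra X) \<Longrightarrow> P p \<Longrightarrow> P (const c * p)"
  shows "P (p :: 'g word \<Rightarrow>\<^sub>0 'k::field)"
  using assms(1)
proof (induct p rule: poly_mapping_add_induct)
  case zero
  have "const 0 * 1 = (0 :: 'g word \<Rightarrow>\<^sub>0 'k)" by (simp add: const_def)
  then show ?case using scale[OF free_algebra_one one, of 0] by simp
next
  case (add p w b)
  have mem: "p \<in> carrier (free_algebra X)" "set (letters w) \<subseteq> X"
    using add(2-4) by (auto simp: free_algebra_mem free_module_mem keys_add_single)
  obtain gs where w: "w = Word gs" by (cases w)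
  have "set gs \<subseteq> X \<Longrightarrow> Poly_Mapping.single (Word gs) (1::'k) \<in> carrier (free_algebra X) \<and>
      P (Poly_Mapping.single (Word gs) (1::'k))"
  proof (induct gs)
    case Nil
    then show ?case using one by (simp flip: zero_word_def)
  next
    case (Cons g gs)
    have e: "Poly_Mapping.single (Word (g # gs)) (1::'k) = var g * Poly_Mapping.single (Word gs) 1"
      by (simp add: var_def mult_single plus_word_def)
    show ?case unfolding e using Cons var[of g] by simp
  qed
  moreover have "Poly_Mapping.single w b = const b * Poly_Mapping.single (Word gs) 1"
    by (simp add: const_def mult_single w)
  ultimately show ?case using mem w add(1) assms(4)[OF mem(1)] scale by simp
qed

section \<open>Representations of the quantum affine algebra\<close>

lemma rr_nonzero [simp]: "rr \<noteq> 0" and ss_nonzero [simp]: "ss \<noteq> 0"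
proof -
  have "sqrt_r \<noteq> 0" "sqrt_s \<noteq> 0"
    by (simp_all add: sqrt_r_def sqrt_s_def Zero_fract_def eq_fract)
  then show "rr \<noteq> 0" "ss \<noteq> 0" by (simp_all add: rr_def ss_def)
qed

lemma weight_nonzero [simp]: "x \<noteq> 0 \<Longrightarrow> y \<noteq> 0 \<Longrightarrow> weight n x y j i \<noteq> 0"
  by (simp add: weight_def power_int_def)

text \<open>The eigenvalue of e_i under conjugation by any group-like generator. It merges the eight
  action relations and the centrality of the square roots, which have weight 1, into one exchange
  rule for the e_i and one for the f_i.\<close>

fun wt :: "nat \<Rightarrow> grouplike \<Rightarrow> nat \<Rightarrow> K" where
  "wt n (Omega j) i = weight n rr ss j i"
| "wt n (Omega' j) i = weight n ss rr j i"
| "wt n SqrtGamma i = 1"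
| "wt n SqrtGamma' i = 1"
| "wt n Deg i = (if i = 0 then rr else 1)"
| "wt n Deg' i = (if i = 0 then ss else 1)"

lemma wt_nonzero [simp]: "wt n t i \<noteq> 0"
  by (cases t) simp_all

definition grouplikes :: "nat \<Rightarrow> grouplike set" where
  "grouplikes n = grouplikes_B n \<union> grouplikes_B' n"

text \<open>The iterated q-commutator [x, [x, y]_a]_b with [x, z]_b = xz - b zx, expanded; it is
  symmetric in a and b. Products are nested to the right, the normal form of
  \<open>alg_assoc\<close>.\<close>

definition serre :: "('k::field, 'a, 'm) module_scheme \<Rightarrow> 'k \<Rightarrow> 'k \<Rightarrow> 'a \<Rightarrow> 'a \<Rightarrow> 'a" where
  "serre A a b x y = x \<otimes>\<^bsub>A\<^esub> (x \<otimes>\<^bsub>A\<^esub> y) \<oplus>\<^bsub>A\<^esub> (- (a + b)) \<odot>\<^bsub>A\<^esub> (x \<otimes>\<^bsub>A\<^esub> (y \<otimes>\<^bsub>A\<^esub> x))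
     \<oplus>\<^bsub>A\<^esub> (a * b) \<odot>\<^bsub>A\<^esub> (y \<otimes>\<^bsub>A\<^esub> (x \<otimes>\<^bsub>A\<^esub> x))"

text \<open>
  The relations (A6) and (A7) of degree one in \<open>e\<^sub>i\<close> and \<open>f\<^sub>i\<close> are the others read in the
  opposite algebra.
\<close>

locale U_rep =
  fixes A :: "(K, 'a) module" (structure) and n :: nat and \<phi> :: "generator \<Rightarrow> 'a"
  assumes alg: "assoc_algebra A"
    and closed: "g \<in> gens n \<Longrightarrow> \<phi> g \<in> carrier A"
    and Grp_Inv: "t \<in> grouplikes n \<Longrightarrow> \<phi> (Grp t) \<otimes> \<phi> (Inv t) = \<one>"
    and Inv_Grp: "t \<in> grouplikes n \<Longrightarrow> \<phi> (Inv t) \<otimes> \<phi> (Grp t) = \<one>"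
    and Grp_comm: "t \<in> grouplikes n \<Longrightarrow> u \<in> grouplikes n \<Longrightarrow> \<phi> (Grp t) \<otimes> \<phi> (Grp u) = \<phi> (Grp u) \<otimes> \<phi> (Grp t)"
    and gamma: "\<phi> (Grp SqrtGamma) \<otimes> \<phi> (Grp SqrtGamma) =
      foldr (\<lambda>i x. \<phi> (Grp (Omega i)) \<otimes> x) [0..<n] \<one>"
    and gamma': "\<phi> (Grp SqrtGamma') \<otimes> \<phi> (Grp SqrtGamma') =
      foldr (\<lambda>i x. \<phi> (Grp (Omega' i)) \<otimes> x) [0..<n] \<one>"
    and Grp_E: "t \<in> grouplikes n \<Longrightarrow> i < n \<Longrightarrow>
      \<phi> (Grp t) \<otimes> \<phi> (GenE i) = wt n t i \<odot> (\<phi> (GenE i) \<otimes> \<phi> (Grp t))"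
    and Grp_F: "t \<in> grouplikes n \<Longrightarrow> i < n \<Longrightarrow>
      \<phi> (Grp t) \<otimes> \<phi> (GenF i) = inverse (wt n t i) \<odot> (\<phi> (GenF i) \<otimes> \<phi> (Grp t))"
    and E_F: "i < n \<Longrightarrow> j < n \<Longrightarrow> \<phi> (GenE i) \<otimes> \<phi> (GenF j) = \<phi> (GenF j) \<otimes> \<phi> (GenE i) \<oplus>
      ((if i = j then 1 else 0) / (rr - ss)) \<odot> (\<phi> (Grp (Omega i)) \<oplus> (- 1) \<odot> \<phi> (Grp (Omega' i)))"
    and E_E: "i < n \<Longrightarrow> j < n \<Longrightarrow> (i, j) \<notin> {(0, n - 1), (n - 1, 0)} \<Longrightarrow>
      inner_prod n (alpha n i) (alpha n j) = 0 \<Longrightarrow>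
      \<phi> (GenE i) \<otimes> \<phi> (GenE j) = \<phi> (GenE j) \<otimes> \<phi> (GenE i)"
    and F_F: "i < n \<Longrightarrow> j < n \<Longrightarrow> (i, j) \<notin> {(0, n - 1), (n - 1, 0)} \<Longrightarrow>
      inner_prod n (alpha n i) (alpha n j) = 0 \<Longrightarrow>
      \<phi> (GenF i) \<otimes> \<phi> (GenF j) = \<phi> (GenF j) \<otimes> \<phi> (GenF i)"
    and Serre_E1: "i < n \<Longrightarrow> j = Suc i mod n \<Longrightarrow> serre A rr ss (\<phi> (GenE i)) (\<phi> (GenE j)) = \<zero>"
    and Serre_E2: "i < n \<Longrightarrow> j = Suc i mod n \<Longrightarrow> serre (opposite A) rr ss (\<phi> (GenE j)) (\<phi> (GenE i)) = \<zero>"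
    and Serre_F1: "i < n \<Longrightarrow> j = Suc i mod n \<Longrightarrow>
      serre A (inverse rr) (inverse ss) (\<phi> (GenF i)) (\<phi> (GenF j)) = \<zero>"
    and Serre_F2: "i < n \<Longrightarrow> j = Suc i mod n \<Longrightarrow>
      serre (opposite A) (inverse rr) (inverse ss) (\<phi> (GenF j)) (\<phi> (GenF i)) = \<zero>"

lemma gens_simps [simp]:
  "GenE i \<in> gens n \<longleftrightarrow> i < n" "GenF i \<in> gens n \<longleftrightarrow> i < n"
  "Grp t \<in> gens n \<longleftrightarrow> t \<in> grouplikes n" "Inv t \<in> gens n \<longleftrightarrow> t \<in> grouplikes n"
  by (auto simp: gens_def gens_B_def gens_B'_def grouplikes_def)

lemma grouplikes_simps [simp]:
  "Omega i \<in> grouplikes n \<longleftrightarrow> i < n" "Omega' i \<in> grouplikes n \<longleftrightarrow> i < n"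
  "SqrtGamma \<in> grouplikes n" "SqrtGamma' \<in> grouplikes n" "Deg \<in> grouplikes n" "Deg' \<in> grouplikes n"
  by (auto simp: grouplikes_def grouplikes_B_def grouplikes_B'_def)

lemma gens_cases [consumes 1, case_names E F Grp Inv]:
  assumes "g \<in> gens n"
  obtains i where "i < n" "g = GenE i" | i where "i < n" "g = GenF i"
  | t where "t \<in> grouplikes n" "g = Grp t" | t where "t \<in> grouplikes n" "g = Inv t"
  using assms by (cases g) auto

lemma vs_eq_iff_sub: "vspace M \<Longrightarrow> x \<in> carrier M \<Longrightarrow> y \<in> carrier M \<Longrightarrow>
    x \<oplus>\<^bsub>M\<^esub> (- 1) \<odot>\<^bsub>M\<^esub> y = \<zero>\<^bsub>M\<^esub> \<longleftrightarrow> x = y"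
  using vs_eq_iff_minus[of M x y] by (simp add: vs_minus_eq)

text \<open>Multiply kx = c xk by l from both sides.\<close>

lemma inverse_q_commute:
  assumes A: "assoc_algebra A" and [simp]: "k \<in> carrier A" "l \<in> carrier A" "x \<in> carrier A"
    and kl: "k \<otimes>\<^bsub>A\<^esub> l = \<one>\<^bsub>A\<^esub>" "l \<otimes>\<^bsub>A\<^esub> k = \<one>\<^bsub>A\<^esub>"
    and c: "c \<noteq> 0" and kx: "k \<otimes>\<^bsub>A\<^esub> x = c \<odot>\<^bsub>A\<^esub> (x \<otimes>\<^bsub>A\<^esub> k)"
  shows "l \<otimes>\<^bsub>A\<^esub> x = inverse c \<odot>\<^bsub>A\<^esub> (x \<otimes>\<^bsub>A\<^esub> l)"
proof -
  have "x \<otimes>\<^bsub>A\<^esub> l = l \<otimes>\<^bsub>A\<^esub> (k \<otimes>\<^bsub>A\<^esub> x) \<otimes>\<^bsub>A\<^esub> l"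
    using A by (simp flip: alg_assoc add: kl)
  also have "\<dots> = c \<odot>\<^bsub>A\<^esub> (l \<otimes>\<^bsub>A\<^esub> x)"
    unfolding kx using A by (simp add: alg_assoc kl)
  finally have "x \<otimes>\<^bsub>A\<^esub> l = c \<odot>\<^bsub>A\<^esub> (l \<otimes>\<^bsub>A\<^esub> x)" .
  then show ?thesis using A c by simp
qed

context U_rep
begin

lemma simps [simp]:
  "assoc_algebra A" "vspace A" "g \<in> gens n \<Longrightarrow> \<phi> g \<in> carrier A"
  "t \<in> grouplikes n \<Longrightarrow> \<phi> (Grp t) \<otimes> \<phi> (Inv t) = \<one>"
  "t \<in> grouplikes n \<Longrightarrow> \<phi> (Inv t) \<otimes> \<phi> (Grp t) = \<one>"
  by (simp_all add: alg closed Grp_Inv Inv_Grp)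

lemma Inv_E: "t \<in> grouplikes n \<Longrightarrow> i < n \<Longrightarrow>
      \<phi> (Inv t) \<otimes> \<phi> (GenE i) = inverse (wt n t i) \<odot> (\<phi> (GenE i) \<otimes> \<phi> (Inv t))"
  using inverse_q_commute[OF alg _ _ _ _ _ _ Grp_E[of t i], of "\<phi> (Inv t)"] by simp

lemma Inv_F: "t \<in> grouplikes n \<Longrightarrow> i < n \<Longrightarrow>
      \<phi> (Inv t) \<otimes> \<phi> (GenF i) = wt n t i \<odot> (\<phi> (GenF i) \<otimes> \<phi> (Inv t))"
  using inverse_q_commute[OF alg _ _ _ _ _ _ Grp_F[of t i], of "\<phi> (Inv t)"] by simp

lemma Inv_comm: "t \<in> grouplikes n \<Longrightarrow> u \<in> grouplikes n \<Longrightarrow>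
    x \<in> {Grp t, Inv t} \<Longrightarrow> y \<in> {Grp u, Inv u} \<Longrightarrow> \<phi> x \<otimes> \<phi> y = \<phi> y \<otimes> \<phi> x"
proof -
  have inv: "\<phi> (Inv t) \<otimes> z = z \<otimes> \<phi> (Inv t)"
    if "\<phi> (Grp t) \<otimes> z = z \<otimes> \<phi> (Grp t)" "t \<in> grouplikes n" "z \<in> carrier A" for t z
    using inverse_q_commute[OF alg, of "\<phi> (Grp t)" "\<phi> (Inv t)" z 1] that by simp
  assume "t \<in> grouplikes n" "u \<in> grouplikes n" "x \<in> {Grp t, Inv t}" "y \<in> {Grp u, Inv u}"
  then show ?thesis
    using Grp_comm[of t u] inv[of t "\<phi> (Grp u)"] inv[of u "\<phi> (Grp t)"] inv[of t "\<phi> (Inv u)"] by auto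
qed

end

lemma relations_closed: "n > 0 \<Longrightarrow> relations n \<subseteq> carrier (free_algebra (gens n))"
proof
  fix p assume "n > 0" "p \<in> relations n"
  have pl: "prod_list (map (\<lambda>i. var (Grp (f i))) xs) \<in> carrier (free_algebra (gens n))"
    if "\<And>i. i \<in> set xs \<Longrightarrow> f i \<in> grouplikes n" for f :: "nat \<Rightarrow> grouplike" and xs
    using that by (induct xs) auto
  from \<open>p \<in> relations n\<close> show "p \<in> carrier (free_algebra (gens n))"
    using \<open>n > 0\<close>
    by cases (auto intro!: free_algebra_closed pl simp: commutator_def power2_eq_square
        simp flip: grouplikes_def)
qed

context
  fixes A :: "(K, 'a) module" and n \<phi>
  assumes A: "assoc_algebra A" and n: "n > 0" and \<phi>: "\<And>g. g \<in> gens n \<Longrightarrow> \<phi> g \<in> carrier A"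
begin

private abbreviation "FA \<equiv> free_algebra (gens n) :: (K, generator word \<Rightarrow>\<^sub>0 K) module"
private abbreviation "h \<equiv> free_algebra_hom A \<phi>"

private lemma h_hom: "h \<in> algebra_hom FA A" by (rule free_algebra_hom_hom[OF A \<phi>])

private lemma h_simps [simp]:
  "g \<in> gens n \<Longrightarrow> h (var g) = \<phi> g"
  "p \<in> carrier FA \<Longrightarrow> q \<in> carrier FA \<Longrightarrow> h (p * q) = h p \<otimes>\<^bsub>A\<^esub> h q"
  "p \<in> carrier FA \<Longrightarrow> q \<in> carrier FA \<Longrightarrow> h (p + q) = h p \<oplus>\<^bsub>A\<^esub> h q"
  "p \<in> carrier FA \<Longrightarrow> q \<in> carrier FA \<Longrightarrow> h (p - q) = h p \<oplus>\<^bsub>A\<^esub> (- 1) \<odot>\<^bsub>A\<^esub> h q"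
  "h 1 = \<one>\<^bsub>A\<^esub>"
  "p \<in> carrier FA \<Longrightarrow> h (const c * p) = c \<odot>\<^bsub>A\<^esub> h p"
  "p \<in> carrier FA \<Longrightarrow> h p \<in> carrier A"
proof -
  note l = alg_hom_lin[OF h_hom]
  show "g \<in> gens n \<Longrightarrow> h (var g) = \<phi> g" by (rule free_algebra_hom_var[OF A \<phi>])
  show "p \<in> carrier FA \<Longrightarrow> q \<in> carrier FA \<Longrightarrow> h (p * q) = h p \<otimes>\<^bsub>A\<^esub> h q"
    using alg_hom_mult[OF h_hom] by simp
  show "p \<in> carrier FA \<Longrightarrow> q \<in> carrier FA \<Longrightarrow> h (p + q) = h p \<oplus>\<^bsub>A\<^esub> h q" using lin_add[OF l] by simp
  show "p \<in> carrier FA \<Longrightarrow> q \<in> carrier FA \<Longrightarrow> h (p - q) = h p \<oplus>\<^bsub>A\<^esub> (- 1) \<odot>\<^bsub>A\<^esub> h q"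
    using lin_add[OF l, of p "const (- 1) * q"] lin_smult[OF l, of q "- 1"] free_algebra_closed(4)[of q _ "- 1"]
    by (simp add: minus_eq_scale const_mult)
  show "h 1 = \<one>\<^bsub>A\<^esub>" using alg_hom_one[OF h_hom] by simp
  show "p \<in> carrier FA \<Longrightarrow> h (const c * p) = c \<odot>\<^bsub>A\<^esub> h p"
    using lin_smult[OF l] by (simp add: const_mult)
  show "p \<in> carrier FA \<Longrightarrow> h p \<in> carrier A" by (rule lin_closed[OF l])
qed

private lemma h_prod_list: "(\<And>i. i \<in> set xs \<Longrightarrow> f i \<in> grouplikes n) \<Longrightarrow>
    prod_list (map (\<lambda>i. var (Grp (f i))) xs) \<in> carrier FA \<and>
    h (prod_list (map (\<lambda>i. var (Grp (f i))) xs)) = foldr (\<lambda>i x. \<phi> (Grp (f i)) \<otimes>\<^bsub>A\<^esub> x) xs \<one>\<^bsub>A\<^esub>"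
  by (induct xs) auto

private lemma h_Omega [simp]:
  "prod_list (map (\<lambda>i. var (Grp (Omega i))) [0..<n]) \<in> carrier FA"
  "h (prod_list (map (\<lambda>i. var (Grp (Omega i))) [0..<n])) = foldr (\<lambda>i x. \<phi> (Grp (Omega i)) \<otimes>\<^bsub>A\<^esub> x) [0..<n] \<one>\<^bsub>A\<^esub>"
  "prod_list (map (\<lambda>i. var (Grp (Omega' i))) [0..<n]) \<in> carrier FA"
  "h (prod_list (map (\<lambda>i. var (Grp (Omega' i))) [0..<n])) = foldr (\<lambda>i x. \<phi> (Grp (Omega' i)) \<otimes>\<^bsub>A\<^esub> x) [0..<n] \<one>\<^bsub>A\<^esub>"
  using h_prod_list[of "[0..<n]" Omega] h_prod_list[of "[0..<n]" Omega'] by simp_all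

private lemma foldr_closed [simp]:
  "foldr (\<lambda>i x. \<phi> (Grp (Omega i)) \<otimes>\<^bsub>A\<^esub> x) [0..<n] \<one>\<^bsub>A\<^esub> \<in> carrier A"
  "foldr (\<lambda>i x. \<phi> (Grp (Omega' i)) \<otimes>\<^bsub>A\<^esub> x) [0..<n] \<one>\<^bsub>A\<^esub> \<in> carrier A"
  using h_simps(7)[OF h_Omega(1)] h_simps(7)[OF h_Omega(3)] by simp_all

private lemmas eqs = vs_eq_iff_sub[OF alg_vspace[OF A]]

text \<open>The defining relations conjugate by a group-like element, \<open>U_rep\<close> exchanges
  two factors. For invertible group-likes the two forms are equivalent, by multiplying with
  \<open>Grp t\<close> or \<open>Inv t\<close> from the right.\<close>

private lemma conj_rel:
  assumes t: "t \<in> grouplikes n" and y: "y \<in> gens n"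
    and inv: "\<phi> (Grp t) \<otimes>\<^bsub>A\<^esub> \<phi> (Inv t) = \<one>\<^bsub>A\<^esub>" "\<phi> (Inv t) \<otimes>\<^bsub>A\<^esub> \<phi> (Grp t) = \<one>\<^bsub>A\<^esub>"
  shows "h (var (Grp t) * var y * var (Inv t) - const c * var y) = \<zero>\<^bsub>A\<^esub> \<longleftrightarrow>
    \<phi> (Grp t) \<otimes>\<^bsub>A\<^esub> \<phi> y = c \<odot>\<^bsub>A\<^esub> (\<phi> y \<otimes>\<^bsub>A\<^esub> \<phi> (Grp t))"
proof -
  have cl: "var (Grp t) * var y * var (Inv t) \<in> carrier FA" "const c * var y \<in> carrier FA"
    using t y by simp_all
  have "h (var (Grp t) * var y * var (Inv t) - const c * var y) = \<zero>\<^bsub>A\<^esub> \<longleftrightarrow>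
      \<phi> (Grp t) \<otimes>\<^bsub>A\<^esub> \<phi> y \<otimes>\<^bsub>A\<^esub> \<phi> (Inv t) = c \<odot>\<^bsub>A\<^esub> \<phi> y"
    unfolding h_simps(4)[OF cl] eqs[OF h_simps(7)[OF cl(1)] h_simps(7)[OF cl(2)]]
    using t y by simp
  also have "\<dots> \<longleftrightarrow> \<phi> (Grp t) \<otimes>\<^bsub>A\<^esub> \<phi> y = c \<odot>\<^bsub>A\<^esub> (\<phi> y \<otimes>\<^bsub>A\<^esub> \<phi> (Grp t))"
  proof
    assume "\<phi> (Grp t) \<otimes>\<^bsub>A\<^esub> \<phi> y \<otimes>\<^bsub>A\<^esub> \<phi> (Inv t) = c \<odot>\<^bsub>A\<^esub> \<phi> y"
    from arg_cong[OF this, of "\<lambda>y. y \<otimes>\<^bsub>A\<^esub> \<phi> (Grp t)"]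
    show "\<phi> (Grp t) \<otimes>\<^bsub>A\<^esub> \<phi> y = c \<odot>\<^bsub>A\<^esub> (\<phi> y \<otimes>\<^bsub>A\<^esub> \<phi> (Grp t))"
      using assms A \<phi> by (simp add: alg_assoc)
  qed (use assms A \<phi> in \<open>simp add: alg_assoc\<close>)
  finally show ?thesis .
qed

text \<open>With \<open>U_repI\<close> this makes \<open>U_rep\<close> equivalent to the vanishing
  of all defining relations. This direction yields maps out of U; the converse yields the relations
  of U itself in a form fit for rewriting.\<close>

lemma U_rep_relation:
  assumes "U_rep A n \<phi>" "p \<in> relations n"
  shows "free_algebra_hom A \<phi> p = \<zero>\<^bsub>A\<^esub>"
proof -
  interpret U_rep A n \<phi> by (rule assms)
  have mod [simp]: "Suc i mod n < n" for i using n by simp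
  from assms(2) show ?thesis
  proof cases
    case (central t x y)
    \<comment> \<open>The square roots have weight 1, so their centrality is a case of the exchange
      rules.\<close>
    have t: "t \<in> grouplikes n" "wt n t i = 1" for i using central by auto
    have "\<phi> x \<otimes>\<^bsub>A\<^esub> \<phi> y = \<phi> y \<otimes>\<^bsub>A\<^esub> \<phi> x"
      using central(4)
    proof (cases rule: gens_cases)
      case (E i) then show ?thesis using central(3) t Grp_E[of t i] Inv_E[of t i] by auto
    next
      case (F i) then show ?thesis using central(3) t Grp_F[of t i] Inv_F[of t i] by auto
    next
      case (Grp u) then show ?thesis using central(3) t Inv_comm[of t u x y] by auto
    next
      case (Inv u) then show ?thesis using central(3) t Inv_comm[of t u x y] by auto
    qed
    moreover have "x \<in> gens n" using central(3) t by auto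
    ultimately show ?thesis using central by (simp add: commutator_def eqs)
  next
    case (commute t u x y)
    moreover have "t \<in> grouplikes n" "u \<in> grouplikes n" "x \<in> gens n" "y \<in> gens n"
      using commute by (auto simp flip: grouplikes_def)
    ultimately show ?thesis using Inv_comm[of t u x y] by (simp add: commutator_def eqs)
  next
    case (Deg_E i)
    then show ?thesis
      using Grp_E[of Deg i] conj_rel[of Deg "GenE i" "wt n Deg i"]
      by (simp del: h_simps split: if_splits)
  next
    case (Deg_F i)
    then show ?thesis
      using Grp_F[of Deg i] conj_rel[of Deg "GenF i" "inverse (wt n Deg i)"]
      by (simp del: h_simps split: if_splits)
  next
    case (Deg'_E i)
    then show ?thesis
      using Grp_E[of Deg' i] conj_rel[of Deg' "GenE i" "wt n Deg' i"]
      by (simp del: h_simps split: if_splits)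
  next
    case (Deg'_F i)
    then show ?thesis
      using Grp_F[of Deg' i] conj_rel[of Deg' "GenF i" "inverse (wt n Deg' i)"]
      by (simp del: h_simps split: if_splits)
  next
    case (Omega_E i j)
    then show ?thesis
      using Grp_E[of "Omega j" i] conj_rel[of "Omega j" "GenE i" "wt n (Omega j) i"]
      by (simp del: h_simps split: if_splits)
  next
    case (Omega_F i j)
    then show ?thesis
      using Grp_F[of "Omega j" i] conj_rel[of "Omega j" "GenF i" "inverse (wt n (Omega j) i)"]
      by (simp del: h_simps split: if_splits)
  next
    case (Omega'_E i j)
    then show ?thesis
      using Grp_E[of "Omega' j" i] conj_rel[of "Omega' j" "GenE i" "wt n (Omega' j) i"]
      by (simp del: h_simps split: if_splits)
  next
    case (Omega'_F i j)
    then show ?thesis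
      using Grp_F[of "Omega' j" i] conj_rel[of "Omega' j" "GenF i" "inverse (wt n (Omega' j) i)"]
      by (simp del: h_simps split: if_splits)
  next
    case (E_F i j)
    define z where "z = ((if i = j then 1 else 0) / (rr - ss)) \<odot>\<^bsub>A\<^esub> (\<phi> (Grp (Omega i)) \<oplus>\<^bsub>A\<^esub> (- 1) \<odot>\<^bsub>A\<^esub> \<phi> (Grp (Omega' i)))"
    have z: "z \<in> carrier A" using E_F by (simp add: z_def)
    have "\<phi> (GenE i) \<otimes>\<^bsub>A\<^esub> \<phi> (GenF j) = \<phi> (GenF j) \<otimes>\<^bsub>A\<^esub> \<phi> (GenE i) \<oplus>\<^bsub>A\<^esub> z"
      using U_rep.E_F[OF assms(1)] E_F(2,3) by (simp add: z_def)
    moreover have "(y \<oplus>\<^bsub>A\<^esub> z) \<oplus>\<^bsub>A\<^esub> (- 1) \<odot>\<^bsub>A\<^esub> y = z" if "y \<in> carrier A" for y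
    proof -
      have "(y \<oplus>\<^bsub>A\<^esub> z) \<oplus>\<^bsub>A\<^esub> (- 1) \<odot>\<^bsub>A\<^esub> y = z \<oplus>\<^bsub>A\<^esub> (y \<oplus>\<^bsub>A\<^esub> (- 1) \<odot>\<^bsub>A\<^esub> y)"
        using z that by (simp add: vs_assoc vs_lcomm[of A z])
      then show ?thesis using that z by (simp add: eqs[THEN iffD2])
    qed
    ultimately show ?thesis using E_F z
      by (simp add: commutator_def eqs flip: z_def)
  next
    case (Serre_E1 i j)
    then show ?thesis using U_rep.Serre_E1[OF assms(1) Serre_E1(2,3)]
      by (simp add: power2_eq_square serre_def alg_assoc)
  next
    case (Serre_E2 i j)
    then show ?thesis using U_rep.Serre_E2[OF assms(1) Serre_E2(2,3)]
      by (simp add: power2_eq_square serre_def alg_assoc)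
  next
    case (Serre_F1 i j)
    then show ?thesis using U_rep.Serre_F1[OF assms(1) Serre_F1(2,3)]
      by (simp add: power2_eq_square serre_def alg_assoc)
  next
    case (Serre_F2 i j)
    then show ?thesis using U_rep.Serre_F2[OF assms(1) Serre_F2(2,3)]
      by (simp add: power2_eq_square serre_def alg_assoc)
  next
    case (E_E i j)
    then show ?thesis using U_rep.E_E[OF assms(1) E_E(2-5)] by (simp add: commutator_def eqs)
  next
    case (F_F i j)
    then show ?thesis using U_rep.F_F[OF assms(1) F_F(2-5)] by (simp add: commutator_def eqs)
  qed (simp_all add: power2_eq_square commutator_def eqs gamma gamma' flip: grouplikes_def)
qed

lemma U_repI:
  assumes rel: "\<And>p. p \<in> relations n \<Longrightarrow> free_algebra_hom A \<phi> p = \<zero>\<^bsub>A\<^esub>"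
  shows "U_rep A n \<phi>"
proof -
  have mod [simp]: "Suc i mod n < n" for i using n by simp
  have inv: "\<phi> (Grp t) \<otimes>\<^bsub>A\<^esub> \<phi> (Inv t) = \<one>\<^bsub>A\<^esub>" "\<phi> (Inv t) \<otimes>\<^bsub>A\<^esub> \<phi> (Grp t) = \<one>\<^bsub>A\<^esub>"
    if "t \<in> grouplikes n" for t
    using rel[OF relations.right_inverse, of t] rel[OF relations.left_inverse, of t] that A \<phi>
    by (simp_all add: eqs flip: grouplikes_def)
  have comm: "\<phi> (Grp t) \<otimes>\<^bsub>A\<^esub> \<phi> (Grp u) = \<phi> (Grp u) \<otimes>\<^bsub>A\<^esub> \<phi> (Grp t)"
    if "t \<in> grouplikes n" "u \<in> grouplikes n" for t u
    using rel[OF relations.commute, of t u "Grp t" "Grp u"] that A \<phi>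
    by (simp add: eqs commutator_def flip: grouplikes_def)
  have central: "\<phi> (Grp t) \<otimes>\<^bsub>A\<^esub> \<phi> y = \<phi> y \<otimes>\<^bsub>A\<^esub> \<phi> (Grp t)"
    if "t \<in> {SqrtGamma, SqrtGamma'}" "y \<in> gens n" for t y
    using rel[OF relations.central, of t "Grp t" y] that A \<phi> by (auto simp: eqs commutator_def)
  have E: "\<phi> (Grp t) \<otimes>\<^bsub>A\<^esub> \<phi> (GenE i) = wt n t i \<odot>\<^bsub>A\<^esub> (\<phi> (GenE i) \<otimes>\<^bsub>A\<^esub> \<phi> (Grp t))"
    if t: "t \<in> grouplikes n" and i: "i < n" for t i
  proof (cases t)
    case (Omega j)
    then show ?thesis
      using rel[OF relations.Omega_E[OF i, of j]] conj_rel[OF t _ inv[OF t], of "GenE i" "wt n t i"] i t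
      by (simp del: h_simps split: if_splits)
  next
    case (Omega' j)
    then show ?thesis
      using rel[OF relations.Omega'_E[OF i, of j]] conj_rel[OF t _ inv[OF t], of "GenE i" "wt n t i"] i t
      by (simp del: h_simps split: if_splits)
  next
    case Deg
    then show ?thesis
      using rel[OF relations.Deg_E[OF i]] conj_rel[OF t _ inv[OF t], of "GenE i" "wt n t i"] i t
      by (simp del: h_simps split: if_splits)
  next
    case Deg'
    then show ?thesis
      using rel[OF relations.Deg'_E[OF i]] conj_rel[OF t _ inv[OF t], of "GenE i" "wt n t i"] i t
      by (simp del: h_simps split: if_splits)
  qed (use central[of _ "GenE i"] i A \<phi> in simp_all)
  have F: "\<phi> (Grp t) \<otimes>\<^bsub>A\<^esub> \<phi> (GenF i) = inverse (wt n t i) \<odot>\<^bsub>A\<^esub> (\<phi> (GenF i) \<otimes>\<^bsub>A\<^esub> \<phi> (Grp t))"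
    if t: "t \<in> grouplikes n" and i: "i < n" for t i
  proof (cases t)
    case (Omega j)
    then show ?thesis
      using rel[OF relations.Omega_F[OF i, of j]] conj_rel[OF t _ inv[OF t], of "GenF i" "inverse (wt n t i)"] i t
      by (simp del: h_simps split: if_splits)
  next
    case (Omega' j)
    then show ?thesis
      using rel[OF relations.Omega'_F[OF i, of j]] conj_rel[OF t _ inv[OF t], of "GenF i" "inverse (wt n t i)"] i t
      by (simp del: h_simps split: if_splits)
  next
    case Deg
    then show ?thesis
      using rel[OF relations.Deg_F[OF i]] conj_rel[OF t _ inv[OF t], of "GenF i" "inverse (wt n t i)"] i t
      by (simp del: h_simps split: if_splits)
  next
    case Deg'
    then show ?thesis
      using rel[OF relations.Deg'_F[OF i]] conj_rel[OF t _ inv[OF t], of "GenF i" "inverse (wt n t i)"] i t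
      by (simp del: h_simps split: if_splits)
  qed (use central[of _ "GenF i"] i A \<phi> in simp_all)
  have E_F: "\<phi> (GenE i) \<otimes>\<^bsub>A\<^esub> \<phi> (GenF j) = \<phi> (GenF j) \<otimes>\<^bsub>A\<^esub> \<phi> (GenE i) \<oplus>\<^bsub>A\<^esub>
      ((if i = j then 1 else 0) / (rr - ss)) \<odot>\<^bsub>A\<^esub> (\<phi> (Grp (Omega i)) \<oplus>\<^bsub>A\<^esub> (- 1) \<odot>\<^bsub>A\<^esub> \<phi> (Grp (Omega' i)))"
    if "i < n" "j < n" for i j
  proof -
    define x y z where "x = \<phi> (GenE i) \<otimes>\<^bsub>A\<^esub> \<phi> (GenF j)" and "y = \<phi> (GenF j) \<otimes>\<^bsub>A\<^esub> \<phi> (GenE i)"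
      and "z = ((if i = j then 1 else 0) / (rr - ss)) \<odot>\<^bsub>A\<^esub> (\<phi> (Grp (Omega i)) \<oplus>\<^bsub>A\<^esub> (- 1) \<odot>\<^bsub>A\<^esub> \<phi> (Grp (Omega' i)))"
    have xyz: "x \<in> carrier A" "y \<in> carrier A" "z \<in> carrier A"
      using that A \<phi> by (simp_all add: x_def y_def z_def)
    have "x \<oplus>\<^bsub>A\<^esub> (- 1) \<odot>\<^bsub>A\<^esub> y = z"
      using rel[OF relations.E_F, of i j] that A \<phi>
      by (simp add: eqs commutator_def xyz flip: x_def y_def z_def)
    then have "y \<oplus>\<^bsub>A\<^esub> z = x \<oplus>\<^bsub>A\<^esub> (y \<oplus>\<^bsub>A\<^esub> (- 1) \<odot>\<^bsub>A\<^esub> y)"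
      using xyz A by (auto simp: vs_lcomm[of A y x])
    then have "x = y \<oplus>\<^bsub>A\<^esub> z" using xyz A by (simp add: eqs[THEN iffD2])
    then show ?thesis by (simp only: x_def y_def z_def)
  qed
  show ?thesis
  proof (unfold_locales, goal_cases)
    case (6) then show ?case using rel[OF relations.gamma] A \<phi>
      by (simp add: power2_eq_square eqs h_prod_list)
  next
    case (7) then show ?case using rel[OF relations.gamma'] A \<phi>
      by (simp add: power2_eq_square eqs h_prod_list)
  next
    case (11 i j) then show ?case using rel[OF relations.E_E, of i j] A \<phi>
      by (simp add: commutator_def eqs)
  next
    case (12 i j) then show ?case using rel[OF relations.F_F, of i j] A \<phi>
      by (simp add: commutator_def eqs)
  next
    case (13 i j) then show ?case using rel[OF relations.Serre_E1, of i j] A \<phi>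
      by (simp add: power2_eq_square serre_def alg_assoc)
  next
    case (14 i j) then show ?case using rel[OF relations.Serre_E2, of i j] A \<phi>
      by (simp add: power2_eq_square serre_def alg_assoc)
  next
    case (15 i j) then show ?case using rel[OF relations.Serre_F1, of i j] A \<phi>
      by (simp add: power2_eq_square serre_def alg_assoc)
  next
    case (16 i j) then show ?case using rel[OF relations.Serre_F2, of i j] A \<phi>
      by (simp add: power2_eq_square serre_def alg_assoc)
  qed (simp_all add: A \<phi> inv comm E F E_F)
qed

end

text \<open>The kernel of the evaluation is a two-sided ideal that contains the relations, hence
  contains the ideal generated by them.\<close>

lemma U_rep_lift_zero:
  assumes rep: "U_rep A n \<phi>" and n: "n > 0" and p: "p \<in> U_ideal n"
  shows "free_algebra_hom A \<phi> p = \<zero>\<^bsub>A\<^esub>"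
proof -
  interpret U_rep A n \<phi> by (rule rep)
  let ?FA = "free_algebra (gens n) :: (K, generator word \<Rightarrow>\<^sub>0 K) module"
  let ?I = "{p \<in> carrier ?FA. free_algebra_hom A \<phi> p = \<zero>\<^bsub>A\<^esub>}"
  have "ideal ?I ?FA"
    by (rule ideal_kernel[OF assoc_algebra_free alg free_algebra_hom_hom[OF alg closed]])
  moreover have "relations n \<subseteq> ?I"
    using relations_closed[OF n] U_rep_relation[OF alg n closed rep] by blast
  moreover have "ring ?FA"
    using assoc_algebra_free[of "gens n"] unfolding assoc_algebra_def by blast
  ultimately have "U_ideal n \<subseteq> ?I"
    unfolding U_ideal_def by (intro ring.genideal_minimal)
  then show ?thesis using p by blast
qed

section \<open>The algebra \<open>U\<^sub>r\<^sub>,\<^sub>s\<close>\<close>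

text \<open>Products are allowed only with a generator on the left, so that inductions proceed
  letter by letter; closure under all products is \<open>subalg_mult\<close>. No carrier enters, so
  the set is the same for a Hopf algebra and for its restriction to a subspace.\<close>

inductive_set subalg :: "('k::field, 'a, 'm) module_scheme \<Rightarrow> 'a set \<Rightarrow> 'a set" for A S where
  one: "\<one>\<^bsub>A\<^esub> \<in> subalg A S"
| mult: "s \<in> S \<Longrightarrow> x \<in> subalg A S \<Longrightarrow> s \<otimes>\<^bsub>A\<^esub> x \<in> subalg A S"
| add: "x \<in> subalg A S \<Longrightarrow> y \<in> subalg A S \<Longrightarrow> x \<oplus>\<^bsub>A\<^esub> y \<in> subalg A S"
| smult: "x \<in> subalg A S \<Longrightarrow> c \<odot>\<^bsub>A\<^esub> x \<in> subalg A S"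

lemma subalg_closed: "assoc_algebra A \<Longrightarrow> S \<subseteq> carrier A \<Longrightarrow> x \<in> subalg A S \<Longrightarrow> x \<in> carrier A"
  by (erule subalg.induct) auto

lemma subalg_mult:
  assumes A: "assoc_algebra A" "S \<subseteq> carrier A" and "x \<in> subalg A S" "y \<in> subalg A S"
  shows "x \<otimes>\<^bsub>A\<^esub> y \<in> subalg A S"
  using assms(3)
proof induct
  case one then show ?case using assms subalg_closed[OF A assms(4)] by simp
next
  case (mult s x)
  then show ?case
    using A subalg_closed[OF A mult(2)] subalg_closed[OF A assms(4)] subalg.mult[OF mult(1,3)]
    by (auto simp: alg_assoc subset_iff)
next
  case (add u v)
  then show ?case using A subalg_closed[OF A] subalg_closed[OF A assms(4)] subalg.add[OF add(2,4)]
    by (simp add: alg_l_distr)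
next
  case (smult u c)
  then show ?case using A subalg_closed[OF A] subalg_closed[OF A assms(4)] subalg.smult[OF smult(2)]
    by simp
qed

lemma subalg_incl:
  assumes "assoc_algebra A" "S \<subseteq> carrier A" "s \<in> S" shows "s \<in> subalg A S"
proof -
  have "s \<otimes>\<^bsub>A\<^esub> \<one>\<^bsub>A\<^esub> \<in> subalg A S" by (intro subalg.mult subalg.one assms)
  then show ?thesis using assms by (simp add: subset_iff)
qed

lemma subalg_submodule:
  assumes A: "assoc_algebra A" "S \<subseteq> carrier A"
  shows "submodule (subalg A S) scalars A"
proof (rule submoduleI')
  have "0 \<odot>\<^bsub>A\<^esub> \<one>\<^bsub>A\<^esub> \<in> subalg A S" by (intro subalg.smult subalg.one)
  then show "\<zero>\<^bsub>A\<^esub> \<in> subalg A S" using A(1) by simp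
qed (use A subalg_closed[OF A] in \<open>auto intro: subalg.add subalg.smult\<close>)

lemma subalg_min:
  assumes C: "submodule C scalars A" "\<one>\<^bsub>A\<^esub> \<in> C" "S \<subseteq> C"
    "\<And>x y. x \<in> C \<Longrightarrow> y \<in> C \<Longrightarrow> x \<otimes>\<^bsub>A\<^esub> y \<in> C"
  shows "subalg A S \<subseteq> C"
proof
  fix x assume "x \<in> subalg A S"
  then show "x \<in> C" by induct (use C submoduleD[OF C(1)] in auto)
qed

context
  fixes n :: nat assumes n: "n > 0"
begin

private abbreviation "FU \<equiv> free_algebra (gens n) :: (K, generator word \<Rightarrow>\<^sub>0 K) module"

private lemma ring_FU: "ring FU"
  using assoc_algebra_free[of "gens n"] unfolding assoc_algebra_def by blast

lemma U_ideal: "ideal (U_ideal n) FU"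
  unfolding U_ideal_def by (rule ring.genideal_ideal[OF ring_FU relations_closed[OF n]])

text \<open>A ring ideal of the free algebra is a subspace because the scalars lie in the free
  algebra as the elements \<open>const c\<close>.\<close>

lemma U_ideal_submodule: "submodule (U_ideal n) scalars FU"
proof -
  interpret ideal "U_ideal n" FU by (rule U_ideal)
  have sub: "U_ideal n \<subseteq> carrier FU" using a_subset by simp
  show ?thesis
  proof (rule submoduleI'[OF vspace_free_algebra sub])
    show "x \<oplus>\<^bsub>FU\<^esub> y \<in> U_ideal n" if "x \<in> U_ideal n" "y \<in> U_ideal n" for x y
      using that by (rule additive_subgroup.a_closed[OF is_additive_subgroup])
    show "c \<odot>\<^bsub>FU\<^esub> x \<in> U_ideal n" if x: "x \<in> U_ideal n" for c x
    proof -
      have "const c * 1 \<in> carrier FU" by (rule free_algebra_closed(4)[OF free_algebra_one])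
      then have "const c \<in> carrier FU" by simp
      then show ?thesis using I_l_closed[OF x, of "const c"] by (simp add: const_mult)
    qed
    show "\<zero>\<^bsub>FU\<^esub> \<in> U_ideal n" by (rule additive_subgroup.zero_closed[OF is_additive_subgroup])
  qed
qed

lemma assoc_algebra_U: "assoc_algebra (U_algebra n)"
  unfolding U_algebra_def by (rule assoc_algebra_quotient[OF assoc_algebra_free U_ideal U_ideal_submodule])

lemma gen_closed: "g \<in> gens n \<Longrightarrow> gen n g \<in> carrier (U_algebra n)"
  unfolding gen_def U_algebra_def
  by (simp add: quotient_carrier[OF vspace_free_algebra U_ideal_submodule])

private lemma pi_hom: "(\<lambda>p. U_ideal n +>\<^bsub>FU\<^esub> p) \<in> algebra_hom FU (U_algebra n)"
  unfolding U_algebra_def by (rule coset_alg_hom[OF assoc_algebra_free U_ideal U_ideal_submodule])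

lemma U_eq_subalg: "carrier (U_algebra n) = subalg (U_algebra n) (gen n ` gens n)"
proof
  show "subalg (U_algebra n) (gen n ` gens n) \<subseteq> carrier (U_algebra n)"
    using subalg_closed[OF assoc_algebra_U] gen_closed by blast
  show "carrier (U_algebra n) \<subseteq> subalg (U_algebra n) (gen n ` gens n)"
  proof
    fix x assume "x \<in> carrier (U_algebra n)"
    then obtain p where p: "p \<in> carrier FU" "x = U_ideal n +>\<^bsub>FU\<^esub> p"
      unfolding U_algebra_def by (auto simp: quotient_carrier[OF vspace_free_algebra U_ideal_submodule])
    from p(1) have "U_ideal n +>\<^bsub>FU\<^esub> p \<in> subalg (U_algebra n) (gen n ` gens n)"
    proof (induct p rule: free_algebra_induct)
      case one
      show ?case using alg_hom_one[OF pi_hom] by (simp add: subalg.one)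
    next
      case (var g q)
      then show ?case using alg_hom_mult[OF pi_hom, of "var g" q] subalg.mult[OF imageI[OF var(1)] var(3)]
        by (simp add: gen_def)
    next
      case (add p q)
      then show ?case using lin_add[OF alg_hom_lin[OF pi_hom], of p q] subalg.add[OF add(3,4)] by simp
    next
      case (scale c p)
      then show ?case using lin_smult[OF alg_hom_lin[OF pi_hom], of p c] subalg.smult[OF scale(2)]
        by (simp add: const_mult)
    qed
    then show "x \<in> subalg (U_algebra n) (gen n ` gens n)" by (simp add: p)
  qed
qed

text \<open>Both sides are homomorphisms that agree on the letters. It turns the relations among the
  elements \<open>gen n g\<close> into membership in \<open>U_ideal n\<close>.\<close>

lemma free_algebra_hom_gen:
  assumes "p \<in> carrier FU" shows "free_algebra_hom (U_algebra n) (gen n) p = U_ideal n +>\<^bsub>FU\<^esub> p"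
proof -
  have h: "free_algebra_hom (U_algebra n) (gen n) \<in> algebra_hom FU (U_algebra n)"
    by (rule free_algebra_hom_hom[OF assoc_algebra_U gen_closed])
  have hv: "free_algebra_hom (U_algebra n) (gen n) (var g) = gen n g" if "g \<in> gens n" for g
    by (rule free_algebra_hom_var[OF assoc_algebra_U gen_closed that])
  show ?thesis using assms
  proof (induct p rule: free_algebra_induct)
    case one
    show ?case using alg_hom_one[OF pi_hom] alg_hom_one[OF h] by simp
  next
    case (var g q)
    then show ?case using alg_hom_mult[OF pi_hom, of "var g" q] alg_hom_mult[OF h, of "var g" q]
        hv[OF var(1)]
      by (simp add: gen_def[of n g])
  next
    case (add p q)
    then show ?case using lin_add[OF alg_hom_lin[OF pi_hom], of p q] lin_add[OF alg_hom_lin[OF h], of p q]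
      by simp
  next
    case (scale c p)
    then show ?case
      using lin_smult[OF alg_hom_lin[OF pi_hom], of p c] lin_smult[OF alg_hom_lin[OF h], of p c]
      by (simp add: const_mult)
  qed
qed

lemma U_rep_gen: "U_rep (U_algebra n) n (gen n)"
proof (rule U_repI[OF assoc_algebra_U n gen_closed])
  fix p assume p: "p \<in> relations n"
  then have "p \<in> U_ideal n" "p \<in> carrier FU"
    using ring.genideal_self[OF ring_FU relations_closed[OF n]] relations_closed[OF n]
    by (auto simp: U_ideal_def)
  then show "free_algebra_hom (U_algebra n) (gen n) p = \<zero>\<^bsub>U_algebra n\<^esub>"
    by (simp add: free_algebra_hom_gen)
       (simp add: U_algebra_def coset_eq_zero_iff[OF vspace_free_algebra U_ideal_submodule])
qed

text \<open>The universal property of U, stated for the same \<open>the_elem\<close> expression that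
  defines the structure maps of \<open>U_rs\<close>.\<close>

lemma U_lift_hom:
  assumes rep: "U_rep A n \<phi>"
  shows "(\<lambda>X. the_elem (free_algebra_hom A \<phi> ` X)) \<in> algebra_hom (U_algebra n) A"
  unfolding U_algebra_def
  by (rule quotient_lift_alg_hom[OF assoc_algebra_free U_ideal U_ideal_submodule U_rep.alg[OF rep]
        free_algebra_hom_hom[OF U_rep.alg[OF rep] U_rep.closed[OF rep]] U_rep_lift_zero[OF rep n]])

lemma U_lift_gen:
  assumes rep: "U_rep A n \<phi>" and g: "g \<in> gens n"
  shows "the_elem (free_algebra_hom A \<phi> ` gen n g) = \<phi> g"
  unfolding gen_def
  by (subst the_elem_coset[OF vspace_free_algebra U_ideal_submodule
        free_algebra_hom_lin[OF U_rep.alg[OF rep] U_rep.closed[OF rep]] alg_vspace[OF U_rep.alg[OF rep]]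
        U_rep_lift_zero[OF rep n]])
     (simp_all add: g free_algebra_hom_var[OF U_rep.alg[OF rep] U_rep.closed[OF rep]])

end

section \<open>The Serre polynomial\<close>

text \<open>If v = x - y were nonzero, a projection onto the line through v followed by the
  coordinate would be a functional with value 1 at v. The purpose is computational: applying a
  functional turns an identity of long sums in an algebra into an identity in the field, where
  \<open>field_simps\<close> works.\<close>

lemma vs_eq_by_functionals:
  assumes M: "vspace M" and xy: "x \<in> carrier M" "y \<in> carrier M"
    and eq: "\<And>\<xi>. \<xi> \<in> linear_maps M scalars \<Longrightarrow> \<xi> x = \<xi> y"
  shows "x = y"
proof (rule ccontr)
  assume ne: "x \<noteq> y"
  define v where "v = x \<ominus>\<^bsub>M\<^esub> y"
  have v: "v \<in> carrier M" "v \<noteq> \<zero>\<^bsub>M\<^esub>" using M xy ne by (simp_all add: v_def vs_eq_iff_minus)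
  define C where "C = range (\<lambda>c. c \<odot>\<^bsub>M\<^esub> v)"
  have inj: "c = d" if "c \<odot>\<^bsub>M\<^esub> v = d \<odot>\<^bsub>M\<^esub> v" for c d
  proof (rule ccontr)
    assume "c \<noteq> d"
    have "(c - d) \<odot>\<^bsub>M\<^esub> v = d \<odot>\<^bsub>M\<^esub> v \<oplus>\<^bsub>M\<^esub> (- d) \<odot>\<^bsub>M\<^esub> v"
      using vs_smult_l_distr[OF M v(1), of c "- d"] by (simp add: that)
    also have "\<dots> = \<zero>\<^bsub>M\<^esub>" using M v(1) by (simp flip: vs_smult_l_distr)
    finally have "inverse (c - d) \<odot>\<^bsub>M\<^esub> ((c - d) \<odot>\<^bsub>M\<^esub> v) = \<zero>\<^bsub>M\<^esub>" using M by simp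
    then show False using M v \<open>c \<noteq> d\<close> by simp
  qed
  have zero: "\<zero>\<^bsub>M\<^esub> = 0 \<odot>\<^bsub>M\<^esub> v" using M v(1) by simp
  have C: "submodule C scalars M"
  proof (rule submoduleI'[OF M])
    show "\<zero>\<^bsub>M\<^esub> \<in> C" unfolding zero C_def by blast
  qed (use M v(1) in \<open>auto simp: C_def simp flip: vs_smult_l_distr\<close>)
  obtain \<pi> where \<pi>: "\<pi> \<in> linear_maps M (M\<lparr>carrier := C\<rparr>)" "\<And>x. x \<in> C \<Longrightarrow> \<pi> x = x"
    by (rule projection_exists[OF M C]) blast
  define \<xi> where "\<xi> z = (THE c. \<pi> z = c \<odot>\<^bsub>M\<^esub> v)" for z
  have \<xi>: "\<xi> z = c" if "\<pi> z = c \<odot>\<^bsub>M\<^esub> v" for z c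
    unfolding \<xi>_def using that inj by (intro the_equality) auto
  have ex: "\<exists>c. \<pi> z = c \<odot>\<^bsub>M\<^esub> v" if "z \<in> carrier M" for z
    using lin_closed[OF \<pi>(1) that] by (auto simp: C_def)
  have "\<xi> \<in> linear_maps M scalars"
  proof (rule linI)
    fix z assume z: "z \<in> carrier M"
    obtain c where c: "\<pi> z = c \<odot>\<^bsub>M\<^esub> v" using ex[OF z] by blast
    show "\<xi> z \<in> carrier scalars" by simp
    show "\<xi> (k \<odot>\<^bsub>M\<^esub> z) = k \<odot>\<^bsub>scalars\<^esub> \<xi> z" for k
      using lin_smult[OF \<pi>(1) z, of k] \<xi>[of "k \<odot>\<^bsub>M\<^esub> z" "k * c"] \<xi>[OF c] c M v(1) by simp
    fix z' assume z': "z' \<in> carrier M"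
    obtain c' where c': "\<pi> z' = c' \<odot>\<^bsub>M\<^esub> v" using ex[OF z'] by blast
    show "\<xi> (z \<oplus>\<^bsub>M\<^esub> z') = \<xi> z \<oplus>\<^bsub>scalars\<^esub> \<xi> z'"
      using lin_add[OF \<pi>(1) z z'] \<xi>[of "z \<oplus>\<^bsub>M\<^esub> z'" "c + c'"] \<xi>[OF c] \<xi>[OF c'] c c' M v(1)
      by (simp add: vs_smult_l_distr)
  qed
  from eq[OF this] lin_minus[OF this M vspace_scalars xy] have "\<xi> v = 0"
    by (simp add: v_def vs_minus_eq)
  moreover have "v \<in> C" using M v(1) unfolding C_def by (auto intro!: image_eqI[of _ _ 1])
  then have "\<xi> v = 1" using \<xi>[of v 1] \<pi>(2)[of v] M v(1) by simp
  ultimately show False by simp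
qed

lemma serre_closed: "assoc_algebra A \<Longrightarrow> x \<in> carrier A \<Longrightarrow> y \<in> carrier A \<Longrightarrow> serre A a b x y \<in> carrier A"
  by (simp add: serre_def)

lemma serre_commute: "serre A a b x y = serre A b a x y"
  by (simp add: serre_def add.commute mult.commute)

text \<open>The exchange rule x y = c y x completed by a further factor z on the right; rewriting of
  right-nested products needs both forms.\<close>

lemma left_commute_rule:
  assumes "assoc_algebra A" "x \<in> carrier A" "y \<in> carrier A" "z \<in> carrier A"
    and "x \<otimes>\<^bsub>A\<^esub> y = c \<odot>\<^bsub>A\<^esub> (y \<otimes>\<^bsub>A\<^esub> x)"
  shows "x \<otimes>\<^bsub>A\<^esub> (y \<otimes>\<^bsub>A\<^esub> z) = c \<odot>\<^bsub>A\<^esub> (y \<otimes>\<^bsub>A\<^esub> (x \<otimes>\<^bsub>A\<^esub> z))"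
  using assms by (simp flip: alg_assoc)

text \<open>When all factors x1, y1 are moved to one side, the mixed terms cancel precisely for
  these three exchange constants. No rule between y1 and y2 enters, because the polynomial is linear
  in y. The model case is x1 = e_i \<otimes> 1, x2 = \<omega>_i \<otimes> e_i and likewise y1, y2
  with the neighbour of i.\<close>

lemma serre_add:
  assumes A [simp]: "assoc_algebra A"
    and [simp]: "x1 \<in> carrier A" "x2 \<in> carrier A" "y1 \<in> carrier A" "y2 \<in> carrier A"
    and ab: "a \<noteq> 0" "b \<noteq> 0"
    and xx: "x2 \<otimes>\<^bsub>A\<^esub> x1 = (a / b) \<odot>\<^bsub>A\<^esub> (x1 \<otimes>\<^bsub>A\<^esub> x2)"
    and yx: "y2 \<otimes>\<^bsub>A\<^esub> x1 = inverse a \<odot>\<^bsub>A\<^esub> (x1 \<otimes>\<^bsub>A\<^esub> y2)"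
    and xy: "x2 \<otimes>\<^bsub>A\<^esub> y1 = b \<odot>\<^bsub>A\<^esub> (y1 \<otimes>\<^bsub>A\<^esub> x2)"
    and s1: "serre A a b x1 y1 = \<zero>\<^bsub>A\<^esub>" and s2: "serre A a b x2 y2 = \<zero>\<^bsub>A\<^esub>"
  shows "serre A a b (x1 \<oplus>\<^bsub>A\<^esub> x2) (y1 \<oplus>\<^bsub>A\<^esub> y2) = \<zero>\<^bsub>A\<^esub>"
proof (rule vs_eq_by_functionals[of A])
  fix \<xi> assume \<xi>: "\<xi> \<in> linear_maps A scalars"
  note q = xx yx xy left_commute_rule[OF A _ _ _ xx] left_commute_rule[OF A _ _ _ yx]
    left_commute_rule[OF A _ _ _ xy]
  note l = lin_add[OF \<xi>] lin_smult[OF \<xi>]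
  have z: "\<xi> \<zero>\<^bsub>A\<^esub> = 0" using lin_zero[OF \<xi>] by simp
  have 1: "\<xi> (serre A a b x1 y1) = 0" "\<xi> (serre A a b x2 y2) = 0" by (simp_all add: s1 s2 z)
  have "\<xi> (serre A a b (x1 \<oplus>\<^bsub>A\<^esub> x2) (y1 \<oplus>\<^bsub>A\<^esub> y2)) =
      \<xi> (serre A a b x1 y1) + \<xi> (serre A a b x2 y2)"
    using ab
    by (simp add: serre_def alg_l_distr alg_r_distr alg_assoc vs_smult_r_distr q l)
       (simp add: field_simps)
  then show "\<xi> (serre A a b (x1 \<oplus>\<^bsub>A\<^esub> x2) (y1 \<oplus>\<^bsub>A\<^esub> y2)) = \<xi> \<zero>\<^bsub>A\<^esub>" by (simp add: 1 z)
qed (simp_all add: serre_closed)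

text \<open>Collecting the factors k, k, l on the left turns the reversed Serre polynomial into k k
  l times the original one. With k and l the inverses of \<omega>_i and \<omega>_j this is the
  effect of the antipode on a Serre relation.\<close>

lemma serre_twist:
  assumes A [simp]: "assoc_algebra A"
    and [simp]: "x \<in> carrier A" "y \<in> carrier A" "k \<in> carrier A" "l \<in> carrier A"
    and ab: "a \<noteq> 0" "b \<noteq> 0"
    and xk: "x \<otimes>\<^bsub>A\<^esub> k = (a / b) \<odot>\<^bsub>A\<^esub> (k \<otimes>\<^bsub>A\<^esub> x)"
    and yk: "y \<otimes>\<^bsub>A\<^esub> k = b \<odot>\<^bsub>A\<^esub> (k \<otimes>\<^bsub>A\<^esub> y)"
    and xl: "x \<otimes>\<^bsub>A\<^esub> l = inverse a \<odot>\<^bsub>A\<^esub> (l \<otimes>\<^bsub>A\<^esub> x)"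
    and lk: "l \<otimes>\<^bsub>A\<^esub> k = k \<otimes>\<^bsub>A\<^esub> l"
    and s: "serre A a b x y = \<zero>\<^bsub>A\<^esub>"
  shows "serre (opposite A) a b (k \<otimes>\<^bsub>A\<^esub> x) (l \<otimes>\<^bsub>A\<^esub> y) = \<zero>\<^bsub>A\<^esub>"
proof (rule vs_eq_by_functionals[of A])
  fix \<xi> assume \<xi>: "\<xi> \<in> linear_maps A scalars"
  have lk': "l \<otimes>\<^bsub>A\<^esub> k = 1 \<odot>\<^bsub>A\<^esub> (k \<otimes>\<^bsub>A\<^esub> l)" by (simp add: lk)
  note q = xk yk xl lk left_commute_rule[OF A _ _ _ xk] left_commute_rule[OF A _ _ _ yk]
    left_commute_rule[OF A _ _ _ xl] left_commute_rule[OF A _ _ _ lk']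
  note li = lin_add[OF \<xi>] lin_smult[OF \<xi>]
  have z: "\<xi> \<zero>\<^bsub>A\<^esub> = 0" using lin_zero[OF \<xi>] by simp
  have 1: "\<xi> (k \<otimes>\<^bsub>A\<^esub> (k \<otimes>\<^bsub>A\<^esub> (l \<otimes>\<^bsub>A\<^esub> serre A a b x y))) = 0" by (simp add: s z)
  have "\<xi> (serre (opposite A) a b (k \<otimes>\<^bsub>A\<^esub> x) (l \<otimes>\<^bsub>A\<^esub> y)) =
      \<xi> (k \<otimes>\<^bsub>A\<^esub> (k \<otimes>\<^bsub>A\<^esub> (l \<otimes>\<^bsub>A\<^esub> serre A a b x y)))"
    using ab
    by (simp add: serre_def alg_l_distr alg_r_distr alg_assoc vs_smult_r_distr q li)
       (simp add: field_simps)
  then show "\<xi> (serre (opposite A) a b (k \<otimes>\<^bsub>A\<^esub> x) (l \<otimes>\<^bsub>A\<^esub> y)) = \<xi> \<zero>\<^bsub>A\<^esub>" by (simp add: 1 z)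
qed (simp_all add: serre_closed[of "opposite A", simplified])

section \<open>Weights\<close>

lemma inner_eps: "inner_prod n (eps j) v = (if 1 \<le> j \<and> j \<le> n then v j else 0)"
  by (simp add: inner_prod_def eps_def if_distrib[of "\<lambda>x. x * _"] sum.delta cong: if_cong)

lemma inner_minus: "inner_prod n (\<lambda>k. u k - v k) w = inner_prod n u w - inner_prod n v w"
  by (simp add: inner_prod_def algebra_simps sum_subtractf)

lemma inner_alpha: "i < n \<Longrightarrow> inner_prod n (alpha n i) v = (if i = 0 then v n - v 1 else v i - v (Suc i))"
  by (simp add: alpha_def inner_minus inner_eps)

lemma alpha_eval: "alpha n i k =
    (if i = 0 then (if k = n then 1 else 0) - (if k = 1 then 1 else 0)
     else (if k = i then 1 else 0) - (if k = Suc i then 1 else 0))"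
  by (simp add: alpha_def eps_def)

lemma weight_eval: "n > 0 \<Longrightarrow> i < n \<Longrightarrow> j < n \<Longrightarrow> weight n x y j i =
    (if j = 0 then x powi (- alpha n 0 (Suc i)) * y powi alpha n i 1
     else x powi alpha n i j * y powi alpha n i (Suc j))"
  by (simp add: weight_def inner_eps)

lemma weight_diag: "n > 2 \<Longrightarrow> i < n \<Longrightarrow> weight n x y i i = x / y"
  by (simp add: weight_eval alpha_eval power_int_minus divide_inverse)

lemma weight_far:
  "n > 2 \<Longrightarrow> i < n \<Longrightarrow> j < n \<Longrightarrow> inner_prod n (alpha n i) (alpha n j) = 0 \<Longrightarrow> weight n x y i j = 1"
  unfolding inner_alpha by (simp add: weight_eval alpha_eval split: if_splits)

lemma inner_prod_commute: "inner_prod n u v = inner_prod n v u"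
  by (simp add: inner_prod_def mult.commute)

lemma Suc_mod_cases: "i < n \<Longrightarrow> Suc i mod n = (if i = n - 1 then 0 else Suc i)"
  by auto

text \<open>The values y here, \<open>inverse x\<close> in \<open>weight_prev\<close> and
  \<open>x / y\<close> in \<open>weight_diag\<close> are the exchange constants b, 1/a and a/b of
  \<open>serre_add\<close>. For n > 2 cyclic neighbours are adjacent on one side only; for n = 2
  both contributions would occur at once.\<close>

lemma weight_next: "n > 2 \<Longrightarrow> i < n \<Longrightarrow> weight n x y i (Suc i mod n) = y"
  unfolding Suc_mod_cases by (auto simp: weight_eval alpha_eval)

lemma weight_prev: "n > 2 \<Longrightarrow> i < n \<Longrightarrow> weight n x y (Suc i mod n) i = inverse x"
  unfolding Suc_mod_cases by (auto simp: weight_eval alpha_eval power_int_minus)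

text \<open>The Cartan-type duality between the two tori. It makes the mixed terms of
  \<Delta>(e_i)\<Delta>(f_j) cancel, and it reconciles the pairing \<langle>\<omega>'_j,
  \<omega>_i\<rangle> with the action of \<omega>'_j on e_i.\<close>

lemma weight_swap: "n > 2 \<Longrightarrow> i < n \<Longrightarrow> j < n \<Longrightarrow> weight n y x j i = inverse (weight n x y i j)"
  by (auto simp: weight_eval alpha_eval power_int_minus)

section \<open>The structure maps of \<open>U\<^sub>r\<^sub>,\<^sub>s\<close>\<close>

lemma serre_scale:
  "assoc_algebra A \<Longrightarrow> x \<in> carrier A \<Longrightarrow> y \<in> carrier A \<Longrightarrow>
    serre A a b (c \<odot>\<^bsub>A\<^esub> x) (d \<odot>\<^bsub>A\<^esub> y) = (c * c * d) \<odot>\<^bsub>A\<^esub> serre A a b x y"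
  by (simp add: serre_def vs_smult_r_distr algebra_simps)

context
  fixes n :: nat assumes n: "n > 2"
begin

private abbreviation "U \<equiv> U_algebra n"
private abbreviation "TU \<equiv> tensor_algebra U U"
private abbreviation "TM \<equiv> tensor_module U U"
private abbreviation "g \<equiv> gen n"
private abbreviation tens (infixl "\<otimes>\<otimes>" 75) where "x \<otimes>\<otimes> y \<equiv> tensor U U x y"

interpretation G: U_rep U n g
  using n by (intro U_rep_gen) simp

private lemma mod_less [simp]: "Suc i mod n < n" using n by simp

private lemma VU: "vspace U" and VT: "vspace TM" and AT: "assoc_algebra TU"
  by simp_all

private lemmas tens_simps = tensor_add_left[OF VU VU] tensor_add_right[OF VU VU]
  tensor_smult_left[OF VU VU] tensor_smult_right[OF VU VU]

private lemma tens_mult: "a \<in> carrier U \<Longrightarrow> b \<in> carrier U \<Longrightarrow> c \<in> carrier U \<Longrightarrow> d \<in> carrier U \<Longrightarrow>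
    (a \<otimes>\<otimes> b) \<otimes>\<^bsub>TU\<^esub> (c \<otimes>\<otimes> d) = (a \<otimes>\<^bsub>U\<^esub> c) \<otimes>\<otimes> (b \<otimes>\<^bsub>U\<^esub> d)"
  by simp

private lemma tens_foldr: "(\<And>i. i \<in> set xs \<Longrightarrow> f i \<in> grouplikes n) \<Longrightarrow>
    foldr (\<lambda>i x. g (Grp (f i)) \<otimes>\<^bsub>U\<^esub> x) xs \<one>\<^bsub>U\<^esub> \<in> carrier U \<and>
    foldr (\<lambda>i x. (g (Grp (f i)) \<otimes>\<otimes> g (Grp (f i))) \<otimes>\<^bsub>TU\<^esub> x) xs (\<one>\<^bsub>U\<^esub> \<otimes>\<otimes> \<one>\<^bsub>U\<^esub>) =
    foldr (\<lambda>i x. g (Grp (f i)) \<otimes>\<^bsub>U\<^esub> x) xs \<one>\<^bsub>U\<^esub> \<otimes>\<otimes> foldr (\<lambda>i x. g (Grp (f i)) \<otimes>\<^bsub>U\<^esub> x) xs \<one>\<^bsub>U\<^esub>"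
  by (induct xs) auto

private lemma AT_distr:
  "x \<in> carrier TM \<Longrightarrow> y \<in> carrier TM \<Longrightarrow> z \<in> carrier TM \<Longrightarrow>
    (x \<oplus>\<^bsub>TM\<^esub> y) \<otimes>\<^bsub>TU\<^esub> z = x \<otimes>\<^bsub>TU\<^esub> z \<oplus>\<^bsub>TM\<^esub> y \<otimes>\<^bsub>TU\<^esub> z"
  "x \<in> carrier TM \<Longrightarrow> y \<in> carrier TM \<Longrightarrow> z \<in> carrier TM \<Longrightarrow>
    z \<otimes>\<^bsub>TU\<^esub> (x \<oplus>\<^bsub>TM\<^esub> y) = z \<otimes>\<^bsub>TU\<^esub> x \<oplus>\<^bsub>TM\<^esub> z \<otimes>\<^bsub>TU\<^esub> y"
  using alg_l_distr[OF AT, of x y z] alg_r_distr[OF AT, of x y z] by simp_all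

private lemma comult_closed: "x \<in> gens n \<Longrightarrow> comult_gen n x \<in> carrier TU"
  by (cases x) auto

text \<open>Each of the three monomials has the same commuting factors k, k, l in one slot, so the
  Serre polynomial of the other slot factors out.\<close>

private lemma serre_tensor_right:
  assumes [simp]: "k \<in> carrier U" "l \<in> carrier U" "x \<in> carrier U" "y \<in> carrier U"
    and kl: "l \<otimes>\<^bsub>U\<^esub> k = k \<otimes>\<^bsub>U\<^esub> l"
  shows "serre TU a b (k \<otimes>\<otimes> x) (l \<otimes>\<otimes> y) = (k \<otimes>\<^bsub>U\<^esub> (k \<otimes>\<^bsub>U\<^esub> l)) \<otimes>\<otimes> serre U a b x y"
    "serre (opposite TU) a b (k \<otimes>\<otimes> x) (l \<otimes>\<otimes> y) = (k \<otimes>\<^bsub>U\<^esub> (k \<otimes>\<^bsub>U\<^esub> l)) \<otimes>\<otimes> serre (opposite U) a b x y"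
    "serre TU a b (x \<otimes>\<otimes> k) (y \<otimes>\<otimes> l) = serre U a b x y \<otimes>\<otimes> (k \<otimes>\<^bsub>U\<^esub> (k \<otimes>\<^bsub>U\<^esub> l))"
    "serre (opposite TU) a b (x \<otimes>\<otimes> k) (y \<otimes>\<otimes> l) = serre (opposite U) a b x y \<otimes>\<otimes> (k \<otimes>\<^bsub>U\<^esub> (k \<otimes>\<^bsub>U\<^esub> l))"
proof -
  have "l \<otimes>\<^bsub>U\<^esub> (k \<otimes>\<^bsub>U\<^esub> k) = k \<otimes>\<^bsub>U\<^esub> (k \<otimes>\<^bsub>U\<^esub> l)"
    using left_commute_rule[of U l k k 1] by (simp add: kl)
  then show "serre TU a b (k \<otimes>\<otimes> x) (l \<otimes>\<otimes> y) = (k \<otimes>\<^bsub>U\<^esub> (k \<otimes>\<^bsub>U\<^esub> l)) \<otimes>\<otimes> serre U a b x y"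
    "serre (opposite TU) a b (k \<otimes>\<otimes> x) (l \<otimes>\<otimes> y) = (k \<otimes>\<^bsub>U\<^esub> (k \<otimes>\<^bsub>U\<^esub> l)) \<otimes>\<otimes> serre (opposite U) a b x y"
    "serre TU a b (x \<otimes>\<otimes> k) (y \<otimes>\<otimes> l) = serre U a b x y \<otimes>\<otimes> (k \<otimes>\<^bsub>U\<^esub> (k \<otimes>\<^bsub>U\<^esub> l))"
    "serre (opposite TU) a b (x \<otimes>\<otimes> k) (y \<otimes>\<otimes> l) = serre (opposite U) a b x y \<otimes>\<otimes> (k \<otimes>\<^bsub>U\<^esub> (k \<otimes>\<^bsub>U\<^esub> l))"
    by (simp_all add: serre_def tens_mult tens_simps kl alg_assoc)
qed

text \<open>This is the well-definedness of the coproduct. The Serre relations hold separately for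
  the two summands of each coproduct by \<open>serre_tensor_right\<close>, and
  \<open>serre_add\<close> joins the summands.\<close>

lemma U_rep_comult: "U_rep TU n (comult_gen n)"
proof (unfold_locales, goal_cases)
  case 1 show ?case by (rule AT)
next
  case (2 x) then show ?case by (rule comult_closed)
next
  case (3 t) then show ?case by (simp add: tens_mult)
next
  case (4 t) then show ?case by (simp add: tens_mult)
next
  case (5 t u) then show ?case by (simp add: tens_mult G.Grp_comm)
next
  case 6 then show ?case using tens_foldr[of "[0..<n]" Omega] by (simp add: tens_mult G.gamma)
next
  case 7 then show ?case using tens_foldr[of "[0..<n]" Omega'] by (simp add: tens_mult G.gamma')
next
  case (8 t i) then show ?case
    by (simp add: tens_mult AT_distr tens_simps vs_smult_r_distr G.Grp_E G.Grp_comm[of t "Omega i"])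
next
  case (9 t i) then show ?case
    by (simp add: tens_mult AT_distr tens_simps vs_smult_r_distr G.Grp_F G.Grp_comm[of t "Omega' i"])
next
  case (10 i j)
  \<comment> \<open>Equates the constants in \<omega>_i f_j \<otimes> e_i \<omega>'_j and f_j
    \<omega>_i \<otimes> \<omega>'_j e_i, the only mixed terms that do not agree at sight.\<close>
  have w: "weight n ss rr j i = inverse (weight n rr ss i j)" by (rule weight_swap[OF n 10])
  show ?case
  proof (rule vs_eq_by_functionals[of TM])
    fix \<xi> assume \<xi>: "\<xi> \<in> linear_maps TM scalars"
    note li = lin_add[OF \<xi>] lin_smult[OF \<xi>]
    show "\<xi> (comult_gen n (GenE i) \<otimes>\<^bsub>TU\<^esub> comult_gen n (GenF j)) =
       \<xi> (comult_gen n (GenF j) \<otimes>\<^bsub>TU\<^esub> comult_gen n (GenE i) \<oplus>\<^bsub>TU\<^esub>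
         ((if i = j then 1 else 0) / (rr - ss)) \<odot>\<^bsub>TU\<^esub>
         (comult_gen n (Grp (Omega i)) \<oplus>\<^bsub>TU\<^esub> - 1 \<odot>\<^bsub>TU\<^esub> comult_gen n (Grp (Omega' i))))"
      using 10
      by (simp add: tens_mult AT_distr tens_simps vs_smult_r_distr G.Grp_E G.Grp_F G.E_F w li)
  qed (use 10 AT in \<open>simp_all add: comult_closed[simplified] alg_mult_closed[OF AT, simplified]
        del: comult_gen.simps\<close>)
next
  case (11 i j)
  then have "weight n rr ss i j = 1" "weight n rr ss j i = 1"
    using weight_far[OF n] inner_prod_commute[of n "alpha n i"] by metis+
  with 11 show ?case
    using G.E_E[of i j]
    by (simp add: tens_mult AT_distr tens_simps G.Grp_E G.Grp_comm[of "Omega i"] vs_assoc vs_lcomm[OF VT] vs_comm[OF VT])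
next
  case (12 i j)
  then have "weight n ss rr i j = 1" "weight n ss rr j i = 1"
    using weight_far[OF n] inner_prod_commute[of n "alpha n i"] by metis+
  with 12 show ?case
    using G.F_F[of i j]
    by (simp add: tens_mult AT_distr tens_simps G.Grp_F G.Grp_comm[of "Omega' i"] vs_assoc vs_lcomm[OF VT] vs_comm[OF VT])
next
  case (13 i j)
  note w = weight_diag[OF n] weight_next[OF n] weight_prev[OF n]
  have "serre TU rr ss (g (GenE i) \<otimes>\<otimes> \<one>\<^bsub>U\<^esub> \<oplus>\<^bsub>TU\<^esub> g (Grp (Omega i)) \<otimes>\<otimes> g (GenE i))
      (g (GenE j) \<otimes>\<otimes> \<one>\<^bsub>U\<^esub> \<oplus>\<^bsub>TU\<^esub> g (Grp (Omega j)) \<otimes>\<otimes> g (GenE j)) = \<zero>\<^bsub>TU\<^esub>"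
    using 13
    by (intro serre_add[OF AT])
       (simp_all add: tens_mult tens_simps G.Grp_E G.Grp_comm w serre_tensor_right G.Serre_E1
         tensor_zero_left[OF VU VU] tensor_zero_right[OF VU VU])
  then show ?case by simp
next
  case (14 i j)
  note w = weight_diag[OF n] weight_next[OF n] weight_prev[OF n]
  \<comment> \<open>In the opposite algebra the exchange rules are read backwards, which amounts to
    interchanging r and s; the Serre polynomial is symmetric in them.\<close>
  have "serre (opposite TU) ss rr (g (GenE j) \<otimes>\<otimes> \<one>\<^bsub>U\<^esub> \<oplus>\<^bsub>opposite TU\<^esub> g (Grp (Omega j)) \<otimes>\<otimes> g (GenE j))
      (g (GenE i) \<otimes>\<otimes> \<one>\<^bsub>U\<^esub> \<oplus>\<^bsub>opposite TU\<^esub> g (Grp (Omega i)) \<otimes>\<otimes> g (GenE i)) = \<zero>\<^bsub>opposite TU\<^esub>"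
    using 14
    by (intro serre_add)
       (simp_all add: tens_mult tens_simps G.Grp_E G.Grp_comm w serre_tensor_right
         serre_commute[of _ ss rr] G.Serre_E2 tensor_zero_left[OF VU VU] tensor_zero_right[OF VU VU])
  then show ?case by (simp add: serre_commute[of _ ss rr])
next
  case (15 i j)
  note w = weight_diag[OF n] weight_next[OF n] weight_prev[OF n]
  have "serre TU (inverse rr) (inverse ss) (g (GenF i) \<otimes>\<otimes> g (Grp (Omega' i)) \<oplus>\<^bsub>TU\<^esub> \<one>\<^bsub>U\<^esub> \<otimes>\<otimes> g (GenF i))
      (g (GenF j) \<otimes>\<otimes> g (Grp (Omega' j)) \<oplus>\<^bsub>TU\<^esub> \<one>\<^bsub>U\<^esub> \<otimes>\<otimes> g (GenF j)) = \<zero>\<^bsub>TU\<^esub>"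
    using 15
    by (intro serre_add[OF AT])
       (simp_all add: tens_mult tens_simps G.Grp_F G.Grp_comm w serre_tensor_right G.Serre_F1[unfolded inverse_eq_divide]
         tensor_zero_left[OF VU VU] tensor_zero_right[OF VU VU] field_simps)
  then show ?case by simp
next
  case (16 i j)
  note w = weight_diag[OF n] weight_next[OF n] weight_prev[OF n]
  have "serre (opposite TU) (inverse ss) (inverse rr)
      (g (GenF j) \<otimes>\<otimes> g (Grp (Omega' j)) \<oplus>\<^bsub>opposite TU\<^esub> \<one>\<^bsub>U\<^esub> \<otimes>\<otimes> g (GenF j))
      (g (GenF i) \<otimes>\<otimes> g (Grp (Omega' i)) \<oplus>\<^bsub>opposite TU\<^esub> \<one>\<^bsub>U\<^esub> \<otimes>\<otimes> g (GenF i)) = \<zero>\<^bsub>opposite TU\<^esub>"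
    using 16
    by (intro serre_add)
       (simp_all add: tens_mult tens_simps G.Grp_F G.Grp_comm w serre_tensor_right
         serre_commute[of _ "1 / ss" "1 / rr"] G.Serre_F2[unfolded inverse_eq_divide]
         tensor_zero_left[OF VU VU] tensor_zero_right[OF VU VU] field_simps)
  then show ?case by (simp add: serre_commute[of _ "inverse ss" "inverse rr"])
qed

lemma U_rep_counit: "U_rep scalars n counit_gen"
proof -
  have "foldr (\<lambda>i x. x) xs c = c" for xs :: "nat list" and c :: K by (induct xs) auto
  then show ?thesis
    by unfold_locales (auto simp: serre_def elim: gens_cases)
qed

text \<open>The inverse of an ordered product is the product of the inverses in reverse order, which
  is the order that the opposite algebra produces for the image of \<omega>_\<delta> under the
  antipode.\<close>

private lemma foldr_inverse: "(\<And>i. i \<in> set xs \<Longrightarrow> f i \<in> grouplikes n) \<Longrightarrow>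
    foldr (\<lambda>i x. g (Grp (f i)) \<otimes>\<^bsub>U\<^esub> x) xs \<one>\<^bsub>U\<^esub> \<in> carrier U \<and>
    foldr (\<lambda>i x. x \<otimes>\<^bsub>U\<^esub> g (Inv (f i))) xs \<one>\<^bsub>U\<^esub> \<in> carrier U \<and>
    foldr (\<lambda>i x. g (Grp (f i)) \<otimes>\<^bsub>U\<^esub> x) xs \<one>\<^bsub>U\<^esub> \<otimes>\<^bsub>U\<^esub> foldr (\<lambda>i x. x \<otimes>\<^bsub>U\<^esub> g (Inv (f i))) xs \<one>\<^bsub>U\<^esub> = \<one>\<^bsub>U\<^esub>"
proof (induct xs)
  case (Cons i xs)
  define P Q where "P = foldr (\<lambda>i x. g (Grp (f i)) \<otimes>\<^bsub>U\<^esub> x) xs \<one>\<^bsub>U\<^esub>"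
    and "Q = foldr (\<lambda>i x. x \<otimes>\<^bsub>U\<^esub> g (Inv (f i))) xs \<one>\<^bsub>U\<^esub>"
  have PQ: "P \<in> carrier U" "Q \<in> carrier U" "P \<otimes>\<^bsub>U\<^esub> Q = \<one>\<^bsub>U\<^esub>" "f i \<in> grouplikes n"
    using Cons by (simp_all add: P_def Q_def)
  have "(g (Grp (f i)) \<otimes>\<^bsub>U\<^esub> P) \<otimes>\<^bsub>U\<^esub> (Q \<otimes>\<^bsub>U\<^esub> g (Inv (f i))) =
      g (Grp (f i)) \<otimes>\<^bsub>U\<^esub> (P \<otimes>\<^bsub>U\<^esub> Q) \<otimes>\<^bsub>U\<^esub> g (Inv (f i))"
    using PQ(1,2,4) by (simp add: alg_assoc)
  then show ?case using PQ by (simp flip: P_def Q_def)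
qed simp

private lemma square_inverse:
  assumes t: "t \<in> grouplikes n" and f: "\<And>i. i < n \<Longrightarrow> f i \<in> grouplikes n"
    and eq: "g (Grp t) \<otimes>\<^bsub>U\<^esub> g (Grp t) = foldr (\<lambda>i x. g (Grp (f i)) \<otimes>\<^bsub>U\<^esub> x) [0..<n] \<one>\<^bsub>U\<^esub>"
  shows "g (Inv t) \<otimes>\<^bsub>U\<^esub> g (Inv t) = foldr (\<lambda>i x. x \<otimes>\<^bsub>U\<^esub> g (Inv (f i))) [0..<n] \<one>\<^bsub>U\<^esub>"
proof -
  define Q where "Q = foldr (\<lambda>i x. x \<otimes>\<^bsub>U\<^esub> g (Inv (f i))) [0..<n] \<one>\<^bsub>U\<^esub>"
  have Q: "Q \<in> carrier U" "(g (Grp t) \<otimes>\<^bsub>U\<^esub> g (Grp t)) \<otimes>\<^bsub>U\<^esub> Q = \<one>\<^bsub>U\<^esub>"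
    using foldr_inverse[of "[0..<n]" f] f by (simp_all add: Q_def eq)
  have cancel: "g (Inv t) \<otimes>\<^bsub>U\<^esub> (g (Grp t) \<otimes>\<^bsub>U\<^esub> x) = x" if "x \<in> carrier U" for x
    using t that by (simp flip: alg_assoc)
  have "g (Inv t) \<otimes>\<^bsub>U\<^esub> g (Inv t) = g (Inv t) \<otimes>\<^bsub>U\<^esub> (g (Inv t) \<otimes>\<^bsub>U\<^esub> ((g (Grp t) \<otimes>\<^bsub>U\<^esub> g (Grp t)) \<otimes>\<^bsub>U\<^esub> Q))"
    using t by (simp add: Q)
  also have "\<dots> = Q" using t Q(1) by (simp add: alg_assoc cancel)
  finally show ?thesis by (simp add: Q_def)
qed

private lemma antipode_E: "i < n \<Longrightarrow> antipode_gen n (GenE i) = (- 1) \<odot>\<^bsub>U\<^esub> (g (Inv (Omega i)) \<otimes>\<^bsub>U\<^esub> g (GenE i))"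
  by (simp add: vs_neg_eq[OF VU])

private lemma antipode_F: "i < n \<Longrightarrow> antipode_gen n (GenF i) = (- 1) \<odot>\<^bsub>U\<^esub> (g (GenF i) \<otimes>\<^bsub>U\<^esub> g (Inv (Omega' i)))"
  by (simp add: vs_neg_eq[OF VU])

private lemma antipode_closed: "x \<in> gens n \<Longrightarrow> antipode_gen n x \<in> carrier U"
  by (cases x) auto

private lemma E_Inv: "t \<in> grouplikes n \<Longrightarrow> i < n \<Longrightarrow>
    g (GenE i) \<otimes>\<^bsub>U\<^esub> g (Inv t) = wt n t i \<odot>\<^bsub>U\<^esub> (g (Inv t) \<otimes>\<^bsub>U\<^esub> g (GenE i))"
  by (simp add: G.Inv_E)

private lemma F_Inv: "t \<in> grouplikes n \<Longrightarrow> i < n \<Longrightarrow>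
    g (GenF i) \<otimes>\<^bsub>U\<^esub> g (Inv t) = inverse (wt n t i) \<odot>\<^bsub>U\<^esub> (g (Inv t) \<otimes>\<^bsub>U\<^esub> g (GenF i))"
  by (simp add: G.Inv_F)

text \<open>Antihomomorphisms of U are homomorphisms into the opposite algebra, so the antipode is
  constructed by the universal property there.\<close>

lemma U_rep_antipode: "U_rep (opposite U) n (antipode_gen n)"
proof -
  note w = weight_diag[OF n] weight_next[OF n] weight_prev[OF n]
  have comm: "g (Inv u) \<otimes>\<^bsub>U\<^esub> g (Inv t) = g (Inv t) \<otimes>\<^bsub>U\<^esub> g (Inv u)"
    if "t \<in> grouplikes n" "u \<in> grouplikes n" for t u using G.Inv_comm[of t u "Inv t" "Inv u"] that by simp
  show ?thesis
  proof (unfold_locales, goal_cases)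
    case 1 show ?case by simp
  next
    case (2 x) then show ?case using antipode_closed by simp
  next
    case (3 t) then show ?case by simp
  next
    case (4 t) then show ?case by simp
  next
    case (5 t u) then show ?case using comm by simp
  next
    case 6 then show ?case using square_inverse[of SqrtGamma Omega] by (simp add: G.gamma)
  next
    case 7 then show ?case using square_inverse[of SqrtGamma' Omega'] by (simp add: G.gamma')
  next
    case (8 t i)
    have "g (Inv (Omega i)) \<otimes>\<^bsub>U\<^esub> (g (Inv t) \<otimes>\<^bsub>U\<^esub> g (GenE i)) =
        g (Inv t) \<otimes>\<^bsub>U\<^esub> (g (Inv (Omega i)) \<otimes>\<^bsub>U\<^esub> g (GenE i))"
      using left_commute_rule[of U "g (Inv (Omega i))" "g (Inv t)" "g (GenE i)" 1] 8 comm by simp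
    then show ?case using 8 by (simp add: antipode_E alg_assoc E_Inv del: antipode_gen.simps(1))
  next
    case (9 t i)
    have "g (GenF i) \<otimes>\<^bsub>U\<^esub> (g (Inv (Omega' i)) \<otimes>\<^bsub>U\<^esub> g (Inv t)) =
        inverse (wt n t i) \<odot>\<^bsub>U\<^esub> (g (Inv t) \<otimes>\<^bsub>U\<^esub> (g (GenF i) \<otimes>\<^bsub>U\<^esub> g (Inv (Omega' i))))"
    proof -
      have "g (GenF i) \<otimes>\<^bsub>U\<^esub> (g (Inv (Omega' i)) \<otimes>\<^bsub>U\<^esub> g (Inv t)) =
          (g (GenF i) \<otimes>\<^bsub>U\<^esub> g (Inv t)) \<otimes>\<^bsub>U\<^esub> g (Inv (Omega' i))"
        using 9 comm[of "Omega' i" t] by (simp add: alg_assoc)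
      then show ?thesis unfolding F_Inv[OF 9] using 9 by (simp add: alg_assoc)
    qed
    then show ?case using 9 by (simp add: antipode_F alg_assoc del: antipode_gen.simps(2))
  next
    case (10 i j)
    have w': "weight n ss rr j i = inverse (weight n rr ss i j)" by (rule weight_swap[OF n 10])
    define k l where "k = g (Inv (Omega i))" and "l = g (Inv (Omega' j))"
    have kl: "k \<in> carrier U" "l \<in> carrier U" "l \<otimes>\<^bsub>U\<^esub> k = k \<otimes>\<^bsub>U\<^esub> l"
      using 10 comm by (simp_all add: k_def l_def)
    define e f where "e = g (GenE i)" and "f = g (GenF j)"
    have ef: "e \<in> carrier U" "f \<in> carrier U" using 10 by (simp_all add: e_def f_def)
    have fk: "f \<otimes>\<^bsub>U\<^esub> k = inverse (weight n rr ss i j) \<odot>\<^bsub>U\<^esub> (k \<otimes>\<^bsub>U\<^esub> f)"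
      using F_Inv[of "Omega i" j] 10 by (simp add: k_def f_def)
    have le: "l \<otimes>\<^bsub>U\<^esub> e = weight n rr ss i j \<odot>\<^bsub>U\<^esub> (e \<otimes>\<^bsub>U\<^esub> l)"
      using G.Inv_E[of "Omega' j" i] 10 w' by (simp add: l_def e_def)
    \<comment> \<open>The constants in \<open>fk\<close> and \<open>le\<close> are inverse to each
      other by \<open>weight_swap\<close>. Hence both products of k e and f l are the corresponding
      product of e and f sandwiched between k and l, and so is their difference.\<close>
    have 1: "(f \<otimes>\<^bsub>U\<^esub> l) \<otimes>\<^bsub>U\<^esub> (k \<otimes>\<^bsub>U\<^esub> e) = k \<otimes>\<^bsub>U\<^esub> (f \<otimes>\<^bsub>U\<^esub> e) \<otimes>\<^bsub>U\<^esub> l"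
    proof -
      have "(f \<otimes>\<^bsub>U\<^esub> l) \<otimes>\<^bsub>U\<^esub> (k \<otimes>\<^bsub>U\<^esub> e) = (f \<otimes>\<^bsub>U\<^esub> k) \<otimes>\<^bsub>U\<^esub> (l \<otimes>\<^bsub>U\<^esub> e)"
        using kl ef left_commute_rule[of U l k e 1] by (simp add: alg_assoc)
      also have "\<dots> = k \<otimes>\<^bsub>U\<^esub> (f \<otimes>\<^bsub>U\<^esub> e) \<otimes>\<^bsub>U\<^esub> l"
        unfolding fk le using kl ef by (simp add: alg_assoc)
      finally show ?thesis .
    qed
    have 2: "(k \<otimes>\<^bsub>U\<^esub> e) \<otimes>\<^bsub>U\<^esub> (f \<otimes>\<^bsub>U\<^esub> l) = k \<otimes>\<^bsub>U\<^esub> (e \<otimes>\<^bsub>U\<^esub> f) \<otimes>\<^bsub>U\<^esub> l"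
      using kl ef by (simp add: alg_assoc)
    define c where "c = (if i = j then 1 else 0) / (rr - ss)"
    have 3: "c \<odot>\<^bsub>U\<^esub> (k \<otimes>\<^bsub>U\<^esub> (g (Grp (Omega i)) \<oplus>\<^bsub>U\<^esub> (- 1) \<odot>\<^bsub>U\<^esub> g (Grp (Omega' i))) \<otimes>\<^bsub>U\<^esub> l)
      = c \<odot>\<^bsub>U\<^esub> (g (Inv (Omega' i)) \<oplus>\<^bsub>U\<^esub> (- 1) \<odot>\<^bsub>U\<^esub> k)"
      using 10 by (simp add: c_def k_def l_def alg_l_distr alg_r_distr alg_assoc)
    have 4: "e \<otimes>\<^bsub>U\<^esub> f = f \<otimes>\<^bsub>U\<^esub> e \<oplus>\<^bsub>U\<^esub> c \<odot>\<^bsub>U\<^esub> (g (Grp (Omega i)) \<oplus>\<^bsub>U\<^esub> (- 1) \<odot>\<^bsub>U\<^esub> g (Grp (Omega' i)))"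
      using G.E_F[OF 10] by (simp add: e_def f_def c_def)
    have 5: "(k \<otimes>\<^bsub>U\<^esub> e) \<otimes>\<^bsub>U\<^esub> (f \<otimes>\<^bsub>U\<^esub> l) = (f \<otimes>\<^bsub>U\<^esub> l) \<otimes>\<^bsub>U\<^esub> (k \<otimes>\<^bsub>U\<^esub> e)
        \<oplus>\<^bsub>U\<^esub> c \<odot>\<^bsub>U\<^esub> (g (Inv (Omega' i)) \<oplus>\<^bsub>U\<^esub> (- 1) \<odot>\<^bsub>U\<^esub> k)"
      unfolding 1 2 4 3[symmetric] using 10 kl ef by (simp add: alg_l_distr alg_r_distr)
    have 6: "(f \<otimes>\<^bsub>U\<^esub> l) \<otimes>\<^bsub>U\<^esub> (k \<otimes>\<^bsub>U\<^esub> e) = (k \<otimes>\<^bsub>U\<^esub> e) \<otimes>\<^bsub>U\<^esub> (f \<otimes>\<^bsub>U\<^esub> l)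
        \<oplus>\<^bsub>U\<^esub> c \<odot>\<^bsub>U\<^esub> (k \<oplus>\<^bsub>U\<^esub> (- 1) \<odot>\<^bsub>U\<^esub> g (Inv (Omega' i)))"
    proof (rule vs_eq_by_functionals[OF VU])
      fix \<xi> assume \<xi>: "\<xi> \<in> linear_maps U scalars"
      show "\<xi> ((f \<otimes>\<^bsub>U\<^esub> l) \<otimes>\<^bsub>U\<^esub> (k \<otimes>\<^bsub>U\<^esub> e)) = \<xi> ((k \<otimes>\<^bsub>U\<^esub> e) \<otimes>\<^bsub>U\<^esub> (f \<otimes>\<^bsub>U\<^esub> l)
        \<oplus>\<^bsub>U\<^esub> c \<odot>\<^bsub>U\<^esub> (k \<oplus>\<^bsub>U\<^esub> (- 1) \<odot>\<^bsub>U\<^esub> g (Inv (Omega' i))))"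
        unfolding 5 using kl ef 10 by (simp add: lin_add[OF \<xi>] lin_smult[OF \<xi>] algebra_simps)
    qed (use kl ef 10 in simp_all)
    show ?case using 6 10 kl ef
      by (simp add: antipode_E antipode_F c_def e_def f_def k_def l_def del: antipode_gen.simps(1,2))
  next
    case (11 i j)
    then have "weight n rr ss i j = 1" "weight n rr ss j i = 1"
      using weight_far[OF n] inner_prod_commute[of n "alpha n i"] by metis+
    then have q: "g (GenE i) \<otimes>\<^bsub>U\<^esub> g (Inv (Omega j)) = g (Inv (Omega j)) \<otimes>\<^bsub>U\<^esub> g (GenE i)"
      "g (GenE j) \<otimes>\<^bsub>U\<^esub> g (Inv (Omega i)) = g (Inv (Omega i)) \<otimes>\<^bsub>U\<^esub> g (GenE j)"
      "g (Inv (Omega j)) \<otimes>\<^bsub>U\<^esub> g (Inv (Omega i)) = g (Inv (Omega i)) \<otimes>\<^bsub>U\<^esub> g (Inv (Omega j))"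
      "g (GenE j) \<otimes>\<^bsub>U\<^esub> g (GenE i) = g (GenE i) \<otimes>\<^bsub>U\<^esub> g (GenE j)"
      using E_Inv[of "Omega j" i] E_Inv[of "Omega i" j] 11 comm G.E_E[OF 11] by auto
    have lc: "x \<otimes>\<^bsub>U\<^esub> (y \<otimes>\<^bsub>U\<^esub> z) = y \<otimes>\<^bsub>U\<^esub> (x \<otimes>\<^bsub>U\<^esub> z)"
      if "x \<otimes>\<^bsub>U\<^esub> y = y \<otimes>\<^bsub>U\<^esub> x" "x \<in> carrier U" "y \<in> carrier U" "z \<in> carrier U" for x y z
      using left_commute_rule[of U x y z 1] that by simp
    show ?case using 11 q(4)
      by (simp add: antipode_E alg_assoc q(1-3) lc[OF q(1)] lc[OF q(2)] lc[OF q(3)] lc[OF q(4)] del: antipode_gen.simps(1))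
  next
    case (12 i j)
    then have "weight n ss rr i j = 1" "weight n ss rr j i = 1"
      using weight_far[OF n] inner_prod_commute[of n "alpha n i"] by metis+
    then have q: "g (GenF i) \<otimes>\<^bsub>U\<^esub> g (Inv (Omega' j)) = g (Inv (Omega' j)) \<otimes>\<^bsub>U\<^esub> g (GenF i)"
      "g (GenF j) \<otimes>\<^bsub>U\<^esub> g (Inv (Omega' i)) = g (Inv (Omega' i)) \<otimes>\<^bsub>U\<^esub> g (GenF j)"
      "g (Inv (Omega' j)) \<otimes>\<^bsub>U\<^esub> g (Inv (Omega' i)) = g (Inv (Omega' i)) \<otimes>\<^bsub>U\<^esub> g (Inv (Omega' j))"
      "g (GenF j) \<otimes>\<^bsub>U\<^esub> g (GenF i) = g (GenF i) \<otimes>\<^bsub>U\<^esub> g (GenF j)"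
      using F_Inv[of "Omega' j" i] F_Inv[of "Omega' i" j] 12 comm G.F_F[OF 12] by auto
    have lc: "x \<otimes>\<^bsub>U\<^esub> (y \<otimes>\<^bsub>U\<^esub> z) = y \<otimes>\<^bsub>U\<^esub> (x \<otimes>\<^bsub>U\<^esub> z)"
      if "x \<otimes>\<^bsub>U\<^esub> y = y \<otimes>\<^bsub>U\<^esub> x" "x \<in> carrier U" "y \<in> carrier U" "z \<in> carrier U" for x y z
      using left_commute_rule[of U x y z 1] that by simp
    show ?case using 12 q(4)
      by (simp add: antipode_F F_Inv[of "Omega' _"] alg_assoc q(1-3) lc[OF q(1)] lc[OF q(2)] lc[OF q(3)] lc[OF q(4)]
          mult.commute[of "inverse (weight n ss rr j j)"] del: antipode_gen.simps(2))
  next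
    case (13 i j)
    have "serre (opposite U) rr ss (g (Inv (Omega i)) \<otimes>\<^bsub>U\<^esub> g (GenE i)) (g (Inv (Omega j)) \<otimes>\<^bsub>U\<^esub> g (GenE j)) = \<zero>\<^bsub>U\<^esub>"
      using 13 by (intro serre_twist) (simp_all add: E_Inv w comm G.Serre_E1)
    then show ?case using 13
      by (simp add: antipode_E serre_scale[of "opposite U", simplified] del: antipode_gen.simps(1))
  next
    case (14 i j)
    \<comment> \<open>\<open>serre_twist\<close> is applied inside the opposite algebra, whose
      opposite is U again; the reversed exchange rules interchange r and s.\<close>
    have "serre (opposite (opposite U)) ss rr (g (Inv (Omega j)) \<otimes>\<^bsub>opposite U\<^esub> g (GenE j))
        (g (Inv (Omega i)) \<otimes>\<^bsub>opposite U\<^esub> g (GenE i)) = \<zero>\<^bsub>opposite U\<^esub>"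
      using 14 by (intro serre_twist)
        (simp_all add: G.Inv_E w comm serre_commute[of _ ss rr] G.Serre_E2)
    then show ?case using 14
      by (simp add: antipode_E G.Inv_E serre_scale serre_commute[of _ ss rr] del: antipode_gen.simps(1))
  next
    case (15 i j)
    have "serre (opposite U) (inverse ss) (inverse rr) (g (Inv (Omega' i)) \<otimes>\<^bsub>U\<^esub> g (GenF i)) (g (Inv (Omega' j)) \<otimes>\<^bsub>U\<^esub> g (GenF j)) = \<zero>\<^bsub>U\<^esub>"
      using 15 by (intro serre_twist)
        (simp_all add: F_Inv w comm serre_commute[of _ "1 / ss" "1 / rr"] G.Serre_F1[unfolded inverse_eq_divide] field_simps)
    then show ?case using 15
      by (simp add: antipode_F F_Inv serre_commute[of _ "inverse ss" "inverse rr"]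
          serre_scale[of "opposite U", simplified] del: antipode_gen.simps(2))
  next
    case (16 i j)
    have "serre (opposite (opposite U)) (inverse rr) (inverse ss) (g (Inv (Omega' j)) \<otimes>\<^bsub>opposite U\<^esub> g (GenF j))
        (g (Inv (Omega' i)) \<otimes>\<^bsub>opposite U\<^esub> g (GenF i)) = \<zero>\<^bsub>opposite U\<^esub>"
      using 16 by (intro serre_twist)
        (simp_all add: G.Inv_F w comm G.Serre_F2[unfolded inverse_eq_divide] field_simps)
    then show ?case using 16
      by (simp add: antipode_F serre_scale del: antipode_gen.simps(2))
  qed
qed

end

section \<open>Hopf algebras generated by group-like and skew-primitive elements\<close>

lemma alg_hom_eq_on_generators:
  assumes A: "assoc_algebra A" "S \<subseteq> carrier A" "carrier A = subalg A S"
    and f: "f \<in> algebra_hom A B" and g: "g \<in> algebra_hom A B"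
    and eq: "\<And>s. s \<in> S \<Longrightarrow> f s = g s" and x: "x \<in> carrier A"
  shows "f x = g x"
proof -
  have "x \<in> subalg A S" using x A by simp
  then show ?thesis
  proof induct
    case one then show ?case by (simp add: alg_hom_one[OF f] alg_hom_one[OF g])
  next
    case (mult s x)
    then have "s \<in> carrier A" "x \<in> carrier A" using A by auto
    then show ?case using mult by (simp add: eq alg_hom_mult[OF f] alg_hom_mult[OF g])
  next
    case (add x y)
    then show ?case using A by (simp add: lin_add[OF alg_hom_lin[OF f]] lin_add[OF alg_hom_lin[OF g]])
  next
    case (smult x c)
    then show ?case using A by (simp add: lin_smult[OF alg_hom_lin[OF f]] lin_smult[OF alg_hom_lin[OF g]])
  qed
qed

definition grouplike_elem :: "('k::field, 'a, 'm) hopf_scheme \<Rightarrow> 'a \<Rightarrow> bool" where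
  "grouplike_elem H k \<longleftrightarrow> k \<in> carrier H \<and> comult H k = tensor H H k k \<and> counit H k = 1"

text \<open>Two group-like elements are needed to treat e_i, with (l, k) = (\<omega>_i, 1), and f_i,
  with (l, k) = (1, \<omega>'_i), alike.\<close>

definition skew_primitive :: "('k::field, 'a, 'm) hopf_scheme \<Rightarrow> 'a \<Rightarrow> 'a \<Rightarrow> 'a \<Rightarrow> bool" where
  "skew_primitive H l k s \<longleftrightarrow> s \<in> carrier H \<and> grouplike_elem H k \<and> grouplike_elem H l \<and>
     comult H s = tensor H H s k \<oplus>\<^bsub>tensor_module H H\<^esub> tensor H H l s \<and> counit H s = 0"

lemma sweedler2_lin:
  assumes "vspace H" "vspace V" "comult H \<in> linear_maps H (tensor_module H H)" "bilin H H V f"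
  shows "sweedler2 H V f \<in> linear_maps H V"
  unfolding sweedler2_def using lin_comp[OF assms(3) tensor_lift_lin[OF assms(1,1,2,4)]] by simp

lemma sweedler2_grouplike:
  assumes "vspace H" "vspace V" "bilin H H V f" "grouplike_elem H k"
  shows "sweedler2 H V f k = f k k"
  using assms by (simp add: sweedler2_def grouplike_elem_def)

lemma sweedler2_skew_primitive:
  assumes "vspace H" "vspace V" "bilin H H V f" "skew_primitive H l k s"
  shows "sweedler2 H V f s = f s k \<oplus>\<^bsub>V\<^esub> f l s"
  using assms by (simp add: sweedler2_def grouplike_elem_def skew_primitive_def tensor_lift_add)

lemma tensor_assoc_modules:
  "tensor_module H (tensor_algebra H H) = tensor_module H (tensor_module H H)"
  "tensor H (tensor_algebra H H) = tensor H (tensor_module H H)"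
  by (rule tensor_module_cong; simp)+

text \<open>Coassociativity and the counit laws equate two algebra homomorphisms, so they are tested
  on generators. The antipode laws do not, since S reverses products; there \<open>\<mu>1\<close>
  and \<open>\<mu>2\<close> show that the laws survive multiplication by a generator.\<close>

lemma hopf_algebraI_generated:
  fixes H :: "('k::field, 'a, 'm) hopf_scheme"
  assumes A: "assoc_algebra H" and S: "S \<subseteq> carrier H" "carrier H = subalg H S"
    and comult: "comult H \<in> algebra_hom H (tensor_algebra H H)"
    and counit: "counit H \<in> algebra_hom H scalars"
    and antipode: "antipode H \<in> linear_maps H H" "antipode H \<one>\<^bsub>H\<^esub> = \<one>\<^bsub>H\<^esub>"
      "\<And>x y. x \<in> carrier H \<Longrightarrow> y \<in> carrier H \<Longrightarrow>
        antipode H (x \<otimes>\<^bsub>H\<^esub> y) = antipode H y \<otimes>\<^bsub>H\<^esub> antipode H x"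
    and gens: "\<And>s. s \<in> S \<Longrightarrow>
      (grouplike_elem H s \<and> antipode H s \<otimes>\<^bsub>H\<^esub> s = \<one>\<^bsub>H\<^esub> \<and> s \<otimes>\<^bsub>H\<^esub> antipode H s = \<one>\<^bsub>H\<^esub>) \<or>
      (\<exists>l k. skew_primitive H l k s \<and>
        antipode H s \<otimes>\<^bsub>H\<^esub> k \<oplus>\<^bsub>H\<^esub> antipode H l \<otimes>\<^bsub>H\<^esub> s = \<zero>\<^bsub>H\<^esub> \<and>
        s \<otimes>\<^bsub>H\<^esub> antipode H k \<oplus>\<^bsub>H\<^esub> l \<otimes>\<^bsub>H\<^esub> antipode H s = \<zero>\<^bsub>H\<^esub>)"
  shows "hopf_algebra H"
proof -
  define T where "T = tensor_module H H"
  define TA where "TA = tensor_algebra H H"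
  define H3 where "H3 = tensor_module H T"
  define H3A where "H3A = tensor_algebra H TA"
  define pure where "pure a b c = tensor H T a (tensor H H b c)" for a b c
  have VH: "vspace H" and VT: "vspace T" and VH3: "vspace H3"
    using A by (simp_all add: T_def H3_def)
  have TA: "assoc_algebra TA" and H3A: "assoc_algebra H3A"
    using A by (simp_all add: TA_def H3A_def)
  have H3A': "tensor_module H TA = H3" "tensor H TA = tensor H T"
    unfolding H3_def TA_def T_def by (rule tensor_assoc_modules)+
  have H3A_simps: "carrier H3A = carrier H3" "add H3A = add H3" "smult H3A = smult H3" "zero H3A = zero H3"
    "linear_maps N H3A = linear_maps N H3" "bilin M N H3A = bilin M N H3" for M :: "('k, 'a, 'm) hopf_scheme" and N :: "('k, 'a, 'm) hopf_scheme"
    unfolding H3A_def by (simp_all add: H3A')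
  have \<Delta>l: "comult H \<in> linear_maps H T" using alg_hom_lin[OF comult] by (simp add: T_def)
  note \<Delta>c = lin_closed[OF \<Delta>l]
  have bt: "bilin H H T (tensor H H)" unfolding T_def by (rule bilin_tensor[OF VH VH])
  have bt3: "bilin H T H3 (tensor H T)" unfolding H3_def by (rule bilin_tensor[OF VH VT])
  have pure_c: "pure a b c \<in> carrier H3" if "a \<in> carrier H" "b \<in> carrier H" "c \<in> carrier H" for a b c
    unfolding pure_def using that by (intro bilinD(3)[OF bt3] bilinD(3)[OF bt])
  have pl1: "(\<lambda>a. pure a b c) \<in> linear_maps H H3" if "b \<in> carrier H" "c \<in> carrier H" for b c
    unfolding pure_def using that by (intro bilinD(2)[OF bt3] bilinD(3)[OF bt])
  have pl2: "(\<lambda>b. pure a b c) \<in> linear_maps H H3" if "a \<in> carrier H" "c \<in> carrier H" for a c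
    unfolding pure_def using that by (intro lin_comp[OF bilinD(2)[OF bt] bilinD(1)[OF bt3]])
  have pl3: "(\<lambda>c. pure a b c) \<in> linear_maps H H3" if "a \<in> carrier H" "b \<in> carrier H" for a b
    unfolding pure_def using that by (intro lin_comp[OF bilinD(1)[OF bt] bilinD(1)[OF bt3]])
  have pb12: "bilin H H H3 (\<lambda>a b. pure a b c)" if "c \<in> carrier H" for c
    using that by (intro bilinI pl1 pl2)
  have pb23: "bilin H H H3 (\<lambda>b c. pure a b c)" if "a \<in> carrier H" for a
    using that by (intro bilinI pl2 pl3)
  have pure_mult: "pure a b c \<otimes>\<^bsub>H3A\<^esub> pure a' b' c' = pure (a \<otimes>\<^bsub>H\<^esub> a') (b \<otimes>\<^bsub>H\<^esub> b') (c \<otimes>\<^bsub>H\<^esub> c')"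
    if "a \<in> carrier H" "b \<in> carrier H" "c \<in> carrier H" "a' \<in> carrier H" "b' \<in> carrier H" "c' \<in> carrier H"
    for a b c a' b' c'
    using that A TA unfolding pure_def H3A_def H3A'(2)[symmetric]
    by (subst tensor_mult_tensor) (simp_all add: TA_def)
  have one3: "\<one>\<^bsub>H3A\<^esub> = pure \<one>\<^bsub>H\<^esub> \<one>\<^bsub>H\<^esub> \<one>\<^bsub>H\<^esub>"
    unfolding pure_def H3A_def by (simp add: H3A' flip: T_def) (simp add: TA_def)

  have R_inner: "sweedler2 H H3 (\<lambda>b c. pure a b c) y = tensor H T a (comult H y)"
    if "a \<in> carrier H" "y \<in> carrier H" for a y
    unfolding sweedler2_def
    by (rule tensor_ext[OF VH VH tensor_lift_lin[OF VH VH VH3 pb23[OF that(1)]]])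
       (use that tensor_lift_tensor[OF VH VH VH3 pb23[OF that(1)]] in
         \<open>simp_all add: VH VH3 bilinD(1)[OF bt3] \<Delta>c T_def[symmetric] pure_def\<close>)
  have Rb: "bilin H H H3 (\<lambda>a y. tensor H T a (comult H y))"
    by (rule bilin_comp[OF bt3 lin_id \<Delta>l])
  have R_eq: "sweedler2 H H3 (\<lambda>a y. sweedler2 H H3 (\<lambda>b c. pure a b c) y) x =
      tensor_lift H3 (\<lambda>a y. tensor H T a (comult H y)) (comult H x)" if "x \<in> carrier H" for x
    unfolding sweedler2_def[of H H3 _ x]
    by (rule tensor_lift_cong[OF VH VH VH3 Rb]) (use \<Delta>c[OF that] in \<open>simp_all add: R_inner T_def\<close>)
  have R_hom: "tensor_lift H3A (\<lambda>a y. tensor H T a (comult H y)) \<in> algebra_hom TA H3A"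
    unfolding TA_def
  proof (rule tensor_lift_alg_hom[OF A A H3A])
    show "bilin H H H3A (\<lambda>a y. tensor H T a (comult H y))" using Rb by (simp add: H3A_simps)
    show "tensor H T \<one>\<^bsub>H\<^esub> (comult H \<one>\<^bsub>H\<^esub>) = \<one>\<^bsub>H3A\<^esub>"
      using alg_hom_one[OF comult] by (simp add: one3 pure_def)
    fix a a' b b' assume c: "a \<in> carrier H" "a' \<in> carrier H" "b \<in> carrier H" "b' \<in> carrier H"
    then show "tensor H T (a \<otimes>\<^bsub>H\<^esub> a') (comult H (b \<otimes>\<^bsub>H\<^esub> b')) =
        tensor H T a (comult H b) \<otimes>\<^bsub>H3A\<^esub> tensor H T a' (comult H b')"
      using \<Delta>c A TA unfolding H3A_def H3A'(2)[symmetric]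
      by (subst tensor_mult_tensor) (simp_all add: alg_hom_mult[OF comult] TA_def T_def)
  qed
  \<comment> \<open>The rebracketing (a \<otimes> b) \<otimes> c \<mapsto> a \<otimes> (b \<otimes>
    c) with c as a parameter; it places both sides of coassociativity in the same tensor
    cube.\<close>
  define q where "q c t = tensor_lift H3 (\<lambda>a b. pure a b c) t" for c t
  have q_lin: "q c \<in> linear_maps T H3" if "c \<in> carrier H" for c
    unfolding q_def T_def by (rule tensor_lift_lin[OF VH VH VH3 pb12[OF that]])
  have q_lin2: "(\<lambda>c. q c t) \<in> linear_maps H H3" if "t \<in> carrier T" for t
    unfolding q_def by (rule tensor_lift_param[OF VH VH VH3 pb12 VH pl3 that[unfolded T_def]])
  have q_pure: "q c (tensor H H a b) = pure a b c"
    if "a \<in> carrier H" "b \<in> carrier H" "c \<in> carrier H" for a b c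
    using that by (simp add: q_def VH VH3 pb12)
  have Lb: "bilin H H H3 (\<lambda>y c. q c (comult H y))"
    by (intro bilinI q_lin2 lin_comp[OF \<Delta>l q_lin] \<Delta>c)
  have q_mult: "q (c \<otimes>\<^bsub>H\<^esub> c') (t \<otimes>\<^bsub>TA\<^esub> u) = q c t \<otimes>\<^bsub>H3A\<^esub> q c' u"
    if c: "c \<in> carrier H" "c' \<in> carrier H" and t: "t \<in> carrier T" and u: "u \<in> carrier T" for c c' t u
  proof -
    note mt = bilin_mult[OF TA] and m3 = bilin_mult[OF H3A]
    have TAs: "carrier TA = carrier T" "add TA = add T" by (simp_all add: TA_def T_def)
    from t[unfolded T_def] show ?thesis
    proof (induct t rule: tensor_induct[OF VH VH, consumes 1, case_names pure add])
      case (pure a b)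
      from u[unfolded T_def] show ?case
      proof (induct u rule: tensor_induct[OF VH VH, consumes 1, case_names pure add])
        case (pure a' b')
        then show ?case using \<open>a \<in> carrier H\<close> \<open>b \<in> carrier H\<close> c A
          by (simp add: TA_def q_pure pure_mult)
      next
        case (add u v)
        then show ?case using \<open>a \<in> carrier H\<close> \<open>b \<in> carrier H\<close> c A TA H3A VH
          using alg_r_distr[OF TA, of u v "tensor H H a b"] alg_mult_closed[OF TA, of "tensor H H a b"]
            alg_r_distr[OF H3A, of "q c' u" "q c' v" "q c (tensor H H a b)"]
          by (simp add: TAs[unfolded T_def] H3A_simps lin_add[OF q_lin, unfolded T_def]
              lin_closed[OF q_lin, unfolded T_def] q_pure pure_c)
      qed
    next
      case (add t v)
      then show ?case using u c A TA H3A VH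
        using alg_l_distr[OF TA, of t v u] alg_mult_closed[OF TA, of _ u]
          alg_l_distr[OF H3A, of "q c t" "q c v" "q c' u"]
        by (simp add: TAs[unfolded T_def] H3A_simps lin_add[OF q_lin, unfolded T_def]
            lin_closed[OF q_lin, unfolded T_def] T_def)
    qed
  qed
  have L_eq: "sweedler3 H H3 pure x = tensor_lift H3 (\<lambda>y c. q c (comult H y)) (comult H x)" for x
    by (simp add: sweedler3_def sweedler2_def q_def)
  have L_hom: "tensor_lift H3A (\<lambda>y c. q c (comult H y)) \<in> algebra_hom TA H3A"
    unfolding TA_def
  proof (rule tensor_lift_alg_hom[OF A A H3A])
    show "bilin H H H3A (\<lambda>y c. q c (comult H y))" using Lb by (simp add: H3A_simps)
    show "q \<one>\<^bsub>H\<^esub> (comult H \<one>\<^bsub>H\<^esub>) = \<one>\<^bsub>H3A\<^esub>"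
      using alg_hom_one[OF comult] A by (simp add: one3 q_pure)
    fix a a' b b' assume c: "a \<in> carrier H" "a' \<in> carrier H" "b \<in> carrier H" "b' \<in> carrier H"
    then show "q (b \<otimes>\<^bsub>H\<^esub> b') (comult H (a \<otimes>\<^bsub>H\<^esub> a')) = q b (comult H a) \<otimes>\<^bsub>H3A\<^esub> q b' (comult H a')"
      using q_mult \<Delta>c by (simp add: alg_hom_mult[OF comult] TA_def)
  qed
  \<comment> \<open>\<open>tensor_lift\<close> sees only the vector space structure of its target,
    so algebra and module versions coincide.\<close>
  have lift_H3A: "tensor_lift H3A f = tensor_lift H3 f" for f :: "'a \<Rightarrow> 'a \<Rightarrow> _"
    by (simp add: fun_eq_iff tensor_lift_def finsum_def finprod_def H3A_simps)
  have coassoc: "sweedler3 H H3 pure x = sweedler2 H H3 (\<lambda>a y. sweedler2 H H3 (\<lambda>b c. pure a b c) y) x"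
    if x: "x \<in> carrier H" for x
    unfolding L_eq R_eq[OF x]
  proof (rule alg_hom_eq_on_generators[OF A S])
    show "(\<lambda>x. tensor_lift H3 (\<lambda>y c. q c (comult H y)) (comult H x)) \<in> algebra_hom H H3A"
      using alg_hom_comp[OF comult L_hom[unfolded TA_def]] by (simp add: lift_H3A)
    show "(\<lambda>x. tensor_lift H3 (\<lambda>a y. tensor H T a (comult H y)) (comult H x)) \<in> algebra_hom H H3A"
      using alg_hom_comp[OF comult R_hom[unfolded TA_def]] by (simp add: lift_H3A)
    fix s assume s: "s \<in> S"
    show "tensor_lift H3 (\<lambda>y c. q c (comult H y)) (comult H s) =
        tensor_lift H3 (\<lambda>a y. tensor H T a (comult H y)) (comult H s)"
      using gens[OF s]
    proof (elim disjE exE conjE)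
      assume "grouplike_elem H s"
      then show ?thesis by (simp add: grouplike_elem_def VH VH3 Lb Rb q_pure) (simp add: pure_def)
    next
      fix l k assume "skew_primitive H l k s"
      then have sk: "s \<in> carrier H" "k \<in> carrier H" "l \<in> carrier H" "comult H k = tensor H H k k"
        "comult H l = tensor H H l l" "comult H s = tensor H H s k \<oplus>\<^bsub>T\<^esub> tensor H H l s"
        by (simp_all add: skew_primitive_def grouplike_elem_def T_def)
      have tc: "tensor H H s k \<in> carrier T" "tensor H H l s \<in> carrier T"
        using sk VH by (simp_all add: T_def)
      have "tensor_lift H3 (\<lambda>y c. q c (comult H y)) (comult H s) =
          q k (comult H s) \<oplus>\<^bsub>H3\<^esub> q s (comult H l)"
        using tc sk by (simp add: T_def tensor_lift_add[OF VH VH VH3 Lb] VH VH3 Lb)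
      also have "\<dots> = pure s k k \<oplus>\<^bsub>H3\<^esub> pure l s k \<oplus>\<^bsub>H3\<^esub> pure l l s"
        using sk tc by (simp add: lin_add[OF q_lin] q_pure)
      also have "\<dots> = pure s k k \<oplus>\<^bsub>H3\<^esub> (pure l s k \<oplus>\<^bsub>H3\<^esub> pure l l s)"
        using sk by (simp add: vs_assoc VH3 pure_c)
      also have "\<dots> = tensor H T s (comult H k) \<oplus>\<^bsub>H3\<^esub> tensor H T l (comult H s)"
        using sk tc lin_add[OF bilinD(1)[OF bt3], of l "tensor H H s k" "tensor H H l s"]
        by (simp add: pure_def)
      also have "\<dots> = tensor_lift H3 (\<lambda>a y. tensor H T a (comult H y)) (comult H s)"
        unfolding sk(6) tensor_lift_add[OF VH VH VH3 Rb, folded T_def, OF tc]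
        using sk by (simp add: VH VH3 Rb)
      finally show ?thesis .
    qed
  qed (rule x)

  note \<epsilon>l = alg_hom_lin[OF counit]
  have Eb: "bilin H H H (\<lambda>a b. counit H a \<odot>\<^bsub>H\<^esub> b)" "bilin H H H (\<lambda>a b. counit H b \<odot>\<^bsub>H\<^esub> a)"
    using VH by (auto intro!: bilinI lin_smultI lin_id lin_scalar \<epsilon>l)
  have counit_axiom: "sweedler2 H H (\<lambda>a b. counit H a \<odot>\<^bsub>H\<^esub> b) x = x"
    "sweedler2 H H (\<lambda>a b. counit H b \<odot>\<^bsub>H\<^esub> a) x = x" if x: "x \<in> carrier H" for x
  proof -
    have hom: "(\<lambda>x. tensor_lift H f (comult H x)) \<in> algebra_hom H H"
      if "f = (\<lambda>a b. counit H a \<odot>\<^bsub>H\<^esub> b) \<or> f = (\<lambda>a b. counit H b \<odot>\<^bsub>H\<^esub> a)" for f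
      by (rule alg_hom_comp[OF comult tensor_lift_alg_hom[OF A A A]])
         (use that Eb alg_hom_one[OF counit] A in \<open>auto simp: alg_hom_mult[OF counit] mult.commute\<close>)
    have id: "(\<lambda>x. x) \<in> algebra_hom H H" by (rule alg_homI[OF lin_id]) simp_all
    show "sweedler2 H H (\<lambda>a b. counit H a \<odot>\<^bsub>H\<^esub> b) x = x"
      unfolding sweedler2_def
    proof (rule alg_hom_eq_on_generators[OF A S hom id _ x], simp)
      fix s assume "s \<in> S"
      then show "tensor_lift H (\<lambda>a b. counit H a \<odot>\<^bsub>H\<^esub> b) (comult H s) = s"
        using gens[of s] sweedler2_grouplike[OF VH VH Eb(1)] sweedler2_skew_primitive[OF VH VH Eb(1)] VH
        by (auto simp: sweedler2_def grouplike_elem_def skew_primitive_def)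
    qed
    show "sweedler2 H H (\<lambda>a b. counit H b \<odot>\<^bsub>H\<^esub> a) x = x"
      unfolding sweedler2_def
    proof (rule alg_hom_eq_on_generators[OF A S hom id _ x], simp)
      fix s assume "s \<in> S"
      then show "tensor_lift H (\<lambda>a b. counit H b \<odot>\<^bsub>H\<^esub> a) (comult H s) = s"
        using gens[of s] sweedler2_grouplike[OF VH VH Eb(2)] sweedler2_skew_primitive[OF VH VH Eb(2)] VH
        by (auto simp: sweedler2_def grouplike_elem_def skew_primitive_def)
    qed
  qed

  note Sc = lin_closed[OF antipode(1)]
  have Sb: "bilin H H H (\<lambda>a b. antipode H a \<otimes>\<^bsub>H\<^esub> b)" "bilin H H H (\<lambda>a b. a \<otimes>\<^bsub>H\<^esub> antipode H b)"
    by (rule bilin_comp[OF bilin_mult[OF A]] antipode lin_id)+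
  define \<mu> where "\<mu> = tensor_lift H (\<lambda>a b. antipode H a \<otimes>\<^bsub>H\<^esub> b)"
  define \<mu>' where "\<mu>' = tensor_lift H (\<lambda>a b. a \<otimes>\<^bsub>H\<^esub> antipode H b)"
  have \<mu>l: "\<mu> \<in> linear_maps T H" "\<mu>' \<in> linear_maps T H"
    unfolding \<mu>_def \<mu>'_def T_def by (rule tensor_lift_lin[OF VH VH VH] Sb)+
  have \<mu>p: "\<mu> (tensor H H a b) = antipode H a \<otimes>\<^bsub>H\<^esub> b" "\<mu>' (tensor H H a b) = a \<otimes>\<^bsub>H\<^esub> antipode H b"
    if "a \<in> carrier H" "b \<in> carrier H" for a b
    using that by (simp_all add: \<mu>_def \<mu>'_def VH Sb)
  have TAs: "carrier TA = carrier T" "add TA = add T" "smult TA = smult T" by (simp_all add: TA_def T_def)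
  have TAl: "(\<lambda>t. t \<otimes>\<^bsub>TA\<^esub> u) \<in> linear_maps T T" "(\<lambda>t. u \<otimes>\<^bsub>TA\<^esub> t) \<in> linear_maps T T" if "u \<in> carrier T" for u
    using lin_mult_right[OF TA, of u] lin_mult_left[OF TA, of u] that
    by (simp_all add: linear_maps_def TAs)
  \<comment> \<open>On pure u = a \<otimes> b the left side is S(a) \<mu>(t) b, because S reverses
    products, and the scalar \<mu>(t) can be taken out. For t = \<Delta>(s) and u = \<Delta>(x) this
    is the step from x to s x in the antipode law.\<close>
  have \<mu>1: "\<mu> (t \<otimes>\<^bsub>TA\<^esub> u) = c \<odot>\<^bsub>H\<^esub> \<mu> u"
    if t: "t \<in> carrier T" "\<mu> t = c \<odot>\<^bsub>H\<^esub> \<one>\<^bsub>H\<^esub>" and u: "u \<in> carrier T" for t u c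
  proof (rule tensor_ext[OF VH VH _ _ _ u[unfolded T_def]])
    show "(\<lambda>u. \<mu> (t \<otimes>\<^bsub>TA\<^esub> u)) \<in> linear_maps (tensor_module H H) H"
      using lin_comp[OF TAl(2)[OF t(1)] \<mu>l(1)] by (simp add: T_def)
    show "(\<lambda>u. c \<odot>\<^bsub>H\<^esub> \<mu> u) \<in> linear_maps (tensor_module H H) H"
      using lin_smultI[OF VH \<mu>l(1)] by (simp add: T_def)
    fix a b assume ab: "a \<in> carrier H" "b \<in> carrier H"
    have abT: "tensor H H a b \<in> carrier T" using ab VH by (simp add: T_def)
    have "\<mu> (t \<otimes>\<^bsub>TA\<^esub> tensor H H a b) = antipode H a \<otimes>\<^bsub>H\<^esub> \<mu> t \<otimes>\<^bsub>H\<^esub> b"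
    proof (rule tensor_ext[OF VH VH _ _ _ t(1)[unfolded T_def]])
      show "(\<lambda>t. \<mu> (t \<otimes>\<^bsub>TA\<^esub> tensor H H a b)) \<in> linear_maps (tensor_module H H) H"
        using lin_comp[OF TAl(1)[OF abT] \<mu>l(1)] by (simp add: T_def)
      show "(\<lambda>t. antipode H a \<otimes>\<^bsub>H\<^esub> \<mu> t \<otimes>\<^bsub>H\<^esub> b) \<in> linear_maps (tensor_module H H) H"
        using lin_comp[OF lin_comp[OF \<mu>l(1) lin_mult_left[OF A Sc[OF ab(1)]]] lin_mult_right[OF A ab(2)]]
        by (simp add: T_def)
    qed (use ab A in \<open>simp_all add: TA_def \<mu>p antipode Sc alg_assoc\<close>)
    then show "\<mu> (t \<otimes>\<^bsub>TA\<^esub> tensor H H a b) = c \<odot>\<^bsub>H\<^esub> \<mu> (tensor H H a b)"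
      using ab t(2) A by (simp add: \<mu>p Sc)
  qed
  have \<mu>2: "\<mu>' (t \<otimes>\<^bsub>TA\<^esub> u) = c \<odot>\<^bsub>H\<^esub> \<mu>' t"
    if u: "u \<in> carrier T" "\<mu>' u = c \<odot>\<^bsub>H\<^esub> \<one>\<^bsub>H\<^esub>" and t: "t \<in> carrier T" for t u c
  proof (rule tensor_ext[OF VH VH _ _ _ t[unfolded T_def]])
    show "(\<lambda>t. \<mu>' (t \<otimes>\<^bsub>TA\<^esub> u)) \<in> linear_maps (tensor_module H H) H"
      using lin_comp[OF TAl(1)[OF u(1)] \<mu>l(2)] by (simp add: T_def)
    show "(\<lambda>t. c \<odot>\<^bsub>H\<^esub> \<mu>' t) \<in> linear_maps (tensor_module H H) H"
      using lin_smultI[OF VH \<mu>l(2)] by (simp add: T_def)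
    fix a b assume ab: "a \<in> carrier H" "b \<in> carrier H"
    have abT: "tensor H H a b \<in> carrier T" using ab VH by (simp add: T_def)
    have "\<mu>' (tensor H H a b \<otimes>\<^bsub>TA\<^esub> u) = a \<otimes>\<^bsub>H\<^esub> \<mu>' u \<otimes>\<^bsub>H\<^esub> antipode H b"
    proof (rule tensor_ext[OF VH VH _ _ _ u(1)[unfolded T_def]])
      show "(\<lambda>u. \<mu>' (tensor H H a b \<otimes>\<^bsub>TA\<^esub> u)) \<in> linear_maps (tensor_module H H) H"
        using lin_comp[OF TAl(2)[OF abT] \<mu>l(2)] by (simp add: T_def)
      show "(\<lambda>u. a \<otimes>\<^bsub>H\<^esub> \<mu>' u \<otimes>\<^bsub>H\<^esub> antipode H b) \<in> linear_maps (tensor_module H H) H"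
        using lin_comp[OF lin_comp[OF \<mu>l(2) lin_mult_left[OF A ab(1)]] lin_mult_right[OF A Sc[OF ab(2)]]]
        by (simp add: T_def)
    qed (use ab A in \<open>simp_all add: TA_def \<mu>p antipode Sc alg_assoc\<close>)
    then show "\<mu>' (tensor H H a b \<otimes>\<^bsub>TA\<^esub> u) = c \<odot>\<^bsub>H\<^esub> \<mu>' (tensor H H a b)"
      using ab u(2) A by (simp add: \<mu>p Sc)
  qed
  have antipode_axiom: "\<mu> (comult H x) = counit H x \<odot>\<^bsub>H\<^esub> \<one>\<^bsub>H\<^esub> \<and> \<mu>' (comult H x) = counit H x \<odot>\<^bsub>H\<^esub> \<one>\<^bsub>H\<^esub>"
    if "x \<in> carrier H" for x
  proof -
    have gen: "\<mu> (comult H s) = counit H s \<odot>\<^bsub>H\<^esub> \<one>\<^bsub>H\<^esub> \<and> \<mu>' (comult H s) = counit H s \<odot>\<^bsub>H\<^esub> \<one>\<^bsub>H\<^esub>"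
      if s: "s \<in> S" for s
      using gens[OF s]
    proof (elim disjE exE conjE)
      assume "grouplike_elem H s" "antipode H s \<otimes>\<^bsub>H\<^esub> s = \<one>\<^bsub>H\<^esub>" "s \<otimes>\<^bsub>H\<^esub> antipode H s = \<one>\<^bsub>H\<^esub>"
      then show ?thesis using A by (simp add: grouplike_elem_def \<mu>p)
    next
      fix l k assume sk: "skew_primitive H l k s" and z:
        "antipode H s \<otimes>\<^bsub>H\<^esub> k \<oplus>\<^bsub>H\<^esub> antipode H l \<otimes>\<^bsub>H\<^esub> s = \<zero>\<^bsub>H\<^esub>"
        "s \<otimes>\<^bsub>H\<^esub> antipode H k \<oplus>\<^bsub>H\<^esub> l \<otimes>\<^bsub>H\<^esub> antipode H s = \<zero>\<^bsub>H\<^esub>"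
      show ?thesis
        using sweedler2_skew_primitive[OF VH VH Sb(1) sk] sweedler2_skew_primitive[OF VH VH Sb(2) sk] sk z A
        by (simp add: sweedler2_def \<mu>_def \<mu>'_def skew_primitive_def)
    qed
    have "x \<in> subalg H S" using that S by simp
    then show ?thesis
    proof induct
      case one
      show ?case using alg_hom_one[OF comult] alg_hom_one[OF counit] A by (simp add: \<mu>p antipode)
    next
      case (mult s x)
      have c: "s \<in> carrier H" "x \<in> carrier H" using mult S by auto
      show ?case
        using \<mu>1[OF \<Delta>c[OF c(1)] _ \<Delta>c[OF c(2)], of "counit H s"] \<mu>2[OF \<Delta>c[OF c(2)] _ \<Delta>c[OF c(1)], of "counit H x"]
          gen[OF mult(1)] mult(3) c A
        by (simp add: alg_hom_mult[OF comult] alg_hom_mult[OF counit] mult.commute flip: TA_def)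
    next
      case (add x y)
      have "x \<in> carrier H" "y \<in> carrier H" using add S(2) by simp_all
      then show ?case using add A
        by (simp add: lin_add[OF \<Delta>l] \<Delta>c lin_add[OF \<mu>l(1)] lin_add[OF \<mu>l(2)] lin_add[OF \<epsilon>l] vs_smult_l_distr)
    next
      case (smult x c)
      have "x \<in> carrier H" using smult S(2) by simp
      then show ?case using smult A
        by (simp add: lin_smult[OF \<Delta>l] \<Delta>c lin_smult[OF \<mu>l(1)] lin_smult[OF \<mu>l(2)] lin_smult[OF \<epsilon>l])
    qed
  qed
  show ?thesis
    unfolding hopf_algebra_def Let_def
    using A comult counit antipode(1) coassoc counit_axiom antipode_axiom
    unfolding H3_def T_def pure_def sweedler2_def[of H H "\<lambda>a b. antipode H a \<otimes>\<^bsub>H\<^esub> b"]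
      sweedler2_def[of H H "\<lambda>a b. a \<otimes>\<^bsub>H\<^esub> antipode H b"] \<mu>_def \<mu>'_def
    by blast
qed

section \<open>Hopf subalgebras\<close>

lemma vspace_subspace:
  assumes "vspace M" "submodule C scalars M" shows "vspace (M\<lparr>carrier := C\<rparr>)"
proof -
  note C = submoduleD[OF assms(2)]
  have sub: "x \<in> carrier M" if "x \<in> C" for x using that C(1) by blast
  have neg: "(- 1) \<odot>\<^bsub>M\<^esub> x \<oplus>\<^bsub>M\<^esub> x = \<zero>\<^bsub>M\<^esub>" if "x \<in> C" for x
    using vs_l_neg[OF assms(1) sub[OF that]] sub[OF that] assms(1) by (simp add: vs_neg_eq)
  have neg': "x \<oplus>\<^bsub>M\<^esub> (- 1) \<odot>\<^bsub>M\<^esub> x = \<zero>\<^bsub>M\<^esub>" if "x \<in> C" for x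
    using neg[OF that] vs_comm[OF assms(1), of x "(- 1) \<odot>\<^bsub>M\<^esub> x"] sub[OF that] assms(1) by simp
  show ?thesis
    by (rule vspaceI)
       (use assms(1) C sub in \<open>simp_all add: vs_assoc vs_smult_l_distr vs_smult_r_distr neg neg' vs_comm[of M]\<close>)
qed

lemma lin_subspace_incl: "submodule C scalars M \<Longrightarrow> (\<lambda>x. x) \<in> linear_maps (M\<lparr>carrier := C\<rparr>) M"
  using submoduleD(1) by (intro linI) auto

lemma assoc_algebra_subalgebra:
  assumes A: "assoc_algebra A" and C: "submodule C scalars A" "\<one>\<^bsub>A\<^esub> \<in> C"
    "\<And>x y. x \<in> C \<Longrightarrow> y \<in> C \<Longrightarrow> x \<otimes>\<^bsub>A\<^esub> y \<in> C"
  shows "assoc_algebra (A\<lparr>carrier := C\<rparr>)"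
proof -
  have sub: "x \<in> carrier A" if "x \<in> C" for x using that submoduleD(1)[OF C(1)] by blast
  show ?thesis
    by (intro assoc_algebraI bilinI linI vspace_subspace C)
       (use A C sub in \<open>simp_all add: alg_assoc alg_l_distr alg_r_distr\<close>)
qed

context
  fixes H :: "('k::field, 'a) hopf" and C
  assumes V: "vspace H" and C: "submodule C scalars H"
begin

private abbreviation "HC \<equiv> H\<lparr>carrier := C\<rparr>"

private lemma VC: "vspace HC" by (rule vspace_subspace[OF V C])
private lemma sub: "x \<in> C \<Longrightarrow> x \<in> carrier H" using submoduleD(1)[OF C] by blast
private lemma VTHC: "vspace (tensor_module H H)" and VTC: "vspace (tensor_module HC HC)"
  using V VC by simp_all

private lemma bilin_incl: "bilin HC HC (tensor_module H H) (tensor H H)"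
  by (rule bilin_comp[OF bilin_tensor[OF V V] lin_subspace_incl[OF C] lin_subspace_incl[OF C]])

lemma tensor_incl_lin: "tensor_incl H \<in> linear_maps (tensor_module HC HC) (tensor_module H H)"
  unfolding tensor_incl_def by (rule tensor_lift_lin[OF VC VC VTHC bilin_incl])

lemma tensor_incl_tensor: "a \<in> C \<Longrightarrow> b \<in> C \<Longrightarrow> tensor_incl H (tensor HC HC a b) = tensor H H a b"
  unfolding tensor_incl_def by (rule tensor_lift_tensor[OF VC VC VTHC bilin_incl]) simp_all

text \<open>A projection of \<open>H\<close> onto \<open>C\<close> induces a left inverse of \<open>C \<otimes> C \<rightarrow> H \<otimes> H\<close>.\<close>

lemma tensor_incl_inj: "inj_on (tensor_incl H) (carrier (tensor_module HC HC))"
proof -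
  obtain \<pi> where \<pi>: "\<pi> \<in> linear_maps H HC" "\<And>x. x \<in> C \<Longrightarrow> \<pi> x = x"
    by (rule projection_exists[OF V C]) blast
  let ?P = "tensor_lift (tensor_module HC HC) (\<lambda>a b. tensor HC HC (\<pi> a) (\<pi> b))"
  have b: "bilin H H (tensor_module HC HC) (\<lambda>a b. tensor HC HC (\<pi> a) (\<pi> b))"
    by (rule bilin_comp[OF bilin_tensor[OF VC VC] \<pi>(1) \<pi>(1)])
  have "?P (tensor_incl H t) = t" if "t \<in> carrier (tensor_module HC HC)" for t
    by (rule tensor_ext[OF VC VC lin_comp[OF tensor_incl_lin tensor_lift_lin[OF V V VTC b]] lin_id _ that])
       (simp add: tensor_incl_tensor V VTC b sub \<pi>(2))
  then show ?thesis by (rule inj_on_inverseI)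
qed

end

lemma restrict_hopf_simps [simp]:
  "carrier (restrict_hopf H C) = C" "mult (restrict_hopf H C) = mult H" "one (restrict_hopf H C) = one H"
  "zero (restrict_hopf H C) = zero H" "add (restrict_hopf H C) = add H" "smult (restrict_hopf H C) = smult H"
  "counit (restrict_hopf H C) = counit H" "antipode (restrict_hopf H C) = antipode H"
  by (simp_all add: restrict_hopf_def)

lemma tensor_restrict_hopf:
  "tensor_module (restrict_hopf H C) (restrict_hopf H C) = tensor_module (H\<lparr>carrier := C\<rparr>) (H\<lparr>carrier := C\<rparr>)"
  "tensor (restrict_hopf H C) (restrict_hopf H C) = tensor (H\<lparr>carrier := C\<rparr>) (H\<lparr>carrier := C\<rparr>)"
  "tensor_algebra (restrict_hopf H C) (restrict_hopf H C) = tensor_algebra (H\<lparr>carrier := C\<rparr>) (H\<lparr>carrier := C\<rparr>)"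
  by (rule tensor_module_cong tensor_algebra_cong; simp)+

lemma subalg_cong:
  assumes "add A = add B" "smult A = smult B" "mult A = mult B" "one A = one B"
  shows "subalg A S = subalg B S"
proof -
  have le: "subalg A S \<subseteq> subalg B S"
    if eq: "add A = add B" "smult A = smult B" "mult A = mult B" "one A = one B"
    for A :: "('k::field, 'a, 'm) module_scheme" and B :: "('k, 'a, 'n) module_scheme"
  proof
    fix x assume "x \<in> subalg A S"
    then show "x \<in> subalg B S"
      by induct (simp_all add: eq subalg.intros)
  qed
  show ?thesis
  proof
    show "subalg A S \<subseteq> subalg B S" by (rule le[OF assms])
    show "subalg B S \<subseteq> subalg A S"
    proof
      fix x assume "x \<in> subalg B S"
      then show "x \<in> subalg A S"
        by induct (simp_all add: assms[symmetric] subalg.intros)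
    qed
  qed
qed

text \<open>The set S may generate all of H or only a part, so the locale serves both for U and for
  a Borel inside U. That S reverses products is among the assumptions because it holds by
  construction for U; requiring l, k and the antipodes of generators in \<open>subalg H S\<close>
  makes this subalgebra a Hopf subalgebra.\<close>

locale generated_hopf =
  fixes H :: "('k::field, 'a) hopf" (structure) and S :: "'a set"
  assumes alg: "assoc_algebra H" and S_closed: "S \<subseteq> carrier H"
    and comult_hom: "comult H \<in> algebra_hom H (tensor_algebra H H)"
    and counit_hom: "counit H \<in> algebra_hom H scalars"
    and antipode_lin: "antipode H \<in> linear_maps H H"
    and antipode_one: "antipode H \<one> = \<one>"
    and antipode_mult: "x \<in> carrier H \<Longrightarrow> y \<in> carrier H \<Longrightarrow>
      antipode H (x \<otimes> y) = antipode H y \<otimes> antipode H x"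
    and antipode_gen: "s \<in> S \<Longrightarrow> antipode H s \<in> subalg H S"
    and gens: "s \<in> S \<Longrightarrow>
      (grouplike_elem H s \<and> antipode H s \<otimes> s = \<one> \<and> s \<otimes> antipode H s = \<one>) \<or>
      (\<exists>l\<in>subalg H S. \<exists>k\<in>subalg H S. skew_primitive H l k s \<and>
        antipode H s \<otimes> k \<oplus> antipode H l \<otimes> s = \<zero> \<and>
        s \<otimes> antipode H k \<oplus> l \<otimes> antipode H s = \<zero>)"
begin

lemma vs: "vspace H" using alg by simp

lemma hopf_algebra: "carrier H = subalg H S \<Longrightarrow> hopf_algebra H"
  by (rule hopf_algebraI_generated[OF alg S_closed _ comult_hom counit_hom antipode_lin antipode_one
        antipode_mult]) (use gens in blast)+

definition "sub = restrict_hopf H (subalg H S)"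

abbreviation (input) "HS \<equiv> H\<lparr>carrier := subalg H S\<rparr>"

lemma sub_simps [simp]:
  "carrier sub = subalg H S" "mult sub = mult H" "one sub = one H" "zero sub = zero H"
  "add sub = add H" "smult sub = smult H" "counit sub = counit H" "antipode sub = antipode H"
  by (simp_all add: sub_def)

lemmas submodule = subalg_submodule[OF alg S_closed]

lemma alg_HS: "assoc_algebra HS"
  by (rule assoc_algebra_subalgebra[OF alg submodule subalg.one subalg_mult[OF alg S_closed]])

lemma alg_sub: "assoc_algebra sub"
  by (rule assoc_algebra_cong[OF alg_HS]) simp_all

lemma sub_closed: "x \<in> subalg H S \<Longrightarrow> x \<in> carrier H"
  by (rule subalg_closed[OF alg S_closed])

lemma tensor_incl_hom: "tensor_incl H \<in> algebra_hom (tensor_algebra HS HS) (tensor_algebra H H)"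
proof -
  have V: "vspace HS" by (rule vspace_subspace[OF vs submodule])
  have "tensor_lift (tensor_algebra H H) (tensor H H) \<in> algebra_hom (tensor_algebra HS HS) (tensor_algebra H H)"
    by (rule tensor_lift_alg_hom[OF alg_HS alg_HS])
       (use alg in \<open>auto intro!: bilin_comp[OF bilin_tensor[OF vs vs]] lin_subspace_incl[OF submodule]
          simp: sub_closed\<close>)
  moreover have "tensor_lift (tensor_algebra H H) f = tensor_lift (tensor_module H H) f" for f :: "'a \<Rightarrow> 'a \<Rightarrow> _"
    by (simp add: fun_eq_iff tensor_lift_def finsum_def finprod_def)
  ultimately show ?thesis by (simp add: tensor_incl_def)
qed

text \<open>\<open>tensor_incl\<close> is a homomorphism of algebras, so its image contains the
  coproducts of products as soon as it contains those of the generators.\<close>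

lemma comult_in_image: "x \<in> subalg H S \<Longrightarrow>
    comult H x \<in> tensor_incl H ` carrier (tensor_module HS HS)"
proof (induct rule: subalg.induct)
  case one
  have "comult H \<one> = tensor_incl H (tensor HS HS \<one> \<one>)"
    using alg_hom_one[OF comult_hom] by (simp add: tensor_incl_tensor[OF vs submodule] subalg.one)
  moreover have "tensor HS HS \<one> \<one> \<in> carrier (tensor_module HS HS)"
    using alg_HS by (simp add: subalg.one)
  ultimately show ?case by blast
next
  case (mult s x)
  have s: "s \<in> subalg H S" by (rule subalg_incl[OF alg S_closed mult(1)])
  have pure: "tensor H H a b \<in> tensor_incl H ` carrier (tensor_module HS HS)"
    if "a \<in> subalg H S" "b \<in> subalg H S" for a b
  proof
    show "tensor H H a b = tensor_incl H (tensor HS HS a b)"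
      using that by (simp add: tensor_incl_tensor[OF vs submodule])
    show "tensor HS HS a b \<in> carrier (tensor_module HS HS)" using that alg_HS by simp
  qed
  have "comult H s \<in> tensor_incl H ` carrier (tensor_module HS HS)"
    using gens[OF mult(1)]
  proof (elim disjE bexE conjE)
    assume "grouplike_elem H s"
    then show ?thesis using pure[OF s s] by (simp add: grouplike_elem_def)
  next
    fix l k assume lk: "l \<in> subalg H S" "k \<in> subalg H S" "skew_primitive H l k s"
    obtain t u where "t \<in> carrier (tensor_module HS HS)" "tensor H H s k = tensor_incl H t"
      "u \<in> carrier (tensor_module HS HS)" "tensor H H l s = tensor_incl H u"
      using pure[OF s lk(2)] pure[OF lk(1) s] by blast
    then show ?thesis
      using lk(3) lin_add[OF tensor_incl_lin[OF vs submodule], of t u] alg_HS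
        vs_add_closed[of "tensor_module HS HS" t u]
      by (auto simp: skew_primitive_def intro: image_eqI[of _ _ "t \<oplus>\<^bsub>tensor_module HS HS\<^esub> u"])
  qed
  then obtain t where t: "t \<in> carrier (tensor_module HS HS)" "comult H s = tensor_incl H t" by blast
  obtain u where u: "u \<in> carrier (tensor_module HS HS)" "comult H x = tensor_incl H u"
    using mult(3) by blast
  have "comult H (s \<otimes> x) = tensor_incl H (t \<otimes>\<^bsub>tensor_algebra HS HS\<^esub> u)"
    using alg_hom_mult[OF comult_hom, of s x] alg_hom_mult[OF tensor_incl_hom, of t u] t u s mult(2)
    by (simp add: sub_closed)
  moreover have "t \<otimes>\<^bsub>tensor_algebra HS HS\<^esub> u \<in> carrier (tensor_module HS HS)"
    using alg_mult_closed[OF assoc_algebra_tensor[OF alg_HS alg_HS], of t u] t u by simp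
  ultimately show ?case by blast
next
  case (add x y)
  then obtain t u where "t \<in> carrier (tensor_module HS HS)" "comult H x = tensor_incl H t"
      "u \<in> carrier (tensor_module HS HS)" "comult H y = tensor_incl H u" by blast
  then show ?case
    using lin_add[OF tensor_incl_lin[OF vs submodule], of t u] alg_HS add
      lin_add[OF alg_hom_lin[OF comult_hom], of x y]
    by (auto simp: sub_closed intro!: image_eqI[of _ _ "t \<oplus>\<^bsub>tensor_module HS HS\<^esub> u"])
next
  case (smult x c)
  then obtain t where "t \<in> carrier (tensor_module HS HS)" "comult H x = tensor_incl H t" by blast
  then show ?case
    using lin_smult[OF tensor_incl_lin[OF vs submodule], of t c] alg_HS smult
      lin_smult[OF alg_hom_lin[OF comult_hom], of x c]
    by (auto simp: sub_closed intro!: image_eqI[of _ _ "c \<odot>\<^bsub>tensor_module HS HS\<^esub> t"])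
qed

lemma comult_sub:
  assumes "x \<in> subalg H S"
  shows "comult sub x \<in> carrier (tensor_module HS HS)" "tensor_incl H (comult sub x) = comult H x"
  using comult_in_image[OF assms] unfolding sub_def restrict_hopf_def
  by (simp_all add: inv_into_into f_inv_into_f)

text \<open>The coproduct of \<open>sub\<close> is a chosen preimage. Injectivity of
  \<open>tensor_incl\<close> makes the choice irrelevant and lifts every identity of coproducts from
  H to \<open>sub\<close>.\<close>

lemma comult_sub_eqI:
  assumes "x \<in> subalg H S" "t \<in> carrier (tensor_module HS HS)" "tensor_incl H t = comult H x"
  shows "comult sub x = t"
  using inj_onD[OF tensor_incl_inj[OF vs submodule] _ comult_sub(1)[OF assms(1)] assms(2)]
    comult_sub(2)[OF assms(1)] assms(3) by simp

lemma antipode_closed: "x \<in> subalg H S \<Longrightarrow> antipode H x \<in> subalg H S"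
proof (induct rule: subalg.induct)
  case one then show ?case by (simp add: antipode_one subalg.one)
next
  case (mult s x)
  then show ?case using subalg_mult[OF alg S_closed mult(3) antipode_gen[OF mult(1)]] S_closed
    by (auto simp: antipode_mult sub_closed subset_iff)
next
  case (add x y)
  then show ?case by (simp add: lin_add[OF antipode_lin] sub_closed subalg.add)
next
  case (smult x c)
  then show ?case by (simp add: lin_smult[OF antipode_lin] sub_closed subalg.smult)
qed

lemma hopf_subalgebra: "hopf_subalgebra (subalg H S) H"
  unfolding hopf_subalgebra_def
proof (intro conjI)
  show "submonoid (subalg H S) H"
    by (rule submonoid.intro) (auto simp: sub_closed subalg.one subalg_mult[OF alg S_closed])
qed (use submodule comult_in_image antipode_closed in auto)

text \<open>The generated subalgebra is a Hopf subalgebra itself, and every Hopf subalgebra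
  containing S contains it; so the intersection has an explicit description that permits
  induction.\<close>

lemma generated_hopf_subalgebra_eq: "generated_hopf_subalgebra H S = sub"
proof -
  have "\<Inter>{C. hopf_subalgebra C H \<and> S \<subseteq> C} = subalg H S"
  proof
    show "\<Inter>{C. hopf_subalgebra C H \<and> S \<subseteq> C} \<subseteq> subalg H S"
      using hopf_subalgebra subalg_incl[OF alg S_closed] by blast
    show "subalg H S \<subseteq> \<Inter>{C. hopf_subalgebra C H \<and> S \<subseteq> C}"
    proof (intro Inter_greatest)
      fix C assume "C \<in> {C. hopf_subalgebra C H \<and> S \<subseteq> C}"
      then have C: "submodule C scalars H" "submonoid C H" "S \<subseteq> C"
        by (auto simp: hopf_subalgebra_def)
      show "subalg H S \<subseteq> C"
        by (rule subalg_min[OF C(1) submonoid.one_closed[OF C(2)] C(3) submonoid.m_closed[OF C(2)]])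
    qed
  qed
  then show ?thesis by (simp add: generated_hopf_subalgebra_def sub_def)
qed

lemma tensor_sub:
  "tensor_module sub sub = tensor_module HS HS" "tensor sub sub = tensor HS HS"
  "tensor_algebra sub sub = tensor_algebra HS HS"
  unfolding sub_def by (rule tensor_restrict_hopf)+

lemma subalg_sub: "subalg sub S = subalg H S"
  by (rule subalg_cong) simp_all

lemma grouplike_sub:
  assumes "grouplike_elem H k" "k \<in> subalg H S" shows "grouplike_elem sub k"
proof -
  have "comult sub k = tensor sub sub k k"
    using assms alg_HS
    by (intro comult_sub_eqI) (simp_all add: grouplike_elem_def tensor_sub tensor_incl_tensor[OF vs submodule])
  then show ?thesis using assms by (simp add: grouplike_elem_def)
qed

lemma skew_primitive_sub:
  assumes "skew_primitive H l k s" "l \<in> subalg H S" "k \<in> subalg H S" "s \<in> subalg H S"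
  shows "skew_primitive sub l k s"
proof -
  have "comult sub s = tensor sub sub s k \<oplus>\<^bsub>tensor_module sub sub\<^esub> tensor sub sub l s"
    using assms alg_HS lin_add[OF tensor_incl_lin[OF vs submodule], of "tensor HS HS s k" "tensor HS HS l s"]
    by (intro comult_sub_eqI) (auto simp: tensor_sub skew_primitive_def tensor_incl_tensor[OF vs submodule])
  then show ?thesis using assms grouplike_sub by (simp add: skew_primitive_def)
qed

text \<open>Since \<open>sub\<close> satisfies the same axioms and is generated by S, the Hopf
  axioms for it follow from the general criterion for generated algebras.\<close>

lemma generated_hopf_sub: "generated_hopf sub S"
proof
  show "assoc_algebra sub" by (rule alg_sub)
  show "S \<subseteq> carrier sub" using subalg_incl[OF alg S_closed] by auto
  have closed: "\<And>x y. x \<in> carrier HS \<Longrightarrow> y \<in> carrier HS \<Longrightarrow> x \<otimes> y \<in> carrier HS"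
    using subalg_mult[OF alg S_closed] by simp
  note VTHC = alg_vspace[OF assoc_algebra_tensor[OF alg_HS alg_HS], simplified]
  note il = tensor_incl_lin[OF vs submodule] and \<Delta>l = alg_hom_lin[OF comult_hom]
  show "comult sub \<in> algebra_hom sub (tensor_algebra sub sub)"
    unfolding tensor_sub
  proof (intro alg_homI linI)
    fix x assume x: "x \<in> carrier sub"
    then have x': "x \<in> subalg H S" by simp
    show "comult sub x \<in> carrier (tensor_algebra HS HS)" using comult_sub[OF x'] by simp
    show "comult sub (c \<odot>\<^bsub>sub\<^esub> x) = c \<odot>\<^bsub>tensor_algebra HS HS\<^esub> comult sub x" for c
      using comult_sub[OF x'] x' alg_HS
      by (intro comult_sub_eqI) (simp_all add: subalg.smult lin_smult[OF il] lin_smult[OF \<Delta>l] sub_closed)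
    fix y assume "y \<in> carrier sub"
    then have y': "y \<in> subalg H S" by simp
    show "comult sub (x \<oplus>\<^bsub>sub\<^esub> y) = comult sub x \<oplus>\<^bsub>tensor_algebra HS HS\<^esub> comult sub y"
      using comult_sub[OF x'] comult_sub[OF y'] x' y' alg_HS
      by (intro comult_sub_eqI) (simp_all add: subalg.add lin_add[OF il] lin_add[OF \<Delta>l, simplified] sub_closed)
    show "comult sub (x \<otimes>\<^bsub>sub\<^esub> y) = comult sub x \<otimes>\<^bsub>tensor_algebra HS HS\<^esub> comult sub y"
      using comult_sub[OF x'] comult_sub[OF y'] x' y' alg_HS
        alg_mult_closed[OF assoc_algebra_tensor[OF alg_HS alg_HS], of "comult sub x" "comult sub y"]
        alg_hom_mult[OF tensor_incl_hom, of "comult sub x" "comult sub y"]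
      by (intro comult_sub_eqI)
         (simp_all add: subalg_mult[OF alg S_closed] alg_hom_mult[OF comult_hom] sub_closed)
  next
    show "comult sub \<one>\<^bsub>sub\<^esub> = \<one>\<^bsub>tensor_algebra HS HS\<^esub>"
      using alg_HS alg_hom_one[OF comult_hom]
      by (intro comult_sub_eqI) (simp_all add: subalg.one tensor_incl_tensor[OF vs submodule])
  qed
  show "counit sub \<in> algebra_hom sub scalars"
    using alg_hom_one[OF counit_hom]
    by (intro alg_homI linI)
       (simp_all add: sub_closed alg_hom_mult[OF counit_hom] lin_add[OF alg_hom_lin[OF counit_hom]]
          lin_smult[OF alg_hom_lin[OF counit_hom]])
  show "antipode sub \<in> linear_maps sub sub"
    by (intro linI)
       (simp_all add: antipode_closed sub_closed lin_add[OF antipode_lin] lin_smult[OF antipode_lin])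
  show "antipode sub s \<in> subalg sub S" if "s \<in> S" for s
    using antipode_gen[OF that] by (simp add: subalg_sub)
  show "(grouplike_elem sub s \<and> antipode sub s \<otimes>\<^bsub>sub\<^esub> s = \<one>\<^bsub>sub\<^esub> \<and> s \<otimes>\<^bsub>sub\<^esub> antipode sub s = \<one>\<^bsub>sub\<^esub>) \<or>
      (\<exists>l\<in>subalg sub S. \<exists>k\<in>subalg sub S. skew_primitive sub l k s \<and>
        antipode sub s \<otimes>\<^bsub>sub\<^esub> k \<oplus>\<^bsub>sub\<^esub> antipode sub l \<otimes>\<^bsub>sub\<^esub> s = \<zero>\<^bsub>sub\<^esub> \<and>
        s \<otimes>\<^bsub>sub\<^esub> antipode sub k \<oplus>\<^bsub>sub\<^esub> l \<otimes>\<^bsub>sub\<^esub> antipode sub s = \<zero>\<^bsub>sub\<^esub>)" if s: "s \<in> S" for s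
    using gens[OF s] grouplike_sub[of s] skew_primitive_sub[of _ _ s] subalg_incl[OF alg S_closed s]
    unfolding subalg_sub sub_simps by blast
qed (simp_all add: antipode_one antipode_mult sub_closed)

lemma hopf_algebra_sub: "hopf_algebra sub"
  by (rule generated_hopf.hopf_algebra[OF generated_hopf_sub]) (simp add: subalg_sub)

end

section \<open>\<open>U\<^sub>r\<^sub>,\<^sub>s\<close> and its Borel subalgebras as Hopf algebras\<close>

lemma U_rs_simps [simp]:
  "carrier (U_rs n) = carrier (U_algebra n)" "mult (U_rs n) = mult (U_algebra n)"
  "one (U_rs n) = one (U_algebra n)" "zero (U_rs n) = zero (U_algebra n)"
  "add (U_rs n) = add (U_algebra n)" "smult (U_rs n) = smult (U_algebra n)"
  by (simp_all add: U_rs_def module.defs hopf.defs)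

lemma U_rs_hopf_simps:
  "comult (U_rs n) = (\<lambda>X. the_elem
     (free_algebra_hom (tensor_algebra (U_algebra n) (U_algebra n)) (comult_gen n) ` X))"
  "counit (U_rs n) = (\<lambda>X. the_elem (free_algebra_hom scalars counit_gen ` X))"
  "antipode (U_rs n) = (\<lambda>X. the_elem (free_algebra_hom (opposite (U_algebra n)) (antipode_gen n) ` X))"
  by (simp_all add: U_rs_def module.defs hopf.defs)

lemma tensor_U_rs:
  "tensor_module (U_rs n) (U_rs n) = tensor_module (U_algebra n) (U_algebra n)"
  "tensor (U_rs n) (U_rs n) = tensor (U_algebra n) (U_algebra n)"
  "tensor_algebra (U_rs n) (U_rs n) = tensor_algebra (U_algebra n) (U_algebra n)"
  by (rule tensor_module_cong tensor_algebra_cong; simp)+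

context
  fixes n :: nat assumes n: "n > 2"
begin

private lemma n0: "n > 0" using n by simp

lemma comult_U_gen: "g \<in> gens n \<Longrightarrow> comult (U_rs n) (gen n g) = comult_gen n g"
  using U_lift_gen[OF n0 U_rep_comult[OF n]] by (simp add: U_rs_hopf_simps)

lemma counit_U_gen: "g \<in> gens n \<Longrightarrow> counit (U_rs n) (gen n g) = counit_gen g"
  using U_lift_gen[OF n0 U_rep_counit[OF n]] by (simp add: U_rs_hopf_simps)

lemma antipode_U_gen: "g \<in> gens n \<Longrightarrow> antipode (U_rs n) (gen n g) = antipode_gen n g"
  using U_lift_gen[OF n0 U_rep_antipode[OF n]] by (simp add: U_rs_hopf_simps)

lemma alg_U_rs: "assoc_algebra (U_rs n)"
  by (rule assoc_algebra_cong[OF assoc_algebra_U[OF n0]]) simp_all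

lemma comult_U_hom: "comult (U_rs n) \<in> algebra_hom (U_rs n) (tensor_algebra (U_rs n) (U_rs n))"
  unfolding tensor_U_rs
  using U_lift_hom[OF n0 U_rep_comult[OF n]]
  by (subst algebra_hom_cong[where M = "U_algebra n"]) (simp_all add: U_rs_hopf_simps)

lemma counit_U_hom: "counit (U_rs n) \<in> algebra_hom (U_rs n) scalars"
  using U_lift_hom[OF n0 U_rep_counit[OF n]]
  by (subst algebra_hom_cong[where M = "U_algebra n"]) (simp_all add: U_rs_hopf_simps)

lemma antipode_U_hom: "antipode (U_rs n) \<in> algebra_hom (U_algebra n) (opposite (U_algebra n))"
  using U_lift_hom[OF n0 U_rep_antipode[OF n]] by (simp add: U_rs_hopf_simps)

interpretation G: U_rep "U_algebra n" n "gen n"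
  using n by (intro U_rep_gen) simp

lemma one_grouplike: "grouplike_elem (U_rs n) \<one>\<^bsub>U_rs n\<^esub>"
  using alg_hom_one[OF comult_U_hom] alg_hom_one[OF counit_U_hom] alg_U_rs
  by (simp add: grouplike_elem_def tensor_U_rs)

lemma grouplike_gen: "t \<in> grouplikes n \<Longrightarrow> x \<in> {Grp t, Inv t} \<Longrightarrow> grouplike_elem (U_rs n) (gen n x)"
  by (auto simp: grouplike_elem_def comult_U_gen counit_U_gen tensor_U_rs)

lemma skew_primitive_E: "i < n \<Longrightarrow>
    skew_primitive (U_rs n) (gen n (Grp (Omega i))) \<one>\<^bsub>U_rs n\<^esub> (gen n (GenE i))"
  using one_grouplike grouplike_gen[of "Omega i" "Grp (Omega i)"]
  by (simp add: skew_primitive_def comult_U_gen counit_U_gen tensor_U_rs)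

lemma skew_primitive_F: "i < n \<Longrightarrow>
    skew_primitive (U_rs n) \<one>\<^bsub>U_rs n\<^esub> (gen n (Grp (Omega' i))) (gen n (GenF i))"
  using one_grouplike grouplike_gen[of "Omega' i" "Grp (Omega' i)"]
  by (simp add: skew_primitive_def comult_U_gen counit_U_gen tensor_U_rs)

text \<open>The conditions on S say that it contains the group-like elements occurring in the
  coproducts and antipodes of its members. One lemma then covers U and both Borel
  subalgebras.\<close>

lemma generated_hopf_U:
  assumes S: "S \<subseteq> gens n"
    and E: "\<And>i. GenE i \<in> S \<Longrightarrow> Grp (Omega i) \<in> S \<and> Inv (Omega i) \<in> S"
    and F: "\<And>i. GenF i \<in> S \<Longrightarrow> Grp (Omega' i) \<in> S \<and> Inv (Omega' i) \<in> S"
    and Grp: "\<And>t. Grp t \<in> S \<longleftrightarrow> Inv t \<in> S"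
  shows "generated_hopf (U_rs n) (gen n ` S)"
proof
  show "assoc_algebra (U_rs n)" by (rule alg_U_rs)
  show sub: "gen n ` S \<subseteq> carrier (U_rs n)" using S gen_closed[OF n0] by auto
  show "comult (U_rs n) \<in> algebra_hom (U_rs n) (tensor_algebra (U_rs n) (U_rs n))" by (rule comult_U_hom)
  show "counit (U_rs n) \<in> algebra_hom (U_rs n) scalars" by (rule counit_U_hom)
  show "antipode (U_rs n) \<in> linear_maps (U_rs n) (U_rs n)"
    using alg_hom_lin[OF antipode_U_hom] by (simp add: linear_maps_def)
  show "antipode (U_rs n) \<one>\<^bsub>U_rs n\<^esub> = \<one>\<^bsub>U_rs n\<^esub>"
    using alg_hom_one[OF antipode_U_hom] by simp
  show "antipode (U_rs n) (x \<otimes>\<^bsub>U_rs n\<^esub> y) = antipode (U_rs n) y \<otimes>\<^bsub>U_rs n\<^esub> antipode (U_rs n) x"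
    if "x \<in> carrier (U_rs n)" "y \<in> carrier (U_rs n)" for x y
    using alg_hom_mult[OF antipode_U_hom, of x y] that by simp
  have in_sub: "gen n g \<in> subalg (U_rs n) (gen n ` S)" if "g \<in> S" for g
    by (rule subalg_incl[OF alg_U_rs sub]) (use that in blast)
  have mult: "x \<otimes>\<^bsub>U_algebra n\<^esub> y \<in> subalg (U_rs n) (gen n ` S)"
    if "x \<in> subalg (U_rs n) (gen n ` S)" "y \<in> subalg (U_rs n) (gen n ` S)" for x y
    using subalg_mult[OF alg_U_rs sub that] by simp
  have neg: "\<ominus>\<^bsub>U_algebra n\<^esub> x \<in> subalg (U_rs n) (gen n ` S)"
    if "x \<in> subalg (U_rs n) (gen n ` S)" for x
    using subalg.smult[OF that, of "- 1"] subalg_closed[OF alg_U_rs sub that] by (simp add: vs_neg_eq)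
  show "antipode (U_rs n) s \<in> subalg (U_rs n) (gen n ` S)" if s: "s \<in> gen n ` S" for s
  proof -
    obtain g where g: "g \<in> S" "s = gen n g" using s by blast
    then have "g \<in> gens n" using S by blast
    then show ?thesis
      using g E F Grp antipode_U_gen[of g]
      by (cases rule: gens_cases) (auto intro!: neg mult in_sub)
  qed
  have z: "(- 1) \<odot>\<^bsub>U_algebra n\<^esub> x \<oplus>\<^bsub>U_algebra n\<^esub> x = \<zero>\<^bsub>U_algebra n\<^esub>"
    "x \<oplus>\<^bsub>U_algebra n\<^esub> (- 1) \<odot>\<^bsub>U_algebra n\<^esub> x = \<zero>\<^bsub>U_algebra n\<^esub>" if "x \<in> carrier (U_algebra n)" for x
    using vs_l_neg[OF G.simps(2) that] vs_r_neg[OF G.simps(2) that] that by (simp_all add: vs_neg_eq)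
  fix s assume "s \<in> gen n ` S"
  then obtain g where g: "g \<in> S" "s = gen n g" by blast
  then have "g \<in> gens n" using S by blast
  then show "(grouplike_elem (U_rs n) s \<and> antipode (U_rs n) s \<otimes>\<^bsub>U_rs n\<^esub> s = \<one>\<^bsub>U_rs n\<^esub> \<and>
        s \<otimes>\<^bsub>U_rs n\<^esub> antipode (U_rs n) s = \<one>\<^bsub>U_rs n\<^esub>) \<or>
      (\<exists>l\<in>subalg (U_rs n) (gen n ` S). \<exists>k\<in>subalg (U_rs n) (gen n ` S). skew_primitive (U_rs n) l k s \<and>
        antipode (U_rs n) s \<otimes>\<^bsub>U_rs n\<^esub> k \<oplus>\<^bsub>U_rs n\<^esub> antipode (U_rs n) l \<otimes>\<^bsub>U_rs n\<^esub> s = \<zero>\<^bsub>U_rs n\<^esub> \<and>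
        s \<otimes>\<^bsub>U_rs n\<^esub> antipode (U_rs n) k \<oplus>\<^bsub>U_rs n\<^esub> l \<otimes>\<^bsub>U_rs n\<^esub> antipode (U_rs n) s = \<zero>\<^bsub>U_rs n\<^esub>)"
  proof (cases rule: gens_cases)
    case (Grp t)
    then show ?thesis using grouplike_gen[of t g] antipode_U_gen[of g] g
      by (simp)
  next
    case (Inv t)
    then show ?thesis using grouplike_gen[of t g] antipode_U_gen[of g] g
      by (simp)
  next
    case (E i)
    have cancel: "gen n (Grp (Omega i)) \<otimes>\<^bsub>U_algebra n\<^esub> (gen n (Inv (Omega i)) \<otimes>\<^bsub>U_algebra n\<^esub> gen n (GenE i)) = gen n (GenE i)"
      using E by (simp flip: alg_assoc)
    have "skew_primitive (U_rs n) (gen n (Grp (Omega i))) \<one>\<^bsub>U_rs n\<^esub> s"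
      using skew_primitive_E E g by simp
    moreover have "antipode (U_rs n) \<one>\<^bsub>U_algebra n\<^esub> = \<one>\<^bsub>U_algebra n\<^esub>"
      using alg_hom_one[OF antipode_U_hom] by simp
    moreover have "gen n (Grp (Omega i)) \<in> subalg (U_rs n) (gen n ` S)" using g E assms(2) by (intro in_sub) auto
    ultimately have "skew_primitive (U_rs n) (gen n (Grp (Omega i))) \<one>\<^bsub>U_rs n\<^esub> s \<and>
        antipode (U_rs n) s \<otimes>\<^bsub>U_rs n\<^esub> \<one>\<^bsub>U_rs n\<^esub> \<oplus>\<^bsub>U_rs n\<^esub> antipode (U_rs n) (gen n (Grp (Omega i))) \<otimes>\<^bsub>U_rs n\<^esub> s = \<zero>\<^bsub>U_rs n\<^esub> \<and>
        s \<otimes>\<^bsub>U_rs n\<^esub> antipode (U_rs n) \<one>\<^bsub>U_rs n\<^esub> \<oplus>\<^bsub>U_rs n\<^esub> gen n (Grp (Omega i)) \<otimes>\<^bsub>U_rs n\<^esub> antipode (U_rs n) s = \<zero>\<^bsub>U_rs n\<^esub>"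
      using antipode_U_gen[of "GenE i"] antipode_U_gen[of "Grp (Omega i)"] E g cancel
      by (simp add: vs_neg_eq z)
    then show ?thesis using subalg.one[of "U_rs n" "gen n ` S"] \<open>gen n (Grp (Omega i)) \<in> _\<close> by blast
  next
    case (F i)
    have "skew_primitive (U_rs n) \<one>\<^bsub>U_rs n\<^esub> (gen n (Grp (Omega' i))) s"
      using skew_primitive_F F g by simp
    moreover have "antipode (U_rs n) \<one>\<^bsub>U_algebra n\<^esub> = \<one>\<^bsub>U_algebra n\<^esub>"
      using alg_hom_one[OF antipode_U_hom] by simp
    moreover have "gen n (Grp (Omega' i)) \<in> subalg (U_rs n) (gen n ` S)" using g F assms(3) by (intro in_sub) auto
    ultimately have "skew_primitive (U_rs n) \<one>\<^bsub>U_rs n\<^esub> (gen n (Grp (Omega' i))) s \<and>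
        antipode (U_rs n) s \<otimes>\<^bsub>U_rs n\<^esub> gen n (Grp (Omega' i)) \<oplus>\<^bsub>U_rs n\<^esub> antipode (U_rs n) \<one>\<^bsub>U_rs n\<^esub> \<otimes>\<^bsub>U_rs n\<^esub> s = \<zero>\<^bsub>U_rs n\<^esub> \<and>
        s \<otimes>\<^bsub>U_rs n\<^esub> antipode (U_rs n) (gen n (Grp (Omega' i))) \<oplus>\<^bsub>U_rs n\<^esub> \<one>\<^bsub>U_rs n\<^esub> \<otimes>\<^bsub>U_rs n\<^esub> antipode (U_rs n) s = \<zero>\<^bsub>U_rs n\<^esub>"
      using antipode_U_gen[of "GenF i"] antipode_U_gen[of "Grp (Omega' i)"] F g
      by (simp add: vs_neg_eq alg_assoc z)
    then show ?thesis using subalg.one[of "U_rs n" "gen n ` S"] \<open>gen n (Grp (Omega' i)) \<in> _\<close> by blast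
  qed
qed

lemma generated_hopf_U_all: "generated_hopf (U_rs n) (gen n ` gens n)"
  by (rule generated_hopf_U) auto

lemma generated_hopf_U_B: "generated_hopf (U_rs n) (gen n ` gens_B n)"
  by (rule generated_hopf_U) (auto simp: gens_def gens_B_def grouplikes_B_def)

lemma generated_hopf_U_B': "generated_hopf (U_rs n) (gen n ` gens_B' n)"
  by (rule generated_hopf_U) (auto simp: gens_def gens_B'_def grouplikes_B'_def)

lemma B_hat_eq: "B_hat n = generated_hopf.sub (U_rs n) (gen n ` gens_B n)"
  unfolding B_hat_def by (rule generated_hopf.generated_hopf_subalgebra_eq[OF generated_hopf_U_B])

lemma B'_hat_eq: "B'_hat n = generated_hopf.sub (U_rs n) (gen n ` gens_B' n)"
  unfolding B'_hat_def by (rule generated_hopf.generated_hopf_subalgebra_eq[OF generated_hopf_U_B'])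

end

section \<open>Sweedler calculus\<close>

definition trilin :: "('k::field, 'a, 'm) module_scheme \<Rightarrow> ('k, 'v, 'n) module_scheme \<Rightarrow>
    ('a \<Rightarrow> 'a \<Rightarrow> 'a \<Rightarrow> 'v) \<Rightarrow> bool" where
  "trilin H V g \<longleftrightarrow> (\<forall>a\<in>carrier H. bilin H H V (g a)) \<and>
     (\<forall>b\<in>carrier H. \<forall>c\<in>carrier H. (\<lambda>a. g a b c) \<in> linear_maps H V)"

lemma trilinI:
  assumes "\<And>b c. b \<in> carrier H \<Longrightarrow> c \<in> carrier H \<Longrightarrow> (\<lambda>a. g a b c) \<in> linear_maps H V"
    and "\<And>a c. a \<in> carrier H \<Longrightarrow> c \<in> carrier H \<Longrightarrow> (\<lambda>b. g a b c) \<in> linear_maps H V"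
    and "\<And>a b. a \<in> carrier H \<Longrightarrow> b \<in> carrier H \<Longrightarrow> (\<lambda>c. g a b c) \<in> linear_maps H V"
  shows "trilin H V g"
  using assms by (auto simp: trilin_def intro!: bilinI)

lemma trilinD:
  assumes "trilin H V g"
  shows "b \<in> carrier H \<Longrightarrow> c \<in> carrier H \<Longrightarrow> (\<lambda>a. g a b c) \<in> linear_maps H V"
    and "a \<in> carrier H \<Longrightarrow> c \<in> carrier H \<Longrightarrow> (\<lambda>b. g a b c) \<in> linear_maps H V"
    and "a \<in> carrier H \<Longrightarrow> b \<in> carrier H \<Longrightarrow> (\<lambda>c. g a b c) \<in> linear_maps H V"
    and "a \<in> carrier H \<Longrightarrow> bilin H H V (\<lambda>b c. g a b c)"
    and "c \<in> carrier H \<Longrightarrow> bilin H H V (\<lambda>a b. g a b c)"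
  using assms by (auto simp: trilin_def intro: bilinD bilinI)

lemma trilin_lin: "trilin H V g \<Longrightarrow> k \<in> linear_maps V W \<Longrightarrow> trilin H W (\<lambda>a b c. k (g a b c))"
  by (intro trilinI) (auto intro: lin_comp[of _ _ V] trilinD)

locale hopf_alg =
  fixes H :: "('k::field, 'a, 'm) hopf_scheme" (structure)
  assumes hopf: "hopf_algebra H"
begin

lemma alg [simp]: "assoc_algebra H" and vs [simp]: "vspace H"
  using hopf by (simp_all add: hopf_algebra_def)

lemma comult_hom: "comult H \<in> algebra_hom H (tensor_algebra H H)"
  and counit_hom: "counit H \<in> algebra_hom H scalars"
  and antipode_lin: "antipode H \<in> linear_maps H H"
  using hopf by (simp_all add: hopf_algebra_def)

lemma comult_lin: "comult H \<in> linear_maps H (tensor_module H H)"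
  using alg_hom_lin[OF comult_hom] by simp

lemmas comult_closed = lin_closed[OF comult_lin]
lemmas antipode_closed = lin_closed[OF antipode_lin]
lemmas counit_lin = alg_hom_lin[OF counit_hom]

lemma counit_left: "x \<in> carrier H \<Longrightarrow> sweedler2 H H (\<lambda>a b. counit H a \<odot> b) x = x"
  and counit_right: "x \<in> carrier H \<Longrightarrow> sweedler2 H H (\<lambda>a b. counit H b \<odot> a) x = x"
  using hopf by (simp_all add: hopf_algebra_def Let_def)

lemmas sw_lin = sweedler2_lin[OF vs _ comult_lin]

lemma lin_sweedler2:
  "vspace V \<Longrightarrow> vspace W \<Longrightarrow> bilin H H V f \<Longrightarrow> k \<in> linear_maps V W \<Longrightarrow> x \<in> carrier H \<Longrightarrow>
    k (sweedler2 H V f x) = sweedler2 H W (\<lambda>a b. k (f a b)) x"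
  unfolding sweedler2_def by (rule lin_tensor_lift[OF vs vs]) (auto intro: comult_closed)

lemma sweedler2_cong:
  "vspace V \<Longrightarrow> bilin H H V f \<Longrightarrow> x \<in> carrier H \<Longrightarrow>
    (\<And>a b. a \<in> carrier H \<Longrightarrow> b \<in> carrier H \<Longrightarrow> g a b = f a b) \<Longrightarrow> sweedler2 H V g x = sweedler2 H V f x"
  unfolding sweedler2_def by (rule tensor_lift_cong[OF vs vs]) (auto intro: comult_closed)

lemma sweedler2_param:
  "vspace V \<Longrightarrow> (\<And>l. l \<in> carrier L \<Longrightarrow> bilin H H V (F l)) \<Longrightarrow> vspace L \<Longrightarrow>
    (\<And>a b. a \<in> carrier H \<Longrightarrow> b \<in> carrier H \<Longrightarrow> (\<lambda>l. F l a b) \<in> linear_maps L V) \<Longrightarrow>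
    x \<in> carrier H \<Longrightarrow> (\<lambda>l. sweedler2 H V (F l) x) \<in> linear_maps L V"
  unfolding sweedler2_def by (rule tensor_lift_param[OF vs vs]) (auto intro: comult_closed)

lemma trilin_bilin_left:
  assumes V: "vspace V" and g: "trilin H V g"
  shows "bilin H H V (\<lambda>y c. sweedler2 H V (\<lambda>a b. g a b c) y)"
  by (rule bilinI)
     (rule sweedler2_param[OF V trilinD(5)[OF g] vs trilinD(3)[OF g]] sw_lin[OF V trilinD(5)[OF g]]; assumption)+

lemma trilin_bilin_right:
  assumes V: "vspace V" and g: "trilin H V g"
  shows "bilin H H V (\<lambda>a y. sweedler2 H V (\<lambda>b c. g a b c) y)"
  by (rule bilinI)
     (rule sw_lin[OF V trilinD(4)[OF g]] sweedler2_param[OF V trilinD(4)[OF g] vs trilinD(1)[OF g]]; assumption)+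

lemma lin_sweedler3:
  assumes V: "vspace V" and W: "vspace W" and g: "trilin H V g" and k: "k \<in> linear_maps V W" and x: "x \<in> carrier H"
  shows "k (sweedler3 H V g x) = sweedler3 H W (\<lambda>a b c. k (g a b c)) x"
proof -
  have "k (sweedler3 H V g x) = sweedler2 H W (\<lambda>y c. k (sweedler2 H V (\<lambda>a b. g a b c) y)) x"
    unfolding sweedler3_def by (rule lin_sweedler2[OF V W trilin_bilin_left[OF V g] k x])
  also have "\<dots> = sweedler3 H W (\<lambda>a b c. k (g a b c)) x"
    unfolding sweedler3_def
    by (rule sweedler2_cong[OF W trilin_bilin_left[OF W trilin_lin[OF g k]] x])
       (rule lin_sweedler2[OF V W trilinD(5)[OF g] k])
  finally show ?thesis .
qed

lemma sweedler3_cong: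
  assumes V: "vspace V" and f: "trilin H V f" and x: "x \<in> carrier H"
    and eq: "\<And>a b c. a \<in> carrier H \<Longrightarrow> b \<in> carrier H \<Longrightarrow> c \<in> carrier H \<Longrightarrow> g a b c = f a b c"
  shows "sweedler3 H V g x = sweedler3 H V f x"
  unfolding sweedler3_def
  by (rule sweedler2_cong[OF V trilin_bilin_left[OF V f] x])
     (rule sweedler2_cong[OF V trilinD(5)[OF f]]; simp add: eq)

text \<open>The Hopf axiom is stated for the universal trilinear map into the tensor cube; any other
  trilinear map g factors through it by the linear map G.\<close>

lemma sweedler_coassoc:
  assumes V: "vspace V" and g: "trilin H V g" and x: "x \<in> carrier H"
  shows "sweedler3 H V g x = sweedler2 H V (\<lambda>a y. sweedler2 H V (\<lambda>b c. g a b c) y) x"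
proof -
  define T where "T = tensor_module H H"
  define H3 where "H3 = tensor_module H T"
  define pure where "pure a b c = tensor H T a (tensor H H b c)" for a b c
  define G where "G = tensor_lift V (\<lambda>a t. tensor_lift V (\<lambda>b c. g a b c) t)"
  have VT: "vspace T" and V3: "vspace H3" by (simp_all add: T_def H3_def)
  have bt: "bilin H H T (tensor H H)" "bilin H T H3 (tensor H T)"
    unfolding T_def H3_def by (rule bilin_tensor; simp)+
  have pure: "trilin H H3 pure"
    unfolding pure_def
    by (intro trilinI bilinD(2)[OF bt(2)] bilinD(3)[OF bt(1)] lin_comp[OF bilinD(2)[OF bt(1)] bilinD(1)[OF bt(2)]]
        lin_comp[OF bilinD(1)[OF bt(1)] bilinD(1)[OF bt(2)]])
  have bg: "bilin H T V (\<lambda>a t. tensor_lift V (\<lambda>b c. g a b c) t)"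
    unfolding T_def
    by (intro bilinI tensor_lift_lin tensor_lift_param[OF vs vs V] trilinD[OF g] vs V) auto
  have G: "G \<in> linear_maps H3 V"
    unfolding G_def H3_def by (rule tensor_lift_lin[OF vs VT V bg])
  have Gp: "G (pure a b c) = g a b c" if "a \<in> carrier H" "b \<in> carrier H" "c \<in> carrier H" for a b c
    unfolding G_def pure_def using that VT V bg bilinD(3)[OF bt(1)]
    by (simp add: trilinD(4)[OF g])
  have "sweedler3 H H3 pure x = sweedler2 H H3 (\<lambda>a y. sweedler2 H H3 (\<lambda>b c. pure a b c) y) x"
    using hopf x by (simp add: hopf_algebra_def Let_def T_def H3_def pure_def[abs_def])
  then have "G (sweedler3 H H3 pure x) = G (sweedler2 H H3 (\<lambda>a y. sweedler2 H H3 (\<lambda>b c. pure a b c) y) x)"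
    by simp
  moreover have "G (sweedler3 H H3 pure x) = sweedler3 H V g x"
    unfolding lin_sweedler3[OF V3 V pure G x]
    by (rule sweedler3_cong[OF V g x]) (rule Gp)
  moreover have "G (sweedler2 H H3 (\<lambda>a y. sweedler2 H H3 (\<lambda>b c. pure a b c) y) x) =
      sweedler2 H V (\<lambda>a y. sweedler2 H V (\<lambda>b c. g a b c) y) x"
    unfolding lin_sweedler2[OF V3 V trilin_bilin_right[OF V3 pure] G x]
  proof (rule sweedler2_cong[OF V trilin_bilin_right[OF V g] x])
    fix a y assume ay: "a \<in> carrier H" "y \<in> carrier H"
    show "G (sweedler2 H H3 (\<lambda>b c. pure a b c) y) = sweedler2 H V (\<lambda>b c. g a b c) y"
      unfolding lin_sweedler2[OF V3 V trilinD(4)[OF pure ay(1)] G ay(2)]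
      by (rule sweedler2_cong[OF V trilinD(4)[OF g ay(1)] ay(2)]) (rule Gp[OF ay(1)])
  qed
  ultimately show ?thesis by simp
qed

text \<open>The convolution is the coproduct followed by x \<otimes> y \<mapsto> f x g y, and
  commuting images make the latter multiplicative by swapping the two middle factors.\<close>

lemma convolution_hom:
  assumes E: "assoc_algebra E" and f: "f \<in> algebra_hom H E" and g: "g \<in> algebra_hom H E"
    and comm: "\<And>x y. x \<in> carrier H \<Longrightarrow> y \<in> carrier H \<Longrightarrow> f x \<otimes>\<^bsub>E\<^esub> g y = g y \<otimes>\<^bsub>E\<^esub> f x"
  shows "bilin H H E (\<lambda>x y. f x \<otimes>\<^bsub>E\<^esub> g y)"
    "(\<lambda>b. sweedler2 H E (\<lambda>x y. f x \<otimes>\<^bsub>E\<^esub> g y) b) \<in> algebra_hom H E"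
proof -
  show b: "bilin H H E (\<lambda>x y. f x \<otimes>\<^bsub>E\<^esub> g y)"
    by (rule bilin_comp[OF bilin_mult[OF E] alg_hom_lin[OF f] alg_hom_lin[OF g]])
  show "(\<lambda>b. sweedler2 H E (\<lambda>x y. f x \<otimes>\<^bsub>E\<^esub> g y) b) \<in> algebra_hom H E"
    unfolding sweedler2_def
  proof (rule alg_hom_comp[OF comult_hom tensor_lift_alg_hom[OF alg alg E b]])
    show "f \<one> \<otimes>\<^bsub>E\<^esub> g \<one> = \<one>\<^bsub>E\<^esub>" using E by (simp add: alg_hom_one[OF f] alg_hom_one[OF g])
    fix a a' b b' assume c: "a \<in> carrier H" "a' \<in> carrier H" "b \<in> carrier H" "b' \<in> carrier H"
    have cl: "f a \<in> carrier E" "f a' \<in> carrier E" "g b \<in> carrier E" "g b' \<in> carrier E"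
      using c alg_hom_closed[OF f] alg_hom_closed[OF g] by auto
    have "f (a \<otimes> a') \<otimes>\<^bsub>E\<^esub> g (b \<otimes> b') = f a \<otimes>\<^bsub>E\<^esub> (f a' \<otimes>\<^bsub>E\<^esub> g b) \<otimes>\<^bsub>E\<^esub> g b'"
      using c cl E by (simp add: alg_hom_mult[OF f] alg_hom_mult[OF g] alg_assoc)
    also have "\<dots> = (f a \<otimes>\<^bsub>E\<^esub> g b) \<otimes>\<^bsub>E\<^esub> (f a' \<otimes>\<^bsub>E\<^esub> g b')"
      unfolding comm[OF c(2,3)] using cl E by (simp add: alg_assoc)
    finally show "f (a \<otimes> a') \<otimes>\<^bsub>E\<^esub> g (b \<otimes> b') = (f a \<otimes>\<^bsub>E\<^esub> g b) \<otimes>\<^bsub>E\<^esub> (f a' \<otimes>\<^bsub>E\<^esub> g b')" .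
  qed
qed

end

section \<open>The action of the double on \<open>A \<otimes> B\<close>\<close>

text \<open>
  \<open>P b\<close> and \<open>R b\<close> are the left and right coregular actions \<open>a \<mapsto> \<Sum> \<langle>b, a\<^sub>1\<rangle> a\<^sub>2\<close> and
  \<open>a \<mapsto> \<Sum> \<langle>b, a\<^sub>2\<rangle> a\<^sub>1\<close>.  In the double, \<open>b a = \<Sum> (P (S b\<^sub>1) (R b\<^sub>3 a)) b\<^sub>2\<close>; the right hand side
  defines the operator \<open>op b\<close>.
\<close>

locale hopf_pairing = A: hopf_alg A + B: hopf_alg B
  for A :: "('k::field, 'a) hopf" and B :: "('k, 'b) hopf" +
  fixes p :: "'b \<Rightarrow> 'a \<Rightarrow> 'k"
  assumes pairing: "skew_dual_pairing B A p"
    and antipode_one: "antipode B \<one>\<^bsub>B\<^esub> = \<one>\<^bsub>B\<^esub>"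
    and antipode_mult: "x \<in> carrier B \<Longrightarrow> y \<in> carrier B \<Longrightarrow>
      antipode B (x \<otimes>\<^bsub>B\<^esub> y) = antipode B y \<otimes>\<^bsub>B\<^esub> antipode B x"
begin

lemma p_lin: "b \<in> carrier B \<Longrightarrow> (\<lambda>a. p b a) \<in> linear_maps A scalars"
  and p_lin': "a \<in> carrier A \<Longrightarrow> (\<lambda>b. p b a) \<in> linear_maps B scalars"
  and p_one: "b \<in> carrier B \<Longrightarrow> p b \<one>\<^bsub>A\<^esub> = counit B b"
  and p_one': "a \<in> carrier A \<Longrightarrow> p \<one>\<^bsub>B\<^esub> a = counit A a"
  and p_mult: "b \<in> carrier B \<Longrightarrow> x \<in> carrier A \<Longrightarrow> y \<in> carrier A \<Longrightarrow>
    p b (x \<otimes>\<^bsub>A\<^esub> y) = sweedler2 B scalars (\<lambda>b1 b2. p b2 x * p b1 y) b"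
  and p_mult': "b \<in> carrier B \<Longrightarrow> c \<in> carrier B \<Longrightarrow> a \<in> carrier A \<Longrightarrow>
    p (b \<otimes>\<^bsub>B\<^esub> c) a = sweedler2 A scalars (\<lambda>a1 a2. p b a1 * p c a2) a"
  using pairing by (simp_all add: skew_dual_pairing_def)

definition P :: "'b \<Rightarrow> 'a \<Rightarrow> 'a" where "P b a = sweedler2 A A (\<lambda>x y. p b x \<odot>\<^bsub>A\<^esub> y) a"
definition R :: "'b \<Rightarrow> 'a \<Rightarrow> 'a" where "R b a = sweedler2 A A (\<lambda>x y. p b y \<odot>\<^bsub>A\<^esub> x) a"

lemma P_bilin: "b \<in> carrier B \<Longrightarrow> bilin A A A (\<lambda>x y. p b x \<odot>\<^bsub>A\<^esub> y)"
  and R_bilin: "b \<in> carrier B \<Longrightarrow> bilin A A A (\<lambda>x y. p b y \<odot>\<^bsub>A\<^esub> x)"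
  by (intro bilinI lin_smultI lin_scalar p_lin lin_id A.vs; assumption)+

lemma PR_bilin: "bilin B A A P" "bilin B A A R"
proof -
  show "bilin B A A P"
    unfolding P_def
    by (intro bilinI A.sw_lin A.sweedler2_param P_bilin A.vs B.vs lin_scalar p_lin')
  show "bilin B A A R"
    unfolding R_def
    by (intro bilinI A.sw_lin A.sweedler2_param R_bilin A.vs B.vs lin_scalar p_lin')
qed

lemmas P_lin = bilinD(1)[OF PR_bilin(1)] and R_lin = bilinD(1)[OF PR_bilin(2)]
lemmas P_closed = bilinD(3)[OF PR_bilin(1)] and R_closed = bilinD(3)[OF PR_bilin(2)]

lemma P_one: "a \<in> carrier A \<Longrightarrow> P \<one>\<^bsub>B\<^esub> a = a"
proof -
  assume a: "a \<in> carrier A"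
  have "P \<one>\<^bsub>B\<^esub> a = sweedler2 A A (\<lambda>x y. counit A x \<odot>\<^bsub>A\<^esub> y) a"
    unfolding P_def
    by (rule A.sweedler2_cong[OF A.vs _ a])
       (auto intro!: bilinI lin_smultI lin_scalar A.counit_lin lin_id simp: p_one')
  then show ?thesis by (simp add: A.counit_left a)
qed

lemma R_one: "a \<in> carrier A \<Longrightarrow> R \<one>\<^bsub>B\<^esub> a = a"
proof -
  assume a: "a \<in> carrier A"
  have "R \<one>\<^bsub>B\<^esub> a = sweedler2 A A (\<lambda>x y. counit A y \<odot>\<^bsub>A\<^esub> x) a"
    unfolding R_def
    by (rule A.sweedler2_cong[OF A.vs _ a])
       (auto intro!: bilinI lin_smultI lin_scalar A.counit_lin lin_id simp: p_one')
  then show ?thesis by (simp add: A.counit_right a)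
qed

lemma lin_scale_p: "b \<in> carrier B \<Longrightarrow> (\<lambda>a. k * p b a) \<in> linear_maps A scalars"
  "b \<in> carrier B \<Longrightarrow> (\<lambda>a. p b a * k) \<in> linear_maps A scalars"
  using lin_smultI[OF vspace_scalars p_lin, of b k] by (simp_all add: mult.commute)

lemma trilin_pp:
  assumes "b \<in> carrier B" "c \<in> carrier B"
  shows "trilin A A (\<lambda>x u v. (p b x * p c u) \<odot>\<^bsub>A\<^esub> v)" "trilin A A (\<lambda>x u v. (p b u * p c v) \<odot>\<^bsub>A\<^esub> x)"
    "trilin A A (\<lambda>x u v. (p b x * p c v) \<odot>\<^bsub>A\<^esub> u)"
  by (intro trilinI lin_scalar lin_smultI lin_id A.vs lin_scale_p assms; assumption)+

lemma bilin_pp: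
  assumes "b \<in> carrier B" "c \<in> carrier B"
  shows "bilin A A scalars (\<lambda>x y. p b x * p c y)"
  by (intro bilinI lin_scale_p assms)

text \<open>The inner action consumes the first leg of a and the outer one the next leg, so b' is
  paired to the left of b. Thus P reverses products, whereas R, which consumes legs from the right,
  preserves them.\<close>

lemma P_mult:
  assumes b: "b \<in> carrier B" "b' \<in> carrier B" and a: "a \<in> carrier A"
  shows "P b (P b' a) = P (b' \<otimes>\<^bsub>B\<^esub> b) a"
proof -
  let ?g = "\<lambda>x u v. (p b' x * p b u) \<odot>\<^bsub>A\<^esub> v"
  note g = trilin_pp(1)[OF b(2,1)]
  have "P b (P b' a) = sweedler2 A A (\<lambda>x y. P b (p b' x \<odot>\<^bsub>A\<^esub> y)) a"
    unfolding P_def[of b' a] by (rule A.lin_sweedler2[OF A.vs A.vs P_bilin[OF b(2)] P_lin[OF b(1)] a])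
  also have "\<dots> = sweedler2 A A (\<lambda>x y. sweedler2 A A (\<lambda>u v. ?g x u v) y) a"
  proof (rule A.sweedler2_cong[OF A.vs A.trilin_bilin_right[OF A.vs g] a])
    fix x y assume xy: "x \<in> carrier A" "y \<in> carrier A"
    have "P b (p b' x \<odot>\<^bsub>A\<^esub> y) = p b' x \<odot>\<^bsub>A\<^esub> P b y" using xy by (simp add: lin_smult[OF P_lin[OF b(1)]])
    also have "\<dots> = sweedler2 A A (\<lambda>u v. p b' x \<odot>\<^bsub>A\<^esub> (p b u \<odot>\<^bsub>A\<^esub> v)) y"
      unfolding P_def by (rule A.lin_sweedler2[OF A.vs A.vs P_bilin[OF b(1)] lin_smultI[OF A.vs lin_id] xy(2)])
    also have "\<dots> = sweedler2 A A (\<lambda>u v. ?g x u v) y"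
      by (rule A.sweedler2_cong[OF A.vs trilinD(4)[OF g xy(1)] xy(2)]) simp
    finally show "P b (p b' x \<odot>\<^bsub>A\<^esub> y) = sweedler2 A A (\<lambda>u v. ?g x u v) y" .
  qed
  also have "\<dots> = sweedler2 A A (\<lambda>y v. sweedler2 A A (\<lambda>x u. ?g x u v) y) a"
    using A.sweedler_coassoc[OF A.vs g a] by (simp add: sweedler3_def)
  also have "\<dots> = P (b' \<otimes>\<^bsub>B\<^esub> b) a"
    unfolding P_def
  proof (rule A.sweedler2_cong[OF A.vs P_bilin a])
    show "b' \<otimes>\<^bsub>B\<^esub> b \<in> carrier B" using b by simp
    fix y v assume yv: "y \<in> carrier A" "v \<in> carrier A"
    show "sweedler2 A A (\<lambda>x u. ?g x u v) y = p (b' \<otimes>\<^bsub>B\<^esub> b) y \<odot>\<^bsub>A\<^esub> v"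
      unfolding p_mult'[OF b(2,1) yv(1)]
      by (rule A.lin_sweedler2[symmetric, OF vspace_scalars A.vs bilin_pp[OF b(2,1)] lin_scalar[OF A.vs yv(2)] yv(1)])
         (rule lin_id)
  qed
  finally show ?thesis .
qed

lemma R_mult:
  assumes b: "b \<in> carrier B" "b' \<in> carrier B" and a: "a \<in> carrier A"
  shows "R b (R b' a) = R (b \<otimes>\<^bsub>B\<^esub> b') a"
proof -
  let ?g = "\<lambda>x u v. (p b u * p b' v) \<odot>\<^bsub>A\<^esub> x"
  note g = trilin_pp(2)[OF b]
  have "R b (R b' a) = sweedler2 A A (\<lambda>y v. R b (p b' v \<odot>\<^bsub>A\<^esub> y)) a"
    unfolding R_def[of b' a] by (rule A.lin_sweedler2[OF A.vs A.vs R_bilin[OF b(2)] R_lin[OF b(1)] a])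
  also have "\<dots> = sweedler2 A A (\<lambda>y v. sweedler2 A A (\<lambda>x u. ?g x u v) y) a"
  proof (rule A.sweedler2_cong[OF A.vs A.trilin_bilin_left[OF A.vs g] a])
    fix y v assume yv: "y \<in> carrier A" "v \<in> carrier A"
    have "R b (p b' v \<odot>\<^bsub>A\<^esub> y) = p b' v \<odot>\<^bsub>A\<^esub> R b y" using yv by (simp add: lin_smult[OF R_lin[OF b(1)]])
    also have "\<dots> = sweedler2 A A (\<lambda>x u. p b' v \<odot>\<^bsub>A\<^esub> (p b u \<odot>\<^bsub>A\<^esub> x)) y"
      unfolding R_def by (rule A.lin_sweedler2[OF A.vs A.vs R_bilin[OF b(1)] lin_smultI[OF A.vs lin_id] yv(1)])
    also have "\<dots> = sweedler2 A A (\<lambda>x u. ?g x u v) y"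
      by (rule A.sweedler2_cong[OF A.vs trilinD(5)[OF g yv(2)] yv(1)]) (simp add: mult.commute)
    finally show "R b (p b' v \<odot>\<^bsub>A\<^esub> y) = sweedler2 A A (\<lambda>x u. ?g x u v) y" .
  qed
  also have "\<dots> = sweedler2 A A (\<lambda>x y. sweedler2 A A (\<lambda>u v. ?g x u v) y) a"
    using A.sweedler_coassoc[OF A.vs g a] by (simp add: sweedler3_def)
  also have "\<dots> = R (b \<otimes>\<^bsub>B\<^esub> b') a"
    unfolding R_def
  proof (rule A.sweedler2_cong[OF A.vs R_bilin a])
    show "b \<otimes>\<^bsub>B\<^esub> b' \<in> carrier B" using b by simp
    fix x y assume xy: "x \<in> carrier A" "y \<in> carrier A"
    show "sweedler2 A A (\<lambda>u v. ?g x u v) y = p (b \<otimes>\<^bsub>B\<^esub> b') y \<odot>\<^bsub>A\<^esub> x"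
      unfolding p_mult'[OF b xy(2)]
      by (rule A.lin_sweedler2[symmetric, OF vspace_scalars A.vs bilin_pp[OF b] lin_scalar[OF A.vs xy(1)] xy(2)])
         (rule lin_id)
  qed
  finally show ?thesis .
qed

text \<open>Both orders leave the middle leg, by coassociativity. With S(b_1) for b and b_3 for b'
  the coefficients are those in the product of the double.\<close>

lemma PR_sweedler3:
  assumes b: "b \<in> carrier B" "b' \<in> carrier B" and a: "a \<in> carrier A"
  shows "P b (R b' a) = sweedler3 A A (\<lambda>x u v. (p b x * p b' v) \<odot>\<^bsub>A\<^esub> u) a"
    "R b' (P b a) = sweedler3 A A (\<lambda>x u v. (p b x * p b' v) \<odot>\<^bsub>A\<^esub> u) a"
proof -
  let ?g = "\<lambda>x u v. (p b x * p b' v) \<odot>\<^bsub>A\<^esub> u"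
  note g = trilin_pp(3)[OF b]
  have "P b (R b' a) = sweedler2 A A (\<lambda>y v. P b (p b' v \<odot>\<^bsub>A\<^esub> y)) a"
    unfolding R_def[of b' a] by (rule A.lin_sweedler2[OF A.vs A.vs R_bilin[OF b(2)] P_lin[OF b(1)] a])
  also have "\<dots> = sweedler2 A A (\<lambda>y v. sweedler2 A A (\<lambda>x u. ?g x u v) y) a"
  proof (rule A.sweedler2_cong[OF A.vs A.trilin_bilin_left[OF A.vs g] a])
    fix y v assume yv: "y \<in> carrier A" "v \<in> carrier A"
    have "P b (p b' v \<odot>\<^bsub>A\<^esub> y) = p b' v \<odot>\<^bsub>A\<^esub> P b y" using yv by (simp add: lin_smult[OF P_lin[OF b(1)]])
    also have "\<dots> = sweedler2 A A (\<lambda>x u. p b' v \<odot>\<^bsub>A\<^esub> (p b x \<odot>\<^bsub>A\<^esub> u)) y"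
      unfolding P_def by (rule A.lin_sweedler2[OF A.vs A.vs P_bilin[OF b(1)] lin_smultI[OF A.vs lin_id] yv(1)])
    also have "\<dots> = sweedler2 A A (\<lambda>x u. ?g x u v) y"
      by (rule A.sweedler2_cong[OF A.vs trilinD(5)[OF g yv(2)] yv(1)]) (simp add: mult.commute)
    finally show "P b (p b' v \<odot>\<^bsub>A\<^esub> y) = sweedler2 A A (\<lambda>x u. ?g x u v) y" .
  qed
  finally show "P b (R b' a) = sweedler3 A A ?g a" by (simp add: sweedler3_def)
  have "R b' (P b a) = sweedler2 A A (\<lambda>x y. R b' (p b x \<odot>\<^bsub>A\<^esub> y)) a"
    unfolding P_def[of b a] by (rule A.lin_sweedler2[OF A.vs A.vs P_bilin[OF b(1)] R_lin[OF b(2)] a])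
  also have "\<dots> = sweedler2 A A (\<lambda>x y. sweedler2 A A (\<lambda>u v. ?g x u v) y) a"
  proof (rule A.sweedler2_cong[OF A.vs A.trilin_bilin_right[OF A.vs g] a])
    fix x y assume xy: "x \<in> carrier A" "y \<in> carrier A"
    have "R b' (p b x \<odot>\<^bsub>A\<^esub> y) = p b x \<odot>\<^bsub>A\<^esub> R b' y" using xy by (simp add: lin_smult[OF R_lin[OF b(2)]])
    also have "\<dots> = sweedler2 A A (\<lambda>u v. p b x \<odot>\<^bsub>A\<^esub> (p b' v \<odot>\<^bsub>A\<^esub> u)) y"
      unfolding R_def by (rule A.lin_sweedler2[OF A.vs A.vs R_bilin[OF b(2)] lin_smultI[OF A.vs lin_id] xy(2)])
    also have "\<dots> = sweedler2 A A (\<lambda>u v. ?g x u v) y"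
      by (rule A.sweedler2_cong[OF A.vs trilinD(4)[OF g xy(1)] xy(2)]) simp
    finally show "R b' (p b x \<odot>\<^bsub>A\<^esub> y) = sweedler2 A A (\<lambda>u v. ?g x u v) y" .
  qed
  also have "\<dots> = sweedler3 A A ?g a" by (rule A.sweedler_coassoc[OF A.vs g a, symmetric])
  finally show "R b' (P b a) = sweedler3 A A ?g a" .
qed

lemma PR_commute: "b \<in> carrier B \<Longrightarrow> b' \<in> carrier B \<Longrightarrow> a \<in> carrier A \<Longrightarrow> P b (R b' a) = R b' (P b a)"
  by (simp add: PR_sweedler3)

end

text \<open>The counterpart of \<open>tensor_lift_alg_hom\<close> for twisted derivations. It is
  used with f given by a skew-primitive s, g by its group-like k and h by the unit.\<close>

lemma tensor_lift_derivation:
  assumes A: "assoc_algebra A" and B: "assoc_algebra B" and C: "assoc_algebra C"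
    and f: "bilin A B C f" and g: "bilin A B C g" and h: "bilin A B C h"
    and mult: "\<And>a a' b b'. a \<in> carrier A \<Longrightarrow> a' \<in> carrier A \<Longrightarrow> b \<in> carrier B \<Longrightarrow> b' \<in> carrier B \<Longrightarrow>
      f (a \<otimes>\<^bsub>A\<^esub> a') (b \<otimes>\<^bsub>B\<^esub> b') = g a b \<otimes>\<^bsub>C\<^esub> f a' b' \<oplus>\<^bsub>C\<^esub> f a b \<otimes>\<^bsub>C\<^esub> h a' b'"
    and t: "t \<in> carrier (tensor_module A B)" and u: "u \<in> carrier (tensor_module A B)"
  shows "tensor_lift C f (t \<otimes>\<^bsub>tensor_algebra A B\<^esub> u) =
    tensor_lift C g t \<otimes>\<^bsub>C\<^esub> tensor_lift C f u \<oplus>\<^bsub>C\<^esub> tensor_lift C f t \<otimes>\<^bsub>C\<^esub> tensor_lift C h u"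
proof -
  let ?T = "tensor_module A B" and ?TA = "tensor_algebra A B"
  have VA: "vspace A" and VB: "vspace B" and VC: "vspace C" and VT: "vspace ?T" using A B C by simp_all
  have TA: "assoc_algebra ?TA" using A B by simp
  note lf = tensor_lift_lin[OF VA VB VC f] and lg = tensor_lift_lin[OF VA VB VC g]
    and lh = tensor_lift_lin[OF VA VB VC h]
  have TAl: "(\<lambda>t. t \<otimes>\<^bsub>?TA\<^esub> u) \<in> linear_maps ?T ?T" "(\<lambda>t. u \<otimes>\<^bsub>?TA\<^esub> t) \<in> linear_maps ?T ?T"
    if "u \<in> carrier ?T" for u
    using lin_mult_right[OF TA, of u] lin_mult_left[OF TA, of u] that by (simp_all add: linear_maps_def)
  have mr: "(\<lambda>t. k t \<otimes>\<^bsub>C\<^esub> c) \<in> linear_maps ?T C" if "k \<in> linear_maps ?T C" "c \<in> carrier C" for k c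
    by (rule lin_comp[OF that(1) lin_mult_right[OF C that(2)]])
  have ml: "(\<lambda>t. c \<otimes>\<^bsub>C\<^esub> k t) \<in> linear_maps ?T C" if "k \<in> linear_maps ?T C" "c \<in> carrier C" for k c
    by (rule lin_comp[OF that(1) lin_mult_left[OF C that(2)]])
  note cl = lin_closed[OF lf] lin_closed[OF lg] lin_closed[OF lh]
  show ?thesis
  proof (rule tensor_ext[OF VA VB lin_comp[OF TAl(1)[OF u] lf]
        lin_addI[OF VC mr[OF lg cl(1)[OF u]] mr[OF lf cl(3)[OF u]]] _ t])
    fix a b assume ab: "a \<in> carrier A" "b \<in> carrier B"
    have abT: "tensor A B a b \<in> carrier ?T" using ab VA VB by simp
    show "tensor_lift C f (tensor A B a b \<otimes>\<^bsub>?TA\<^esub> u) =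
        tensor_lift C g (tensor A B a b) \<otimes>\<^bsub>C\<^esub> tensor_lift C f u \<oplus>\<^bsub>C\<^esub>
        tensor_lift C f (tensor A B a b) \<otimes>\<^bsub>C\<^esub> tensor_lift C h u"
      by (rule tensor_ext[OF VA VB lin_comp[OF TAl(2)[OF abT] lf]
            lin_addI[OF VC ml[OF lf cl(2)[OF abT]] ml[OF lh cl(1)[OF abT]]] _ u])
         (use ab A B VA VB VC f g h in \<open>simp add: mult\<close>)
  qed
qed

context hopf_alg
begin

lemma counit_bilin: "bilin H H H (\<lambda>a b. counit H a \<odot> b)" "bilin H H H (\<lambda>a b. counit H b \<odot> a)"
  by (intro bilinI lin_smultI lin_scalar counit_lin lin_id vs; assumption)+

text \<open>Apply the counit to the antipode law: \<epsilon>(x) = \<Sum> \<epsilon>(S(x_1))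
  \<epsilon>(x_2) = \<epsilon>(S(x)).\<close>

lemma counit_antipode: "x \<in> carrier H \<Longrightarrow> counit H (antipode H x) = counit H x"
proof -
  assume x: "x \<in> carrier H"
  have b: "bilin H H H (\<lambda>a b. antipode H a \<otimes> b)"
    by (rule bilin_comp[OF bilin_mult[OF alg] antipode_lin lin_id])
  have b': "bilin H H scalars (\<lambda>a b. counit H (antipode H (counit H b \<odot> a)))"
    by (rule bilin_lin[OF counit_bilin(2) lin_comp[OF antipode_lin counit_lin]])
  have "counit H x = counit H (sweedler2 H H (\<lambda>a b. antipode H a \<otimes> b) x)"
    using hopf x alg_hom_one[OF counit_hom] by (simp add: hopf_algebra_def Let_def lin_smult[OF counit_lin])
  also have "\<dots> = sweedler2 H scalars (\<lambda>a b. counit H (antipode H a \<otimes> b)) x"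
    by (rule lin_sweedler2[OF vs vspace_scalars b counit_lin x])
  also have "\<dots> = sweedler2 H scalars (\<lambda>a b. counit H (antipode H (counit H b \<odot> a))) x"
    by (rule sweedler2_cong[OF vspace_scalars b' x])
       (simp add: alg_hom_mult[OF counit_hom] antipode_closed lin_smult[OF antipode_lin] lin_smult[OF counit_lin])
  also have "\<dots> = counit H (antipode H (sweedler2 H H (\<lambda>a b. counit H b \<odot> a) x))"
    by (rule lin_sweedler2[symmetric, OF vs vspace_scalars counit_bilin(2) lin_comp[OF antipode_lin counit_lin] x])
  also have "\<dots> = counit H (antipode H x)" by (simp add: counit_right x)
  finally show ?thesis by simp
qed

end

section \<open>Operators on the tensor product and the product of the double\<close>

context hopf_pairing
begin

abbreviation (input) "TM \<equiv> tensor_module A B"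
abbreviation (input) "EE \<equiv> end_algebra TM"

lemma VT: "vspace TM" by simp
lemma AE: "assoc_algebra EE" by simp
lemma VE: "vspace EE" by simp

lemma tensor_bilin: "bilin A B TM (tensor A B)"
  by (rule bilin_tensor[OF A.vs B.vs])

definition T_op :: "('a \<Rightarrow> 'b \<Rightarrow> ('a \<times> 'b \<Rightarrow>\<^sub>0 'k) set) \<Rightarrow> ('a \<times> 'b \<Rightarrow>\<^sub>0 'k) set \<Rightarrow> ('a \<times> 'b \<Rightarrow>\<^sub>0 'k) set" where
  "T_op F = (\<lambda>t\<in>carrier TM. tensor_lift TM F t)"

lemma T_op_closed: "bilin A B TM F \<Longrightarrow> T_op F \<in> carrier EE"
  unfolding T_op_def by (intro end_restrictI VT tensor_lift_lin[OF A.vs B.vs VT])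

lemma T_op_tensor: "bilin A B TM F \<Longrightarrow> a \<in> carrier A \<Longrightarrow> c \<in> carrier B \<Longrightarrow> T_op F (tensor A B a c) = F a c"
  by (simp add: T_op_def)

lemma E_eqI:
  assumes "f \<in> carrier EE" "g \<in> carrier EE"
    and "\<And>a c. a \<in> carrier A \<Longrightarrow> c \<in> carrier B \<Longrightarrow> f (tensor A B a c) = g (tensor A B a c)"
  shows "f = g"
  by (rule end_eqI[OF assms(1,2)])
     (rule tensor_ext[OF A.vs B.vs end_carrierD[OF assms(1)] end_carrierD[OF assms(2)] assms(3)])

lemma T_op_lin:
  assumes g: "\<And>l. l \<in> carrier L \<Longrightarrow> bilin A B TM (g l)" and L: "vspace L"
    and lin: "\<And>a c. a \<in> carrier A \<Longrightarrow> c \<in> carrier B \<Longrightarrow> (\<lambda>l. g l a c) \<in> linear_maps L TM"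
  shows "(\<lambda>l. T_op (g l)) \<in> linear_maps L EE"
  by (intro linI E_eqI)
     (use L in \<open>simp_all add: T_op_closed g VE T_op_tensor lin_add[OF lin] lin_smult[OF lin]\<close>)

definition "act_left x = T_op (\<lambda>a c. tensor A B (x \<otimes>\<^bsub>A\<^esub> a) c)"
definition "act1 b = T_op (\<lambda>a c. tensor A B (P (antipode B b) a) c)"
definition "act2 b = T_op (\<lambda>a c. tensor A B a (b \<otimes>\<^bsub>B\<^esub> c))"
definition "act3 b = T_op (\<lambda>a c. tensor A B (R b a) c)"

lemma act_bilin:
  "x \<in> carrier A \<Longrightarrow> bilin A B TM (\<lambda>a c. tensor A B (x \<otimes>\<^bsub>A\<^esub> a) c)"
  "b \<in> carrier B \<Longrightarrow> bilin A B TM (\<lambda>a c. tensor A B (P (antipode B b) a) c)"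
  "b \<in> carrier B \<Longrightarrow> bilin A B TM (\<lambda>a c. tensor A B a (b \<otimes>\<^bsub>B\<^esub> c))"
  "b \<in> carrier B \<Longrightarrow> bilin A B TM (\<lambda>a c. tensor A B (R b a) c)"
  by (rule bilin_comp[OF tensor_bilin] lin_mult_left[OF A.alg] lin_mult_left[OF B.alg]
      P_lin R_lin lin_id B.antipode_closed | assumption)+

lemmas act_closed =
  T_op_closed[OF act_bilin(1), folded act_left_def] T_op_closed[OF act_bilin(2), folded act1_def]
  T_op_closed[OF act_bilin(3), folded act2_def] T_op_closed[OF act_bilin(4), folded act3_def]

lemmas act_tensor =
  T_op_tensor[OF act_bilin(1), folded act_left_def] T_op_tensor[OF act_bilin(2), folded act1_def]
  T_op_tensor[OF act_bilin(3), folded act2_def] T_op_tensor[OF act_bilin(4), folded act3_def]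

lemma act_lin:
  "act_left \<in> linear_maps A EE" "act1 \<in> linear_maps B EE" "act2 \<in> linear_maps B EE" "act3 \<in> linear_maps B EE"
proof -
  show "act_left \<in> linear_maps A EE"
    unfolding act_left_def[abs_def]
    by (rule T_op_lin[OF act_bilin(1) A.vs lin_comp[OF lin_mult_right[OF A.alg] bilinD(2)[OF tensor_bilin]]])
  show "act1 \<in> linear_maps B EE"
    unfolding act1_def[abs_def]
    by (rule T_op_lin[OF act_bilin(2) B.vs lin_comp[OF lin_comp[OF B.antipode_lin bilinD(2)[OF PR_bilin(1)]]
          bilinD(2)[OF tensor_bilin]]])
  show "act2 \<in> linear_maps B EE"
    unfolding act2_def[abs_def]
    by (rule T_op_lin[OF act_bilin(3) B.vs lin_comp[OF lin_mult_right[OF B.alg] bilinD(1)[OF tensor_bilin]]])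
  show "act3 \<in> linear_maps B EE"
    unfolding act3_def[abs_def]
    by (rule T_op_lin[OF act_bilin(4) B.vs lin_comp[OF bilinD(2)[OF PR_bilin(2)] bilinD(2)[OF tensor_bilin]]])
qed

text \<open>For \<open>act1\<close> two reversals cancel: P is an antihomomorphism and so is the
  antipode.\<close>

lemma act_hom:
  "act_left \<in> algebra_hom A EE" "act1 \<in> algebra_hom B EE" "act2 \<in> algebra_hom B EE" "act3 \<in> algebra_hom B EE"
  by (intro alg_homI act_lin E_eqI;
      simp add: act_closed act_tensor AE alg_assoc antipode_one antipode_mult P_one R_one P_mult R_mult
        B.antipode_closed P_closed R_closed)+

lemma act_commute:
  assumes "b \<in> carrier B" "b' \<in> carrier B"
  shows "act1 b \<otimes>\<^bsub>EE\<^esub> act2 b' = act2 b' \<otimes>\<^bsub>EE\<^esub> act1 b"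
    "act1 b \<otimes>\<^bsub>EE\<^esub> act3 b' = act3 b' \<otimes>\<^bsub>EE\<^esub> act1 b"
    "act2 b \<otimes>\<^bsub>EE\<^esub> act3 b' = act3 b' \<otimes>\<^bsub>EE\<^esub> act2 b"
  by (intro E_eqI;
      use assms in \<open>simp add: act_closed act_tensor AE PR_commute B.antipode_closed P_closed R_closed\<close>)+

text \<open>The bracketing follows \<open>sweedler3\<close>, which splits the first leg of the outer
  coproduct again; the convolution lemma then applies twice.\<close>

definition "op12 b = sweedler2 B EE (\<lambda>x y. act1 x \<otimes>\<^bsub>EE\<^esub> act2 y) b"
definition "op b = sweedler2 B EE (\<lambda>x y. op12 x \<otimes>\<^bsub>EE\<^esub> act3 y) b"

lemma op12_hom: "bilin B B EE (\<lambda>x y. act1 x \<otimes>\<^bsub>EE\<^esub> act2 y)" "op12 \<in> algebra_hom B EE"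
  using B.convolution_hom[OF AE act_hom(2,3) act_commute(1)] by (simp_all add: op12_def[abs_def])

lemma op12_act3: "b \<in> carrier B \<Longrightarrow> c \<in> carrier B \<Longrightarrow> op12 b \<otimes>\<^bsub>EE\<^esub> act3 c = act3 c \<otimes>\<^bsub>EE\<^esub> op12 b"
proof -
  assume b: "b \<in> carrier B" and c: "c \<in> carrier B"
  note bl = op12_hom(1)
  have bl': "bilin B B EE (\<lambda>x y. act3 c \<otimes>\<^bsub>EE\<^esub> (act1 x \<otimes>\<^bsub>EE\<^esub> act2 y))"
    by (rule bilin_lin[OF bl lin_mult_left[OF AE act_closed(4)[OF c]]])
  have "op12 b \<otimes>\<^bsub>EE\<^esub> act3 c = sweedler2 B EE (\<lambda>x y. (act1 x \<otimes>\<^bsub>EE\<^esub> act2 y) \<otimes>\<^bsub>EE\<^esub> act3 c) b"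
    unfolding op12_def by (rule B.lin_sweedler2[OF VE VE bl lin_mult_right[OF AE act_closed(4)[OF c]] b])
  also have "\<dots> = sweedler2 B EE (\<lambda>x y. act3 c \<otimes>\<^bsub>EE\<^esub> (act1 x \<otimes>\<^bsub>EE\<^esub> act2 y)) b"
  proof (rule B.sweedler2_cong[OF VE bl' b])
    fix x y assume xy: "x \<in> carrier B" "y \<in> carrier B"
    have "(act1 x \<otimes>\<^bsub>EE\<^esub> act2 y) \<otimes>\<^bsub>EE\<^esub> act3 c = act1 x \<otimes>\<^bsub>EE\<^esub> (act3 c \<otimes>\<^bsub>EE\<^esub> act2 y)"
      unfolding act_commute(3)[OF xy(2) c, symmetric]
      using xy c by (simp add: alg_assoc[OF AE] act_closed)
    also have "\<dots> = (act1 x \<otimes>\<^bsub>EE\<^esub> act3 c) \<otimes>\<^bsub>EE\<^esub> act2 y"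
      using xy c by (simp add: alg_assoc[OF AE] act_closed)
    also have "\<dots> = act3 c \<otimes>\<^bsub>EE\<^esub> (act1 x \<otimes>\<^bsub>EE\<^esub> act2 y)"
      unfolding act_commute(2)[OF xy(1) c] using xy c by (simp add: alg_assoc[OF AE] act_closed)
    finally show "(act1 x \<otimes>\<^bsub>EE\<^esub> act2 y) \<otimes>\<^bsub>EE\<^esub> act3 c = act3 c \<otimes>\<^bsub>EE\<^esub> (act1 x \<otimes>\<^bsub>EE\<^esub> act2 y)" .
  qed
  also have "\<dots> = act3 c \<otimes>\<^bsub>EE\<^esub> op12 b"
    unfolding op12_def by (rule B.lin_sweedler2[symmetric, OF VE VE bl lin_mult_left[OF AE act_closed(4)[OF c]] b])
  finally show ?thesis .
qed

lemma op_hom: "bilin B B EE (\<lambda>x y. op12 x \<otimes>\<^bsub>EE\<^esub> act3 y)" "op \<in> algebra_hom B EE"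
  using B.convolution_hom[OF AE op12_hom(2) act_hom(4) op12_act3] by (simp_all add: op_def[abs_def])

lemmas op_closed = alg_hom_closed[OF op_hom(2)]

lemma eval_lin: "t \<in> carrier TM \<Longrightarrow> (\<lambda>f. f t) \<in> linear_maps EE TM"
  by (rule linI) (simp_all add: end_carrier_closed)

lemma op_trilin:
  assumes "a \<in> carrier A" "c \<in> carrier B"
  shows "trilin B TM (\<lambda>b1 b2 b3. tensor A B (P (antipode B b1) (R b3 a)) (b2 \<otimes>\<^bsub>B\<^esub> c))"
proof (rule trilinI)
  fix x y assume xy: "x \<in> carrier B" "y \<in> carrier B"
  show "(\<lambda>b1. tensor A B (P (antipode B b1) (R y a)) (x \<otimes>\<^bsub>B\<^esub> c)) \<in> linear_maps B TM"
    by (rule lin_comp[OF lin_comp[OF B.antipode_lin bilinD(2)[OF PR_bilin(1)]] bilinD(2)[OF tensor_bilin]])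
       (use assms xy in \<open>simp_all add: R_closed\<close>)
  show "(\<lambda>b2. tensor A B (P (antipode B x) (R y a)) (b2 \<otimes>\<^bsub>B\<^esub> c)) \<in> linear_maps B TM"
    by (rule lin_comp[OF lin_mult_right[OF B.alg] bilinD(1)[OF tensor_bilin]])
       (use assms xy in \<open>simp_all add: R_closed P_closed B.antipode_closed\<close>)
  show "(\<lambda>b3. tensor A B (P (antipode B x) (R b3 a)) (y \<otimes>\<^bsub>B\<^esub> c)) \<in> linear_maps B TM"
    by (rule lin_comp[OF lin_comp[OF bilinD(2)[OF PR_bilin(2)] P_lin] bilinD(2)[OF tensor_bilin]])
       (use assms xy in \<open>simp_all add: R_closed P_closed B.antipode_closed\<close>)
qed

lemma op_tensor:
  assumes b: "b \<in> carrier B" and a: "a \<in> carrier A" and c: "c \<in> carrier B"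
  shows "op b (tensor A B a c) =
    sweedler3 B TM (\<lambda>b1 b2 b3. tensor A B (P (antipode B b1) (R b3 a)) (b2 \<otimes>\<^bsub>B\<^esub> c)) b"
proof -
  have ac: "tensor A B a c \<in> carrier TM" using a c by simp
  have "op b (tensor A B a c) = sweedler2 B TM (\<lambda>x y. (op12 x \<otimes>\<^bsub>EE\<^esub> act3 y) (tensor A B a c)) b"
    unfolding op_def by (rule B.lin_sweedler2[OF VE VT op_hom(1) eval_lin[OF ac] b])
  also have "\<dots> = sweedler3 B TM (\<lambda>b1 b2 b3. tensor A B (P (antipode B b1) (R b3 a)) (b2 \<otimes>\<^bsub>B\<^esub> c)) b"
    unfolding sweedler3_def
  proof (rule B.sweedler2_cong[OF VT B.trilin_bilin_left[OF VT op_trilin[OF a c]] b])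
    fix x y assume xy: "x \<in> carrier B" "y \<in> carrier B"
    let ?a = "R y a"
    have aA: "?a \<in> carrier A" using a xy by (simp add: R_closed)
    have aT: "tensor A B ?a c \<in> carrier TM" using aA c by simp
    have "(op12 x \<otimes>\<^bsub>EE\<^esub> act3 y) (tensor A B a c) = op12 x (tensor A B ?a c)"
      using ac xy a c by (simp add: act_tensor)
    also have "\<dots> = sweedler2 B TM (\<lambda>b1 b2. (act1 b1 \<otimes>\<^bsub>EE\<^esub> act2 b2) (tensor A B ?a c)) x"
      unfolding op12_def by (rule B.lin_sweedler2[OF VE VT op12_hom(1) eval_lin[OF aT] xy(1)])
    also have "\<dots> = sweedler2 B TM (\<lambda>b1 b2. tensor A B (P (antipode B b1) ?a) (b2 \<otimes>\<^bsub>B\<^esub> c)) x"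
      by (rule B.sweedler2_cong[OF VT trilinD(5)[OF op_trilin[OF a c] xy(2)] xy(1)])
         (use aA aT c in \<open>simp add: act_tensor\<close>)
    finally show "(op12 x \<otimes>\<^bsub>EE\<^esub> act3 y) (tensor A B a c) =
        sweedler2 B TM (\<lambda>b1 b2. tensor A B (P (antipode B b1) ?a) (b2 \<otimes>\<^bsub>B\<^esub> c)) x" .
  qed
  finally show ?thesis .
qed

text \<open>On the unit both coregular actions are multiplication by the counit, and
  \<epsilon>(S(b)) = \<epsilon>(b); the counit laws then absorb the two outer legs of b. This is
  what lets an element of the double be recovered from its action on 1 \<otimes> 1.\<close>

lemma op_one_tensor:
  assumes b: "b \<in> carrier B"
  shows "op b (tensor A B \<one>\<^bsub>A\<^esub> \<one>\<^bsub>B\<^esub>) = tensor A B \<one>\<^bsub>A\<^esub> b"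
proof -
  have PR1: "P c \<one>\<^bsub>A\<^esub> = counit B c \<odot>\<^bsub>A\<^esub> \<one>\<^bsub>A\<^esub>" "R c \<one>\<^bsub>A\<^esub> = counit B c \<odot>\<^bsub>A\<^esub> \<one>\<^bsub>A\<^esub>" if "c \<in> carrier B" for c
    using that alg_hom_one[OF A.comult_hom] by (simp_all add: P_def R_def sweedler2_def P_bilin R_bilin p_one)
  define g where "g b1 b2 b3 = (counit B b1 * counit B b3) \<odot>\<^bsub>B\<^esub> b2" for b1 b2 b3
  have g: "trilin B B g"
    unfolding g_def
    by (intro trilinI lin_scalar lin_smultI lin_id B.vs)
       (use lin_smultI[OF vspace_scalars B.counit_lin] in \<open>simp_all add: mult.commute\<close>)
  have Z: "(\<lambda>c. tensor A B \<one>\<^bsub>A\<^esub> c) \<in> linear_maps B TM" by (rule bilinD(1)[OF tensor_bilin]) simp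
  have "op b (tensor A B \<one>\<^bsub>A\<^esub> \<one>\<^bsub>B\<^esub>) =
      sweedler3 B TM (\<lambda>b1 b2 b3. tensor A B (P (antipode B b1) (R b3 \<one>\<^bsub>A\<^esub>)) (b2 \<otimes>\<^bsub>B\<^esub> \<one>\<^bsub>B\<^esub>)) b"
    by (rule op_tensor[OF b]) simp_all
  also have "\<dots> = sweedler3 B TM (\<lambda>b1 b2 b3. tensor A B \<one>\<^bsub>A\<^esub> (g b1 b2 b3)) b"
    by (rule B.sweedler3_cong[OF VT trilin_lin[OF g Z] b])
       (simp add: PR1 lin_smult[OF P_lin] B.antipode_closed B.counit_antipode g_def
         tensor_smult_left tensor_smult_right mult.commute)
  also have "\<dots> = tensor A B \<one>\<^bsub>A\<^esub> (sweedler3 B B g b)"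
    by (rule B.lin_sweedler3[OF B.vs VT g Z b, symmetric])
  also have "sweedler3 B B g b = sweedler2 B B (\<lambda>a b. counit B b \<odot>\<^bsub>B\<^esub> a) b"
    unfolding sweedler3_def
  proof (rule B.sweedler2_cong[OF B.vs _ b])
    show "bilin B B B (\<lambda>a b. counit B b \<odot>\<^bsub>B\<^esub> a)" by (rule B.counit_bilin)
    fix y c assume yc: "y \<in> carrier B" "c \<in> carrier B"
    have "counit B c \<odot>\<^bsub>B\<^esub> y = counit B c \<odot>\<^bsub>B\<^esub> sweedler2 B B (\<lambda>a b. counit B a \<odot>\<^bsub>B\<^esub> b) y"
      by (simp add: B.counit_left yc)
    also have "\<dots> = sweedler2 B B (\<lambda>a b. counit B c \<odot>\<^bsub>B\<^esub> (counit B a \<odot>\<^bsub>B\<^esub> b)) y"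
      by (rule B.lin_sweedler2[OF B.vs B.vs B.counit_bilin(1) lin_smultI[OF B.vs lin_id] yc(1)])
    also have "\<dots> = sweedler2 B B (\<lambda>a b. g a b c) y"
      by (rule B.sweedler2_cong[OF B.vs trilinD(5)[OF g yc(2)] yc(1)]) (simp add: g_def mult.commute)
    finally show "sweedler2 B B (\<lambda>a b. g a b c) y = counit B c \<odot>\<^bsub>B\<^esub> y" by simp
  qed
  also have "\<dots> = b" by (rule B.counit_right[OF b])
  finally show ?thesis .
qed

text \<open>The factors \<langle>S(b_1), a_1\<rangle> and \<langle>b_3, a_3\<rangle> of the double's
  product are exactly what P and R extract from a', so the innermost expression is the action of a
  after that of b on a' \<otimes> b'. The rest is pulling linear maps out of Sweedler sums and
  lifts.\<close>

lemma double_mult_eq: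
  assumes t: "t \<in> carrier TM" and u: "u \<in> carrier TM"
  shows "bilin A B TM (\<lambda>a b. act_left a (op b u))"
    "double_mult A B p t u = tensor_lift TM (\<lambda>a b. act_left a (op b u)) t"
proof -
  have bl: "bilin A B TM (\<lambda>a b. act_left a (op b u))" if u: "u \<in> carrier TM" for u
  proof (rule bilinI)
    fix a assume a: "a \<in> carrier A"
    show "(\<lambda>b. act_left a (op b u)) \<in> linear_maps B TM"
      by (rule lin_comp[OF lin_comp[OF alg_hom_lin[OF op_hom(2)] eval_lin[OF u]]
            end_carrierD[OF act_closed(1)[OF a]]])
  next
    fix b assume b: "b \<in> carrier B"
    show "(\<lambda>a. act_left a (op b u)) \<in> linear_maps A TM"
      by (rule lin_comp[OF act_lin(1) eval_lin]) (use b u in \<open>simp add: end_carrier_closed op_closed\<close>)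
  qed
  show "bilin A B TM (\<lambda>a b. act_left a (op b u))" by (rule bl[OF u])
  define Q where "Q a b a' b' = sweedler3 B TM (\<lambda>b1 b2 b3. sweedler3 A TM (\<lambda>a1 a2 a3.
          (p (antipode B b1) a1 * p b3 a3) \<odot>\<^bsub>TM\<^esub> tensor A B (a \<otimes>\<^bsub>A\<^esub> a2) (b2 \<otimes>\<^bsub>B\<^esub> b')) a') b" for a b a' b'
  have Q: "Q a b a' b' = act_left a (op b (tensor A B a' b'))"
    if "a \<in> carrier A" "b \<in> carrier B" "a' \<in> carrier A" "b' \<in> carrier B" for a b a' b'
  proof -
    have L: "act_left a \<in> linear_maps TM TM" by (rule end_carrierD[OF act_closed(1)[OF that(1)]])
    have "act_left a (op b (tensor A B a' b')) =
        sweedler3 B TM (\<lambda>b1 b2 b3. act_left a (tensor A B (P (antipode B b1) (R b3 a')) (b2 \<otimes>\<^bsub>B\<^esub> b'))) b"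
      unfolding op_tensor[OF that(2-4)]
      by (rule B.lin_sweedler3[OF VT VT op_trilin[OF that(3,4)] L that(2)])
    moreover have "Q a b a' b' = \<dots>"
      unfolding Q_def
    proof (rule B.sweedler3_cong[OF VT trilin_lin[OF op_trilin[OF that(3,4)] L] that(2)])
      fix b1 b2 b3 assume c: "b1 \<in> carrier B" "b2 \<in> carrier B" "b3 \<in> carrier B"
      let ?Z = "\<lambda>x. tensor A B (a \<otimes>\<^bsub>A\<^esub> x) (b2 \<otimes>\<^bsub>B\<^esub> b')"
      have Sb: "antipode B b1 \<in> carrier B" using c by (simp add: B.antipode_closed)
      have Z: "?Z \<in> linear_maps A TM"
        by (rule lin_comp[OF lin_mult_left[OF A.alg that(1)] bilinD(2)[OF tensor_bilin]]) (use c that in simp)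
      note g = trilin_pp(3)[OF Sb c(3)]
      have "act_left a (tensor A B (P (antipode B b1) (R b3 a')) (b2 \<otimes>\<^bsub>B\<^esub> b')) = ?Z (P (antipode B b1) (R b3 a'))"
        using that c Sb by (simp add: act_tensor P_closed R_closed)
      also have "\<dots> = sweedler3 A TM (\<lambda>x y v. ?Z ((p (antipode B b1) x * p b3 v) \<odot>\<^bsub>A\<^esub> y)) a'"
        unfolding PR_sweedler3(1)[OF Sb c(3) that(3)]
        by (rule A.lin_sweedler3[OF A.vs VT g Z that(3)])
      also have "\<dots> = sweedler3 A TM (\<lambda>a1 a2 a3. (p (antipode B b1) a1 * p b3 a3) \<odot>\<^bsub>TM\<^esub> ?Z a2) a'"
        by (rule A.sweedler3_cong[symmetric, OF VT trilin_lin[OF g Z] that(3)]) (simp add: lin_smult[OF Z])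
      finally show "sweedler3 A TM (\<lambda>a1 a2 a3. (p (antipode B b1) a1 * p b3 a3) \<odot>\<^bsub>TM\<^esub> ?Z a2) a' =
        act_left a (tensor A B (P (antipode B b1) (R b3 a')) (b2 \<otimes>\<^bsub>B\<^esub> b'))" by simp
    qed
    ultimately show ?thesis by simp
  qed
  have inner: "tensor_lift TM (\<lambda>a' b'. Q a b a' b') u = act_left a (op b u)"
    if "a \<in> carrier A" "b \<in> carrier B" for a b
  proof -
    have lin: "(\<lambda>u. act_left a (op b u)) \<in> linear_maps TM TM"
      by (rule lin_comp[OF end_carrierD[OF op_closed[OF that(2)]] end_carrierD[OF act_closed(1)[OF that(1)]]])
    have bq: "bilin A B TM (\<lambda>a' b'. act_left a (op b (tensor A B a' b')))"
      by (rule bilin_lin[OF tensor_bilin lin])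
    have "tensor_lift TM (\<lambda>a' b'. Q a b a' b') u = tensor_lift TM (\<lambda>a' b'. act_left a (op b (tensor A B a' b'))) u"
      by (rule tensor_lift_cong[OF A.vs B.vs VT bq u]) (rule Q[OF that])
    also have "\<dots> = act_left a (op b u)"
      by (rule tensor_ext[OF A.vs B.vs tensor_lift_lin[OF A.vs B.vs VT bq] lin _ u]) (simp add: bq)
    finally show ?thesis .
  qed
  show "double_mult A B p t u = tensor_lift TM (\<lambda>a b. act_left a (op b u)) t"
    unfolding double_mult_def Let_def Q_def[symmetric]
    by (rule tensor_lift_cong[OF A.vs B.vs VT bl[OF u] t]) (rule inner)
qed

end

section \<open>Exchange relations for group-like and skew-primitive elements\<close>

context hopf_pairing
begin

lemma p_grouplike_mult:
  assumes k: "grouplike_elem B k" and x: "x \<in> carrier A" "y \<in> carrier A"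
  shows "p k (x \<otimes>\<^bsub>A\<^esub> y) = p k x * p k y"
proof -
  have kB: "k \<in> carrier B" using k by (simp add: grouplike_elem_def)
  have "bilin B B scalars (\<lambda>b1 b2. p b2 x * p b1 y)"
    using lin_smultI[OF vspace_scalars p_lin'[OF x(1)]] lin_smultI[OF vspace_scalars p_lin'[OF x(2)]]
    by (intro bilinI) (simp_all add: mult.commute)
  then show ?thesis unfolding p_mult[OF kB x] by (simp add: sweedler2_grouplike k)
qed

text \<open>The pairing uses the opposite coproduct, so the right leg of s \<otimes> k + 1 \<otimes>
  s meets the left factor x.\<close>

lemma p_skew_mult:
  assumes s: "skew_primitive B \<one>\<^bsub>B\<^esub> k s" and x: "x \<in> carrier A" "y \<in> carrier A"
  shows "p s (x \<otimes>\<^bsub>A\<^esub> y) = p k x * p s y + p s x * p \<one>\<^bsub>B\<^esub> y"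
proof -
  have sB: "s \<in> carrier B" using s by (simp add: skew_primitive_def)
  have "bilin B B scalars (\<lambda>b1 b2. p b2 x * p b1 y)"
    using lin_smultI[OF vspace_scalars p_lin'[OF x(1)]] lin_smultI[OF vspace_scalars p_lin'[OF x(2)]]
    by (intro bilinI) (simp_all add: mult.commute)
  then show ?thesis unfolding p_mult[OF sB x] by (simp add: sweedler2_skew_primitive[OF _ _ _ s])
qed

lemma PR_grouplike_hom:
  assumes k: "grouplike_elem B k"
  shows "P k \<in> algebra_hom A A" "R k \<in> algebra_hom A A"
proof -
  have kB: "k \<in> carrier B" "counit B k = 1" using k by (simp_all add: grouplike_elem_def)
  show "P k \<in> algebra_hom A A"
    unfolding P_def[abs_def] sweedler2_def
    by (rule alg_hom_comp[OF A.comult_hom tensor_lift_alg_hom[OF A.alg A.alg A.alg P_bilin[OF kB(1)]]])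
       (simp_all add: kB p_one p_grouplike_mult[OF k] mult.commute)
  show "R k \<in> algebra_hom A A"
    unfolding R_def[abs_def] sweedler2_def
    by (rule alg_hom_comp[OF A.comult_hom tensor_lift_alg_hom[OF A.alg A.alg A.alg R_bilin[OF kB(1)]]])
       (simp_all add: kB p_one p_grouplike_mult[OF k] mult.commute)
qed

text \<open>Instance of \<open>tensor_lift_derivation\<close>: the functional of s obeys the twisted
  product rule \<open>p_skew_mult\<close>, and the unit of B acts as the identity.\<close>

lemma PR_skew:
  assumes s: "skew_primitive B \<one>\<^bsub>B\<^esub> k s" and x: "x \<in> carrier A" "a \<in> carrier A"
  shows "P s (x \<otimes>\<^bsub>A\<^esub> a) = P k x \<otimes>\<^bsub>A\<^esub> P s a \<oplus>\<^bsub>A\<^esub> P s x \<otimes>\<^bsub>A\<^esub> a"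
    "R s (x \<otimes>\<^bsub>A\<^esub> a) = R k x \<otimes>\<^bsub>A\<^esub> R s a \<oplus>\<^bsub>A\<^esub> R s x \<otimes>\<^bsub>A\<^esub> a"
proof -
  have B: "s \<in> carrier B" "k \<in> carrier B" using s by (simp_all add: skew_primitive_def grouplike_elem_def)
  have o: "\<one>\<^bsub>B\<^esub> \<in> carrier B" by simp
  note \<Delta> = A.comult_closed[OF x(1)] A.comult_closed[OF x(2)]
  have "P s (x \<otimes>\<^bsub>A\<^esub> a) = P k x \<otimes>\<^bsub>A\<^esub> P s a \<oplus>\<^bsub>A\<^esub> P s x \<otimes>\<^bsub>A\<^esub> P \<one>\<^bsub>B\<^esub> a"
    unfolding P_def sweedler2_def alg_hom_mult[OF A.comult_hom x]
    by (rule tensor_lift_derivation[OF A.alg A.alg A.alg P_bilin[OF B(1)] P_bilin[OF B(2)] P_bilin[OF o] _ \<Delta>])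
       (simp add: p_skew_mult[OF s] vs_smult_l_distr mult.commute)
  then show "P s (x \<otimes>\<^bsub>A\<^esub> a) = P k x \<otimes>\<^bsub>A\<^esub> P s a \<oplus>\<^bsub>A\<^esub> P s x \<otimes>\<^bsub>A\<^esub> a" by (simp add: P_one x)
  have "R s (x \<otimes>\<^bsub>A\<^esub> a) = R k x \<otimes>\<^bsub>A\<^esub> R s a \<oplus>\<^bsub>A\<^esub> R s x \<otimes>\<^bsub>A\<^esub> R \<one>\<^bsub>B\<^esub> a"
    unfolding R_def sweedler2_def alg_hom_mult[OF A.comult_hom x]
    by (rule tensor_lift_derivation[OF A.alg A.alg A.alg R_bilin[OF B(1)] R_bilin[OF B(2)] R_bilin[OF o] _ \<Delta>])
       (simp add: p_skew_mult[OF s] vs_smult_l_distr mult.commute)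
  then show "R s (x \<otimes>\<^bsub>A\<^esub> a) = R k x \<otimes>\<^bsub>A\<^esub> R s a \<oplus>\<^bsub>A\<^esub> R s x \<otimes>\<^bsub>A\<^esub> a" by (simp add: R_one x)
qed

lemma PR_of_grouplike:
  "b \<in> carrier B \<Longrightarrow> grouplike_elem A g \<Longrightarrow> P b g = p b g \<odot>\<^bsub>A\<^esub> g"
  "b \<in> carrier B \<Longrightarrow> grouplike_elem A g \<Longrightarrow> R b g = p b g \<odot>\<^bsub>A\<^esub> g"
  by (simp_all add: P_def R_def sweedler2_grouplike P_bilin R_bilin)

lemma PR_of_skew:
  assumes "b \<in> carrier B" "skew_primitive A l \<one>\<^bsub>A\<^esub> e"
  shows "P b e = p b e \<odot>\<^bsub>A\<^esub> \<one>\<^bsub>A\<^esub> \<oplus>\<^bsub>A\<^esub> p b l \<odot>\<^bsub>A\<^esub> e"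
    "R b e = counit B b \<odot>\<^bsub>A\<^esub> e \<oplus>\<^bsub>A\<^esub> p b e \<odot>\<^bsub>A\<^esub> l"
  using assms
  by (simp_all add: P_def R_def sweedler2_skew_primitive[OF _ _ _ assms(2)] P_bilin R_bilin p_one)

lemma op_grouplike:
  assumes k: "grouplike_elem B k" and a: "a \<in> carrier A" "c \<in> carrier B"
  shows "op k (tensor A B a c) = tensor A B (P (antipode B k) (R k a)) (k \<otimes>\<^bsub>B\<^esub> c)"
proof -
  have kB: "k \<in> carrier B" using k by (simp add: grouplike_elem_def)
  have "op k = (act1 k \<otimes>\<^bsub>EE\<^esub> act2 k) \<otimes>\<^bsub>EE\<^esub> act3 k"
    by (simp add: op_def op12_def sweedler2_grouplike[OF B.vs VE _ k] op12_hom(1) op_hom(1)[unfolded op12_def])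
  then show ?thesis using a kB by (simp add: act_tensor R_closed)
qed

text \<open>The three terms come from the iterated coproduct s \<otimes> k \<otimes> k + 1 \<otimes>
  s \<otimes> k + 1 \<otimes> 1 \<otimes> s.\<close>

lemma op_skew:
  assumes s: "skew_primitive B \<one>\<^bsub>B\<^esub> k s" and a: "a \<in> carrier A" "c \<in> carrier B"
  shows "op s (tensor A B a c) = tensor A B (P (antipode B s) (R k a)) (k \<otimes>\<^bsub>B\<^esub> c) \<oplus>\<^bsub>TM\<^esub>
    tensor A B (R k a) (s \<otimes>\<^bsub>B\<^esub> c) \<oplus>\<^bsub>TM\<^esub> tensor A B (R s a) c"
proof -
  have B: "s \<in> carrier B" "k \<in> carrier B" using s by (simp_all add: skew_primitive_def grouplike_elem_def)
  have "op s = op12 s \<otimes>\<^bsub>EE\<^esub> act3 k \<oplus>\<^bsub>EE\<^esub> op12 \<one>\<^bsub>B\<^esub> \<otimes>\<^bsub>EE\<^esub> act3 s"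
    unfolding op_def by (rule sweedler2_skew_primitive[OF B.vs VE op_hom(1) s])
  moreover have "op12 s = act1 s \<otimes>\<^bsub>EE\<^esub> act2 k \<oplus>\<^bsub>EE\<^esub> act1 \<one>\<^bsub>B\<^esub> \<otimes>\<^bsub>EE\<^esub> act2 s"
    unfolding op12_def by (rule sweedler2_skew_primitive[OF B.vs VE op12_hom(1) s])
  ultimately show ?thesis using a B
    by (simp add: act_tensor alg_hom_one[OF op12_hom(2)] alg_hom_one[OF act_hom(2)] R_closed)
qed

lemma p_grouplike_inverse:
  assumes "antipode B k \<otimes>\<^bsub>B\<^esub> k = \<one>\<^bsub>B\<^esub>" "k \<in> carrier B" "grouplike_elem A g"
  shows "p (antipode B k) g * p k g = 1"
proof -
  have g: "g \<in> carrier A" "counit A g = 1" using assms by (simp_all add: grouplike_elem_def)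
  have Sk: "antipode B k \<in> carrier B" by (rule B.antipode_closed[OF assms(2)])
  have "p (antipode B k \<otimes>\<^bsub>B\<^esub> k) g = p (antipode B k) g * p k g"
    unfolding p_mult'[OF Sk assms(2) g(1)]
    by (rule sweedler2_grouplike[OF A.vs vspace_scalars bilin_pp[OF Sk assms(2)] assms(3)])
  then show ?thesis using assms(1) g by (simp add: p_one')
qed

context
  fixes k assumes k: "grouplike_elem B k" "grouplike_elem B (antipode B k)"
    and Sk: "antipode B k \<otimes>\<^bsub>B\<^esub> k = \<one>\<^bsub>B\<^esub>"
begin

private lemma kB: "k \<in> carrier B" "antipode B k \<in> carrier B"
  using k by (simp_all add: grouplike_elem_def)

private lemmas PR_mult = alg_hom_mult[OF PR_grouplike_hom(1)[OF k(1)]] alg_hom_mult[OF PR_grouplike_hom(2)[OF k(1)]]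
  alg_hom_mult[OF PR_grouplike_hom(1)[OF k(2)]]

private lemmas ts = tensor_smult_left[OF A.vs B.vs] tensor_smult_right[OF A.vs B.vs]
  tensor_add_left[OF A.vs B.vs] tensor_add_right[OF A.vs B.vs]

text \<open>P and R contribute the constants \<langle>S(k), g\<rangle> and \<langle>k, g\<rangle>,
  whose product is 1. The actual value of the pairing, and with it the sign left open for the square
  roots, drops out.\<close>

lemma op_grouplike_grouplike:
  assumes g: "grouplike_elem A g"
  shows "op k \<otimes>\<^bsub>EE\<^esub> act_left g = act_left g \<otimes>\<^bsub>EE\<^esub> op k"
proof -
  have gA: "g \<in> carrier A" using g by (simp add: grouplike_elem_def)
  note inv = p_grouplike_inverse[OF Sk kB(1) g]
  show ?thesis
    by (rule E_eqI)
       (simp_all add: alg_mult_closed[OF AE] op_closed act_closed gA kB act_tensor op_grouplike[OF k(1)] PR_mult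
          PR_of_grouplike[OF _ g] R_closed P_closed lin_smult[OF P_lin] ts inv mult.commute[of "p k g"])
qed

text \<open>As k pairs to zero with e and has counit 1, R k fixes e; the constant comes from the
  action of P at S(k) alone, which multiplies e by \<langle>S(k), l\<rangle>.\<close>

lemma op_grouplike_skew:
  assumes e: "skew_primitive A l \<one>\<^bsub>A\<^esub> e" and z: "p k e = 0" "p (antipode B k) e = 0"
  shows "op k \<otimes>\<^bsub>EE\<^esub> act_left e = p (antipode B k) l \<odot>\<^bsub>EE\<^esub> (act_left e \<otimes>\<^bsub>EE\<^esub> op k)"
proof -
  have eA: "e \<in> carrier A" "l \<in> carrier A" using e by (simp_all add: skew_primitive_def grouplike_elem_def)
  have \<epsilon>: "counit B k = 1" using k by (simp add: grouplike_elem_def)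
  show ?thesis
    by (rule E_eqI)
       (simp_all add: alg_mult_closed[OF AE] vs_smult_closed[OF VE] op_closed act_closed eA kB act_tensor
          op_grouplike[OF k(1)] PR_mult PR_of_skew[OF _ e] R_closed P_closed ts z \<epsilon>)
qed

context
  fixes s assumes s: "skew_primitive B \<one>\<^bsub>B\<^esub> k s"
    and Ss: "antipode B s = (- 1) \<odot>\<^bsub>B\<^esub> (s \<otimes>\<^bsub>B\<^esub> antipode B k)"
begin

private lemma sB: "s \<in> carrier B" "counit B s = 0"
  using s by (simp_all add: skew_primitive_def)

text \<open>S(s) = - s S(k), and P reverses the product.\<close>

private lemma P_Ss: "a \<in> carrier A \<Longrightarrow> P (antipode B s) a = (- 1) \<odot>\<^bsub>A\<^esub> P (antipode B k) (P s a)"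
  using sB kB by (simp add: Ss bilin_simps[OF PR_bilin(1)] P_mult)

text \<open>R k or R s contributes \<langle>k, g\<rangle> to each of the three terms of
  \<open>op_skew\<close>, while P at S(s) passes g freely because the constants of k and S(k)
  cancel.\<close>

lemma op_skew_grouplike:
  assumes g: "grouplike_elem A g" and z: "p s g = 0"
  shows "op s \<otimes>\<^bsub>EE\<^esub> act_left g = p k g \<odot>\<^bsub>EE\<^esub> (act_left g \<otimes>\<^bsub>EE\<^esub> op s)"
proof -
  have gA: "g \<in> carrier A" using g by (simp add: grouplike_elem_def)
  note inv = p_grouplike_inverse[OF Sk kB(1) g]
  note cl = alg_mult_closed[OF AE] vs_smult_closed[OF VE] op_closed act_closed gA sB kB R_closed P_closed
    B.antipode_closed
  have P_Ssg: "P (antipode B s) (g \<otimes>\<^bsub>A\<^esub> y) = g \<otimes>\<^bsub>A\<^esub> P (antipode B s) y" if y: "y \<in> carrier A" for y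
    using y inv
    by (simp add: P_Ss PR_skew[OF s] PR_of_grouplike[OF _ g] cl z lin_smult[OF P_lin] PR_mult mult.commute[of "p k g"])
  show ?thesis
    by (rule E_eqI)
       (simp_all add: cl act_tensor op_skew[OF s] PR_mult(2) PR_skew(2)[OF s] P_Ssg PR_of_grouplike(2)[OF _ g]
          lin_smult[OF P_lin] lin_add[OF end_carrierD[OF act_closed(1)]] ts z vs_smult_r_distr)
qed

text \<open>Two correction terms appear: R s sends e to \<langle>s, e\<rangle> l, which gives
  \<open>act_left l\<close>, and P at S(s) yields - \<langle>s, e\<rangle> times P at S(k), which
  reassembles to \<open>op k\<close>. For s = f_i and e = e_i this is the relation between e_i and
  f_i.\<close>

lemma op_skew_skew:
  assumes e: "skew_primitive A l \<one>\<^bsub>A\<^esub> e" and z: "p k e = 0" "p (antipode B k) e = 0" "p s l = 0"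
  shows "op s \<otimes>\<^bsub>EE\<^esub> act_left e = act_left e \<otimes>\<^bsub>EE\<^esub> op s \<oplus>\<^bsub>EE\<^esub>
    p s e \<odot>\<^bsub>EE\<^esub> (act_left l \<oplus>\<^bsub>EE\<^esub> (- 1) \<odot>\<^bsub>EE\<^esub> op k)"
proof -
  have eA: "e \<in> carrier A" "l \<in> carrier A" and l: "grouplike_elem A l"
    using e by (simp_all add: skew_primitive_def grouplike_elem_def)
  have \<epsilon>: "counit B k = 1" using k by (simp add: grouplike_elem_def)
  note inv = p_grouplike_inverse[OF Sk kB(1) l]
  note cl = alg_mult_closed[OF AE] vs_smult_closed[OF VE] vs_add_closed[OF VE] op_closed act_closed
    eA sB kB R_closed P_closed B.antipode_closed
  have P_Sse: "P (antipode B s) (e \<otimes>\<^bsub>A\<^esub> y) = e \<otimes>\<^bsub>A\<^esub> P (antipode B s) y \<oplus>\<^bsub>A\<^esub> (- p s e) \<odot>\<^bsub>A\<^esub> P (antipode B k) y"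
    if y: "y \<in> carrier A" for y
    using y inv
    by (simp add: P_Ss PR_skew[OF s] PR_of_skew[OF _ e] cl z alg_l_distr lin_add[OF P_lin] lin_smult[OF P_lin]
        PR_mult vs_smult_r_distr mult.commute[of "p k l"])
  show ?thesis
  proof (rule E_eqI)
    fix a c assume ac: "a \<in> carrier A" "c \<in> carrier B"
    have cT: "tensor A B a c \<in> carrier TM" using ac by simp
    show "(op s \<otimes>\<^bsub>EE\<^esub> act_left e) (tensor A B a c) = (act_left e \<otimes>\<^bsub>EE\<^esub> op s \<oplus>\<^bsub>EE\<^esub>
        p s e \<odot>\<^bsub>EE\<^esub> (act_left l \<oplus>\<^bsub>EE\<^esub> (- 1) \<odot>\<^bsub>EE\<^esub> op k)) (tensor A B a c)"
    proof (rule vs_eq_by_functionals[OF VT])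
      fix \<xi> assume \<xi>: "\<xi> \<in> linear_maps TM scalars"
      show "\<xi> ((op s \<otimes>\<^bsub>EE\<^esub> act_left e) (tensor A B a c)) = \<xi> ((act_left e \<otimes>\<^bsub>EE\<^esub> op s \<oplus>\<^bsub>EE\<^esub>
          p s e \<odot>\<^bsub>EE\<^esub> (act_left l \<oplus>\<^bsub>EE\<^esub> (- 1) \<odot>\<^bsub>EE\<^esub> op k)) (tensor A B a c))"
        using ac
        by (simp add: cT act_tensor cl op_skew[OF s] op_grouplike[OF k(1)] PR_mult(2) P_Sse PR_skew(2)[OF s]
            PR_of_skew(2)[OF _ e] z \<epsilon> alg_l_distr lin_add[OF end_carrierD[OF act_closed(1)]] ts
            lin_add[OF \<xi>] lin_smult[OF \<xi>] algebra_simps)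
    qed (use cT in \<open>simp_all add: cl end_carrier_closed\<close>)
  qed (simp_all add: cl)
qed

end

end

end

section \<open>Transport of Hopf structures\<close>

lemma tensor_lift_tensor_algebra:
  "tensor_lift (tensor_algebra A B) f = tensor_lift (tensor_module A B) f"
  by (simp add: fun_eq_iff tensor_lift_def finsum_def finprod_def)

text \<open>D is not known beforehand to be associative or coassociative; its operations only have
  to correspond to those of L under the linear bijection m. Identities in D are tested after m,
  identities in D \<otimes> D after m \<otimes> m, and the preimages of S serve as generators of
  D.\<close>

lemma hopf_transport:
  fixes D :: "('k::field, 'd) hopf" and L :: "('k, 'a) hopf"
  assumes L: "generated_hopf L S" "carrier L = subalg L S"
    and VD: "vspace D" and one: "\<one>\<^bsub>D\<^esub> \<in> carrier D"
    and mult: "\<And>x y. x \<in> carrier D \<Longrightarrow> y \<in> carrier D \<Longrightarrow> x \<otimes>\<^bsub>D\<^esub> y \<in> carrier D"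
    and comult: "\<And>x. x \<in> carrier D \<Longrightarrow> comult D x \<in> carrier (tensor_module D D)"
    and antipode: "\<And>x. x \<in> carrier D \<Longrightarrow> antipode D x \<in> carrier D"
    and m: "m \<in> linear_maps D L" "bij_betw m (carrier D) (carrier L)"
    and m_one: "m \<one>\<^bsub>D\<^esub> = \<one>\<^bsub>L\<^esub>"
    and m_mult: "\<And>x y. x \<in> carrier D \<Longrightarrow> y \<in> carrier D \<Longrightarrow> m (x \<otimes>\<^bsub>D\<^esub> y) = m x \<otimes>\<^bsub>L\<^esub> m y"
    and m_comult: "\<And>x. x \<in> carrier D \<Longrightarrow>
      tensor_lift (tensor_module L L) (\<lambda>a b. tensor L L (m a) (m b)) (comult D x) = comult L (m x)"
    and m_counit: "\<And>x. x \<in> carrier D \<Longrightarrow> counit L (m x) = counit D x"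
    and m_antipode: "\<And>x. x \<in> carrier D \<Longrightarrow> m (antipode D x) = antipode L (m x)"
  shows "hopf_isomorphic D L"
proof -
  interpret L: generated_hopf L S by (rule L)
  note VL = L.vs
  note mc = lin_closed[OF m(1)] and m_simps = lin_add[OF m(1)] lin_smult[OF m(1)]
  have inj: "x = y" if "m x = m y" "x \<in> carrier D" "y \<in> carrier D" for x y
    using that m(2) by (auto simp: bij_betw_def inj_on_def)
  define \<psi> where "\<psi> = inv_into (carrier D) m"
  have \<psi>: "\<psi> x \<in> carrier D" "m (\<psi> x) = x" if "x \<in> carrier L" for x
    using that m(2) by (auto simp: \<psi>_def bij_betw_def inv_into_into f_inv_into_f)
  have \<psi>m: "\<psi> (m x) = x" if "x \<in> carrier D" for x
    using that m(2) by (simp add: \<psi>_def bij_betw_def)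
  have \<psi>l: "\<psi> \<in> linear_maps L D"
    by (intro linI inj) (use VD VL in \<open>simp_all add: \<psi> m_simps\<close>)
  have bD: "bilin D D D (\<lambda>x y. x \<otimes>\<^bsub>D\<^esub> y)"
    by (intro bilinI linI inj)
       (use VD VL L.alg in \<open>simp_all add: mult m_mult m_simps mc alg_l_distr alg_r_distr\<close>)
  have AD: "assoc_algebra D"
    by (intro assoc_algebraI VD one bD inj)
       (use L.alg in \<open>simp_all add: mult one m_mult m_one mc alg_assoc\<close>)
  define TD where "TD = tensor_module D D"
  define TL where "TL = tensor_module L L"
  have VTD: "vspace TD" and VTL: "vspace TL" using VD VL by (simp_all add: TD_def TL_def)
  have b2: "bilin D D TL (\<lambda>a b. tensor L L (m a) (m b))"
    unfolding TL_def by (rule bilin_comp[OF bilin_tensor[OF VL VL] m(1) m(1)])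
  have b2': "bilin L L TD (\<lambda>a b. tensor D D (\<psi> a) (\<psi> b))"
    unfolding TD_def by (rule bilin_comp[OF bilin_tensor[OF VD VD] \<psi>l \<psi>l])
  define M2 where "M2 = tensor_lift TL (\<lambda>a b. tensor L L (m a) (m b))"
  have M2l: "M2 \<in> linear_maps TD TL"
    unfolding M2_def TD_def by (rule tensor_lift_lin[OF VD VD VTL b2])
  have M2p: "M2 (tensor D D a b) = tensor L L (m a) (m b)" if "a \<in> carrier D" "b \<in> carrier D" for a b
    using that VD VTL b2 by (simp add: M2_def)
  \<comment> \<open>The inverse of m, applied to both legs, undoes m \<otimes> m; so equality in D
    \<otimes> D may be tested in L \<otimes> L.\<close>
  have M2_left: "tensor_lift TD (\<lambda>a b. tensor D D (\<psi> a) (\<psi> b)) (M2 t) = t" if "t \<in> carrier TD" for t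
    by (rule tensor_ext[OF VD VD lin_comp[OF M2l[unfolded TD_def] tensor_lift_lin[OF VL VL VTD b2', folded TL_def]]])
       (use that VL VTD b2' in \<open>simp_all add: M2p mc \<psi>m TD_def lin_id\<close>)
  have M2_inj: "t = u" if "M2 t = M2 u" "t \<in> carrier TD" "u \<in> carrier TD" for t u
    using that M2_left by metis
  have M2_hom: "M2 \<in> algebra_hom (tensor_algebra D D) (tensor_algebra L L)"
    unfolding M2_def TL_def tensor_lift_tensor_algebra[symmetric]
    by (rule tensor_lift_alg_hom[OF AD AD])
       (use L.alg b2 in \<open>simp_all add: TL_def m_one m_mult mc\<close>)
  have \<Delta>: "comult D x \<in> carrier TD" "M2 (comult D x) = comult L (m x)" if "x \<in> carrier D" for x
    using comult[OF that] m_comult[OF that] by (simp_all add: TD_def TL_def M2_def)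
  note \<Delta>Ll = alg_hom_lin[OF L.comult_hom]
  have TAD: "assoc_algebra (tensor_algebra D D)" using AD by simp
  have comult_hom: "comult D \<in> algebra_hom D (tensor_algebra D D)"
  proof (intro alg_homI linI)
    show "comult D \<one>\<^bsub>D\<^esub> = \<one>\<^bsub>tensor_algebra D D\<^esub>"
      using alg_hom_one[OF L.comult_hom] alg_hom_one[OF M2_hom] \<Delta>[OF one] VD one
      by (intro M2_inj) (simp_all add: m_one TD_def)
    fix x assume x: "x \<in> carrier D"
    show "comult D x \<in> carrier (tensor_algebra D D)" using \<Delta>[OF x] by (simp add: TD_def)
    show "comult D (c \<odot>\<^bsub>D\<^esub> x) = c \<odot>\<^bsub>tensor_algebra D D\<^esub> comult D x" for c
      unfolding tensor_algebra_simps TD_def[symmetric]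
      using \<Delta>[OF x] \<Delta>[of "c \<odot>\<^bsub>D\<^esub> x"] x VD VTD
      by (intro M2_inj) (simp_all add: lin_smult[OF M2l] m_simps lin_smult[OF \<Delta>Ll] mc TL_def)
    fix y assume y: "y \<in> carrier D"
    show "comult D (x \<oplus>\<^bsub>D\<^esub> y) = comult D x \<oplus>\<^bsub>tensor_algebra D D\<^esub> comult D y"
      unfolding tensor_algebra_simps TD_def[symmetric]
      using \<Delta>[OF x] \<Delta>[OF y] \<Delta>[of "x \<oplus>\<^bsub>D\<^esub> y"] x y VD VTD
      by (intro M2_inj) (simp_all add: lin_add[OF M2l] m_simps lin_add[OF \<Delta>Ll] mc TL_def)
    show "comult D (x \<otimes>\<^bsub>D\<^esub> y) = comult D x \<otimes>\<^bsub>tensor_algebra D D\<^esub> comult D y"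
      using \<Delta>[OF x] \<Delta>[OF y] \<Delta>[OF mult[OF x y]] x y alg_mult_closed[OF TAD, of "comult D x" "comult D y"]
        alg_hom_mult[OF M2_hom, of "comult D x" "comult D y"] alg_hom_mult[OF L.comult_hom, of "m x" "m y"]
      by (intro M2_inj) (simp_all add: TD_def m_mult mc)
  qed
  have counit_hom: "counit D \<in> algebra_hom D scalars"
    using alg_hom_one[OF L.counit_hom] VD
    by (intro alg_homI linI)
       (simp_all add: m_counit[symmetric] one mult m_one m_mult m_simps mc alg_hom_mult[OF L.counit_hom]
          lin_add[OF alg_hom_lin[OF L.counit_hom]] lin_smult[OF alg_hom_lin[OF L.counit_hom]])
  have antipode_lin: "antipode D \<in> linear_maps D D"
    by (intro linI inj)
       (use VD in \<open>simp_all add: antipode m_antipode m_simps mc lin_add[OF L.antipode_lin] lin_smult[OF L.antipode_lin]\<close>)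
  have antipode_one: "antipode D \<one>\<^bsub>D\<^esub> = \<one>\<^bsub>D\<^esub>"
    by (intro inj) (simp_all add: antipode one m_antipode m_one L.antipode_one)
  have antipode_mult: "antipode D (x \<otimes>\<^bsub>D\<^esub> y) = antipode D y \<otimes>\<^bsub>D\<^esub> antipode D x"
    if "x \<in> carrier D" "y \<in> carrier D" for x y
    using that by (intro inj) (simp_all add: antipode mult m_antipode m_mult mc L.antipode_mult)
  have grouplike: "grouplike_elem D (\<psi> k)" if k: "grouplike_elem L k" for k
  proof -
    have kL: "k \<in> carrier L" "comult L k = tensor L L k k" "counit L k = 1" using k by (simp_all add: grouplike_elem_def)
    have "comult D (\<psi> k) = tensor D D (\<psi> k) (\<psi> k)"
      using \<Delta>[OF \<psi>(1)[OF kL(1)]] kL \<psi> VD by (intro M2_inj) (simp_all add: M2p TD_def)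
    then show ?thesis using kL \<psi> m_counit[OF \<psi>(1)[OF kL(1)]] by (simp add: grouplike_elem_def)
  qed
  have skew: "skew_primitive D (\<psi> l) (\<psi> k) (\<psi> s)" if s: "skew_primitive L l k s" for l k s
  proof -
    have sL: "s \<in> carrier L" "l \<in> carrier L" "k \<in> carrier L" "grouplike_elem L l" "grouplike_elem L k"
      "comult L s = tensor L L s k \<oplus>\<^bsub>TL\<^esub> tensor L L l s" "counit L s = 0"
      using s by (simp_all add: skew_primitive_def grouplike_elem_def TL_def)
    have tc: "tensor D D (\<psi> s) (\<psi> k) \<in> carrier TD" "tensor D D (\<psi> l) (\<psi> s) \<in> carrier TD"
      using sL \<psi> VD by (simp_all add: TD_def)
    have "comult D (\<psi> s) = tensor D D (\<psi> s) (\<psi> k) \<oplus>\<^bsub>TD\<^esub> tensor D D (\<psi> l) (\<psi> s)"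
      using \<Delta>[OF \<psi>(1)[OF sL(1)]] sL \<psi> tc VTD
      by (intro M2_inj) (simp_all add: M2p lin_add[OF M2l])
    then show ?thesis using sL \<psi> m_counit[OF \<psi>(1)[OF sL(1)]] grouplike by (simp add: skew_primitive_def TD_def)
  qed
  have "hopf_algebra D"
  proof (rule hopf_algebraI_generated[OF AD _ _ comult_hom counit_hom antipode_lin antipode_one antipode_mult])
    show sub: "\<psi> ` S \<subseteq> carrier D" using L.S_closed \<psi> by blast
    have "\<psi> x \<in> subalg D (\<psi> ` S)" if "x \<in> subalg L S" for x
      using that
    proof induct
      case one
      have "\<psi> \<one>\<^bsub>L\<^esub> = \<one>\<^bsub>D\<^esub>" using \<psi>m[OF \<open>\<one>\<^bsub>D\<^esub> \<in> carrier D\<close>] by (simp add: m_one)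
      then show ?case by (simp add: subalg.one)
    next
      case (mult s x)
      have c: "s \<in> carrier L" "x \<in> carrier L" using mult L.S_closed L(2) by auto
      have "\<psi> (s \<otimes>\<^bsub>L\<^esub> x) = \<psi> s \<otimes>\<^bsub>D\<^esub> \<psi> x"
        using c \<psi> L.alg by (intro inj) (simp_all add: m_mult assms(5))
      then show ?case using mult by (simp add: subalg.mult)
    next
      case (add x y)
      then show ?case using L(2) by (simp add: lin_add[OF \<psi>l] subalg.add)
    next
      case (smult x c)
      then show ?case using L(2) by (simp add: lin_smult[OF \<psi>l] subalg.smult)
    qed
    then show "carrier D = subalg D (\<psi> ` S)"
      using subalg_closed[OF AD sub] \<psi>m mc L(2) by (metis subsetI subset_antisym)
    fix s' assume "s' \<in> \<psi> ` S"
    then obtain s where s: "s \<in> S" "s' = \<psi> s" by blast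
    have sL: "s \<in> carrier L" using s L.S_closed by blast
    have zero: "x = \<zero>\<^bsub>D\<^esub>" if "x \<in> carrier D" "m x = \<zero>\<^bsub>L\<^esub>" for x
      using that VD VL by (intro inj) (simp_all add: lin_zero[OF m(1)])
    show "(grouplike_elem D s' \<and> antipode D s' \<otimes>\<^bsub>D\<^esub> s' = \<one>\<^bsub>D\<^esub> \<and> s' \<otimes>\<^bsub>D\<^esub> antipode D s' = \<one>\<^bsub>D\<^esub>) \<or>
      (\<exists>l k. skew_primitive D l k s' \<and>
        antipode D s' \<otimes>\<^bsub>D\<^esub> k \<oplus>\<^bsub>D\<^esub> antipode D l \<otimes>\<^bsub>D\<^esub> s' = \<zero>\<^bsub>D\<^esub> \<and>
        s' \<otimes>\<^bsub>D\<^esub> antipode D k \<oplus>\<^bsub>D\<^esub> l \<otimes>\<^bsub>D\<^esub> antipode D s' = \<zero>\<^bsub>D\<^esub>)"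
      using L.gens[OF s(1)]
    proof (elim disjE bexE conjE)
      assume g: "grouplike_elem L s" "antipode L s \<otimes>\<^bsub>L\<^esub> s = \<one>\<^bsub>L\<^esub>" "s \<otimes>\<^bsub>L\<^esub> antipode L s = \<one>\<^bsub>L\<^esub>"
      have "antipode D s' \<otimes>\<^bsub>D\<^esub> s' = \<one>\<^bsub>D\<^esub>" "s' \<otimes>\<^bsub>D\<^esub> antipode D s' = \<one>\<^bsub>D\<^esub>"
        using g sL \<psi> s by (auto intro!: inj simp: mult antipode one m_mult m_antipode m_one)
      then show ?thesis using grouplike[OF g(1)] s by simp
    next
      fix l k assume lk: "l \<in> subalg L S" "k \<in> subalg L S" "skew_primitive L l k s"
        and z: "antipode L s \<otimes>\<^bsub>L\<^esub> k \<oplus>\<^bsub>L\<^esub> antipode L l \<otimes>\<^bsub>L\<^esub> s = \<zero>\<^bsub>L\<^esub>"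
        "s \<otimes>\<^bsub>L\<^esub> antipode L k \<oplus>\<^bsub>L\<^esub> l \<otimes>\<^bsub>L\<^esub> antipode L s = \<zero>\<^bsub>L\<^esub>"
      have c: "l \<in> carrier L" "k \<in> carrier L" using lk L(2) by simp_all
      have "antipode D s' \<otimes>\<^bsub>D\<^esub> \<psi> k \<oplus>\<^bsub>D\<^esub> antipode D (\<psi> l) \<otimes>\<^bsub>D\<^esub> s' = \<zero>\<^bsub>D\<^esub>"
        "s' \<otimes>\<^bsub>D\<^esub> antipode D (\<psi> k) \<oplus>\<^bsub>D\<^esub> \<psi> l \<otimes>\<^bsub>D\<^esub> antipode D s' = \<zero>\<^bsub>D\<^esub>"
        using z c sL \<psi> s VD by (auto intro!: zero simp: mult antipode m_mult m_antipode m_simps)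
      then show ?thesis using skew[OF lk(3)] s by blast
    qed
  qed
  moreover have "hopf_algebra L" by (rule L.hopf_algebra[OF L(2)])
  moreover have "m \<in> algebra_hom D L" by (rule alg_homI[OF m(1) m_one m_mult])
  ultimately show ?thesis
    unfolding hopf_isomorphic_def sweedler2_def
    using m(2) m_comult m_counit m_antipode by (intro conjI bexI[of _ m] ballI) auto
qed

section \<open>Recognising a Drinfeld double\<close>

text \<open>A criterion for a Hopf algebra L to be the double of two Hopf subalgebras: the common
  extension \<open>\<rho>\<close> of the two actions makes the multiplication map injective, and
  \<open>factor\<close> makes it surjective.\<close>

locale double_factorization =
  L: generated_hopf L S + HA: generated_hopf L SA + HB: generated_hopf L SB +
  hopf_pairing "generated_hopf.sub L SA" "generated_hopf.sub L SB" p
  for L :: "('k::field, 'a) hopf" and S SA SB p +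
  fixes \<rho>
  assumes carrier_L: "carrier L = subalg L S"
    and \<rho>: "\<rho> \<in> algebra_hom L (end_algebra (tensor_module HA.sub HB.sub))"
    and \<rho>_A: "a \<in> subalg L SA \<Longrightarrow> \<rho> a = act_left a"
    and \<rho>_B: "b \<in> subalg L SB \<Longrightarrow> \<rho> b = op b"
    and factor: "x \<in> carrier L \<Longrightarrow> x \<in> tensor_lift L (\<lambda>a b. a \<otimes>\<^bsub>L\<^esub> b) ` carrier (tensor_module HA.sub HB.sub)"
begin

abbreviation "AA \<equiv> HA.sub"
abbreviation "BB \<equiv> HB.sub"
abbreviation "T \<equiv> tensor_module AA BB"
abbreviation "D \<equiv> drinfeld_double AA BB p"
abbreviation "TL \<equiv> tensor_module L L"

lemma L_simps [simp]: "assoc_algebra L" "vspace L" "vspace AA" "vspace BB" "vspace T" "vspace TL"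
    "vspace (tensor_module T T)"
  and sub_closed [simp]: "a \<in> subalg L SA \<Longrightarrow> a \<in> carrier L" "b \<in> subalg L SB \<Longrightarrow> b \<in> carrier L"
  by (simp_all add: L.alg HA.sub_closed HB.sub_closed)

lemma incl_lin: "(\<lambda>x. x) \<in> linear_maps AA L" "(\<lambda>x. x) \<in> linear_maps BB L"
  by (rule linI; simp)+

lemma mult_bilin: "bilin AA BB L (\<lambda>a b. a \<otimes>\<^bsub>L\<^esub> b)"
  by (rule bilin_comp[OF bilin_mult[OF L.alg] incl_lin])

definition "m = tensor_lift L (\<lambda>a b. a \<otimes>\<^bsub>L\<^esub> b)"
definition "\<psi> x = \<rho> x (tensor AA BB \<one>\<^bsub>L\<^esub> \<one>\<^bsub>L\<^esub>)"

lemma m_lin: "m \<in> linear_maps T L"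
  unfolding m_def by (rule tensor_lift_lin[OF _ _ _ mult_bilin]) simp_all

lemmas m_closed = lin_closed[OF m_lin]

lemma m_tensor: "a \<in> subalg L SA \<Longrightarrow> b \<in> subalg L SB \<Longrightarrow> m (tensor AA BB a b) = a \<otimes>\<^bsub>L\<^esub> b"
  using mult_bilin by (simp add: m_def)

lemma one_T: "tensor AA BB \<one>\<^bsub>L\<^esub> \<one>\<^bsub>L\<^esub> \<in> carrier T"
  by (simp add: subalg.one)

lemmas \<rho>_lin = alg_hom_lin[OF \<rho>] and \<rho>_closed = alg_hom_closed[OF \<rho>]

lemma \<psi>_lin: "\<psi> \<in> linear_maps L T"
  unfolding \<psi>_def[abs_def] by (rule lin_comp[OF \<rho>_lin eval_lin[OF one_T]])

lemma \<psi>_m: "t \<in> carrier T \<Longrightarrow> \<psi> (m t) = t"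
proof (rule tensor_ext[OF _ _ lin_comp[OF m_lin \<psi>_lin] lin_id])
  fix a b assume ab: "a \<in> carrier AA" "b \<in> carrier BB"
  then have "\<psi> (m (tensor AA BB a b)) = act_left a (op b (tensor AA BB \<one>\<^bsub>L\<^esub> \<one>\<^bsub>L\<^esub>))"
    using one_T by (simp add: m_tensor \<psi>_def alg_hom_mult[OF \<rho>] \<rho>_A \<rho>_B)
  also have "\<dots> = tensor AA BB a b"
    using ab op_one_tensor[of b] act_tensor(1)[of a "\<one>\<^bsub>L\<^esub>" b] by (simp add: subalg.one)
  finally show "\<psi> (m (tensor AA BB a b)) = tensor AA BB a b" .
qed simp_all

lemma m_bij: "bij_betw m (carrier T) (carrier L)"
  unfolding bij_betw_def
  using inj_on_inverseI[of "carrier T" \<psi> m] \<psi>_m factor m_closed by (auto simp: m_def)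

lemma m_\<psi>: "x \<in> carrier L \<Longrightarrow> m (\<psi> x) = x"
  using factor[of x] \<psi>_m unfolding m_def[symmetric] by fastforce

text \<open>Since u = \<open>\<psi>\<close> (m u) is the image of 1 \<otimes> 1 under
  \<open>\<rho>\<close> (m u), the vector \<open>\<rho>\<close> (m t) u is the image of 1 \<otimes>
  1 under \<open>\<rho>\<close> of the product of m t and m u. Multiplicativity of m follows from
  that of \<open>\<rho>\<close>.\<close>

lemma double_mult:
  assumes t: "t \<in> carrier T" and u: "u \<in> carrier T"
  shows "double_mult AA BB p t u = \<rho> (m t) u" "m (double_mult AA BB p t u) = m t \<otimes>\<^bsub>L\<^esub> m u"
proof -
  note d = double_mult_eq[OF t u]
  have "tensor_lift T (\<lambda>a b. act_left a (op b u)) t = \<rho> (m t) u"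
    by (rule tensor_ext[OF _ _ tensor_lift_lin[OF _ _ _ d(1)] lin_comp[OF lin_comp[OF m_lin \<rho>_lin] eval_lin[OF u]] _ t])
       (use u in \<open>simp_all add: d(1) m_tensor alg_hom_mult[OF \<rho>] \<rho>_A \<rho>_B\<close>)
  with d(2) show eq: "double_mult AA BB p t u = \<rho> (m t) u" by simp
  have "\<rho> (m t) u = \<rho> (m t) (\<psi> (m u))" by (simp add: \<psi>_m u)
  also have "\<dots> = \<psi> (m t \<otimes>\<^bsub>L\<^esub> m u)"
    using one_T by (simp add: \<psi>_def alg_hom_mult[OF \<rho> m_closed[OF t] m_closed[OF u]])
  finally show "m (double_mult AA BB p t u) = m t \<otimes>\<^bsub>L\<^esub> m u"
    using t u by (simp add: eq m_\<psi> m_closed)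
qed

lemma double_mult_bilin: "bilin T T T (double_mult AA BB p)"
proof (rule bilin_cong)
  show "bilin T T T (\<lambda>t u. \<rho> (m t) u)"
    by (intro bilinI end_carrierD[OF \<rho>_closed] m_closed lin_comp[OF lin_comp[OF m_lin \<rho>_lin] eval_lin])
qed (simp_all add: double_mult)

definition "pure2 a1 a2 b1 b2 = tensor T T (tensor AA BB a1 b1) (tensor AA BB a2 b2)"
text \<open>The interchange of the two middle legs that defines the tensor product coalgebra, a1
  \<otimes> a2 and b1 \<otimes> b2 going to (a1 \<otimes> b1) \<otimes> (a2 \<otimes> b2); stated
  for whole tensors so that it can be fed with coproducts.\<close>

definition "W t u = tensor_lift (tensor_module T T) (\<lambda>a1 a2. tensor_lift (tensor_module T T) (pure2 a1 a2) u) t"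

lemma pure2_bilin:
  "a1 \<in> subalg L SA \<Longrightarrow> a2 \<in> subalg L SA \<Longrightarrow> bilin BB BB (tensor_module T T) (pure2 a1 a2)"
  "b1 \<in> subalg L SB \<Longrightarrow> b2 \<in> subalg L SB \<Longrightarrow> bilin AA AA (tensor_module T T) (\<lambda>a1 a2. pure2 a1 a2 b1 b2)"
  unfolding pure2_def[abs_def]
  by (rule bilin_comp[OF bilin_tensor bilinD(1)[OF tensor_bilin] bilinD(1)[OF tensor_bilin]]
      bilin_comp[OF bilin_tensor bilinD(2)[OF tensor_bilin] bilinD(2)[OF tensor_bilin]]; simp)+

lemma W_inner:
  assumes u: "u \<in> carrier (tensor_module BB BB)"
  shows "bilin AA AA (tensor_module T T) (\<lambda>a1 a2. tensor_lift (tensor_module T T) (pure2 a1 a2) u)"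
proof (rule bilinI)
  fix x assume x: "x \<in> carrier AA"
  show "(\<lambda>y. tensor_lift (tensor_module T T) (pure2 x y) u) \<in> linear_maps AA (tensor_module T T)"
    by (rule tensor_lift_param[OF _ _ _ pure2_bilin(1) _ bilinD(1)[OF pure2_bilin(2)] u]) (use x in simp_all)
  show "(\<lambda>y. tensor_lift (tensor_module T T) (pure2 y x) u) \<in> linear_maps AA (tensor_module T T)"
    by (rule tensor_lift_param[OF _ _ _ pure2_bilin(1) _ bilinD(2)[OF pure2_bilin(2)] u]) (use x in simp_all)
qed

lemma W_bilin: "bilin (tensor_module AA AA) (tensor_module BB BB) (tensor_module T T) W"
  unfolding W_def[abs_def]
proof (rule bilinI)
  fix u assume "u \<in> carrier (tensor_module BB BB)"
  then show "(\<lambda>t. tensor_lift (tensor_module T T) (\<lambda>a1 a2. tensor_lift (tensor_module T T) (pure2 a1 a2) u) t)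
      \<in> linear_maps (tensor_module AA AA) (tensor_module T T)"
    by (intro tensor_lift_lin W_inner) simp_all
next
  fix t assume t: "t \<in> carrier (tensor_module AA AA)"
  show "(\<lambda>u. tensor_lift (tensor_module T T) (\<lambda>a1 a2. tensor_lift (tensor_module T T) (pure2 a1 a2) u) t)
      \<in> linear_maps (tensor_module BB BB) (tensor_module T T)"
    by (rule tensor_lift_param[OF _ _ _ W_inner _ tensor_lift_lin[OF _ _ _ pure2_bilin(1)] t]) simp_all
qed

lemma mm_bilin: "bilin T T TL (\<lambda>x y. tensor L L (m x) (m y))"
  by (rule bilin_comp[OF bilin_tensor m_lin m_lin]) simp_all

text \<open>On pure tensors both sides are a1 b1 \<otimes> a2 b2. Fed with coproducts, it turns the
  coproduct of the double into \<Delta>(a)\<Delta>(b) = \<Delta>(ab).\<close>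

lemma W_mult:
  assumes t: "t \<in> carrier (tensor_module AA AA)" and u: "u \<in> carrier (tensor_module BB BB)"
  shows "tensor_lift TL (\<lambda>x y. tensor L L (m x) (m y)) (W t u) =
    tensor_incl L t \<otimes>\<^bsub>tensor_algebra L L\<^esub> tensor_incl L u"
proof -
  let ?M = "tensor_lift TL (\<lambda>x y. tensor L L (m x) (m y))"
  have M: "?M \<in> linear_maps (tensor_module T T) TL" by (rule tensor_lift_lin[OF _ _ _ mm_bilin]) simp_all
  have TA: "assoc_algebra (tensor_algebra L L)" by simp
  have il: "tensor_incl L \<in> linear_maps (tensor_module AA AA) TL" "tensor_incl L \<in> linear_maps (tensor_module BB BB) TL"
    unfolding HA.tensor_sub HB.tensor_sub
    by (rule tensor_incl_lin[OF L.vs HA.submodule] tensor_incl_lin[OF L.vs HB.submodule])+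
  have ip: "tensor_incl L (tensor AA AA a a') = tensor L L a a'" if "a \<in> subalg L SA" "a' \<in> subalg L SA" for a a'
    unfolding HA.tensor_sub using that by (rule tensor_incl_tensor[OF L.vs HA.submodule])
  have ip': "tensor_incl L (tensor BB BB a a') = tensor L L a a'" if "a \<in> subalg L SB" "a' \<in> subalg L SB" for a a'
    unfolding HB.tensor_sub using that by (rule tensor_incl_tensor[OF L.vs HB.submodule])
  have ml: "(\<lambda>u. x \<otimes>\<^bsub>tensor_algebra L L\<^esub> u) \<in> linear_maps TL TL" "(\<lambda>t. t \<otimes>\<^bsub>tensor_algebra L L\<^esub> x) \<in> linear_maps TL TL"
    if "x \<in> carrier TL" for x
    using lin_mult_left[OF TA, of x] lin_mult_right[OF TA, of x] that by (simp_all add: linear_maps_def)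
  show ?thesis
  proof (rule tensor_ext[OF _ _ lin_comp[OF bilinD(2)[OF W_bilin u] M] lin_comp[OF il(1) ml(2)] _ t])
    show "tensor_incl L u \<in> carrier TL" using lin_closed[OF il(2)] u by simp
    fix a a' assume a: "a \<in> carrier AA" "a' \<in> carrier AA"
    show "?M (W (tensor AA AA a a') u) = tensor_incl L (tensor AA AA a a') \<otimes>\<^bsub>tensor_algebra L L\<^esub> tensor_incl L u"
    proof (rule tensor_ext[OF _ _ lin_comp[OF bilinD(1)[OF W_bilin] M] lin_comp[OF il(2) ml(1)] _ u])
      show "tensor AA AA a a' \<in> carrier (tensor_module AA AA)" using a by simp
      show "tensor_incl L (tensor AA AA a a') \<in> carrier TL" using a by (simp add: ip)
      fix b b' assume b: "b \<in> carrier BB" "b' \<in> carrier BB"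
      have "W (tensor AA AA a a') (tensor BB BB b b') = pure2 a a' b b'"
        using a b W_inner[of "tensor BB BB b b'"] pure2_bilin(1) by (simp add: W_def)
      then show "?M (W (tensor AA AA a a') (tensor BB BB b b')) =
          tensor_incl L (tensor AA AA a a') \<otimes>\<^bsub>tensor_algebra L L\<^esub> tensor_incl L (tensor BB BB b b')"
        using a b mm_bilin by (simp add: pure2_def m_tensor ip ip')
    qed simp_all
  qed simp_all
qed

lemma D_simps:
  "carrier D = carrier T" "mult D = double_mult AA BB p" "one D = tensor AA BB \<one>\<^bsub>L\<^esub> \<one>\<^bsub>L\<^esub>" "zero D = zero T"
  "add D = add T" "smult D = smult T" "comult D = tensor_lift (tensor_module T T) (\<lambda>a b. W (comult AA a) (comult BB b))"
  "counit D = tensor_lift scalars (\<lambda>a b. counit L a * counit L b)"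
  "antipode D = tensor_lift T (\<lambda>a b.
     double_mult AA BB p (tensor AA BB \<one>\<^bsub>L\<^esub> (antipode L b)) (tensor AA BB (antipode L a) \<one>\<^bsub>L\<^esub>))"
  by (simp_all add: drinfeld_double_def Let_def W_def[abs_def] pure2_def[abs_def] sweedler2_def)

lemma double_isomorphic: "hopf_isomorphic D L"
proof (rule hopf_transport[OF L.generated_hopf_axioms carrier_L])
  note \<Delta> = bilin_comp[OF W_bilin A.comult_lin B.comult_lin]
  have \<epsilon>: "bilin AA BB scalars (\<lambda>a b. counit L a * counit L b)"
    using lin_smultI[OF vspace_scalars A.counit_lin] lin_smultI[OF vspace_scalars B.counit_lin]
    by (intro bilinI) (simp_all add: mult.commute)
  have \<sigma>: "bilin AA BB T (\<lambda>a b.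
     double_mult AA BB p (tensor AA BB \<one>\<^bsub>L\<^esub> (antipode L b)) (tensor AA BB (antipode L a) \<one>\<^bsub>L\<^esub>))"
    by (rule bilin_swap[OF bilin_comp[OF double_mult_bilin lin_comp[OF B.antipode_lin bilinD(1)[OF tensor_bilin]]
          lin_comp[OF A.antipode_lin bilinD(2)[OF tensor_bilin]]], simplified])
       (simp_all add: subalg.one)
  have TD: "tensor_module D D = tensor_module T T" "linear_maps D L = linear_maps T L"
    by (rule tensor_module_cong; simp add: D_simps) (simp add: D_simps linear_maps_def)
  note lins = tensor_lift_lin[OF _ _ _ \<Delta>] tensor_lift_lin[OF _ _ _ \<epsilon>] tensor_lift_lin[OF _ _ _ \<sigma>]
  show "vspace D" using vspace_cong[of T D] by (simp add: D_simps)
  show "\<one>\<^bsub>D\<^esub> \<in> carrier D" by (simp add: D_simps subalg.one)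
  show "x \<otimes>\<^bsub>D\<^esub> y \<in> carrier D" "m (x \<otimes>\<^bsub>D\<^esub> y) = m x \<otimes>\<^bsub>L\<^esub> m y" if "x \<in> carrier D" "y \<in> carrier D" for x y
    using that bilinD(3)[OF double_mult_bilin] by (simp_all add: D_simps double_mult(2))
  show "m \<in> linear_maps D L" by (simp add: TD m_lin)
  show "bij_betw m (carrier D) (carrier L)" by (simp add: D_simps m_bij)
  show "m \<one>\<^bsub>D\<^esub> = \<one>\<^bsub>L\<^esub>" by (simp add: D_simps m_tensor subalg.one)
  fix x assume "x \<in> carrier D"
  then have x: "x \<in> carrier T" by (simp add: D_simps)
  show "comult D x \<in> carrier (tensor_module D D)"
    unfolding TD D_simps by (rule lin_closed[OF lins(1) x]) simp_all
  show "antipode D x \<in> carrier D" 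
    unfolding TD D_simps by (rule lin_closed[OF lins(3) x]) simp_all
  have M: "tensor_lift TL (\<lambda>x y. tensor L L (m x) (m y)) \<in> linear_maps (tensor_module T T) TL"
    by (rule tensor_lift_lin[OF _ _ _ mm_bilin]) simp_all
  have \<Delta>L: "comult L \<in> linear_maps L TL" using alg_hom_lin[OF L.comult_hom] by simp
  show "tensor_lift TL (\<lambda>x y. tensor L L (m x) (m y)) (comult D x) = comult L (m x)"
    unfolding D_simps
  proof (rule tensor_ext[OF _ _ lin_comp[OF lins(1) M] lin_comp[OF m_lin \<Delta>L] _ x])
    fix a b assume ab: "a \<in> carrier AA" "b \<in> carrier BB"
    then show "tensor_lift TL (\<lambda>x y. tensor L L (m x) (m y))
        (tensor_lift (tensor_module T T) (\<lambda>a b. W (comult AA a) (comult BB b)) (tensor AA BB a b)) =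
      comult L (m (tensor AA BB a b))"
      using \<Delta> W_mult[OF A.comult_closed[OF ab(1)] B.comult_closed[OF ab(2)]]
      by (simp add: m_tensor alg_hom_mult[OF L.comult_hom] HA.comult_sub(2) HB.comult_sub(2))
  qed simp_all
  show "counit L (m x) = counit D x"
    unfolding D_simps
  proof (rule tensor_ext[OF _ _ lin_comp[OF m_lin alg_hom_lin[OF L.counit_hom]] lins(2) _ x])
    fix a b assume "a \<in> carrier AA" "b \<in> carrier BB"
    then show "counit L (m (tensor AA BB a b)) =
        tensor_lift scalars (\<lambda>a b. counit L a * counit L b) (tensor AA BB a b)"
      using \<epsilon> by (simp add: m_tensor alg_hom_mult[OF L.counit_hom])
  qed simp_all
  \<comment> \<open>Under m the antipode (1 \<otimes> S(b))(S(a) \<otimes> 1) becomes S(b)S(a),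
    which is S(ab).\<close>
  show "m (antipode D x) = antipode L (m x)"
    unfolding D_simps
  proof (rule tensor_ext[OF _ _ lin_comp[OF lins(3) m_lin] lin_comp[OF m_lin L.antipode_lin] _ x])
    fix a b assume ab: "a \<in> carrier AA" "b \<in> carrier BB"
    then have "antipode L a \<in> subalg L SA" "antipode L b \<in> subalg L SB"
      by (simp_all add: HA.antipode_closed HB.antipode_closed)
    then show "m (tensor_lift T (\<lambda>a b. double_mult AA BB p (tensor AA BB \<one>\<^bsub>L\<^esub> (antipode L b))
          (tensor AA BB (antipode L a) \<one>\<^bsub>L\<^esub>)) (tensor AA BB a b)) = antipode L (m (tensor AA BB a b))"
      using ab \<sigma> by (simp add: double_mult(2) m_tensor subalg.one L.antipode_mult)
  qed simp_all
qed

end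

section \<open>The Drinfeld double of the Borel subalgebras\<close>

lemma vs_shift:
  assumes V: "vspace V" and x: "x \<in> carrier V" and w: "w \<in> carrier V"
    and y: "y = x \<oplus>\<^bsub>V\<^esub> (- c) \<odot>\<^bsub>V\<^esub> w"
  shows "x = y \<oplus>\<^bsub>V\<^esub> c \<odot>\<^bsub>V\<^esub> w"
proof -
  have "y \<oplus>\<^bsub>V\<^esub> c \<odot>\<^bsub>V\<^esub> w = x \<oplus>\<^bsub>V\<^esub> (- c + c) \<odot>\<^bsub>V\<^esub> w"
    unfolding y vs_smult_l_distr[OF V w] using x w V by (simp add: vs_assoc)
  then show ?thesis using x w V by simp
qed

lemma serre_hom:
  assumes f: "f \<in> algebra_hom A C" and A: "assoc_algebra A" and "x \<in> carrier A" "y \<in> carrier A"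
  shows "f (serre A a b x y) = serre C a b (f x) (f y)"
  using assms by (simp add: serre_def lin_add[OF alg_hom_lin[OF f]] lin_smult[OF alg_hom_lin[OF f]] alg_hom_mult[OF f])

lemma opposite_hom: "f \<in> algebra_hom A C \<Longrightarrow> f \<in> algebra_hom (opposite A) (opposite C)"
  by (rule alg_homI) (auto simp: alg_hom_one alg_hom_mult linear_maps_def dest!: alg_hom_lin)

lemma hom_foldr:
  assumes f: "f \<in> algebra_hom A C" and A: "assoc_algebra A" and c: "\<And>i. i \<in> set xs \<Longrightarrow> c i \<in> carrier A"
  shows "foldr (\<lambda>i x. c i \<otimes>\<^bsub>A\<^esub> x) xs \<one>\<^bsub>A\<^esub> \<in> carrier A \<and>
    f (foldr (\<lambda>i x. c i \<otimes>\<^bsub>A\<^esub> x) xs \<one>\<^bsub>A\<^esub>) = foldr (\<lambda>i x. f (c i) \<otimes>\<^bsub>C\<^esub> x) xs \<one>\<^bsub>C\<^esub>"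
  using c by (induct xs) (use A in \<open>auto simp: alg_hom_one[OF f] alg_hom_mult[OF f]\<close>)

lemma grouplikes_B_simps [simp]:
  "Omega i \<in> grouplikes_B n \<longleftrightarrow> i < n" "Omega' i \<notin> grouplikes_B n"
  "SqrtGamma \<in> grouplikes_B n" "SqrtGamma' \<notin> grouplikes_B n" "Deg \<in> grouplikes_B n" "Deg' \<notin> grouplikes_B n"
  "Omega' i \<in> grouplikes_B' n \<longleftrightarrow> i < n" "Omega i \<notin> grouplikes_B' n"
  "SqrtGamma' \<in> grouplikes_B' n" "SqrtGamma \<notin> grouplikes_B' n" "Deg' \<in> grouplikes_B' n" "Deg \<notin> grouplikes_B' n"
  by (auto simp: grouplikes_B_def grouplikes_B'_def)

lemma gens_B_simps [simp]:
  "GenE i \<in> gens_B n \<longleftrightarrow> i < n" "GenF i \<notin> gens_B n"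
  "Grp t \<in> gens_B n \<longleftrightarrow> t \<in> grouplikes_B n" "Inv t \<in> gens_B n \<longleftrightarrow> t \<in> grouplikes_B n"
  "GenF i \<in> gens_B' n \<longleftrightarrow> i < n" "GenE i \<notin> gens_B' n"
  "Grp t \<in> gens_B' n \<longleftrightarrow> t \<in> grouplikes_B' n" "Inv t \<in> gens_B' n \<longleftrightarrow> t \<in> grouplikes_B' n"
  by (auto simp: gens_B_def gens_B'_def)

lemma grouplikes_B_B': "t \<in> grouplikes_B n \<Longrightarrow> t \<notin> grouplikes_B' n"
  by (cases t) simp_all

locale U_pairing =
  fixes n :: nat and p :: "U_elem \<Rightarrow> U_elem \<Rightarrow> K"
  assumes n: "n > 2"
    and skew: "skew_dual_pairing (B'_hat n) (B_hat n) p"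
    and pairing_gens: "pairing_on_generators n p"

sublocale U_pairing \<subseteq> L: generated_hopf "U_rs n" "gen n ` gens n"
  by (rule generated_hopf_U_all[OF n])
sublocale U_pairing \<subseteq> HA: generated_hopf "U_rs n" "gen n ` gens_B n"
  by (rule generated_hopf_U_B[OF n])
sublocale U_pairing \<subseteq> HB: generated_hopf "U_rs n" "gen n ` gens_B' n"
  by (rule generated_hopf_U_B'[OF n])
sublocale U_pairing \<subseteq> hopf_pairing HA.sub HB.sub p
proof (rule hopf_pairing.intro)
  show "hopf_alg HA.sub" "hopf_alg HB.sub"
    by (simp_all add: hopf_alg_def HA.hopf_algebra_sub HB.hopf_algebra_sub)
  show "hopf_pairing_axioms HA.sub HB.sub p"
    using skew B_hat_eq[OF n] B'_hat_eq[OF n] HB.antipode_one HB.antipode_mult HB.sub_closed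
    by unfold_locales (simp_all add: hopf_pairing_axioms_def)
qed

context U_pairing
begin

lemma n0: "n > 0" using n by simp

lemma mod_n [simp]: "Suc i mod n < n" using n by simp

abbreviation "U \<equiv> U_algebra n"

sublocale G: U_rep "U" n "gen n"
  by (rule U_rep_gen[OF n0])

abbreviation "AA \<equiv> HA.sub"
abbreviation "BB \<equiv> HB.sub"
abbreviation "E \<equiv> end_algebra (tensor_module AA BB)"

lemma gen_sub [simp]:
  "g \<in> gens_B n \<Longrightarrow> gen n g \<in> subalg (U_rs n) (gen n ` gens_B n)"
  "g \<in> gens_B' n \<Longrightarrow> gen n g \<in> subalg (U_rs n) (gen n ` gens_B' n)"
  by (simp_all add: subalg_incl[OF HA.alg HA.S_closed] subalg_incl[OF HB.alg HB.S_closed])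

lemma one_sub [simp]: "\<one>\<^bsub>U\<^esub> \<in> subalg (U_rs n) S"
  using subalg.one[of "U_rs n" S] by simp

lemma grouplikes_sub [simp]: "t \<in> grouplikes_B n \<Longrightarrow> t \<in> grouplikes n" "t \<in> grouplikes_B' n \<Longrightarrow> t \<in> grouplikes n"
  by (simp_all add: grouplikes_def)

lemma grouplike_A: "t \<in> grouplikes_B n \<Longrightarrow> x \<in> {Grp t, Inv t} \<Longrightarrow> grouplike_elem AA (gen n x)"
  by (rule HA.grouplike_sub[OF grouplike_gen[OF n]]) auto

lemma grouplike_B: "t \<in> grouplikes_B' n \<Longrightarrow> x \<in> {Grp t, Inv t} \<Longrightarrow> grouplike_elem BB (gen n x)"
  by (rule HB.grouplike_sub[OF grouplike_gen[OF n]]) auto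

lemma antipode_Grp: "t \<in> grouplikes n \<Longrightarrow> antipode (U_rs n) (gen n (Grp t)) = gen n (Inv t)"
  by (simp add: antipode_U_gen[OF n])

lemma antipode_F: "i < n \<Longrightarrow> antipode (U_rs n) (gen n (GenF i)) =
    (- 1) \<odot>\<^bsub>U\<^esub> (gen n (GenF i) \<otimes>\<^bsub>U\<^esub> gen n (Inv (Omega' i)))"
  by (simp add: antipode_U_gen[OF n] vs_neg_eq)

lemma skew_primitive_A: "i < n \<Longrightarrow>
    skew_primitive AA (gen n (Grp (Omega i))) \<one>\<^bsub>AA\<^esub> (gen n (GenE i))"
  using HA.skew_primitive_sub[OF skew_primitive_E[OF n]] by simp

lemma skew_primitive_B: "i < n \<Longrightarrow>
    skew_primitive BB \<one>\<^bsub>BB\<^esub> (gen n (Grp (Omega' i))) (gen n (GenF i))"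
  using HB.skew_primitive_sub[OF skew_primitive_F[OF n]] by simp

lemma p_Grp_E: "t \<in> grouplikes_B' n \<Longrightarrow> j < n \<Longrightarrow> x \<in> {Grp t, Inv t} \<Longrightarrow> p (gen n x) (gen n (GenE j)) = 0"
  and p_F_Grp: "t \<in> grouplikes_B n \<Longrightarrow> j < n \<Longrightarrow> x \<in> {Grp t, Inv t} \<Longrightarrow> p (gen n (GenF j)) (gen n x) = 0"
  using pairing_gens unfolding pairing_on_generators_def
  by (auto simp: gpow_def)

text \<open>The pairing is normalised by s - r and the relation by r - s; the minus sign is absorbed
  when f e is solved for e f.\<close>

lemma p_F_E: "i < n \<Longrightarrow> j < n \<Longrightarrow> p (gen n (GenF i)) (gen n (GenE j)) = - ((if i = j then 1 else 0) / (rr - ss))"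
proof -
  assume "i < n" "j < n"
  then have "p (gen n (GenF i)) (gen n (GenE j)) = (if i = j then 1 else 0) * (1 / (ss - rr))"
    using conjunct1[OF pairing_gens[unfolded pairing_on_generators_def]] by simp
  also have "\<dots> = - ((if i = j then 1 else 0) / (rr - ss))"
    using minus_divide_right[of 1 "rr - ss"] by simp
  finally show ?thesis .
qed

text \<open>The constant demanded by \<open>op_skew_grouplike\<close>. The prescribed pairing values
  are such that \<omega>'_i acts as the character by which conjugation scales e_i.\<close>

lemma p_Omega'_Grp: 
  assumes i: "i < n" and t: "t \<in> grouplikes_B n"
  shows "p (gen n (Grp (Omega' i))) (gen n (Grp t)) = wt n t i"
proof -
  note v = pairing_gens[unfolded pairing_on_generators_def, simplified, unfolded gpow_def, simplified]
  show ?thesis using i t v by (cases t) auto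
qed

text \<open>The constant demanded by \<open>op_grouplike_skew\<close>. For t = \<omega>'_j it is the
  inverse of \<langle>\<omega>'_j, \<omega>_i\<rangle>, which \<open>weight_swap\<close> rewrites as
  the weight with r and s interchanged; the other cases are prescribed values.\<close>

lemma p_Inv_Omega:
  assumes i: "i < n" and t: "t \<in> grouplikes_B' n"
  shows "p (gen n (Inv t)) (gen n (Grp (Omega i))) = wt n t i"
proof -
  note v = pairing_gens[unfolded pairing_on_generators_def, simplified, unfolded gpow_def, simplified]
  show ?thesis
  proof (cases t)
    case (Omega' j)
    then have j: "j < n" using t by simp
    have "p (gen n (Inv t)) (gen n (Grp (Omega i))) * p (gen n (Grp t)) (gen n (Grp (Omega i))) = 1"
      using p_grouplike_inverse[of "gen n (Grp t)" "gen n (Grp (Omega i))"] i t grouplike_A[of "Omega i" "Grp (Omega i)"]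
      by (simp add: antipode_Grp)
    moreover have "p (gen n (Grp t)) (gen n (Grp (Omega i))) = weight n rr ss i j"
      using p_Omega'_Grp[of j "Omega i"] i j Omega' by simp
    ultimately have "inverse (weight n rr ss i j) = p (gen n (Inv t)) (gen n (Grp (Omega i)))"
      by (intro inverse_unique) (simp add: mult.commute)
    then show ?thesis
      using weight_swap[OF n i j, where x = rr and y = ss] Omega' by simp
  qed (use i t v in auto)
qed

lemma op_Grp:
  assumes t: "t \<in> grouplikes_B' n"
  shows "u \<in> grouplikes_B n \<Longrightarrow> op (gen n (Grp t)) \<otimes>\<^bsub>E\<^esub> act_left (gen n (Grp u)) =
      act_left (gen n (Grp u)) \<otimes>\<^bsub>E\<^esub> op (gen n (Grp t))"
    and "i < n \<Longrightarrow> op (gen n (Grp t)) \<otimes>\<^bsub>E\<^esub> act_left (gen n (GenE i)) =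
      wt n t i \<odot>\<^bsub>E\<^esub> (act_left (gen n (GenE i)) \<otimes>\<^bsub>E\<^esub> op (gen n (Grp t)))"
proof -
  have k: "grouplike_elem BB (gen n (Grp t))" "grouplike_elem BB (antipode BB (gen n (Grp t)))"
    "antipode BB (gen n (Grp t)) \<otimes>\<^bsub>BB\<^esub> gen n (Grp t) = \<one>\<^bsub>BB\<^esub>"
    using t grouplike_B[OF t] by (simp_all add: antipode_Grp)
  show "op (gen n (Grp t)) \<otimes>\<^bsub>E\<^esub> act_left (gen n (Grp u)) =
      act_left (gen n (Grp u)) \<otimes>\<^bsub>E\<^esub> op (gen n (Grp t))" if "u \<in> grouplikes_B n"
    by (rule op_grouplike_grouplike[OF k grouplike_A[OF that]]) simp
  show "op (gen n (Grp t)) \<otimes>\<^bsub>E\<^esub> act_left (gen n (GenE i)) =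
      wt n t i \<odot>\<^bsub>E\<^esub> (act_left (gen n (GenE i)) \<otimes>\<^bsub>E\<^esub> op (gen n (Grp t)))" if "i < n"
    using op_grouplike_skew[OF k skew_primitive_A[OF that]] t that
    by (simp add: p_Grp_E[OF t that] p_Inv_Omega antipode_Grp)
qed

lemma op_F:
  assumes j: "j < n"
  shows "t \<in> grouplikes_B n \<Longrightarrow> op (gen n (GenF j)) \<otimes>\<^bsub>E\<^esub> act_left (gen n (Grp t)) =
      wt n t j \<odot>\<^bsub>E\<^esub> (act_left (gen n (Grp t)) \<otimes>\<^bsub>E\<^esub> op (gen n (GenF j)))"
    and "i < n \<Longrightarrow> op (gen n (GenF j)) \<otimes>\<^bsub>E\<^esub> act_left (gen n (GenE i)) =
      act_left (gen n (GenE i)) \<otimes>\<^bsub>E\<^esub> op (gen n (GenF j)) \<oplus>\<^bsub>E\<^esub>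
      (- ((if j = i then 1 else 0) / (rr - ss))) \<odot>\<^bsub>E\<^esub>
        (act_left (gen n (Grp (Omega i))) \<oplus>\<^bsub>E\<^esub> (- 1) \<odot>\<^bsub>E\<^esub> op (gen n (Grp (Omega' j))))"
proof -
  let ?k = "gen n (Grp (Omega' j))"
  have t: "Omega' j \<in> grouplikes_B' n" using j by simp
  have k: "grouplike_elem BB ?k" "grouplike_elem BB (antipode BB ?k)"
    "antipode BB ?k \<otimes>\<^bsub>BB\<^esub> ?k = \<one>\<^bsub>BB\<^esub>"
    using j grouplike_B[OF t] by (simp_all add: antipode_Grp)
  have Ss: "antipode BB (gen n (GenF j)) = (- 1) \<odot>\<^bsub>BB\<^esub> (gen n (GenF j) \<otimes>\<^bsub>BB\<^esub> antipode BB ?k)"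
    using j by (simp add: antipode_F antipode_Grp)
  note s = k skew_primitive_B[OF j] Ss
  show "op (gen n (GenF j)) \<otimes>\<^bsub>E\<^esub> act_left (gen n (Grp t)) =
      wt n t j \<odot>\<^bsub>E\<^esub> (act_left (gen n (Grp t)) \<otimes>\<^bsub>E\<^esub> op (gen n (GenF j)))" if "t \<in> grouplikes_B n" for t
    using op_skew_grouplike[OF s grouplike_A[OF that, of "Grp t"]] that j
    by (simp add: p_F_Grp p_Omega'_Grp)
  show "op (gen n (GenF j)) \<otimes>\<^bsub>E\<^esub> act_left (gen n (GenE i)) =
      act_left (gen n (GenE i)) \<otimes>\<^bsub>E\<^esub> op (gen n (GenF j)) \<oplus>\<^bsub>E\<^esub>
      (- ((if j = i then 1 else 0) / (rr - ss))) \<odot>\<^bsub>E\<^esub>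
        (act_left (gen n (Grp (Omega i))) \<oplus>\<^bsub>E\<^esub> (- 1) \<odot>\<^bsub>E\<^esub> op ?k)" if "i < n"
    using op_skew_skew[OF s skew_primitive_A[OF that]] that j
    by (simp add: p_F_Grp[of "Omega i"] p_Grp_E[OF t] antipode_Grp p_F_E)
qed


section \<open>The action of U on the tensor product of its Borel subalgebras\<close>

definition "\<phi> g = (if g \<in> gens_B n then act_left (gen n g) else op (gen n g))"

lemma \<phi>_simps [simp]:
  "\<phi> (GenF i) = op (gen n (GenF i))" "i < n \<Longrightarrow> \<phi> (GenE i) = act_left (gen n (GenE i))"
  "t \<in> grouplikes_B n \<Longrightarrow> \<phi> (Grp t) = act_left (gen n (Grp t))"
  "t \<in> grouplikes_B n \<Longrightarrow> \<phi> (Inv t) = act_left (gen n (Inv t))"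
  "t \<in> grouplikes_B' n \<Longrightarrow> \<phi> (Grp t) = op (gen n (Grp t))"
  "t \<in> grouplikes_B' n \<Longrightarrow> \<phi> (Inv t) = op (gen n (Inv t))"
  using grouplikes_B_B'[of t n] by (auto simp: \<phi>_def)

lemma hom_mult:
  "a \<in> subalg (U_rs n) (gen n ` gens_B n) \<Longrightarrow> b \<in> subalg (U_rs n) (gen n ` gens_B n) \<Longrightarrow>
    act_left a \<otimes>\<^bsub>E\<^esub> act_left b = act_left (a \<otimes>\<^bsub>U\<^esub> b)"
  "c \<in> subalg (U_rs n) (gen n ` gens_B' n) \<Longrightarrow> d \<in> subalg (U_rs n) (gen n ` gens_B' n) \<Longrightarrow>
    op c \<otimes>\<^bsub>E\<^esub> op d = op (c \<otimes>\<^bsub>U\<^esub> d)"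
  using alg_hom_mult[OF act_hom(1), of a b] alg_hom_mult[OF op_hom(2), of c d] by simp_all

lemma mult_sub:
  "a \<in> subalg (U_rs n) (gen n ` gens_B n) \<Longrightarrow> b \<in> subalg (U_rs n) (gen n ` gens_B n) \<Longrightarrow>
    a \<otimes>\<^bsub>U\<^esub> b \<in> subalg (U_rs n) (gen n ` gens_B n)"
  "c \<in> subalg (U_rs n) (gen n ` gens_B' n) \<Longrightarrow> d \<in> subalg (U_rs n) (gen n ` gens_B' n) \<Longrightarrow>
    c \<otimes>\<^bsub>U\<^esub> d \<in> subalg (U_rs n) (gen n ` gens_B' n)"
  using subalg_mult[OF HA.alg HA.S_closed, of a b] subalg_mult[OF HB.alg HB.S_closed, of c d] by simp_all

lemma hom_smult:
  "a \<in> subalg (U_rs n) (gen n ` gens_B n) \<Longrightarrow> c \<odot>\<^bsub>E\<^esub> act_left a = act_left (c \<odot>\<^bsub>U\<^esub> a)"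
  "b \<in> subalg (U_rs n) (gen n ` gens_B' n) \<Longrightarrow> c \<odot>\<^bsub>E\<^esub> op b = op (c \<odot>\<^bsub>U\<^esub> b)"
  using lin_smult[OF alg_hom_lin[OF act_hom(1)], of a c] lin_smult[OF alg_hom_lin[OF op_hom(2)], of b c] by simp_all

lemma hom_one: "act_left \<one>\<^bsub>U\<^esub> = \<one>\<^bsub>E\<^esub>" "op \<one>\<^bsub>U\<^esub> = \<one>\<^bsub>E\<^esub>"
  using alg_hom_one[OF act_hom(1)] alg_hom_one[OF op_hom(2)] by simp_all

lemma \<phi>_closed: "g \<in> gens n \<Longrightarrow> \<phi> g \<in> carrier E"
  by (auto simp: \<phi>_def gens_def act_closed op_closed)

lemma grouplikes_cases:
  assumes "t \<in> grouplikes n" obtains "t \<in> grouplikes_B n" | "t \<in> grouplikes_B' n"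
  using assms by (auto simp: grouplikes_def)

text \<open>\<open>opposite\<close> takes plain module records. The Borel subalgebras are therefore
  presented as restrictions of U instead of the Hopf records \<open>AA\<close> and
  \<open>BB\<close>, so that both forms of the Serre relation can be transported.\<close>

lemma module_hom:
  fixes V :: "(K, U_elem) module"
  shows "V = U\<lparr>carrier := subalg (U_rs n) (gen n ` gens_B n)\<rparr> \<Longrightarrow> assoc_algebra V \<and> act_left \<in> algebra_hom V E"
    "V = U\<lparr>carrier := subalg (U_rs n) (gen n ` gens_B' n)\<rparr> \<Longrightarrow> assoc_algebra V \<and> op \<in> algebra_hom V E"
  using act_hom(1) op_hom(2) assoc_algebra_cong[OF HA.alg_sub, of V] assoc_algebra_cong[OF HB.alg_sub, of V]
    algebra_hom_cong[of V AA E E] algebra_hom_cong[of V BB E E]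
  by simp_all

lemma hom_serre:
  assumes ij: "i < n" "j < n"
  shows "serre E a b (act_left (gen n (GenE i))) (act_left (gen n (GenE j))) =
      act_left (serre U a b (gen n (GenE i)) (gen n (GenE j)))"
    "serre (opposite E) a b (act_left (gen n (GenE i))) (act_left (gen n (GenE j))) =
      act_left (serre (opposite U) a b (gen n (GenE i)) (gen n (GenE j)))"
    "serre E a b (op (gen n (GenF i))) (op (gen n (GenF j))) =
      op (serre U a b (gen n (GenF i)) (gen n (GenF j)))"
    "serre (opposite E) a b (op (gen n (GenF i))) (op (gen n (GenF j))) =
      op (serre (opposite U) a b (gen n (GenF i)) (gen n (GenF j)))"
proof -
  define V where "V = U\<lparr>carrier := subalg (U_rs n) (gen n ` gens_B n)\<rparr>"
  define W where "W = U\<lparr>carrier := subalg (U_rs n) (gen n ` gens_B' n)\<rparr>"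
  have V: "assoc_algebra V" "act_left \<in> algebra_hom V E" "gen n (GenE i) \<in> carrier V" "gen n (GenE j) \<in> carrier V"
    and W: "assoc_algebra W" "op \<in> algebra_hom W E" "gen n (GenF i) \<in> carrier W" "gen n (GenF j) \<in> carrier W"
    using module_hom(1)[OF V_def] module_hom(2)[OF W_def] ij by (simp_all add: V_def W_def)
  have "serre V = serre U" "serre (opposite V) = serre (opposite U)"
    "serre W = serre U" "serre (opposite W) = serre (opposite U)"
    by (simp_all add: fun_eq_iff serre_def V_def W_def)
  then show "serre E a b (act_left (gen n (GenE i))) (act_left (gen n (GenE j))) =
      act_left (serre U a b (gen n (GenE i)) (gen n (GenE j)))"
    "serre (opposite E) a b (act_left (gen n (GenE i))) (act_left (gen n (GenE j))) =
      act_left (serre (opposite U) a b (gen n (GenE i)) (gen n (GenE j)))"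
    "serre E a b (op (gen n (GenF i))) (op (gen n (GenF j))) =
      op (serre U a b (gen n (GenF i)) (gen n (GenF j)))"
    "serre (opposite E) a b (op (gen n (GenF i))) (op (gen n (GenF j))) =
      op (serre (opposite U) a b (gen n (GenF i)) (gen n (GenF j)))"
    using serre_hom[OF V(2,1,3,4)] serre_hom[OF W(2,1,3,4)]
      serre_hom[OF opposite_hom[OF V(2)] assoc_algebra_opposite[OF V(1)], simplified, OF V(3,4)]
      serre_hom[OF opposite_hom[OF W(2)] assoc_algebra_opposite[OF W(1)], simplified, OF W(3,4)]
    by simp_all
qed

lemma hom_zero: "act_left \<zero>\<^bsub>U\<^esub> = \<zero>\<^bsub>E\<^esub>" "op \<zero>\<^bsub>U\<^esub> = \<zero>\<^bsub>E\<^esub>"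
  using lin_zero[OF alg_hom_lin[OF act_hom(1)] A.vs VE] lin_zero[OF alg_hom_lin[OF op_hom(2)] B.vs VE] by simp_all

lemma foldr_mult_cong: "(\<And>i x. i \<in> set xs \<Longrightarrow> c i \<otimes>\<^bsub>A\<^esub> x = d i \<otimes>\<^bsub>B\<^esub> x) \<Longrightarrow>
    foldr (\<lambda>i x. c i \<otimes>\<^bsub>A\<^esub> x) xs z = foldr (\<lambda>i x. d i \<otimes>\<^bsub>B\<^esub> x) xs z"
  by (induct xs) simp_all

lemma hom_foldr_gens:
  "foldr (\<lambda>i x. \<phi> (Grp (Omega i)) \<otimes>\<^bsub>E\<^esub> x) [0..<n] \<one>\<^bsub>E\<^esub> =
    act_left (foldr (\<lambda>i x. gen n (Grp (Omega i)) \<otimes>\<^bsub>U\<^esub> x) [0..<n] \<one>\<^bsub>U\<^esub>)"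
  "foldr (\<lambda>i x. \<phi> (Grp (Omega' i)) \<otimes>\<^bsub>E\<^esub> x) [0..<n] \<one>\<^bsub>E\<^esub> =
    op (foldr (\<lambda>i x. gen n (Grp (Omega' i)) \<otimes>\<^bsub>U\<^esub> x) [0..<n] \<one>\<^bsub>U\<^esub>)"
proof -
  have "foldr (\<lambda>i x. \<phi> (Grp (Omega i)) \<otimes>\<^bsub>E\<^esub> x) [0..<n] \<one>\<^bsub>E\<^esub> =
      foldr (\<lambda>i x. act_left (gen n (Grp (Omega i))) \<otimes>\<^bsub>E\<^esub> x) [0..<n] \<one>\<^bsub>E\<^esub>"
    by (rule foldr_mult_cong) simp
  then show "foldr (\<lambda>i x. \<phi> (Grp (Omega i)) \<otimes>\<^bsub>E\<^esub> x) [0..<n] \<one>\<^bsub>E\<^esub> =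
    act_left (foldr (\<lambda>i x. gen n (Grp (Omega i)) \<otimes>\<^bsub>U\<^esub> x) [0..<n] \<one>\<^bsub>U\<^esub>)"
    using hom_foldr[OF act_hom(1) A.alg, of "[0..<n]" "\<lambda>i. gen n (Grp (Omega i))"] by simp
  have "foldr (\<lambda>i x. \<phi> (Grp (Omega' i)) \<otimes>\<^bsub>E\<^esub> x) [0..<n] \<one>\<^bsub>E\<^esub> =
      foldr (\<lambda>i x. op (gen n (Grp (Omega' i))) \<otimes>\<^bsub>E\<^esub> x) [0..<n] \<one>\<^bsub>E\<^esub>"
    by (rule foldr_mult_cong) simp
  then show "foldr (\<lambda>i x. \<phi> (Grp (Omega' i)) \<otimes>\<^bsub>E\<^esub> x) [0..<n] \<one>\<^bsub>E\<^esub> =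
    op (foldr (\<lambda>i x. gen n (Grp (Omega' i)) \<otimes>\<^bsub>U\<^esub> x) [0..<n] \<one>\<^bsub>U\<^esub>)"
    using hom_foldr[OF op_hom(2) B.alg, of "[0..<n]" "\<lambda>i. gen n (Grp (Omega' i))"] by simp
qed

lemma E_smult_inverse: "c \<noteq> 0 \<Longrightarrow> x \<in> carrier E \<Longrightarrow> y = c \<odot>\<^bsub>E\<^esub> x \<Longrightarrow> x = inverse c \<odot>\<^bsub>E\<^esub> y"
  using VE by simp

text \<open>Relations inside one Borel are images of relations of U under \<open>act_left\<close> or
  \<open>op\<close>. Genuinely new are the exchanges between a generator of B and one of B',
  supplied by \<open>op_Grp\<close> and \<open>op_F\<close>.\<close>

lemma U_rep_\<phi>: "U_rep E n \<phi>"
proof (standard, goal_cases)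
  case 1 show ?case by (rule AE)
next
  case 2 then show ?case by (rule \<phi>_closed)
next
  case (3 t)
  then show ?case by (cases rule: grouplikes_cases) (simp_all add: hom_mult hom_one)
next
  case (4 t)
  then show ?case by (cases rule: grouplikes_cases) (simp_all add: hom_mult hom_one)
next
  case (5 t u)
  from 5(1) show ?case
  proof (cases rule: grouplikes_cases)
    assume t: "t \<in> grouplikes_B n"
    from 5(2) show ?thesis
      by (cases rule: grouplikes_cases) (use t op_Grp(1)[of u t] G.Grp_comm[of t u] in \<open>simp_all add: hom_mult\<close>)
  next
    assume t: "t \<in> grouplikes_B' n"
    from 5(2) show ?thesis
      by (cases rule: grouplikes_cases) (use t op_Grp(1)[of t u] G.Grp_comm[of t u] in \<open>simp_all add: hom_mult\<close>)
  qed
next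
  case 6
  show ?case unfolding hom_foldr_gens by (simp add: hom_mult G.gamma)
next
  case 7
  show ?case unfolding hom_foldr_gens by (simp add: hom_mult G.gamma')
next
  case (8 t i)
  from 8(1) show ?case
    by (cases rule: grouplikes_cases)
       (use 8(2) op_Grp(2)[of t i] G.Grp_E[of t i] in \<open>simp_all add: hom_mult hom_smult mult_sub\<close>)
next
  case (9 t i)
  from 9(1) show ?case
  proof (cases rule: grouplikes_cases)
    assume t: "t \<in> grouplikes_B n"
    then show ?thesis
      using 9(2) by (simp add: E_smult_inverse[OF wt_nonzero alg_mult_closed[OF AE act_closed(1) op_closed] op_F(1)])
  qed (use 9(2) G.Grp_F[of t i] in \<open>simp add: hom_mult hom_smult mult_sub\<close>)
next
  case (10 i j)
  have "act_left (gen n (GenE i)) \<otimes>\<^bsub>E\<^esub> op (gen n (GenF j)) = op (gen n (GenF j)) \<otimes>\<^bsub>E\<^esub> act_left (gen n (GenE i))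
    \<oplus>\<^bsub>E\<^esub> ((if j = i then 1 else 0) / (rr - ss)) \<odot>\<^bsub>E\<^esub>
        (act_left (gen n (Grp (Omega i))) \<oplus>\<^bsub>E\<^esub> (- 1) \<odot>\<^bsub>E\<^esub> op (gen n (Grp (Omega' j))))"
    by (rule vs_shift[OF VE _ _ op_F(2)[OF 10(2,1)]])
       (use 10 in \<open>simp_all add: alg_mult_closed[OF AE] vs_add_closed[OF VE] vs_smult_closed[OF VE] act_closed op_closed\<close>)
  \<comment> \<open>The coefficient vanishes unless i = j, so the index of \<omega>' may be
    renamed.\<close>
  moreover have "((if j = i then 1 else 0) / (rr - ss)) \<odot>\<^bsub>E\<^esub> (x \<oplus>\<^bsub>E\<^esub> (- 1) \<odot>\<^bsub>E\<^esub> op (gen n (Grp (Omega' j)))) =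
     ((if i = j then 1 else 0) / (rr - ss)) \<odot>\<^bsub>E\<^esub> (x \<oplus>\<^bsub>E\<^esub> (- 1) \<odot>\<^bsub>E\<^esub> op (gen n (Grp (Omega' i))))"
    if "x \<in> carrier E" for x
    using 10 that VE by (cases "i = j") (simp_all add: op_closed vs_add_closed[OF VE] vs_smult_closed[OF VE])
  ultimately show ?case using 10 by (simp add: act_closed)
next
  case (11 i j)
  then show ?case using G.E_E[OF 11] by (simp add: hom_mult)
next
  case (12 i j)
  then show ?case using G.F_F[OF 12] by (simp add: hom_mult)
next
  case (13 i j)
  then show ?case using G.Serre_E1[OF 13] by (simp add: hom_serre hom_zero)
next
  case (14 i j)
  then show ?case using G.Serre_E2[OF 14] by (simp add: hom_serre hom_zero)
next
  case (15 i j)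
  then show ?case using G.Serre_F1[OF 15] by (simp add: hom_serre hom_zero)
next
  case (16 i j)
  then show ?case using G.Serre_F2[OF 16] by (simp add: hom_serre hom_zero)
qed

end

context U_pairing
begin

definition "\<rho> = (\<lambda>X. the_elem (free_algebra_hom E \<phi> ` X))"

lemma \<rho>_U: "\<rho> \<in> algebra_hom U E" and \<rho>_gen: "g \<in> gens n \<Longrightarrow> \<rho> (gen n g) = \<phi> g"
  unfolding \<rho>_def by (rule U_lift_hom[OF n0 U_rep_\<phi>] U_lift_gen[OF n0 U_rep_\<phi>]; assumption?)+

lemma sub_U [simp]:
  "x \<in> subalg (U_rs n) (gen n ` gens_B n) \<Longrightarrow> x \<in> carrier U"
  "x \<in> subalg (U_rs n) (gen n ` gens_B' n) \<Longrightarrow> x \<in> carrier U"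
  using HA.sub_closed HB.sub_closed by simp_all

lemma \<rho>_sub:
  "a \<in> subalg (U_rs n) (gen n ` gens_B n) \<Longrightarrow> \<rho> a = act_left a"
  "b \<in> subalg (U_rs n) (gen n ` gens_B' n) \<Longrightarrow> \<rho> b = op b"
proof -
  have gB: "gens_B n \<subseteq> gens n" "gens_B' n \<subseteq> gens n" by (auto simp: gens_def)
  have disj: "g \<notin> gens_B n" if "g \<in> gens_B' n" for g
    using that grouplikes_B_B' by (cases g) auto
  have "\<rho> \<in> algebra_hom AA E" "\<rho> \<in> algebra_hom BB E"
    using \<rho>_U
    by (auto intro!: alg_homI linI simp: alg_hom_one alg_hom_mult alg_hom_closed
        lin_add[OF alg_hom_lin] lin_smult[OF alg_hom_lin])
  note h = this
  show "\<rho> a = act_left a" if "a \<in> subalg (U_rs n) (gen n ` gens_B n)"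
  proof (rule alg_hom_eq_on_generators[OF HA.alg_sub _ _ h(1) act_hom(1)])
    show "carrier AA = subalg AA (gen n ` gens_B n)" by (simp add: HA.subalg_sub)
    show "\<rho> s = act_left s" if "s \<in> gen n ` gens_B n" for s
      using that gB by (auto simp: \<rho>_gen \<phi>_def subset_iff)
  qed (use that in auto)
  show "\<rho> b = op b" if "b \<in> subalg (U_rs n) (gen n ` gens_B' n)"
  proof (rule alg_hom_eq_on_generators[OF HB.alg_sub _ _ h(2) op_hom(2)])
    show "carrier BB = subalg BB (gen n ` gens_B' n)" by (simp add: HB.subalg_sub)
    show "\<rho> s = op s" if "s \<in> gen n ` gens_B' n" for s
      using that gB disj by (auto simp: \<rho>_gen \<phi>_def subset_iff)
  qed (use that in auto)
qed

section \<open>Surjectivity of the multiplication map: every element of U is a sum of products from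
  B B'\<close>

abbreviation "T \<equiv> tensor_module AA BB"

definition "m = tensor_lift U (\<lambda>a b. a \<otimes>\<^bsub>U\<^esub> b)"

lemma mult_bilin: "bilin AA BB U (\<lambda>a b. a \<otimes>\<^bsub>U\<^esub> b)"
  by (rule bilin_comp[OF bilin_mult[OF G.alg]]; rule linI; simp)

lemma m_lin: "m \<in> linear_maps T U"
  unfolding m_def by (rule tensor_lift_lin[OF A.vs B.vs _ mult_bilin]) simp

lemma m_tensor: "a \<in> carrier AA \<Longrightarrow> b \<in> carrier BB \<Longrightarrow> m (tensor AA BB a b) = a \<otimes>\<^bsub>U\<^esub> b"
  using mult_bilin by (simp add: m_def)

definition "AB = m ` carrier T"

lemma AB_submodule:
  "x \<in> AB \<Longrightarrow> y \<in> AB \<Longrightarrow> x \<oplus>\<^bsub>U\<^esub> y \<in> AB" "x \<in> AB \<Longrightarrow> c \<odot>\<^bsub>U\<^esub> x \<in> AB"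
  "x \<in> AB \<Longrightarrow> x \<in> carrier U"
  using VT lin_closed[OF m_lin]
  by (auto simp: AB_def lin_add[OF m_lin, symmetric] lin_smult[OF m_lin, symmetric])

lemma AB_mult: "a \<in> carrier AA \<Longrightarrow> b \<in> carrier BB \<Longrightarrow> a \<otimes>\<^bsub>U\<^esub> b \<in> AB"
  unfolding AB_def by (rule image_eqI[where x = "tensor AA BB a b"]) (simp_all add: m_tensor)

lemma AB_sub: "a \<in> carrier AA \<Longrightarrow> a \<in> AB" "b \<in> carrier BB \<Longrightarrow> b \<in> AB"
  using AB_mult[of a "\<one>\<^bsub>U\<^esub>"] AB_mult[of "\<one>\<^bsub>U\<^esub>" b] by simp_all

lemma AB_induct [consumes 1, case_names mult add]:
  assumes x: "x \<in> AB"
    and mult: "\<And>a b. a \<in> carrier AA \<Longrightarrow> b \<in> carrier BB \<Longrightarrow> Q (a \<otimes>\<^bsub>U\<^esub> b)"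
    and add: "\<And>x y. x \<in> AB \<Longrightarrow> y \<in> AB \<Longrightarrow> Q x \<Longrightarrow> Q y \<Longrightarrow> Q (x \<oplus>\<^bsub>U\<^esub> y)"
  shows "Q x"
proof -
  obtain t where t: "t \<in> carrier T" "x = m t" using x by (auto simp: AB_def)
  have "Q (m t)"
    using t(1)
  proof (induct t rule: tensor_induct[OF A.vs B.vs, consumes 1, case_names pure add])
    case (pure a b)
    then show ?case using mult by (simp add: m_tensor)
  next
    case (add t u)
    then show ?case using assms(3)[of "m t" "m u"] by (simp add: lin_add[OF m_lin] AB_def)
  qed
  then show ?thesis using t by simp
qed

lemma AB_left: 
  assumes a: "a \<in> carrier AA" and x: "x \<in> AB" shows "a \<otimes>\<^bsub>U\<^esub> x \<in> AB"
  using x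
proof (induct rule: AB_induct)
  case (mult c b)
  then show ?case
    using a AB_mult[of "a \<otimes>\<^bsub>U\<^esub> c" b] mult_sub(1)[of a c] by (simp add: alg_assoc[OF G.alg])
next
  case (add x y)
  then show ?case using a AB_submodule by (simp add: alg_r_distr[OF G.alg])
qed

lemma AB_right: 
  assumes b: "b \<in> carrier BB" and x: "x \<in> AB" shows "x \<otimes>\<^bsub>U\<^esub> b \<in> AB"
  using x
proof (induct rule: AB_induct)
  case (mult a c)
  then show ?case
    using b AB_mult[of a "c \<otimes>\<^bsub>U\<^esub> b"] mult_sub(2)[of c b] by (simp add: alg_assoc[OF G.alg])
next
  case (add x y)
  then show ?case using b AB_submodule by (simp add: alg_l_distr[OF G.alg])
qed

text \<open>Induction on the letters of a: f passes the leading generator up to a scalar and an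
  error w. Requiring that w carries B into \<open>AB\<close> allows errors that are themselves not
  in B, such as \<omega>'_i.\<close>

lemma AB_straighten:
  assumes f: "f \<in> carrier BB"
    and comm: "\<And>g. g \<in> gens_B n \<Longrightarrow> \<exists>c. \<exists>w \<in> carrier U.
      f \<otimes>\<^bsub>U\<^esub> gen n g = c \<odot>\<^bsub>U\<^esub> (gen n g \<otimes>\<^bsub>U\<^esub> f) \<oplus>\<^bsub>U\<^esub> w \<and>
      (\<forall>a\<in>carrier AA. w \<otimes>\<^bsub>U\<^esub> a \<in> AB)"
    and a: "a \<in> carrier AA"
  shows "f \<otimes>\<^bsub>U\<^esub> a \<in> AB"
proof -
  have "a \<in> subalg (U_rs n) (gen n ` gens_B n)" using a by simp
  then show ?thesis
  proof induct
    case one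
    then show ?case using f AB_sub(2)[OF f] by simp
  next
    case (mult s x)
    then obtain g where g: "g \<in> gens_B n" "s = gen n g" by blast
    then obtain c w where w: "w \<in> carrier U"
      "f \<otimes>\<^bsub>U\<^esub> s = c \<odot>\<^bsub>U\<^esub> (s \<otimes>\<^bsub>U\<^esub> f) \<oplus>\<^bsub>U\<^esub> w"
      "\<forall>a\<in>carrier AA. w \<otimes>\<^bsub>U\<^esub> a \<in> AB" using comm by blast
    have s: "s \<in> carrier AA" using g by simp
    have "f \<otimes>\<^bsub>U\<^esub> (s \<otimes>\<^bsub>U\<^esub> x) = (f \<otimes>\<^bsub>U\<^esub> s) \<otimes>\<^bsub>U\<^esub> x"
      using f s mult by (simp add: alg_assoc[OF G.alg])
    also have "\<dots> = c \<odot>\<^bsub>U\<^esub> (s \<otimes>\<^bsub>U\<^esub> (f \<otimes>\<^bsub>U\<^esub> x)) \<oplus>\<^bsub>U\<^esub> w \<otimes>\<^bsub>U\<^esub> x"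
      unfolding w(2) using f s mult w(1) by (simp add: alg_l_distr[OF G.alg] alg_assoc[OF G.alg])
    finally show ?case using AB_left[OF s mult(3)] w(3) mult(2) AB_submodule by simp
  next
    case (add x y)
    then show ?case using f AB_submodule by (simp add: alg_r_distr[OF G.alg])
  next
    case (smult x c)
    then show ?case using f AB_submodule by simp
  qed
qed

lemma AB_gens_B':
  assumes h: "h \<in> gens_B' n" and a: "a \<in> carrier AA"
  shows "gen n h \<otimes>\<^bsub>U\<^esub> a \<in> AB"
proof -
  have z: "\<zero>\<^bsub>U\<^esub> \<otimes>\<^bsub>U\<^esub> a \<in> AB" if "a \<in> carrier AA" for a
    using that AB_submodule(2)[OF AB_sub(1)[OF that], of 0] ring.ring_simprules(24)[of "U"] G.alg
    by (simp add: assoc_algebra_def ring.ring_simprules)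
  \<comment> \<open>Group-like elements exchange with every generator without error. They come first
    because the error for f_i and e_i contains \<omega>'_i, which has to be straightened in
    turn.\<close>
  have grp: "gen n x \<otimes>\<^bsub>U\<^esub> a \<in> AB"
    if t: "t \<in> grouplikes_B' n" and x: "x \<in> {Grp t, Inv t}" and a: "a \<in> carrier AA" for t x a
  proof (rule AB_straighten[OF _ _ a])
    show "gen n x \<in> carrier BB" using t x by auto
    fix g assume g: "g \<in> gens_B n"
    then have "g \<in> gens n" by (simp add: gens_def)
    have comm: "gen n x \<otimes>\<^bsub>U\<^esub> gen n g = 1 \<odot>\<^bsub>U\<^esub> (gen n g \<otimes>\<^bsub>U\<^esub> gen n x)"
      if u: "u \<in> grouplikes n" "g \<in> {Grp u, Inv u}" for u
    proof -
      have "gen n x \<in> carrier U" "gen n g \<in> carrier U" using u t x by auto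
      then show ?thesis
        unfolding G.Inv_comm[OF grouplikes_sub(2)[OF t] u(1) x u(2)] by simp
    qed
    from \<open>g \<in> gens n\<close> have "\<exists>c. gen n x \<otimes>\<^bsub>U\<^esub> gen n g = c \<odot>\<^bsub>U\<^esub> (gen n g \<otimes>\<^bsub>U\<^esub> gen n x)"
    proof (cases rule: gens_cases)
      case (E i)
      then show ?thesis using x t G.Grp_E[of t i] G.Inv_E[of t i] by auto
    next
      case (Grp u)
      then show ?thesis by (intro exI[of _ 1]) (rule comm[of u], simp_all)
    next
      case (Inv u)
      then show ?thesis by (intro exI[of _ 1]) (rule comm[of u], simp_all)
    qed (use g in simp)
    then obtain c where "gen n x \<otimes>\<^bsub>U\<^esub> gen n g = c \<odot>\<^bsub>U\<^esub> (gen n g \<otimes>\<^bsub>U\<^esub> gen n x)" ..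
    moreover have "gen n g \<in> carrier U" "gen n x \<in> carrier U" using g t x by auto
    ultimately show "\<exists>c. \<exists>w \<in> carrier U.
      gen n x \<otimes>\<^bsub>U\<^esub> gen n g = c \<odot>\<^bsub>U\<^esub> (gen n g \<otimes>\<^bsub>U\<^esub> gen n x) \<oplus>\<^bsub>U\<^esub> w \<and>
      (\<forall>a\<in>carrier AA. w \<otimes>\<^bsub>U\<^esub> a \<in> AB)"
      using z by (intro exI[of _ c] bexI[of _ "\<zero>\<^bsub>U\<^esub>"]) simp_all
  qed
  have "h \<in> gens n" using h by (simp add: gens_def)
  then show ?thesis
  proof (cases rule: gens_cases)
    case (F j)
    show ?thesis
    proof (rule AB_straighten[OF _ _ a])
      show "gen n h \<in> carrier BB" using h by simp
      fix g assume g: "g \<in> gens_B n"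
      have hU: "gen n h \<in> carrier U" and gU: "gen n g \<in> carrier U"
        using g h by auto
      have q: "\<exists>c. \<exists>w \<in> carrier U.
          gen n h \<otimes>\<^bsub>U\<^esub> gen n g = c \<odot>\<^bsub>U\<^esub> (gen n g \<otimes>\<^bsub>U\<^esub> gen n h) \<oplus>\<^bsub>U\<^esub> w \<and>
          (\<forall>a\<in>carrier AA. w \<otimes>\<^bsub>U\<^esub> a \<in> AB)"
        if "c \<noteq> 0" "gen n g \<otimes>\<^bsub>U\<^esub> gen n h = c \<odot>\<^bsub>U\<^esub> (gen n h \<otimes>\<^bsub>U\<^esub> gen n g)" for c
        using z hU gU that by (intro exI[of _ "inverse c"] bexI[of _ "\<zero>\<^bsub>U\<^esub>"]) simp_all
      have "g \<in> gens n" using g by (simp add: gens_def)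
      then show "\<exists>c. \<exists>w \<in> carrier U.
          gen n h \<otimes>\<^bsub>U\<^esub> gen n g = c \<odot>\<^bsub>U\<^esub> (gen n g \<otimes>\<^bsub>U\<^esub> gen n h) \<oplus>\<^bsub>U\<^esub> w \<and>
          (\<forall>a\<in>carrier AA. w \<otimes>\<^bsub>U\<^esub> a \<in> AB)"
      proof (cases rule: gens_cases)
        case (Grp t)
        then show ?thesis using q[of "inverse (wt n t j)"] G.Grp_F[of t j] F by simp
      next
        case (Inv t)
        then show ?thesis using q[of "wt n t j"] G.Inv_F[of t j] F by simp
      next
        case (E i)
        let ?c = "(if i = j then 1 else 0) / (rr - ss)"
        let ?u = "gen n (Grp (Omega i)) \<oplus>\<^bsub>U\<^esub> (- 1) \<odot>\<^bsub>U\<^esub> gen n (Grp (Omega' i))"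
        have uU: "?u \<in> carrier U" using E by simp
        have "gen n g \<otimes>\<^bsub>U\<^esub> gen n h =
            gen n h \<otimes>\<^bsub>U\<^esub> gen n g \<oplus>\<^bsub>U\<^esub> ?c \<odot>\<^bsub>U\<^esub> ?u"
          using G.E_F[of i j] E F by simp
        then have "gen n h \<otimes>\<^bsub>U\<^esub> gen n g =
            gen n g \<otimes>\<^bsub>U\<^esub> gen n h \<oplus>\<^bsub>U\<^esub> (- ?c) \<odot>\<^bsub>U\<^esub> ?u"
          using vs_shift[OF G.simps(2) alg_mult_closed[OF G.alg hU gU] uU, of _ "- ?c"] by simp
        \<comment> \<open>The error is a multiple of \<omega>_i - \<omega>'_i: the first term lies
          in B, the second is covered by the group-like case.\<close>
        moreover have "((- ?c) \<odot>\<^bsub>U\<^esub> ?u) \<otimes>\<^bsub>U\<^esub> a \<in> AB" if a: "a \<in> carrier AA" for a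
        proof -
          have aU: "a \<in> carrier U" using a by simp
          have "gen n (Grp (Omega i)) \<otimes>\<^bsub>U\<^esub> a \<in> AB"
            by (rule AB_left[OF _ AB_sub(1)[OF a]]) (use E in simp)
          moreover have "gen n (Grp (Omega' i)) \<otimes>\<^bsub>U\<^esub> a \<in> AB"
            by (rule grp[of "Omega' i", OF _ _ a]) (use E in simp_all)
          moreover have "((- ?c) \<odot>\<^bsub>U\<^esub> ?u) \<otimes>\<^bsub>U\<^esub> a = (- ?c) \<odot>\<^bsub>U\<^esub>
              (gen n (Grp (Omega i)) \<otimes>\<^bsub>U\<^esub> a \<oplus>\<^bsub>U\<^esub>
               (- 1) \<odot>\<^bsub>U\<^esub> (gen n (Grp (Omega' i)) \<otimes>\<^bsub>U\<^esub> a))"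
            unfolding alg_smult_left[OF G.alg uU aU] using E aU by (simp add: alg_l_distr[OF G.alg])
          ultimately show ?thesis using AB_submodule(1,2) by simp
        qed
        ultimately show ?thesis
          using uU hU gU by (intro exI[of _ 1] bexI[of _ "(- ?c) \<odot>\<^bsub>U\<^esub> ?u"]) auto
      qed (use g in simp)
    qed
  qed (use h a grp in auto)
qed

lemma AB_gens:
  assumes g: "g \<in> gens n" and x: "x \<in> AB" shows "gen n g \<otimes>\<^bsub>U\<^esub> x \<in> AB"
proof (cases "g \<in> gens_B n")
  case True
  then show ?thesis using AB_left[OF _ x] by simp
next
  case False
  with g have h: "g \<in> gens_B' n" by (simp add: gens_def)
  from x show ?thesis
  proof (induct rule: AB_induct)
    case (mult a b)
    then show ?case using g AB_right[OF mult(2) AB_gens_B'[OF h mult(1)]] by (simp add: alg_assoc[OF G.alg])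
  next
    case (add x y)
    then show ?case using g AB_submodule by (simp add: alg_r_distr[OF G.alg])
  qed
qed

text \<open>\<open>AB\<close> contains 1 and is stable under addition, scaling and left
  multiplication by generators, the four operations that build up U.\<close>

lemma U_subset_AB: "x \<in> carrier U \<Longrightarrow> x \<in> AB"
  unfolding U_eq_subalg[OF n0]
proof (induct rule: subalg.induct)
  case one
  show ?case using AB_sub(1)[of "\<one>\<^bsub>U\<^esub>"] by simp
next
  case (mult s x)
  then show ?case using AB_gens by auto
qed (simp_all add: AB_submodule)

lemma isomorphic: "hopf_isomorphic (drinfeld_double AA BB p) (U_rs n)"
proof -
  have "double_factorization (U_rs n) (gen n ` gens n) (gen n ` gens_B n) (gen n ` gens_B' n) p \<rho>"
  proof unfold_locales
    show "carrier (U_rs n) = subalg (U_rs n) (gen n ` gens n)"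
      using U_eq_subalg[OF n0] subalg_cong[of "U_rs n" "U" "gen n ` gens n"] by simp
    show "\<rho> \<in> algebra_hom (U_rs n) E"
      using \<rho>_U algebra_hom_cong[of "U_rs n" "U" E E] by simp
    show "x \<in> tensor_lift (U_rs n) (\<lambda>a b. a \<otimes>\<^bsub>U_rs n\<^esub> b) ` carrier T" if "x \<in> carrier (U_rs n)" for x
    proof -
      have "tensor_lift (U_rs n) f = tensor_lift U f" for f :: "U_elem \<Rightarrow> U_elem \<Rightarrow> U_elem"
        by (simp add: fun_eq_iff tensor_lift_def finsum_def finprod_def)
      then show ?thesis using U_subset_AB[of x] that by (simp add: AB_def m_def)
    qed
  qed (simp_all add: \<rho>_sub)
  then show ?thesis by (rule double_factorization.double_isomorphic)
qed

end

theorem theorem2p5: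
  fixes n :: nat and p :: "U_elem \<Rightarrow> U_elem \<Rightarrow> K"
  assumes "n > 2"
    and "skew_dual_pairing (B'_hat n) (B_hat n) p"
    and "pairing_on_generators n p"
  shows "hopf_isomorphic (drinfeld_double (B_hat n) (B'_hat n) p) (U_rs n)"
  using U_pairing.isomorphic[OF U_pairing.intro[OF assms]] B_hat_eq[OF assms(1)] B'_hat_eq[OF assms(1)] by simp

end
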